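(* Let the coefficients be admissible, and let $\mathcal{A}$, with domain $D(\mathcal{A})$, be the associated operator on the Hilbert space $\mathcal{H}$ (admissible coefficients, $\mathcal{H}$, $\mathcal{A}$, $D(\mathcal{A})$ as defined in the context). Suppose that, for $i=1,2,3$, $$f_i,\ s,\ Q_i\in C^1([0,\infty);L^2(\Omega))\cap C^0([0,\infty);W_0^{1,2}(\Omega)),$$ and that $\mathcal{U}_0\in D(\mathcal{A})$. Put $$\mathcal{F}(t)=\big(0,\ f_i,\ 0,\ c^{-1}\rho s,\ 0,\ \ell_{ij}\rho Q_j\big)(t).$$ Then there exists a unique solution $\mathcal{U}\in C^1([0,\infty);\mathcal{H})\cap C^0([0,\infty);D(\mathcal{A}))$ of the Cauchy problem $$\frac{d\mathcal{U}(t)}{dt}=\mathcal{A}\,\mathcal{U}(t)+\mathcal{F}(t),\quad t\ge 0,\qquad \mathcal{U}(0)=\mathcal{U}_0,$$ where $D(\mathcal{A})$ carries the graph norm.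
   Context: Conventions: $\Omega\subset\mathbb{R}^3$ is a bounded domain with smooth boundary; all functions are real-valued; Latin indices range over $1,2,3$; repeated indices are summed; $g_{,j}=\partial g/\partial x_j$; $e_{ij}=\frac12(u_{i,j}+u_{j,i})$ and $e^*_{ij}=\frac12(u^*_{i,j}+u^*_{j,i})$. $W_0^{1,2}(\Omega)$ and $L^2(\Omega)$ are the usual Sobolev and Lebesgue spaces, and boldface $\mathbf{W}_0^{1,2}(\Omega)=[W_0^{1,2}(\Omega)]^3$, $\mathbf{L}^2(\Omega)=[L^2(\Omega)]^3$. Admissible coefficients: functions $\rho, c, c_{ij}, A_{ijkl}, a_{ij}, B_{ijkl}, b_{ij}, C_{ijkl}, d_{ij}, K_{ij},\tilde K_{ij},\tilde C_{ijkl}$ in $C^1(\overline\Omega)$ such that: (a) $A_{ijkl}=A_{jikl}=A_{klij}$, $B_{ijkl}=B_{jikl}=B_{klij}$, $C_{ijkl}=C_{jikl}=C_{klij}$, $a_{ij}=a_{ji}$, $b_{ij}=b_{ji}$, $c_{ij}=c_{ji}$, $d_{ij}=d_{ji}$, $K_{ij}=K_{ji}$, $\tilde K_{ij}=\tilde K_{ji}$, $\tilde C_{ijkl}=\tilde C_{klij}$; (b) on $\overline\Omega$: $\rho>0$, $c>0$, $(c_{ij})$ is positive definite, and $\tilde K_{ij}\xi_i\xi_j+\tilde C_{ijkl}m_{lk}m_{ij}\ge 0$ for all $\xi\in\mathbb{R}^3$, $m\in\mathbb{R}^{3\times3}$; (c) there is a constant $c_0>0$ such that for all $(\mathbf{u},\tau,\mathbf{R})\in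 \mathbf{W}_0^{1,2}(\Omega)\times W_0^{1,2}(\Omega)\times\mathbf{W}_0^{1,2}(\Omega)$, $$\int_\Omega\big(A_{ijkl}e_{kl}e_{ij}+2B_{ijkl}e_{ij}R_{k,l}+K_{ij}\tau_{,i}\tau_{,j}+C_{ijkl}R_{i,j}R_{k,l}\big)dv\ge c_0\int_\Omega\big(e_{ij}e_{ij}+\tau_{,i}\tau_{,i}+R_{i,j}R_{i,j}\big)dv.$$ Hilbert space: $\mathcal{H}$ is the set of $\mathcal{U}=(\mathbf{u},\mathbf{v},\tau,\theta,\mathbf{R},\mathbf{M})$ with $\mathbf{u},\mathbf{R}\in\mathbf{W}_0^{1,2}(\Omega)$, $\mathbf{v},\mathbf{M}\in\mathbf{L}^2(\Omega)$, $\tau\in W_0^{1,2}(\Omega)$, $\theta\in L^2(\Omega)$, with inner product $$\langle\mathcal{U},\mathcal{U}^*\rangle=\tfrac12\int_\Omega\big(\rho v_iv_i^*+c\,\theta\theta^*+c_{ij}M_iM_j^*+A_{ijkl}e_{kl}e^*_{ij}+B_{ijkl}(e_{ij}R^*_{k,l}+e^*_{ij}R_{k,l})+K_{ij}\tau_{,i}\tau^*_{,j}+C_{ijkl}R_{i,j}R^*_{k,l}\big)dv,$$ which is equivalent to the usual one. Operator: let $(\ell_{ij})$ be the inverse matrix of $(c_{ij})$. For $\mathcal{U}=(\mathbf{u},\mathbf{v},\tau,\theta,\mathbf{R},\mathbf{M})$, $\mathcal{A}\,\mathcal{U}$ is the 6-tuple with entries (derivatives in the sense of distributions): 1st: $\mathbf{v}$;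 2nd (component $i$): $\rho^{-1}\big(A_{jikl}u_{k,l}-a_{ji}\theta+B_{jikl}R_{l,k}\big)_{,j}$; 3rd: $\theta$; 4th: $c^{-1}\big[-a_{ij}v_{i,j}+(K_{ij}\tau_{,j}+\tilde K_{ij}\theta_{,j}-d_{ij}M_j)_{,i}-b_{ji}M_{i,j}\big]$; 5th: $\mathbf{M}$; 6th (component $s$): $\ell_{si}\big[(B_{klji}u_{k,l}-b_{ji}\theta+C_{jikl}R_{k,l}+\tilde C_{jikl}M_{k,l})_{,j}-d_{ij}\theta_{,j}\big]$. Its domain is $D(\mathcal{A})=\{\mathcal{U}\in\mathcal{H}:\ \mathcal{A}\,\mathcal{U}\in\mathcal{H}\}$. This is the linear anisotropic type III thermoelastic problem with microtemperatures, with $\mathbf{v}=\dot{\mathbf{u}}$, $\theta=\dot\tau$, $\mathbf{M}=\dot{\mathbf{R}}$ and homogeneous Dirichlet conditions on $\mathbf{u},\tau,\mathbf{R}$. *)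

theory Defs
  imports "HOL-Analysis.Analysis"
begin

section \<open>Smooth functions, test functions, domains\<close>

definition pd :: "3 \<Rightarrow> (real^3 \<Rightarrow> real) \<Rightarrow> real^3 \<Rightarrow> real" where
  "pd j f x = frechet_derivative f (at x) (axis j 1)"

primrec Ck :: "nat \<Rightarrow> (real^3 \<Rightarrow> real) \<Rightarrow> bool" where
  "Ck 0 f \<longleftrightarrow> continuous_on UNIV f"
| "Ck (Suc k) f \<longleftrightarrow> (\<forall>x. f differentiable (at x)) \<and> (\<forall>j. Ck k (pd j f))"

definition smooth :: "(real^3 \<Rightarrow> real) \<Rightarrow> bool" where
  "smooth f \<longleftrightarrow> (\<forall>k. Ck k f)"

definition test_fun :: "(real^3) set \<Rightarrow> (real^3 \<Rightarrow> real) \<Rightarrow> bool" where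
  "test_fun \<Omega> \<phi> \<longleftrightarrow> smooth \<phi> \<and> compact (closure {x. \<phi> x \<noteq> 0}) \<and> closure {x. \<phi> x \<noteq> 0} \<subseteq> \<Omega>"

text \<open>Near every boundary point the domain is the sublevel set of a smooth function with
  non-vanishing gradient; by the implicit function theorem the boundary is then locally a smooth
  graph with the domain on one side of it.\<close>

definition smooth_boundary :: "(real^3) set \<Rightarrow> bool" where
  "smooth_boundary \<Omega> \<longleftrightarrow>
     (\<forall>x\<in>frontier \<Omega>. \<exists>V g. open V \<and> x \<in> V \<and> smooth g \<and>
        (\<forall>y\<in>V. \<exists>j. pd j g y \<noteq> 0) \<and> \<Omega> \<inter> V = {y\<in>V. g y < 0})"

definition smooth_bounded_domain :: "(real^3) set \<Rightarrow> bool" where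
  "smooth_bounded_domain \<Omega> \<longleftrightarrow>
     open \<Omega> \<and> connected \<Omega> \<and> \<Omega> \<noteq> {} \<and> bounded \<Omega> \<and> smooth_boundary \<Omega>"

text \<open>The class \<open>C\<^sup>1\<close> on the closure: values and first derivatives are continuous
  in the interior and extend continuously to the boundary.\<close>

definition C1_closure :: "(real^3) set \<Rightarrow> (real^3 \<Rightarrow> real) \<Rightarrow> bool" where
  "C1_closure \<Omega> a \<longleftrightarrow>
     continuous_on (closure \<Omega>) a \<and> (\<forall>x\<in>\<Omega>. a differentiable (at x)) \<and>
     (\<forall>j. \<exists>g. continuous_on (closure \<Omega>) g \<and> (\<forall>x\<in>\<Omega>. g x = pd j a x))"


section \<open>Square-integrable functions modulo equality almost everywhere\<close>

definition sq_int :: "(real^3 \<Rightarrow> real) \<Rightarrow> bool" where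
  "sq_int f \<longleftrightarrow> f \<in> borel_measurable lebesgue \<and> integrable lebesgue (\<lambda>x. (f x)\<^sup>2)"

definition l2_rel :: "(real^3 \<Rightarrow> real) \<Rightarrow> (real^3 \<Rightarrow> real) \<Rightarrow> bool" where
  "l2_rel f g \<longleftrightarrow> sq_int f \<and> sq_int g \<and> (AE x in lebesgue. f x = g x)"

lemma integrable_sq_prod:
  assumes "sq_int f" "sq_int g"
  shows "integrable lebesgue (\<lambda>x. f x * g x)"
proof (rule Bochner_Integration.integrable_bound)
  show "integrable lebesgue (\<lambda>x. (f x)\<^sup>2 + (g x)\<^sup>2)"
    using assms by (auto simp: sq_int_def)
  show "(\<lambda>x. f x * g x) \<in> borel_measurable lebesgue"
    using assms by (auto simp: sq_int_def)
  have "\<bar>f x * g x\<bar> \<le> (f x)\<^sup>2 + (g x)\<^sup>2" for x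
  proof -
    have "2 * (\<bar>f x\<bar> * \<bar>g x\<bar>) \<le> (f x)\<^sup>2 + (g x)\<^sup>2"
      using sum_squares_bound[of "\<bar>f x\<bar>" "\<bar>g x\<bar>"] by (simp add: mult.assoc)
    moreover have "0 \<le> \<bar>f x\<bar> * \<bar>g x\<bar>" by simp
    ultimately show ?thesis by (simp only: abs_mult)
  qed
  then show "AE x in lebesgue. norm (f x * g x) \<le> norm ((f x)\<^sup>2 + (g x)\<^sup>2)"
    by (simp add: abs_of_nonneg)
qed

lemma sq_int_zero: "sq_int (\<lambda>x. 0)"
  by (simp add: sq_int_def)

lemma sq_int_add:
  assumes "sq_int f" "sq_int g"
  shows "sq_int (\<lambda>x. f x + g x)"
proof -
  have "integrable lebesgue (\<lambda>x. (f x)\<^sup>2 + (g x)\<^sup>2 + 2 * (f x * g x))"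
    using assms integrable_sq_prod[OF assms] by (auto simp: sq_int_def)
  then have "integrable lebesgue (\<lambda>x. (f x + g x)\<^sup>2)"
    by (simp add: power2_sum mult.assoc)
  then show ?thesis using assms by (auto simp: sq_int_def)
qed

lemma sq_int_scale: "sq_int f \<Longrightarrow> sq_int (\<lambda>x. r * f x)"
  by (auto simp: sq_int_def power_mult_distrib)

quotient_type l2 = "real^3 \<Rightarrow> real" / partial: l2_rel
proof (rule part_equivpI)
  show "\<exists>f. l2_rel f f"
    by (rule exI[of _ "\<lambda>x. 0"]) (simp add: l2_rel_def sq_int_zero)
  show "symp l2_rel"
    by (auto simp: symp_def l2_rel_def elim: eventually_mono)
  show "transp l2_rel"
    unfolding transp_def l2_rel_def by (auto elim: eventually_elim2)
qed

instantiation l2 :: real_vector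
begin

lift_definition zero_l2 :: l2 is "\<lambda>x. 0"
  by (simp add: l2_rel_def sq_int_zero)

lift_definition plus_l2 :: "l2 \<Rightarrow> l2 \<Rightarrow> l2" is "\<lambda>f g x. f x + g x"
  unfolding l2_rel_def by (auto intro: sq_int_add elim: eventually_elim2)

lift_definition scaleR_l2 :: "real \<Rightarrow> l2 \<Rightarrow> l2" is "\<lambda>r f x. r * f x"
  unfolding l2_rel_def by (auto intro: sq_int_scale elim: eventually_mono)

lift_definition uminus_l2 :: "l2 \<Rightarrow> l2" is "\<lambda>f x. - f x"
  unfolding l2_rel_def by (auto simp: sq_int_def elim: eventually_mono)

definition minus_l2 :: "l2 \<Rightarrow> l2 \<Rightarrow> l2" where "minus_l2 f g = f + (- g)"

instance
proof
  fix f g h :: l2 and r s :: real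
  show "f + g + h = f + (g + h)"
    by transfer (auto simp: l2_rel_def add.assoc intro!: sq_int_add)
  show "f + g = g + f"
    by transfer (auto simp: l2_rel_def add.commute intro!: sq_int_add)
  show "0 + f = f"
    by transfer (auto simp: l2_rel_def)
  show "- f + f = 0"
    by transfer (auto simp: l2_rel_def sq_int_zero)
  show "f - g = f + - g" by (simp add: minus_l2_def)
  show "r *\<^sub>R (f + g) = r *\<^sub>R f + r *\<^sub>R g"
    by transfer (auto simp: l2_rel_def distrib_left intro!: sq_int_add sq_int_scale)
  show "(r + s) *\<^sub>R f = r *\<^sub>R f + s *\<^sub>R f"
    by transfer (auto simp: l2_rel_def distrib_right intro!: sq_int_add sq_int_scale)
  show "r *\<^sub>R s *\<^sub>R f = (r * s) *\<^sub>R f"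
    by transfer (auto simp: l2_rel_def mult.assoc intro!: sq_int_scale)
  show "1 *\<^sub>R f = f"
    by transfer (auto simp: l2_rel_def)
qed

end

instantiation l2 :: real_inner
begin

lift_definition inner_l2 :: "l2 \<Rightarrow> l2 \<Rightarrow> real" is "\<lambda>f g. LINT x|lebesgue. f x * g x"
proof -
  fix f f' g g' assume r: "l2_rel f f'" "l2_rel g g'"
  show "(LINT x|lebesgue. f x * g x) = (LINT x|lebesgue. f' x * g' x)"
  proof (rule integral_cong_AE)
    have "AE x in lebesgue. f x = f' x" "AE x in lebesgue. g x = g' x"
      using r by (auto simp: l2_rel_def)
    then show "AE x in lebesgue. f x * g x = f' x * g' x" by eventually_elim simp
  qed (use r in \<open>auto simp: l2_rel_def sq_int_def\<close>)
qed

definition norm_l2 :: "l2 \<Rightarrow> real" where "norm_l2 f = sqrt (inner f f)"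
definition sgn_l2 :: "l2 \<Rightarrow> l2" where "sgn_l2 f = f /\<^sub>R norm f"
definition dist_l2 :: "l2 \<Rightarrow> l2 \<Rightarrow> real" where "dist_l2 f g = norm (f - g)"
definition uniformity_l2 :: "(l2 \<times> l2) filter" where
  "uniformity_l2 = (INF e\<in>{0 <..}. principal {(x, y). dist x y < e})"
definition open_l2 :: "l2 set \<Rightarrow> bool" where
  "open_l2 U = (\<forall>x\<in>U. eventually (\<lambda>(x', y). x' = x \<longrightarrow> y \<in> U) uniformity)"

instance
proof
  fix f g h :: l2 and r :: real and U :: "l2 set"
  show "sgn f = f /\<^sub>R norm f" by (simp add: sgn_l2_def)
  show "dist f g = norm (f - g)" by (simp add: dist_l2_def)
  show "(uniformity :: (l2 \<times> l2) filter) = (INF e\<in>{0 <..}. principal {(x, y). dist x y < e})"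
    by (simp add: uniformity_l2_def)
  show "open U = (\<forall>x\<in>U. eventually (\<lambda>(x', y). x' = x \<longrightarrow> y \<in> U) uniformity)"
    by (simp add: open_l2_def)
  show "inner f g = inner g f"
    by transfer (simp add: mult.commute)
  show "inner (f + g) h = inner f h + inner g h"
    by transfer (simp add: l2_rel_def distrib_right integrable_sq_prod)
  show "inner (r *\<^sub>R f) g = r * inner f g"
    by transfer (simp add: mult.assoc)
  show "0 \<le> inner f f"
    by transfer simp
  show "(inner f f = 0) = (f = 0)"
  proof transfer
    fix f :: "real^3 \<Rightarrow> real"
    assume "l2_rel f f"
    then have sf: "sq_int f" by (simp add: l2_rel_def)
    have "(LINT x|lebesgue. f x * f x) = 0 \<longleftrightarrow> (AE x in lebesgue. f x * f x = 0)"
      by (rule integral_nonneg_eq_0_iff_AE) (auto intro: integrable_sq_prod sf)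
    then show "((LINT x|lebesgue. f x * f x) = 0) = l2_rel f (\<lambda>x. 0)"
      using sf by (simp add: l2_rel_def sq_int_zero)
  qed
  show "norm f = sqrt (inner f f)" by (simp add: norm_l2_def)
qed

end

text \<open>\<open>L\<^sup>2(\<Omega>)\<close> consists of the classes vanishing almost everywhere outside \<open>\<Omega>\<close>
  (extension by zero), so its norm is the one of the type. \<open>rep_l2\<close> selects a representative;
  below it occurs only inside integrals and as the argument of \<open>l2_on\<close>, neither of which depends
  on the choice. \<open>l2_on\<close> forms the class of the restriction of a function to \<open>\<Omega>\<close>, and is applied
  only to functions that are square-integrable on \<open>\<Omega>\<close>.\<close>

definition L2 :: "(real^3) set \<Rightarrow> l2 set" where
  "L2 \<Omega> = {f. AE x in lebesgue. x \<notin> \<Omega> \<longrightarrow> rep_l2 f x = 0}"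

definition l2_on :: "(real^3) set \<Rightarrow> (real^3 \<Rightarrow> real) \<Rightarrow> l2" where
  "l2_on \<Omega> g = abs_l2 (\<lambda>x. indicat_real \<Omega> x * g x)"


section \<open>Distributions and Sobolev spaces\<close>

text \<open>Distributions are represented by functionals that are only looked at on \<open>test_fun \<Omega>\<close>.\<close>

type_synonym distribution = "(real^3 \<Rightarrow> real) \<Rightarrow> real"

definition distr_of :: "(real^3) set \<Rightarrow> (real^3 \<Rightarrow> real) \<Rightarrow> distribution" where
  "distr_of \<Omega> g = (\<lambda>\<phi>. LINT x:\<Omega>|lebesgue. g x * \<phi> x)"

definition ddist :: "3 \<Rightarrow> distribution \<Rightarrow> distribution" where
  "ddist j T = (\<lambda>\<phi>. - T (pd j \<phi>))"

definition eq_distr :: "(real^3) set \<Rightarrow> distribution \<Rightarrow> distribution \<Rightarrow> bool" where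
  "eq_distr \<Omega> S T \<longleftrightarrow> (\<forall>\<phi>. test_fun \<Omega> \<phi> \<longrightarrow> S \<phi> = T \<phi>)"

definition has_weak_pd :: "(real^3) set \<Rightarrow> 3 \<Rightarrow> l2 \<Rightarrow> l2 \<Rightarrow> bool" where
  "has_weak_pd \<Omega> j f g \<longleftrightarrow> f \<in> L2 \<Omega> \<and> g \<in> L2 \<Omega> \<and>
     eq_distr \<Omega> (ddist j (distr_of \<Omega> (rep_l2 f))) (distr_of \<Omega> (rep_l2 g))"

definition weak_pd :: "(real^3) set \<Rightarrow> 3 \<Rightarrow> l2 \<Rightarrow> l2" where
  "weak_pd \<Omega> j f = (THE g. has_weak_pd \<Omega> j f g)"

definition W12 :: "(real^3) set \<Rightarrow> l2 set" where
  "W12 \<Omega> = {f \<in> L2 \<Omega>. \<forall>j. \<exists>g. has_weak_pd \<Omega> j f g}"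

definition W12_norm :: "(real^3) set \<Rightarrow> l2 \<Rightarrow> real" where
  "W12_norm \<Omega> f = sqrt ((norm f)\<^sup>2 + (\<Sum>j\<in>UNIV. (norm (weak_pd \<Omega> j f))\<^sup>2))"

definition W012 :: "(real^3) set \<Rightarrow> l2 set" where
  "W012 \<Omega> = {f \<in> W12 \<Omega>. \<forall>\<epsilon>>0. \<exists>\<phi>. test_fun \<Omega> \<phi> \<and> W12_norm \<Omega> (f - l2_on \<Omega> \<phi>) < \<epsilon>}"

definition L2vec :: "(real^3) set \<Rightarrow> (l2^3) set" where
  "L2vec \<Omega> = {v. \<forall>i. v $ i \<in> L2 \<Omega>}"

definition W012vec :: "(real^3) set \<Rightarrow> (l2^3) set" where
  "W012vec \<Omega> = {u. \<forall>i. u $ i \<in> W012 \<Omega>}"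

text \<open>\<open>wd \<Omega> g j\<close> is a representative of \<open>g\<^sub>,\<^sub>j\<close>, so that \<open>wd \<Omega> (u $ i) j\<close>
  is \<open>u\<^sub>i\<^sub>,\<^sub>j\<close>.\<close>

definition wd :: "(real^3) set \<Rightarrow> l2 \<Rightarrow> 3 \<Rightarrow> real^3 \<Rightarrow> real" where
  "wd \<Omega> g j = rep_l2 (weak_pd \<Omega> j g)"

definition strain :: "(real^3) set \<Rightarrow> l2^3 \<Rightarrow> 3 \<Rightarrow> 3 \<Rightarrow> real^3 \<Rightarrow> real" where
  "strain \<Omega> u i j x = (wd \<Omega> (u $ i) j x + wd \<Omega> (u $ j) i x) / 2"


section \<open>Continuity and differentiability on the half-line\<close>

text \<open>\<open>N\<close> is the norm of the space \<open>X\<close>; derivatives at \<open>0\<close> are one-sided.\<close>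

definition C0_in :: "'a::real_vector set \<Rightarrow> ('a \<Rightarrow> real) \<Rightarrow> (real \<Rightarrow> 'a) \<Rightarrow> bool" where
  "C0_in X N u \<longleftrightarrow> (\<forall>t\<ge>0. u t \<in> X) \<and>
     (\<forall>t\<ge>0. ((\<lambda>s. N (u s - u t)) \<longlongrightarrow> 0) (at t within {0..}))"

definition deriv_in :: "('a::real_vector \<Rightarrow> real) \<Rightarrow> (real \<Rightarrow> 'a) \<Rightarrow> real \<Rightarrow> 'a \<Rightarrow> bool" where
  "deriv_in N u t D \<longleftrightarrow>
     ((\<lambda>s. N ((1 / (s - t)) *\<^sub>R (u s - u t) - D)) \<longlongrightarrow> 0) (at t within {0..})"

definition C1_in :: "'a::real_vector set \<Rightarrow> ('a \<Rightarrow> real) \<Rightarrow> (real \<Rightarrow> 'a) \<Rightarrow> bool" where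
  "C1_in X N u \<longleftrightarrow> (\<forall>t\<ge>0. u t \<in> X) \<and>
     (\<exists>u'. C0_in X N u' \<and> (\<forall>t\<ge>0. deriv_in N u t (u' t)))"


section \<open>Coefficients\<close>

text \<open>\<open>thc\<close> is the scalar coefficient \<open>c\<close>; \<open>mc\<close>, \<open>ac\<close>, \<open>bc\<close>, \<open>dc\<close>, \<open>kc\<close>, \<open>ktc\<close> are
  \<open>c\<^sub>i\<^sub>j\<close>, \<open>a\<^sub>i\<^sub>j\<close>, \<open>b\<^sub>i\<^sub>j\<close>, \<open>d\<^sub>i\<^sub>j\<close>, \<open>K\<^sub>i\<^sub>j\<close> and \<open>K\<^sub>i\<^sub>j\<close> with tilde; \<open>At\<close>, \<open>Bt\<close>, \<open>Ct\<close>, \<open>Ctt\<close>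
  are \<open>A\<^sub>i\<^sub>j\<^sub>k\<^sub>l\<close>, \<open>B\<^sub>i\<^sub>j\<^sub>k\<^sub>l\<close>, \<open>C\<^sub>i\<^sub>j\<^sub>k\<^sub>l\<close> and \<open>C\<^sub>i\<^sub>j\<^sub>k\<^sub>l\<close> with tilde. Only values on the closure
  of the domain matter.\<close>

record coeffs =
  rho :: "real^3 \<Rightarrow> real"
  thc :: "real^3 \<Rightarrow> real"
  mc :: "3 \<Rightarrow> 3 \<Rightarrow> real^3 \<Rightarrow> real"
  At :: "3 \<Rightarrow> 3 \<Rightarrow> 3 \<Rightarrow> 3 \<Rightarrow> real^3 \<Rightarrow> real"
  ac :: "3 \<Rightarrow> 3 \<Rightarrow> real^3 \<Rightarrow> real"
  Bt :: "3 \<Rightarrow> 3 \<Rightarrow> 3 \<Rightarrow> 3 \<Rightarrow> real^3 \<Rightarrow> real"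
  bc :: "3 \<Rightarrow> 3 \<Rightarrow> real^3 \<Rightarrow> real"
  Ct :: "3 \<Rightarrow> 3 \<Rightarrow> 3 \<Rightarrow> 3 \<Rightarrow> real^3 \<Rightarrow> real"
  dc :: "3 \<Rightarrow> 3 \<Rightarrow> real^3 \<Rightarrow> real"
  kc :: "3 \<Rightarrow> 3 \<Rightarrow> real^3 \<Rightarrow> real"
  ktc :: "3 \<Rightarrow> 3 \<Rightarrow> real^3 \<Rightarrow> real"
  Ctt :: "3 \<Rightarrow> 3 \<Rightarrow> 3 \<Rightarrow> 3 \<Rightarrow> real^3 \<Rightarrow> real"

definition coeffs_C1 :: "(real^3) set \<Rightarrow> coeffs \<Rightarrow> bool" where
  "coeffs_C1 \<Omega> P \<longleftrightarrow>
     C1_closure \<Omega> (rho P) \<and> C1_closure \<Omega> (thc P) \<and>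
     (\<forall>i j. C1_closure \<Omega> (mc P i j) \<and> C1_closure \<Omega> (ac P i j) \<and> C1_closure \<Omega> (bc P i j) \<and>
        C1_closure \<Omega> (dc P i j) \<and> C1_closure \<Omega> (kc P i j) \<and> C1_closure \<Omega> (ktc P i j)) \<and>
     (\<forall>i j k l. C1_closure \<Omega> (At P i j k l) \<and> C1_closure \<Omega> (Bt P i j k l) \<and>
        C1_closure \<Omega> (Ct P i j k l) \<and> C1_closure \<Omega> (Ctt P i j k l))"

definition coeffs_symmetric :: "(real^3) set \<Rightarrow> coeffs \<Rightarrow> bool" where
  "coeffs_symmetric \<Omega> P \<longleftrightarrow> (\<forall>x\<in>closure \<Omega>.
     (\<forall>i j k l.
        At P i j k l x = At P j i k l x \<and> At P i j k l x = At P k l i j x \<and>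
        Bt P i j k l x = Bt P j i k l x \<and> Bt P i j k l x = Bt P k l i j x \<and>
        Ct P i j k l x = Ct P j i k l x \<and> Ct P i j k l x = Ct P k l i j x \<and>
        Ctt P i j k l x = Ctt P k l i j x) \<and>
     (\<forall>i j.
        ac P i j x = ac P j i x \<and> bc P i j x = bc P j i x \<and> mc P i j x = mc P j i x \<and>
        dc P i j x = dc P j i x \<and> kc P i j x = kc P j i x \<and> ktc P i j x = ktc P j i x))"

definition coeffs_positive :: "(real^3) set \<Rightarrow> coeffs \<Rightarrow> bool" where
  "coeffs_positive \<Omega> P \<longleftrightarrow> (\<forall>x\<in>closure \<Omega>.
     rho P x > 0 \<and> thc P x > 0 \<and>
     (\<forall>\<xi>::real^3. \<xi> \<noteq> 0 \<longrightarrow> (\<Sum>i\<in>UNIV. \<Sum>j\<in>UNIV. mc P i j x * \<xi> $ i * \<xi> $ j) > 0) \<and>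
     (\<forall>(\<xi>::real^3) (m::real^3^3).
        (\<Sum>i\<in>UNIV. \<Sum>j\<in>UNIV. ktc P i j x * \<xi> $ i * \<xi> $ j) +
        (\<Sum>i\<in>UNIV. \<Sum>j\<in>UNIV. \<Sum>k\<in>UNIV. \<Sum>l\<in>UNIV.
           Ctt P i j k l x * m $ l $ k * m $ i $ j) \<ge> 0))"

definition coeffs_coercive :: "(real^3) set \<Rightarrow> coeffs \<Rightarrow> bool" where
  "coeffs_coercive \<Omega> P \<longleftrightarrow>
     (\<exists>c0>0. \<forall>u\<in>W012vec \<Omega>. \<forall>\<tau>\<in>W012 \<Omega>. \<forall>R\<in>W012vec \<Omega>.
        (LINT x:\<Omega>|lebesgue.
           (\<Sum>i\<in>UNIV. \<Sum>j\<in>UNIV. \<Sum>k\<in>UNIV. \<Sum>l\<in>UNIV.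
              At P i j k l x * strain \<Omega> u k l x * strain \<Omega> u i j x +
              2 * Bt P i j k l x * strain \<Omega> u i j x * wd \<Omega> (R $ k) l x +
              Ct P i j k l x * wd \<Omega> (R $ i) j x * wd \<Omega> (R $ k) l x) +
           (\<Sum>i\<in>UNIV. \<Sum>j\<in>UNIV. kc P i j x * wd \<Omega> \<tau> i x * wd \<Omega> \<tau> j x))
        \<ge> c0 *
        (LINT x:\<Omega>|lebesgue.
           (\<Sum>i\<in>UNIV. \<Sum>j\<in>UNIV. strain \<Omega> u i j x * strain \<Omega> u i j x) +
           (\<Sum>i\<in>UNIV. wd \<Omega> \<tau> i x * wd \<Omega> \<tau> i x) +
           (\<Sum>i\<in>UNIV. \<Sum>j\<in>UNIV. wd \<Omega> (R $ i) j x * wd \<Omega> (R $ i) j x)))"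

definition admissible :: "(real^3) set \<Rightarrow> coeffs \<Rightarrow> bool" where
  "admissible \<Omega> P \<longleftrightarrow> coeffs_C1 \<Omega> P \<and> coeffs_symmetric \<Omega> P \<and> coeffs_positive \<Omega> P \<and>
     coeffs_coercive \<Omega> P"

definition mc_inv :: "coeffs \<Rightarrow> 3 \<Rightarrow> 3 \<Rightarrow> real^3 \<Rightarrow> real" where
  "mc_inv P i j x = matrix_inv (\<chi> p q. mc P p q x) $ i $ j"


section \<open>The Hilbert space\<close>

type_synonym state = "(l2^3) \<times> (l2^3) \<times> l2 \<times> l2 \<times> (l2^3) \<times> (l2^3)"

definition Hsp :: "(real^3) set \<Rightarrow> state set" where
  "Hsp \<Omega> = W012vec \<Omega> \<times> L2vec \<Omega> \<times> W012 \<Omega> \<times> L2 \<Omega> \<times> W012vec \<Omega> \<times> L2vec \<Omega>"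

fun Hinner :: "(real^3) set \<Rightarrow> coeffs \<Rightarrow> state \<Rightarrow> state \<Rightarrow> real" where
  "Hinner \<Omega> P (u, v, \<tau>, \<theta>, R, M) (u', v', \<tau>', \<theta>', R', M') =
     1 / 2 * (LINT x:\<Omega>|lebesgue.
       (\<Sum>i\<in>UNIV. rho P x * rep_l2 (v $ i) x * rep_l2 (v' $ i) x) +
       thc P x * rep_l2 \<theta> x * rep_l2 \<theta>' x +
       (\<Sum>i\<in>UNIV. \<Sum>j\<in>UNIV. mc P i j x * rep_l2 (M $ i) x * rep_l2 (M' $ j) x) +
       (\<Sum>i\<in>UNIV. \<Sum>j\<in>UNIV. \<Sum>k\<in>UNIV. \<Sum>l\<in>UNIV.
          At P i j k l x * strain \<Omega> u k l x * strain \<Omega> u' i j x +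
          Bt P i j k l x * (strain \<Omega> u i j x * wd \<Omega> (R' $ k) l x +
                            strain \<Omega> u' i j x * wd \<Omega> (R $ k) l x) +
          Ct P i j k l x * wd \<Omega> (R $ i) j x * wd \<Omega> (R' $ k) l x) +
       (\<Sum>i\<in>UNIV. \<Sum>j\<in>UNIV. kc P i j x * wd \<Omega> \<tau> i x * wd \<Omega> \<tau>' j x))"

definition Hnorm :: "(real^3) set \<Rightarrow> coeffs \<Rightarrow> state \<Rightarrow> real" where
  "Hnorm \<Omega> P U = sqrt (Hinner \<Omega> P U U)"


section \<open>The operator\<close>

text \<open>The distributions in the second, fourth and sixth entry before multiplication by
  \<open>\<rho>\<^sup>-\<^sup>1\<close>, \<open>c\<^sup>-\<^sup>1\<close> and \<open>\<ell>\<^sub>s\<^sub>i\<close>. The gradients of \<open>v\<close>, \<open>\<theta>\<close>, \<open>M\<close> are meaningful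
  because the first, third and fifth entry of the image are required to lie in the
  \<open>W\<^sub>0\<^sup>1\<^sup>,\<^sup>2\<close> spaces.\<close>

fun bracket2 :: "(real^3) set \<Rightarrow> coeffs \<Rightarrow> state \<Rightarrow> 3 \<Rightarrow> distribution" where
  "bracket2 \<Omega> P (u, v, \<tau>, \<theta>, R, M) i = (\<lambda>\<phi>.
     \<Sum>j\<in>UNIV. ddist j (distr_of \<Omega> (\<lambda>x.
       (\<Sum>k\<in>UNIV. \<Sum>l\<in>UNIV. At P j i k l x * wd \<Omega> (u $ k) l x)
       - ac P j i x * rep_l2 \<theta> x
       + (\<Sum>k\<in>UNIV. \<Sum>l\<in>UNIV. Bt P j i k l x * wd \<Omega> (R $ l) k x))) \<phi>)"

fun bracket4 :: "(real^3) set \<Rightarrow> coeffs \<Rightarrow> state \<Rightarrow> distribution" where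
  "bracket4 \<Omega> P (u, v, \<tau>, \<theta>, R, M) = (\<lambda>\<phi>.
     - distr_of \<Omega> (\<lambda>x. \<Sum>i\<in>UNIV. \<Sum>j\<in>UNIV. ac P i j x * wd \<Omega> (v $ i) j x) \<phi>
     + (\<Sum>i\<in>UNIV. ddist i (distr_of \<Omega> (\<lambda>x. \<Sum>j\<in>UNIV.
         kc P i j x * wd \<Omega> \<tau> j x + ktc P i j x * wd \<Omega> \<theta> j x
         - dc P i j x * rep_l2 (M $ j) x)) \<phi>)
     - distr_of \<Omega> (\<lambda>x. \<Sum>i\<in>UNIV. \<Sum>j\<in>UNIV. bc P j i x * wd \<Omega> (M $ i) j x) \<phi>)"

fun bracket6 :: "(real^3) set \<Rightarrow> coeffs \<Rightarrow> state \<Rightarrow> 3 \<Rightarrow> distribution" where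
  "bracket6 \<Omega> P (u, v, \<tau>, \<theta>, R, M) i = (\<lambda>\<phi>.
     (\<Sum>j\<in>UNIV. ddist j (distr_of \<Omega> (\<lambda>x.
       (\<Sum>k\<in>UNIV. \<Sum>l\<in>UNIV. Bt P k l j i x * wd \<Omega> (u $ k) l x)
       - bc P j i x * rep_l2 \<theta> x
       + (\<Sum>k\<in>UNIV. \<Sum>l\<in>UNIV. Ct P j i k l x * wd \<Omega> (R $ k) l x)
       + (\<Sum>k\<in>UNIV. \<Sum>l\<in>UNIV. Ctt P j i k l x * wd \<Omega> (M $ k) l x))) \<phi>)
     - distr_of \<Omega> (\<lambda>x. \<Sum>j\<in>UNIV. dc P i j x * wd \<Omega> \<theta> j x) \<phi>)"

text \<open>\<open>A_graph \<Omega> P U W\<close>: the image of \<open>U\<close> is the element \<open>W\<close> of the Hilbert space.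
  A product \<open>\<rho>\<^sup>-\<^sup>1 T\<close> of a distribution with a continuous, nowhere vanishing coefficient is an
  \<open>L\<^sup>2\<close> function iff \<open>T\<close> is one, and likewise for the multiplication with the invertible
  matrix \<open>(\<ell>\<^sub>s\<^sub>i)\<close>; hence the brackets are identified with \<open>L\<^sup>2\<close> functions \<open>G2\<close>, \<open>G4\<close>, \<open>G6\<close>
  before the multiplication is carried out.\<close>

definition A_graph :: "(real^3) set \<Rightarrow> coeffs \<Rightarrow> state \<Rightarrow> state \<Rightarrow> bool" where
  "A_graph \<Omega> P U W \<longleftrightarrow> U \<in> Hsp \<Omega> \<and> W \<in> Hsp \<Omega> \<and>
     (case U of (u, v, \<tau>, \<theta>, R, M) \<Rightarrow>
       \<exists>G2\<in>L2vec \<Omega>. \<exists>G4\<in>L2 \<Omega>. \<exists>G6\<in>L2vec \<Omega>.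
         (\<forall>i. eq_distr \<Omega> (distr_of \<Omega> (rep_l2 (G2 $ i))) (bracket2 \<Omega> P U i)) \<and>
         eq_distr \<Omega> (distr_of \<Omega> (rep_l2 G4)) (bracket4 \<Omega> P U) \<and>
         (\<forall>i. eq_distr \<Omega> (distr_of \<Omega> (rep_l2 (G6 $ i))) (bracket6 \<Omega> P U i)) \<and>
         W = (v,
              (\<chi> i. l2_on \<Omega> (\<lambda>x. inverse (rho P x) * rep_l2 (G2 $ i) x)),
              \<theta>,
              l2_on \<Omega> (\<lambda>x. inverse (thc P x) * rep_l2 G4 x),
              M,
              (\<chi> s. l2_on \<Omega> (\<lambda>x. \<Sum>i\<in>UNIV. mc_inv P s i x * rep_l2 (G6 $ i) x))))"

definition domA :: "(real^3) set \<Rightarrow> coeffs \<Rightarrow> state set" where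
  "domA \<Omega> P = {U \<in> Hsp \<Omega>. \<exists>W\<in>Hsp \<Omega>. A_graph \<Omega> P U W}"

definition opA :: "(real^3) set \<Rightarrow> coeffs \<Rightarrow> state \<Rightarrow> state" where
  "opA \<Omega> P U = (THE W. A_graph \<Omega> P U W)"

definition graph_norm :: "(real^3) set \<Rightarrow> coeffs \<Rightarrow> state \<Rightarrow> real" where
  "graph_norm \<Omega> P U = Hnorm \<Omega> P U + Hnorm \<Omega> P (opA \<Omega> P U)"


section \<open>The Cauchy problem\<close>

definition source ::
  "(real^3) set \<Rightarrow> coeffs \<Rightarrow> (real \<Rightarrow> l2^3) \<Rightarrow> (real \<Rightarrow> l2) \<Rightarrow> (real \<Rightarrow> l2^3) \<Rightarrow> real \<Rightarrow> state" where
  "source \<Omega> P f s Q t =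
     (0, f t, 0,
      l2_on \<Omega> (\<lambda>x. inverse (thc P x) * rho P x * rep_l2 (s t) x),
      0,
      (\<chi> i. l2_on \<Omega> (\<lambda>x. \<Sum>j\<in>UNIV. mc_inv P i j x * rho P x * rep_l2 (Q t $ j) x)))"

definition solution ::
  "(real^3) set \<Rightarrow> coeffs \<Rightarrow> (real \<Rightarrow> state) \<Rightarrow> state \<Rightarrow> (real \<Rightarrow> state) \<Rightarrow> bool" where
  "solution \<Omega> P F U0 U \<longleftrightarrow>
     C1_in (Hsp \<Omega>) (Hnorm \<Omega> P) U \<and>
     C0_in (domA \<Omega> P) (graph_norm \<Omega> P) U \<and>
     (\<forall>t\<ge>0. deriv_in (Hnorm \<Omega> P) U t (opA \<Omega> P (U t) + F t)) \<and>
     U 0 = U0"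

end

theory Submission
  imports Defs
begin

text \<open>Write \<open>y = (\<^bold>u, \<tau>, \<^bold>R)\<close> and \<open>z = y'\<close>. By the symmetry of the coefficients the system has
  the weak form \<open>m(z',\<phi>) + b(z,\<phi>) + a(y,\<phi>) = m(F,\<phi>)\<close> for all \<open>\<phi>\<close> in \<open>W\<^sub>0\<^sup>1\<^sup>,\<^sup>2\<close>: here \<open>a\<close> is
  the stored energy, which is coercive by assumption (c) together with the inequalities of Korn and
  Poincare; \<open>m\<close> is the inertia; and \<open>b(z,z) \<ge> 0\<close>, since the couplings through \<open>a\<^sub>i\<^sub>j\<close>, \<open>b\<^sub>i\<^sub>j\<close>,
  \<open>d\<^sub>i\<^sub>j\<close> are skew. Hence the operator is dissipative for the energy product, and its resolvents exist by
  the Lax-Milgram theorem. For a dissipative operator with everywhere defined resolvents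
  \<open>J\<^sub>h = (1 - h A)\<^sup>-\<^sup>1\<close> the implicit Euler iterates with steps \<open>2\<^sup>-\<^sup>k\<close> converge to the semigroup,
  because \<open>J\<^sub>h\<^sup>2 - J\<^sub>2\<^sub>h\<close> is of order \<open>h\<^sup>2\<close> on \<open>D(A\<^sup>2)\<close>. For a \<open>C\<^sup>1\<close> source \<open>F\<close> the derivative of the
  solution is \<open>w(t) = S(t) (A U\<^sub>0 + F(0)) + \<integral>\<^sub>0\<^sup>t S(t - r) F'(r) dr\<close>, and that \<open>U\<^sub>0 + \<integral>\<^sub>0\<^sup>t w\<close> lies in the
  domain with image \<open>w(t) - F(t)\<close> follows by exchanging the order of integration. Uniqueness is the
  energy estimate.\<close>

section \<open>Coercive forms on closed subspaces of a Hilbert space\<close>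

text \<open>The brackets of the operator only ask that whole divergences be square-integrable, so an
  element of the domain need not have second derivatives of its own. The operator is therefore kept
  as a linear relation cut out by testing, and the semigroup is built for relations: since the graph
  is a closed subspace, the integral of a curve in it stays in it, which replaces every exchange of
  an unbounded operator with an integral. Spaces such as \<open>L2 \<Omega>\<close> are subspaces of
  the type \<open>l2\<close>, hence the carriers \<open>S\<close>, \<open>V\<close> and
  \<open>H\<close>. A Sobolev function is stored together with its gradient; W_0^{1,2} is then a
  closed subspace of a product of copies of \<open>l2\<close>, and its norm is the product norm, so
  the Hilbert space arguments apply to it directly. The energy product is only equivalent to this
  norm, so contractions in energy appear as bounds with a constant \<open>M\<close>. Computations
  with coefficients are done pointwise: forms are matched with integrands term by term, and the
  symmetries enter as identities between finite sums at a point.\<close>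

lemma nonneg_quadratic_imp_linear_zero:
  fixes a b :: real
  assumes "\<And>t. 0 \<le> 2 * t * a + t\<^sup>2 * b"
  shows "a = 0"
proof (rule ccontr)
  assume a: "a \<noteq> 0"
  \<comment> \<open>At \<open>t = - a / c\<close> the quadratic equals
    \<open>(a\<^sup>2 / c\<^sup>2) * (b - 2 * c)\<close>, negative for nonzero \<open>a\<close> as
    soon as \<open>b < c\<close>; the summand 1 keeps \<open>c\<close> positive when
    \<open>b = 0\<close>.\<close>
  define c where "c = \<bar>b\<bar> + 1"
  have c: "c > 0" "b < c" by (auto simp: c_def)
  have "0 \<le> 2 * (- a / c) * a + (- a / c)\<^sup>2 * b" by (rule assms)
  also have "\<dots> = (a\<^sup>2 / c\<^sup>2) * (b - 2 * c)"
    using c by (simp add: field_simps power2_eq_square)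
  also have "\<dots> < 0"
    using a c by (intro mult_pos_neg) auto
  finally show False by simp
qed

text \<open>Direct method: \<open>J x\<close> is the squared distance to the representing vector up
  to a constant, so its minimiser over \<open>V\<close> is that vector. The parallelogram law makes
  minimising sequences Cauchy, and the first variation of \<open>J\<close> at the minimiser vanishes
  in every direction of \<open>V\<close>.\<close>

lemma riesz_representation:
  fixes V :: "'a::{real_inner,banach} set" and l :: "'a \<Rightarrow> real"
  assumes V: "closed V" "subspace V" and l: "bounded_linear l"
  obtains w where "w \<in> V" "\<And>x. x \<in> V \<Longrightarrow> inner w x = l x"
proof -
  interpret l: bounded_linear l by fact
  define J where "J x = inner x x - 2 * l x" for x
  obtain C where C: "\<And>x. norm (l x) \<le> norm x * C" "C > 0"
    using l.pos_bounded by (auto simp: mult.commute)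
  have lb: "- C\<^sup>2 \<le> J x" for x
  proof -
    have "l x \<le> norm x * C" using C(1)[of x] by simp
    moreover have "0 \<le> (norm x - C)\<^sup>2" by simp
    ultimately show ?thesis
      by (simp add: J_def power2_norm_eq_inner[symmetric] power2_diff)
  qed
  define m where "m = Inf (J ` V)"
  have bdd: "bdd_below (J ` V)" using lb by (auto simp: bdd_below_def)
  have V0: "0 \<in> V" using V subspace_0 by blast
  have m: "m \<le> J x" if "x \<in> V" for x
    unfolding m_def using bdd that by (intro cInf_lower) auto
  have "\<exists>x\<in>V. J x < m + 1 / Suc n" for n
  proof -
    have "Inf (J ` V) < m + 1 / Suc n" by (simp add: m_def)
    then show ?thesis using V0 bdd by (subst (asm) cInf_less_iff) auto
  qed
  then obtain X where X: "\<And>n. X n \<in> V" "\<And>n. J (X n) < m + 1 / Suc n" by metis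
  have par: "(norm (x - y))\<^sup>2 \<le> 2 * (J x - m) + 2 * (J y - m)" if "x \<in> V" "y \<in> V" for x y
  proof -
    have "(1/2) *\<^sub>R (x + y) \<in> V" using that V by (simp add: subspace_add subspace_scale)
    then have "m \<le> J ((1/2) *\<^sub>R (x + y))" by (rule m)
    moreover have "(norm (x - y))\<^sup>2 = 2 * J x + 2 * J y - 4 * J ((1/2) *\<^sub>R (x + y))"
      by (simp add: J_def power2_norm_eq_inner inner_diff inner_add l.add l.scaleR inner_commute algebra_simps)
    ultimately show ?thesis by simp
  qed
  have "Cauchy X"
  proof (rule CauchyI)
    fix e :: real assume e: "0 < e"
    \<comment> \<open>Both excesses over the infimum fall below \<open>e\<^sup>2 / 4\<close>, and
      \<open>par\<close> counts each of them twice.\<close>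
    obtain N where N: "4 / e\<^sup>2 < real N" using reals_Archimedean2 by blast
    have "norm (X a - X b) < e" if "a \<ge> N" "b \<ge> N" for a b
    proof -
      have inv: "J (X k) - m < e\<^sup>2 / 4" if "k \<ge> N" for k
      proof -
        have "4 / e\<^sup>2 < real (Suc k)" using N that by simp
        then have "1 / real (Suc k) < e\<^sup>2 / 4" using e by (simp add: field_simps)
        then show ?thesis using X(2)[of k] by argo
      qed
      have "(norm (X a - X b))\<^sup>2 \<le> 2 * (J (X a) - m) + 2 * (J (X b) - m)" using par X by blast
      also have "\<dots> < 2 * (e\<^sup>2 / 4) + 2 * (e\<^sup>2 / 4)"
        using inv[OF that(1)] inv[OF that(2)] by argo
      finally have "(norm (X a - X b))\<^sup>2 < e\<^sup>2" by simp
      then show ?thesis using e by (simp add: power_less_imp_less_base)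
    qed
    then show "\<exists>M. \<forall>m\<ge>M. \<forall>n\<ge>M. norm (X m - X n) < e" by blast
  qed
  then obtain w where w: "X \<longlonglongrightarrow> w" using Cauchy_convergent convergent_def by blast
  have wV: "w \<in> V" using V(1) w X(1) closed_sequentially by blast
  have "(\<lambda>n. J (X n)) \<longlonglongrightarrow> J w"
    unfolding J_def by (intro tendsto_intros w l.tendsto)
  moreover have "(\<lambda>n. m + 1 / Suc n) \<longlonglongrightarrow> m + 0"
    by (intro tendsto_intros LIMSEQ_Suc[OF lim_1_over_n])
  ultimately have Jw: "J w \<le> m"
    using X(2) by (metis (no_types, lifting) LIMSEQ_le add.right_neutral less_imp_le)
  have "inner w x = l x" if x: "x \<in> V" for x
  proof -
    have "inner w x - l x = 0"
    proof (rule nonneg_quadratic_imp_linear_zero)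
      fix t :: real
      have "w + t *\<^sub>R x \<in> V" using V wV x by (simp add: subspace_add subspace_scale)
      then have "J w \<le> J (w + t *\<^sub>R x)" using Jw m by force
      then show "0 \<le> 2 * t * (inner w x - l x) + t\<^sup>2 * inner x x"
        by (simp add: J_def l.add l.scaleR inner_add inner_commute power2_eq_square algebra_simps)
    qed
    then show ?thesis by simp
  qed
  then show ?thesis using wV that by blast
qed

text \<open>Without symmetry there is nothing to minimise. Instead \<open>f w\<close> is the Riesz
  representative of the damped iteration \<open>w - r (B w - l)\<close>, a contraction of
  \<open>V\<close> for small \<open>r\<close>; its fixed point solves the equation.\<close>

lemma lax_milgram:
  fixes V :: "'a::{real_inner,banach} set" and B :: "'a \<Rightarrow> 'a \<Rightarrow> real"
  assumes V: "closed V" "subspace V" and B: "bounded_bilinear B" and l: "bounded_linear l"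
    and c: "c > 0" "\<And>x. x \<in> V \<Longrightarrow> c * (norm x)\<^sup>2 \<le> B x x"
  obtains w where "w \<in> V" "\<And>x. x \<in> V \<Longrightarrow> B w x = l x"
proof -
  interpret B: bounded_bilinear B by fact
  interpret l: bounded_linear l by fact
  obtain K0 where K0: "K0 > 0" "\<And>x y. norm (B x y) \<le> norm x * norm y * K0"
    using B.pos_bounded by blast
  \<comment> \<open>Taking the maximum ensures \<open>c \<le> K\<close>, hence a nonnegative number
    under the root in \<open>q\<close>.\<close>
  define K where "K = max K0 c"
  have K: "K > 0" "K \<ge> c" "\<And>x y. \<bar>B x y\<bar> \<le> K * norm x * norm y"
  proof -
    fix x y
    have "\<bar>B x y\<bar> \<le> norm x * norm y * K0" using K0 by simp
    also have "\<dots> \<le> norm x * norm y * K" by (intro mult_left_mono) (auto simp: K_def)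
    finally show "\<bar>B x y\<bar> \<le> K * norm x * norm y" by (simp add: algebra_simps)
  qed (use K0 c in \<open>auto simp: K_def\<close>)
  \<comment> \<open>This \<open>r\<close> minimises the squared contraction factor
    \<open>1 - 2 * r * c + r\<^sup>2 * K\<^sup>2\<close>; the minimum is the square of
    \<open>q\<close> below.\<close>
  define r where "r = c / K\<^sup>2"
  have r: "r > 0" using c K by (simp add: r_def)
  have "\<exists>y\<in>V. \<forall>x\<in>V. inner y x = inner w x - r * (B w x - l x)" for w
  proof -
    have "bounded_linear (\<lambda>x. inner w x - r * (B w x - l x))"
      by (intro bounded_linear_sub bounded_linear_const_mult bounded_linear_inner_right
          B.bounded_linear_right l)
    from riesz_representation[OF V this] show ?thesis by metis
  qed
  then obtain f where f: "\<And>w. f w \<in> V"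
      "\<And>w x. x \<in> V \<Longrightarrow> inner (f w) x = inner w x - r * (B w x - l x)"
    by metis
  define q where "q = sqrt (1 - c\<^sup>2 / K\<^sup>2)"
  have cK: "0 < c\<^sup>2 / K\<^sup>2" "c\<^sup>2 / K\<^sup>2 \<le> 1" using c K by (auto simp: power_mono)
  have lip: "dist (f x) (f y) \<le> q * dist x y" if xy: "x \<in> V" "y \<in> V" for x y
  proof -
    define z where "z = x - y"
    have z: "z \<in> V" using xy V by (simp add: z_def subspace_diff)
    obtain t where t: "t \<in> V" "\<And>v. v \<in> V \<Longrightarrow> inner t v = B z v"
      using riesz_representation[OF V B.bounded_linear_right] by metis
    have nt: "norm t \<le> K * norm z"
    proof (cases "t = 0")
      case False
      have "(norm t)\<^sup>2 = B z t" using t by (simp add: power2_norm_eq_inner)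
      also have "\<dots> \<le> K * norm z * norm t" using K(3)[of z t] by simp
      finally show ?thesis using False by (simp add: power2_eq_square)
    qed (use K in simp)
    have dV: "f x - f y \<in> V" using f V by (simp add: subspace_diff)
    have "inner (f x - f y) v = inner (z - r *\<^sub>R t) v" if "v \<in> V" for v
    proof -
      have "r * B x v - r * B y v = r * inner t v"
        using t(2)[OF that] by (simp add: z_def B.diff_left right_diff_distrib)
      then show ?thesis
        using f(2)[OF that, of x] f(2)[OF that, of y]
        by (simp add: inner_diff z_def algebra_simps)
    qed
    moreover have "f x - f y - (z - r *\<^sub>R t) \<in> V"
      using dV z t V by (simp add: subspace_diff subspace_scale)
    ultimately have "inner (f x - f y - (z - r *\<^sub>R t)) (f x - f y - (z - r *\<^sub>R t)) = 0"
      by (metis inner_diff_left right_minus_eq)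
    then have d: "f x - f y = z - r *\<^sub>R t" by simp
    have "(norm (f x - f y))\<^sup>2 = (norm z)\<^sup>2 - 2 * r * B z z + r\<^sup>2 * (norm t)\<^sup>2"
      unfolding d power2_norm_eq_inner using t(2)[OF z]
      by (simp add: inner_diff inner_commute power2_eq_square algebra_simps)
    also have "\<dots> \<le> (norm z)\<^sup>2 - 2 * r * (c * (norm z)\<^sup>2) + r\<^sup>2 * (K * norm z)\<^sup>2"
    proof -
      have "r * (c * (norm z)\<^sup>2) \<le> r * B z z" using r c(2)[OF z] by (intro mult_left_mono) auto
      moreover have "r\<^sup>2 * (norm t)\<^sup>2 \<le> r\<^sup>2 * (K * norm z)\<^sup>2"
        using nt by (intro mult_left_mono power_mono) auto
      ultimately show ?thesis by linarith
    qed
    also have "\<dots> = (1 - c\<^sup>2 / K\<^sup>2) * (norm z)\<^sup>2"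
      using K by (simp add: r_def field_simps power2_eq_square)
    also have "\<dots> = (q * norm z)\<^sup>2" using cK by (simp add: q_def power_mult_distrib)
    finally have "norm (f x - f y) \<le> q * norm z"
      by (rule power2_le_imp_le) (use cK in \<open>auto simp: q_def\<close>)
    then show ?thesis by (simp add: dist_norm z_def)
  qed
  have "\<exists>!x\<in>V. f x = x"
    using V subspace_0 cK f lip
    by (intro Banach_fix[of V q]) (auto simp: q_def complete_eq_closed)
  then obtain w where w: "w \<in> V" "f w = w" by blast
  have "B w x = l x" if "x \<in> V" for x
    using f(2)[OF that, of w] w r by simp
  then show ?thesis using w that by blast
qed

section \<open>Linear maximal dissipative relations\<close>

text \<open>If \<open>p\<close> is the orthogonal projection of the integral \<open>x\<close> onto
  \<open>V\<close>, then \<open>x - p\<close> is orthogonal to every value of the integrand, hence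
  to \<open>x\<close> as well as to \<open>p\<close>, hence to itself. The main use is with the
  graph of the operator as \<open>V\<close>.\<close>

lemma integral_in_closed_subspace:
  fixes f :: "real \<Rightarrow> 'a::{real_inner,banach}"
  assumes V: "closed V" "subspace V" and f: "continuous_on {a..b} f" "\<And>t. t \<in> {a..b} \<Longrightarrow> f t \<in> V"
  shows "integral {a..b} f \<in> V"
proof -
  define x where "x = integral {a..b} f"
  obtain p where p: "p \<in> V" "\<And>v. v \<in> V \<Longrightarrow> inner p v = inner x v"
    using riesz_representation[OF V bounded_linear_inner_right] by metis
  have "inner (x - p) x = integral {a..b} (\<lambda>t. inner (x - p) (f t))"
    using integral_linear[OF integrable_continuous_real[OF f(1)] bounded_linear_inner_right[of "x - p"]]
    by (simp add: x_def o_def)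
  also have "\<dots> = integral {a..b} (\<lambda>t. 0)"
    using p f(2) by (intro integral_cong) (simp add: inner_diff_left)
  finally have "inner (x - p) x = 0" by simp
  moreover have "inner (x - p) p = 0" using p by (simp add: inner_diff_left)
  ultimately have "inner (x - p) (x - p) = 0" by (simp add: inner_diff_right)
  then show ?thesis using p by (simp add: x_def)
qed

lemma integral_Pair:
  fixes f :: "real \<Rightarrow> 'a::banach" and g :: "real \<Rightarrow> 'b::banach"
  assumes "continuous_on {a..b} f" "continuous_on {a..b} g"
  shows "integral {a..b} (\<lambda>t. (f t, g t)) = (integral {a..b} f, integral {a..b} g)"
proof -
  have i: "(\<lambda>t. (f t, g t)) integrable_on {a..b}"
    using assms by (intro integrable_continuous_real continuous_intros)
  show ?thesis
    using integral_linear[OF i bounded_linear_fst] integral_linear[OF i bounded_linear_snd]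
    by (simp add: o_def prod_eq_iff)
qed

lemma has_vector_derivative_quadratic_bound:
  fixes f :: "real \<Rightarrow> 'a::real_normed_vector"
  assumes "\<And>s. s \<in> A \<Longrightarrow> norm (f s - f t - (s - t) *\<^sub>R D) \<le> C * (s - t)\<^sup>2"
  shows "(f has_vector_derivative D) (at t within A)"
proof -
  have "((\<lambda>s. (f s - f t - (s - t) *\<^sub>R D) /\<^sub>R norm (s - t)) \<longlongrightarrow> 0) (at t within A)"
  proof (rule Lim_null_comparison)
    show "\<forall>\<^sub>F s in at t within A. norm ((f s - f t - (s - t) *\<^sub>R D) /\<^sub>R norm (s - t)) \<le> C * \<bar>s - t\<bar>"
    proof (rule eventually_at_filter[THEN iffD2], rule always_eventually, intro allI impI)
      fix s assume "s \<noteq> t" "s \<in> A"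
      have "norm (f s - f t - (s - t) *\<^sub>R D) \<le> C * (\<bar>s - t\<bar> * \<bar>s - t\<bar>)"
        using assms[OF \<open>s \<in> A\<close>] by (simp add: power2_eq_square abs_mult[symmetric])
      then show "norm ((f s - f t - (s - t) *\<^sub>R D) /\<^sub>R norm (s - t)) \<le> C * \<bar>s - t\<bar>"
        using \<open>s \<noteq> t\<close> by (simp add: divide_simps mult_ac)
    qed
    have "((\<lambda>s. C * \<bar>s - t\<bar>) \<longlongrightarrow> C * \<bar>t - t\<bar>) (at t within A)"
      by (intro tendsto_intros)
    then show "((\<lambda>s. C * \<bar>s - t\<bar>) \<longlongrightarrow> 0) (at t within A)" by simp
  qed
  then show ?thesis
    unfolding has_vector_derivative_def has_derivative_within
    by (auto intro!: bounded_linear_scaleR_left simp: diff_diff_eq divide_inverse)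
qed

lemma subspace_closure:
  fixes W :: "'a::real_normed_vector set"
  assumes "subspace W"
  shows "subspace (closure W)"
proof (rule subspaceI)
  show "0 \<in> closure W" using subspace_0[OF assms] closure_subset by blast
next
  fix x y assume "x \<in> closure W" "y \<in> closure W"
  then obtain X Y where "\<And>n. X n \<in> W" "X \<longlonglongrightarrow> x" "\<And>n. Y n \<in> W" "Y \<longlonglongrightarrow> y"
    unfolding closure_sequential by blast
  then have "\<forall>n. X n + Y n \<in> W" "(\<lambda>n. X n + Y n) \<longlonglongrightarrow> x + y"
    using assms by (auto intro: subspace_add tendsto_add)
  then show "x + y \<in> closure W" unfolding closure_sequential by (intro exI[of _ "\<lambda>n. X n + Y n"]) auto
next
  fix r x assume "x \<in> closure W"
  then obtain X where "\<And>n. X n \<in> W" "X \<longlonglongrightarrow> x" unfolding closure_sequential by blast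
  then have "\<forall>n. r *\<^sub>R X n \<in> W" "(\<lambda>n. r *\<^sub>R X n) \<longlonglongrightarrow> r *\<^sub>R x"
    using assms by (auto intro: subspace_scale tendsto_intros)
  then show "r *\<^sub>R x \<in> closure W" unfolding closure_sequential by (intro exI[of _ "\<lambda>n. r *\<^sub>R X n"]) auto
qed

text \<open>\<open>G\<close> is the graph of the operator and \<open>ip\<close> the energy product,
  which needs to be an inner product on \<open>S\<close> only. The assumption \<open>single\<close>
  is single-valuedness, for a linear relation a condition at 0; together with \<open>range\<close>
  it also forces the domain to be dense.\<close>

locale m_dissipative =
  fixes S :: "'e::{real_inner,banach} set" and ip :: "'e \<Rightarrow> 'e \<Rightarrow> real"
    and G :: "('e \<times> 'e) set" and c :: real
  assumes closed_S: "closed S" and subspace_S: "subspace S"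
    and bilinear_ip: "bounded_bilinear ip"
    and ip_sym: "\<And>x y. x \<in> S \<Longrightarrow> y \<in> S \<Longrightarrow> ip x y = ip y x"
    and c_pos: "c > 0" and coercive: "\<And>x. x \<in> S \<Longrightarrow> c * (norm x)\<^sup>2 \<le> ip x x"
    and subspace_G: "subspace G" and G_S: "G \<subseteq> S \<times> S"
    and dissip: "\<And>x y. (x, y) \<in> G \<Longrightarrow> ip x y \<le> 0"
    and range: "\<And>h x. h > 0 \<Longrightarrow> x \<in> S \<Longrightarrow> \<exists>y z. (y, z) \<in> G \<and> y - h *\<^sub>R z = x"
    and single: "\<And>y. (0, y) \<in> G \<Longrightarrow> y = 0"
begin

section \<open>Resolvents, closedness of the graph, density of the domain\<close>

interpretation ip: bounded_bilinear ip by (rule bilinear_ip)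

lemmas S_add = subspace_add[OF subspace_S]
  and S_diff = subspace_diff[OF subspace_S]
  and S_scale = subspace_scale[OF subspace_S]

lemma G_add: "(x, y) \<in> G \<Longrightarrow> (x', y') \<in> G \<Longrightarrow> (x + x', y + y') \<in> G"
  using subspace_add[OF subspace_G, of "(x, y)" "(x', y')"] by simp

lemma G_diff: "(x, y) \<in> G \<Longrightarrow> (x', y') \<in> G \<Longrightarrow> (x - x', y - y') \<in> G"
  using subspace_diff[OF subspace_G, of "(x, y)" "(x', y')"] by simp

lemma G_scale: "(x, y) \<in> G \<Longrightarrow> (r *\<^sub>R x, r *\<^sub>R y) \<in> G"
  using subspace_scale[OF subspace_G, of "(x, y)" r] by simp

lemma G_in_S: "(x, y) \<in> G \<Longrightarrow> x \<in> S" "(x, y) \<in> G \<Longrightarrow> y \<in> S"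
  using G_S by auto

lemma ip_self_pos: "x \<in> S \<Longrightarrow> 0 \<le> ip x x"
  using coercive[of x] c_pos by (smt (verit) mult_nonneg_nonneg zero_le_power2)

lemma ip_self_zero: "x \<in> S \<Longrightarrow> ip x x \<le> 0 \<Longrightarrow> x = 0"
  using coercive[of x] c_pos
  by (smt (verit) mult_pos_pos norm_eq_zero power2_less_0 zero_less_power2)

text \<open>The resolvent (1 - h A)^{-1}. The choice is unambiguous for \<open>h > 0\<close> and
  \<open>x \<in> S\<close>, where existence is \<open>range\<close> and uniqueness is
  dissipativity.\<close>

definition J :: "real \<Rightarrow> 'e \<Rightarrow> 'e" where
  "J h x = (SOME y. \<exists>z. (y, z) \<in> G \<and> y - h *\<^sub>R z = x)"

text \<open>The difference \<open>d\<close> of two solutions equals \<open>h\<close> times its own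
  image, so dissipativity makes \<open>ip d d\<close> nonpositive.\<close>

lemma G_unique:
  assumes "h > 0" "(y, z) \<in> G" "(y', z') \<in> G" "y - h *\<^sub>R z = y' - h *\<^sub>R z'"
  shows "y = y'"
proof -
  have g: "(y - y', z - z') \<in> G" using assms by (intro G_diff)
  have e: "y - y' = h *\<^sub>R (z - z')" using assms(4) by (simp add: algebra_simps)
  have "ip (y - y') (y - y') = h * ip (y - y') (z - z')"
    by (subst (2) e) (simp add: ip.scaleR_right)
  also have "\<dots> \<le> 0" using dissip[OF g] assms(1) by (simp add: mult_le_0_iff)
  finally have "y - y' = 0" using g G_in_S ip_self_zero by blast
  then show ?thesis by simp
qed

lemma J_eq:
  assumes "h > 0" "(y, z) \<in> G" "y - h *\<^sub>R z = x"
  shows "J h x = y"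
proof -
  have "\<exists>z. (J h x, z) \<in> G \<and> J h x - h *\<^sub>R z = x"
    unfolding J_def by (rule someI[of _ y]) (use assms in blast)
  then show ?thesis using G_unique assms by metis
qed

lemma J_G:
  assumes "h > 0" "x \<in> S"
  shows "(J h x, (J h x - x) /\<^sub>R h) \<in> G"
proof -
  obtain y z where yz: "(y, z) \<in> G" "y - h *\<^sub>R z = x" using range assms by blast
  then have "J h x = y" using J_eq assms by blast
  moreover have "(y - x) /\<^sub>R h = z" using yz assms by (auto simp: algebra_simps)
  ultimately show ?thesis using yz by simp
qed

lemma J_S: "h > 0 \<Longrightarrow> x \<in> S \<Longrightarrow> J h x \<in> S"
  using J_G G_in_S by blast

lemma J_diff: "h > 0 \<Longrightarrow> x \<in> S \<Longrightarrow> y \<in> S \<Longrightarrow> J h (x - y) = J h x - J h y"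
  by (rule J_eq[OF _ G_diff[OF J_G J_G]]) (auto simp: algebra_simps)

lemma J_scale: "h > 0 \<Longrightarrow> x \<in> S \<Longrightarrow> J h (r *\<^sub>R x) = r *\<^sub>R J h x"
  by (rule J_eq[OF _ G_scale[OF J_G]]) (auto simp: scaleR_diff_right mult.left_commute[of _ r])

text \<open>The resolvent commutes with the operator. If \<open>z\<close> is the image of
  \<open>J h x\<close>, subtracting \<open>(x, y)\<close> gives
  \<open>(h *\<^sub>R z, z - y) \<in> G\<close>; after division by \<open>h\<close> this says that
  \<open>z\<close> solves the resolvent equation for \<open>y\<close>.\<close>

lemma J_of_G:
  assumes "h > 0" "(x, y) \<in> G"
  shows "J h x = x + h *\<^sub>R J h y" "(J h x, J h y) \<in> G"
proof -
  have xS: "x \<in> S" "y \<in> S" using assms G_in_S by auto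
  define z where "z = (J h x - x) /\<^sub>R h"
  have Jz: "(J h x, z) \<in> G" using J_G assms xS by (simp add: z_def)
  have e: "J h x - x = h *\<^sub>R z" using assms by (simp add: z_def)
  have "(h *\<^sub>R z, z - y) \<in> G" using G_diff[OF Jz assms(2)] e by simp
  then have "(z, (z - y) /\<^sub>R h) \<in> G" using G_scale[of _ _ "inverse h"] assms by fastforce
  then have "J h y = z" by (rule J_eq[OF assms(1)]) (use assms in \<open>simp add: algebra_simps\<close>)
  then show "J h x = x + h *\<^sub>R J h y" "(J h x, J h y) \<in> G" using e Jz by (auto simp: algebra_simps)
qed

lemma Jn_S: "h > 0 \<Longrightarrow> x \<in> S \<Longrightarrow> (J h ^^ n) x \<in> S"
  by (induction n) (auto intro: J_S)

lemma Jn_diff: "h > 0 \<Longrightarrow> x \<in> S \<Longrightarrow> y \<in> S \<Longrightarrow> (J h ^^ n) (x - y) = (J h ^^ n) x - (J h ^^ n) y"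
  by (induction n) (auto simp: J_diff Jn_S)

lemma Jn_scale: "h > 0 \<Longrightarrow> x \<in> S \<Longrightarrow> (J h ^^ n) (r *\<^sub>R x) = r *\<^sub>R (J h ^^ n) x"
  by (induction n) (auto simp: J_scale Jn_S)

lemma Jn_of_G: "h > 0 \<Longrightarrow> (x, y) \<in> G \<Longrightarrow> ((J h ^^ n) x, (J h ^^ n) y) \<in> G"
  by (induction n) (auto intro: J_of_G)

text \<open>Expanding the energy of \<open>x = y - h *\<^sub>R z\<close>, the cross term
  \<open>- 2 * h * ip y z\<close> is nonnegative by dissipativity, and so is the last term.\<close>

lemma ip_J_le:
  assumes "h > 0" "x \<in> S"
  shows "ip (J h x) (J h x) \<le> ip x x"
proof -
  define y z where "y = J h x" and "z = (J h x - x) /\<^sub>R h"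
  have g: "(y, z) \<in> G" using J_G assms by (simp add: y_def z_def)
  then have s: "y \<in> S" "z \<in> S" using G_in_S by auto
  have x: "x = y - h *\<^sub>R z" using assms by (simp add: y_def z_def)
  have "ip x x = ip y y - 2 * h * ip y z + h\<^sup>2 * ip z z"
    unfolding x using ip_sym[OF s]
    by (simp add: ip.diff_left ip.diff_right ip.scaleR_left ip.scaleR_right power2_eq_square algebra_simps)
  moreover have "h * ip y z \<le> 0" using dissip[OF g] assms by (simp add: mult_le_0_iff)
  moreover have "0 \<le> h\<^sup>2 * ip z z" using ip_self_pos[OF s(2)] by simp
  ultimately show ?thesis by (simp add: y_def)
qed

lemma ip_Jn_le: "h > 0 \<Longrightarrow> x \<in> S \<Longrightarrow> ip ((J h ^^ n) x) ((J h ^^ n) x) \<le> ip x x"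
  by (induction n) (auto intro: order.trans[OF ip_J_le] Jn_S)

text \<open>Powers of the resolvent contract the energy; passing to the norm and back costs the
  factor \<open>sqrt (K / c)\<close> once, whatever \<open>n\<close> and \<open>h\<close> are. The
  bound is raised to at least 1 so that products of \<open>M\<close> can be rounded up.\<close>

lemma bound_ex: "\<exists>M\<ge>1. \<forall>h n x. h > 0 \<longrightarrow> x \<in> S \<longrightarrow> norm ((J h ^^ n) x) \<le> M * norm x"
proof -
  obtain K where K: "K > 0" "\<And>x y. norm (ip x y) \<le> norm x * norm y * K"
    using ip.pos_bounded by blast
  define M where "M = max 1 (sqrt (K / c))"
  have "norm ((J h ^^ n) x) \<le> M * norm x" if "h > 0" "x \<in> S" for h n x
  proof -
    have "c * (norm ((J h ^^ n) x))\<^sup>2 \<le> ip x x"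
      using coercive[OF Jn_S[OF that]] ip_Jn_le[OF that] by (meson order.trans)
    also have "\<dots> \<le> K * (norm x)\<^sup>2" using K(2)[of x x] by (simp add: power2_eq_square mult_ac)
    finally have "(norm ((J h ^^ n) x))\<^sup>2 \<le> (K / c) * (norm x)\<^sup>2"
      using c_pos by (simp add: field_simps)
    also have "\<dots> = (sqrt (K / c) * norm x)\<^sup>2"
      using K c_pos by (simp add: power_mult_distrib)
    finally have "norm ((J h ^^ n) x) \<le> sqrt (K / c) * norm x"
      by (rule power2_le_imp_le) (use K c_pos in simp)
    also have "\<dots> \<le> M * norm x" by (intro mult_right_mono) (auto simp: M_def)
    finally show ?thesis .
  qed
  then show ?thesis by (intro exI[of _ M]) (auto simp: M_def)
qed

definition M :: real where
  "M = (SOME M. M \<ge> 1 \<and> (\<forall>h n x. h > 0 \<longrightarrow> x \<in> S \<longrightarrow> norm ((J h ^^ n) x) \<le> M * norm x))"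

lemma M_ge: "M \<ge> 1" and Jn_bound: "h > 0 \<Longrightarrow> x \<in> S \<Longrightarrow> norm ((J h ^^ n) x) \<le> M * norm x"
  using someI_ex[OF bound_ex] unfolding M_def[symmetric] by auto

lemma J_bound: "h > 0 \<Longrightarrow> x \<in> S \<Longrightarrow> norm (J h x) \<le> M * norm x"
  using Jn_bound[of h x 1] by simp

text \<open>\<open>(x, y) \<in> G\<close> says that \<open>J 1 (x - y) = x\<close> with
  \<open>x - y \<in> S\<close>, and \<open>J 1\<close> is continuous on \<open>S\<close>.\<close>

lemma closed_G: "closed G"
  unfolding closed_sequential_limits
proof (intro allI impI, elim conjE)
  fix f l assume f: "\<forall>n. f n \<in> G" and lim: "f \<longlonglongrightarrow> l"
  define d where "d n = fst (f n) - snd (f n)" for n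
  define dl where "dl = fst l - snd l"
  have d: "d \<longlonglongrightarrow> dl" unfolding d_def dl_def by (intro tendsto_intros lim)
  have fS: "fst (f n) \<in> S" "snd (f n) \<in> S" for n
    using f G_S by (metis mem_Sigma_iff prod.collapse subsetD)+
  then have dS: "d n \<in> S" for n unfolding d_def by (intro S_diff)
  then have dlS: "dl \<in> S" using closed_S d closed_sequentially by blast
  have Jd: "J 1 (d n) = fst (f n)" for n
    by (rule J_eq[of 1 _ "snd (f n)"]) (use f in \<open>auto simp: d_def\<close>)
  have "(\<lambda>n. J 1 (d n) - J 1 dl) \<longlonglongrightarrow> 0"
  proof (rule Lim_null_comparison)
    show "\<forall>\<^sub>F n in sequentially. norm (J 1 (d n) - J 1 dl) \<le> M * norm (d n - dl)"
      using dS dlS by (intro always_eventually allI) (metis J_bound J_diff S_diff zero_less_one)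
    show "(\<lambda>n. M * norm (d n - dl)) \<longlonglongrightarrow> 0"
      using d by (intro tendsto_mult_right_zero tendsto_norm_zero) (simp add: LIM_zero)
  qed
  then have "(\<lambda>n. fst (f n)) \<longlonglongrightarrow> J 1 dl" using Jd LIM_zero_cancel by simp
  moreover have "(\<lambda>n. fst (f n)) \<longlonglongrightarrow> fst l" by (intro tendsto_intros lim)
  ultimately have e: "J 1 dl = fst l" using LIMSEQ_unique by blast
  have "(J 1 dl, (J 1 dl - dl) /\<^sub>R 1) \<in> G" using J_G[of 1 dl] dlS by simp
  then have "(fst l, fst l - dl) \<in> G" using e by simp
  then show "l \<in> G" by (simp add: dl_def)
qed

text \<open>Let \<open>w\<close> be the projection of \<open>x\<close>, with respect to
  \<open>ip\<close>, onto the closure of the domain, and \<open>d = J 1 (x - w)\<close>. As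
  \<open>d\<close> lies in the domain it is orthogonal to \<open>x - w\<close>, and dissipativity
  gives \<open>ip d d \<le> ip d (x - w) = 0\<close>. Then \<open>x - w\<close> is up to sign the
  image of 0 and vanishes by \<open>single\<close>.\<close>

lemma D_dense:
  assumes "x \<in> S" "e > 0"
  obtains y z where "(y, z) \<in> G" "norm (x - y) < e"
proof -
  define W where "W = closure (fst ` G)"
  have subW: "subspace W"
    unfolding W_def using subspace_G
    by (intro subspace_closure linear_subspace_image) (auto intro: bounded_linear.linear bounded_linear_fst)
  have WS: "W \<subseteq> S"
    unfolding W_def using G_S closed_S by (intro closure_minimal) auto
  obtain w where w: "w \<in> W" "\<And>v. v \<in> W \<Longrightarrow> ip w v = ip x v"
    using lax_milgram[of W ip "ip x" c] subW WS coercive c_pos bilinear_ip ip.bounded_linear_right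
    by (metis (no_types, lifting) W_def closed_closure subsetD)
  have wS: "w \<in> S" using w WS by auto
  define d where "d = J 1 (x - w)"
  have xw: "x - w \<in> S" using assms wS by (intro S_diff)
  have g: "(d, d - (x - w)) \<in> G" using J_G[OF _ xw, of 1] by (simp add: d_def)
  then have "d \<in> W" unfolding W_def using closure_subset by force
  then have "ip (x - w) d = 0" using w by (simp add: ip.diff_left)
  then have "ip d (x - w) = 0" using ip_sym xw g G_in_S by metis
  then have "ip d d \<le> 0" using dissip[OF g] by (simp add: ip.diff_right)
  then have "d = 0" using g G_in_S ip_self_zero by blast
  then have "x - w = 0" using g single[of "- (x - w)"] by simp
  then have "x \<in> W" using w by simp
  then obtain y where "y \<in> fst ` G" "dist y x < e"
    unfolding W_def closure_approachable using assms by blast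
  then show ?thesis using that by (auto simp: dist_norm norm_minus_commute)
qed

lemma J_near_G:
  assumes "h > 0" "(x, y) \<in> G"
  shows "norm (J h x - x) \<le> h * (M * norm y)"
proof -
  have "J h x - x = h *\<^sub>R J h y" using J_of_G[OF assms] by simp
  then show ?thesis using J_bound[of h y] assms G_in_S by (simp add: mult_left_mono)
qed

text \<open>On the domain the error is of order \<open>h\<close>; the uniform bound and density
  extend the convergence to \<open>S\<close>. An approximation error \<open>e'\<close> of
  \<open>x\<close> enters once directly and once through \<open>J\<close> with factor
  \<open>M\<close>, hence its denominator.\<close>

lemma J_tendsto:
  assumes "x \<in> S"
  shows "(\<lambda>n. J (1 / Suc n) x) \<longlonglongrightarrow> x"
proof (rule LIMSEQ_I)
  fix e :: real assume e: "e > 0"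
  define e' where "e' = e / (2 * (M + 1))"
  have e': "e' > 0" using e M_ge by (simp add: e'_def)
  obtain y z where yz: "(y, z) \<in> G" "norm (x - y) < e'"
    using D_dense[OF assms e'] by blast
  have yS: "y \<in> S" using yz G_in_S by blast
  have "(\<lambda>n. 1 / real (Suc n) * (M * norm z)) \<longlonglongrightarrow> 0 * (M * norm z)"
    by (intro tendsto_intros LIMSEQ_Suc[OF lim_1_over_n])
  then have "\<forall>\<^sub>F n in sequentially. 1 / real (Suc n) * (M * norm z) < e / 2"
    using e by (intro order_tendstoD) auto
  then obtain N where N: "\<And>n. n \<ge> N \<Longrightarrow> 1 / real (Suc n) * (M * norm z) < e / 2"
    by (auto simp: eventually_sequentially)
  have "norm (J (1 / Suc n) x - x) < e" if "n \<ge> N" for n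
  proof -
    have "J (1 / Suc n) x - x = J (1 / Suc n) (x - y) + (J (1 / Suc n) y - y) - (x - y)"
      using assms yS by (simp add: J_diff)
    also have "norm \<dots> \<le> norm (J (1 / Suc n) (x - y)) + norm (J (1 / Suc n) y - y) + norm (x - y)"
      by (meson norm_triangle_ineq norm_triangle_ineq4 order.trans add_mono order_refl)
    also have "\<dots> \<le> M * norm (x - y) + 1 / Suc n * (M * norm z) + norm (x - y)"
      using assms yS by (intro add_mono J_bound J_near_G[OF _ yz(1)]) (auto intro: S_diff)
    also have "\<dots> = (M + 1) * norm (x - y) + 1 / Suc n * (M * norm z)" by (simp add: algebra_simps)
    also have "\<dots> < (M + 1) * e' + e / 2"
      using N[OF that] yz M_ge by (intro add_strict_mono mult_strict_left_mono) auto
    also have "\<dots> = e" using M_ge by (simp add: e'_def field_simps)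
    finally show ?thesis .
  qed
  then show "\<exists>N. \<forall>n\<ge>N. norm (J (1 / Suc n) x - x) < e" by blast
qed

text \<open>One application of the resolvent maps into the domain, two map into the domain of the
  square, and \<open>J h (J h x)\<close> tends to \<open>x\<close> with \<open>h\<close>. The
  sequences \<open>z\<close> and \<open>z'\<close> record the first and the second image.\<close>

lemma D2_dense:
  assumes "x \<in> S"
  obtains y z z' where "\<And>n. (y n, z n) \<in> G" "\<And>n. (z n, z' n) \<in> G" "y \<longlonglongrightarrow> x"
proof -
  define h where "h n = 1 / real (Suc n)" for n
  have h: "h n > 0" for n by (simp add: h_def)
  have lim: "(\<lambda>n. J (h n) y) \<longlonglongrightarrow> y" if "y \<in> S" for y
    using J_tendsto[OF that] by (simp add: h_def)
  define y where "y n = J (h n) (J (h n) x)" for n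
  define z where "z n = (J (h n) x - x) /\<^sub>R h n" for n
  have Jx: "(J (h n) x, z n) \<in> G" for n using J_G[OF h assms] by (simp add: z_def)
  have 1: "(y n, J (h n) (z n)) \<in> G" for n
    unfolding y_def by (rule J_of_G[OF h Jx])
  have 2: "(J (h n) (z n), (J (h n) (z n) - z n) /\<^sub>R h n) \<in> G" for n
    using J_G h G_in_S Jx by blast
  have "y \<longlonglongrightarrow> x"
  proof -
    have "(\<lambda>n. J (h n) (J (h n) x - x)) \<longlonglongrightarrow> 0"
    proof (rule Lim_null_comparison)
      show "\<forall>\<^sub>F n in sequentially. norm (J (h n) (J (h n) x - x)) \<le> M * norm (J (h n) x - x)"
        using assms h by (intro always_eventually allI J_bound S_diff J_S) auto
      show "(\<lambda>n. M * norm (J (h n) x - x)) \<longlonglongrightarrow> 0"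
        using lim[OF assms] by (intro tendsto_mult_right_zero tendsto_norm_zero) (simp add: LIM_zero)
    qed
    then have "(\<lambda>n. J (h n) (J (h n) x - x) + J (h n) x) \<longlonglongrightarrow> 0 + x"
      by (intro tendsto_add lim assms)
    moreover have "J (h n) (J (h n) x - x) + J (h n) x = y n" for n
      using assms h by (simp add: y_def J_diff J_S)
    ultimately show ?thesis by simp
  qed
  then show ?thesis by (rule that[OF 1 2])
qed

subsection \<open>The semigroup as a limit of implicit Euler schemes with dyadic steps\<close>

text \<open>Expanding by \<open>J_of_G\<close> until only resolvents of the second image
  \<open>z\<close> are left, the terms in \<open>x\<close> and \<open>y\<close> cancel. What remains
  is \<open>h\<^sup>2\<close> times a combination of such resolvents with coefficients 2, 1 and 4,
  whence the 7.\<close>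

lemma J_double_step:
  assumes h: "h > 0" and G: "(x, y) \<in> G" "(y, z) \<in> G" and B: "norm z \<le> B"
  shows "norm (J h (J h x) - J (2 * h) x) \<le> 7 * M * M * h\<^sup>2 * B"
proof -
  have S: "x \<in> S" "y \<in> S" "z \<in> S" using G G_in_S by auto
  have 1: "J h (J h x) = J h x + h *\<^sub>R J h (J h y)" using J_of_G h G by blast
  have 2: "J h x = x + h *\<^sub>R J h y" using J_of_G h G by blast
  have 3: "J (2 * h) x = x + (2 * h) *\<^sub>R J (2 * h) y" using J_of_G[of "2 * h"] h G by simp
  have 4: "J h (J h y) = J h y + h *\<^sub>R J h (J h z)" using J_of_G h G by blast
  have 5: "J h y = y + h *\<^sub>R J h z" using J_of_G h G by blast
  have 6: "J (2 * h) y = y + (2 * h) *\<^sub>R J (2 * h) z" using J_of_G[of "2 * h"] h G by simp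
  have e: "J h (J h x) - J (2 * h) x
      = h\<^sup>2 *\<^sub>R (2 *\<^sub>R J h z + J h (J h z) - 4 *\<^sub>R J (2 * h) z)"
    unfolding 1 unfolding 4 unfolding 2 3 unfolding 5 6
    by (simp add: algebra_simps power2_eq_square flip: scaleR_add_left)
  have b1: "norm (J h z) \<le> M * B" "norm (J (2 * h) z) \<le> M * B"
    using J_bound[of h z] J_bound[of "2 * h" z] h S B M_ge
    by (smt (verit) mult_left_mono)+
  have B0: "B \<ge> 0" using B norm_ge_zero order.trans by blast
  have MB: "M * B \<le> M * (M * B)" "0 \<le> M * B" using M_ge B0 mult_right_mono[OF M_ge, of "M * B"] by simp_all
  have b2: "norm (J h (J h z)) \<le> M * (M * B)"
    using J_bound[of h "J h z"] h S b1 M_ge by (smt (verit) mult_left_mono J_S)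
  have "norm (2 *\<^sub>R J h z + J h (J h z) - 4 *\<^sub>R J (2 * h) z)
      \<le> norm (2 *\<^sub>R J h z) + norm (J h (J h z)) + norm (4 *\<^sub>R J (2 * h) z)"
    by (meson norm_triangle_ineq norm_triangle_ineq4 order.trans add_mono order_refl)
  also have "\<dots> \<le> 7 * (M * (M * B))" using b1 b2 MB by simp
  finally have "h\<^sup>2 * norm (2 *\<^sub>R J h z + J h (J h z) - 4 *\<^sub>R J (2 * h) z) \<le> h\<^sup>2 * (7 * (M * (M * B)))"
    by (intro mult_left_mono) auto
  then show ?thesis unfolding e by (simp add: mult_ac)
qed

text \<open>Stability and consistency: in each of the \<open>n\<close> steps a local error of order
  \<open>h\<^sup>2\<close> is made and then propagated by a bounded power of \<open>J h\<close>. The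
  bound \<open>B\<close> is required along all iterates of \<open>z\<close>, since the induction
  replaces \<open>z\<close> by \<open>J (2 * h) z\<close>.\<close>

lemma Jn_double_step:
  assumes h: "h > 0" and G: "(x, y) \<in> G" "(y, z) \<in> G" and B: "\<And>i. norm ((J (2 * h) ^^ i) z) \<le> B"
  shows "norm ((J h ^^ (2 * n)) x - (J (2 * h) ^^ n) x) \<le> real n * (7 * M * M * M * h\<^sup>2 * B)"
  using G B
proof (induction n arbitrary: x y z)
  case (Suc n)
  have h2: "2 * h > 0" using h by simp
  have S: "x \<in> S" using Suc.prems G_in_S by blast
  define d where "d = J h (J h x) - J (2 * h) x"
  have dS: "d \<in> S" unfolding d_def using h h2 S by (intro S_diff J_S)
  have "(J h ^^ (2 * Suc n)) x - (J (2 * h) ^^ Suc n) x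
      = (J h ^^ (2 * n)) (J h (J h x)) - (J (2 * h) ^^ n) (J (2 * h) x)"
    by (simp add: funpow_swap1)
  also have "\<dots> = (J h ^^ (2 * n)) d + ((J h ^^ (2 * n)) (J (2 * h) x) - (J (2 * h) ^^ n) (J (2 * h) x))"
    unfolding d_def using h h2 S by (simp add: Jn_diff J_S)
  also have "norm \<dots> \<le> norm ((J h ^^ (2 * n)) d) +
      norm ((J h ^^ (2 * n)) (J (2 * h) x) - (J (2 * h) ^^ n) (J (2 * h) x))"
    by (rule norm_triangle_ineq)
  also have "\<dots> \<le> M * (7 * M * M * h\<^sup>2 * B) + real n * (7 * M * M * M * h\<^sup>2 * B)"
  proof (rule add_mono)
    have "norm d \<le> 7 * M * M * h\<^sup>2 * B"
      unfolding d_def by (rule J_double_step[OF h Suc.prems(1,2)]) (use Suc.prems(3)[of 0] in simp)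
    then show "norm ((J h ^^ (2 * n)) d) \<le> M * (7 * M * M * h\<^sup>2 * B)"
      using Jn_bound[OF h dS, of "2 * n"] M_ge by (smt (verit) mult_left_mono)
    show "norm ((J h ^^ (2 * n)) (J (2 * h) x) - (J (2 * h) ^^ n) (J (2 * h) x))
        \<le> real n * (7 * M * M * M * h\<^sup>2 * B)"
    proof (rule Suc.IH)
      show "(J (2 * h) x, J (2 * h) y) \<in> G" "(J (2 * h) y, J (2 * h) z) \<in> G"
        using J_of_G h2 Suc.prems by blast+
      show "norm ((J (2 * h) ^^ i) (J (2 * h) z)) \<le> B" for i
        using Suc.prems(3)[of "Suc i"] by (simp add: funpow_swap1)
    qed
  qed
  also have "\<dots> = real (Suc n) * (7 * M * M * M * h\<^sup>2 * B)" by (simp add: algebra_simps)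
  finally show ?case .
qed simp

text \<open>Discrete Taylor formulas: by \<open>step\<close> the n-th increment is \<open>h\<close>
  times the n-th iterate of the image \<open>y\<close>, and its deviation from
  \<open>h *\<^sub>R y\<close> is controlled by the first formula applied to
  \<open>y\<close>.\<close>

lemma Jn_taylor:
  assumes h: "h > 0" and G: "(x, y) \<in> G"
  shows "norm ((J h ^^ n) x - x) \<le> real n * h * (M * norm y)"
    and "(y, z) \<in> G \<Longrightarrow> norm ((J h ^^ n) x - x - (real n * h) *\<^sub>R y) \<le> (real n * h)\<^sup>2 * (M * norm z)"
proof -
  have step: "(J h ^^ Suc n) x - x = ((J h ^^ n) x - x) + h *\<^sub>R (J h ^^ Suc n) y" if "(x, y) \<in> G" for n x y
  proof -
    have "(J h ^^ Suc n) x - x = (J h ^^ n) (J h x - x) + ((J h ^^ n) x - x)"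
      using that h G_in_S[OF that] by (simp add: funpow_swap1 Jn_diff J_S)
    also have "J h x - x = h *\<^sub>R J h y" using J_of_G[OF h that] by simp
    finally show ?thesis using h that G_in_S(2) by (simp add: Jn_scale J_S funpow_swap1)
  qed
  have 1: "norm ((J h ^^ n) x - x) \<le> real n * h * (M * norm y)" if "(x, y) \<in> G" for n x y
  proof (induction n)
    case (Suc n)
    have "norm ((J h ^^ Suc n) x - x) \<le> norm ((J h ^^ n) x - x) + norm (h *\<^sub>R (J h ^^ Suc n) y)"
      unfolding step[OF that] by (rule norm_triangle_ineq)
    also have "\<dots> \<le> real n * h * (M * norm y) + h * (M * norm y)"
      using Jn_bound[OF h G_in_S(2)[OF that], of "Suc n"] h Suc by (intro add_mono) (auto intro: mult_left_mono)
    finally show ?case by (simp add: algebra_simps)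
  qed simp
  show "norm ((J h ^^ n) x - x) \<le> real n * h * (M * norm y)" by (rule 1[OF G])
  show "norm ((J h ^^ n) x - x - (real n * h) *\<^sub>R y) \<le> (real n * h)\<^sup>2 * (M * norm z)" if "(y, z) \<in> G"
  proof (induction n)
    case (Suc n)
    have "(J h ^^ Suc n) x - x - (real (Suc n) * h) *\<^sub>R y
        = ((J h ^^ n) x - x - (real n * h) *\<^sub>R y) + h *\<^sub>R ((J h ^^ Suc n) y - y)"
      unfolding step[OF G] by (simp add: algebra_simps)
    also have "norm \<dots> \<le> norm ((J h ^^ n) x - x - (real n * h) *\<^sub>R y) + norm (h *\<^sub>R ((J h ^^ Suc n) y - y))"
      by (rule norm_triangle_ineq)
    also have "\<dots> \<le> (real n * h)\<^sup>2 * (M * norm z) + h * (real (Suc n) * h * (M * norm z))"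
      using 1[OF that, of "Suc n"] h Suc by (intro add_mono) (auto intro: mult_left_mono)
    also have "\<dots> = ((real n)\<^sup>2 + real (Suc n)) * (h\<^sup>2 * (M * norm z))"
      by (simp add: algebra_simps power2_eq_square)
    \<comment> \<open>The accumulated factor is really about half of this; the square of the elapsed
      time suffices and survives the induction.\<close>
    also have "\<dots> \<le> (real (Suc n))\<^sup>2 * (h\<^sup>2 * (M * norm z))"
      using M_ge h by (intro mult_right_mono) (auto simp: power2_eq_square algebra_simps)
    finally show ?case by (simp add: power_mult_distrib mult_ac)
  qed simp
qed

text \<open>At negative times \<open>nat\<close> cuts the count off at 0. The limit semigroup is
  thereby the identity on the negative half-line, which later lets integrals over a triangle be
  written over a square.\<close>

definition steps :: "nat \<Rightarrow> real \<Rightarrow> nat" where "steps k t = nat \<lfloor>t * 2 ^ k\<rfloor>"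
definition approx :: "nat \<Rightarrow> real \<Rightarrow> 'e \<Rightarrow> 'e" where "approx k t = J (1 / 2 ^ k) ^^ steps k t"

text \<open>Halving the step length doubles the number of steps except for at most one additional
  step, so consecutive approximations differ by the doubling error and one small step.\<close>

lemma steps_Suc: "steps (Suc k) t = 2 * steps k t \<or> steps (Suc k) t = Suc (2 * steps k t)"
proof -
  have "\<lfloor>t * 2 ^ Suc k\<rfloor> = 2 * \<lfloor>t * 2 ^ k\<rfloor> \<or> \<lfloor>t * 2 ^ Suc k\<rfloor> = 2 * \<lfloor>t * 2 ^ k\<rfloor> + 1"
    using floor_correct[of "t * 2 ^ k"] floor_correct[of "t * 2 ^ Suc k"] by simp linarith
  then show ?thesis unfolding steps_def by linarith
qed

lemma steps_le: "t \<ge> 0 \<Longrightarrow> real (steps k t) \<le> t * 2 ^ k"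
  unfolding steps_def by (simp add: of_nat_nat)

lemma steps_nonpos: "t \<le> 0 \<Longrightarrow> steps k t = 0"
proof -
  assume "t \<le> 0"
  then have "t * 2 ^ k \<le> 0" by (simp add: mult_le_0_iff)
  then show ?thesis by (simp add: steps_def)
qed

lemma steps_tendsto:
  assumes "t \<ge> 0"
  shows "(\<lambda>k. real (steps k t) / 2 ^ k) \<longlonglongrightarrow> t"
proof -
  have l: "t - (1/2) ^ k \<le> real (steps k t) / 2 ^ k" for k
  proof -
    have "t * 2 ^ k - 1 \<le> real (steps k t)" using assms unfolding steps_def by (simp add: of_nat_nat)
    then have "(t * 2 ^ k - 1) / 2 ^ k \<le> real (steps k t) / 2 ^ k" by (rule divide_right_mono) simp
    then show ?thesis by (simp add: diff_divide_distrib power_divide)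
  qed
  have u: "real (steps k t) / 2 ^ k \<le> t" for k
    using steps_le[OF assms, of k] by (simp add: field_simps)
  show ?thesis
  proof (rule tendsto_sandwich)
    have "(\<lambda>k. t - (1/2) ^ k) \<longlonglongrightarrow> t - 0" by (intro tendsto_intros LIMSEQ_realpow_zero) auto
    then show "(\<lambda>k. t - (1/2) ^ k) \<longlonglongrightarrow> t" by simp
  qed (use l u in auto)
qed

lemma steps_mono: "s \<le> t \<Longrightarrow> steps k s \<le> steps k t"
  unfolding steps_def by (intro nat_mono floor_mono mult_right_mono) auto

lemma approx_diff: "x \<in> S \<Longrightarrow> y \<in> S \<Longrightarrow> approx k t (x - y) = approx k t x - approx k t y"
  unfolding approx_def by (rule Jn_diff) auto

lemma approx_bound: "x \<in> S \<Longrightarrow> norm (approx k t x) \<le> M * norm x"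
  unfolding approx_def by (rule Jn_bound) auto

text \<open>With about \<open>t / h\<close> steps of local error \<open>h\<^sup>2\<close>,
  consecutive levels differ by O(h). For dyadic \<open>h\<close> these differences are summable, and
  completeness gives the limit.\<close>

lemma approx_convergent_D2:
  assumes G: "(x, y) \<in> G" "(y, z) \<in> G"
  shows "convergent (\<lambda>k. approx k t x)"
proof -
  define B where "B = M * norm z"
  \<comment> \<open>The first summand bounds the doubling error over time
    \<open>\<bar>t\<bar>\<close>, the second the possible odd step, each per unit of
    \<open>h\<close>.\<close>
  define C where "C = \<bar>t\<bar> * (7 * M * M * M * B) + M * (M * norm y)"
  have B0: "B \<ge> 0" using M_ge by (simp add: B_def)
  have step: "norm (approx (Suc k) t x - approx k t x) \<le> C * (1/2) ^ k" for k
  proof -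
    define h n :: real where "h = 1 / 2 ^ Suc k" and "n = steps k t"
    have h: "h > 0" "1 / 2 ^ k = 2 * h" by (auto simp: h_def)
    have n: "n * h \<le> \<bar>t\<bar>"
    proof (cases "t \<ge> 0")
      case True
      have "n * h \<le> (t * 2 ^ k) * h" unfolding n_def using steps_le[OF True, of k] h by (intro mult_right_mono) auto
      also have "\<dots> \<le> \<bar>t\<bar>" using True by (simp add: h_def)
      finally show ?thesis .
    next
      case False
      then have "steps k t = 0" by (intro steps_nonpos) simp
      then show ?thesis by (simp add: n_def)
    qed
    have xS: "x \<in> S" using G G_in_S by blast
    have bnd: "norm ((J h ^^ (2 * steps k t)) x - approx k t x) \<le> n * (7 * M * M * M * h\<^sup>2 * B)"
      unfolding approx_def h n_def
      by (rule Jn_double_step[OF h(1) G]) (use h G_in_S G Jn_bound in \<open>auto simp: B_def\<close>)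
    also have "\<dots> = (n * h) * (7 * M * M * M * B) * h" by (simp add: power2_eq_square)
    also have "\<dots> \<le> \<bar>t\<bar> * (7 * M * M * M * B) * h"
      using n h B0 M_ge by (intro mult_right_mono) auto
    finally have bnd: "norm ((J h ^^ (2 * steps k t)) x - approx k t x) \<le> \<bar>t\<bar> * (7 * M * M * M * B) * h" .
    have d: "norm (approx (Suc k) t x - (J h ^^ (2 * steps k t)) x) \<le> M * (M * norm y) * h"
    proof (cases "steps (Suc k) t = 2 * steps k t")
      case True
      then show ?thesis using M_ge h by (simp add: approx_def h_def)
    next
      case False
      then have "steps (Suc k) t = Suc (2 * steps k t)" using steps_Suc by blast
      then have "approx (Suc k) t x - (J h ^^ (2 * steps k t)) x = (J h ^^ (2 * steps k t)) (J h x - x)"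
        using h xS by (simp add: approx_def funpow_swap1 Jn_diff J_S) (simp add: h_def)
      also have "norm \<dots> \<le> M * norm (J h x - x)"
        using h xS by (intro Jn_bound S_diff J_S)
      also have "\<dots> \<le> M * (h * (M * norm y))"
        using J_near_G[OF h(1) G(1)] M_ge by (intro mult_left_mono) auto
      finally show ?thesis by (simp add: mult_ac)
    qed
    have "norm (approx (Suc k) t x - approx k t x) \<le> C * h"
      using norm_triangle_le[OF add_mono[OF d bnd]] by (simp add: C_def algebra_simps)
    also have "\<dots> \<le> C * (1/2) ^ k"
      using M_ge B0 by (intro mult_left_mono) (auto simp: h_def C_def field_simps power_divide)
    finally show ?thesis .
  qed
  have "summable (\<lambda>k. norm (approx (Suc k) t x - approx k t x))"
    by (rule summable_comparison_test'[where N = 0 and g = "\<lambda>k. C * (1/2) ^ k"])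
       (use step in \<open>auto intro!: summable_mult summable_geometric\<close>)
  then have "summable (\<lambda>k. approx (Suc k) t x - approx k t x)" by (rule summable_norm_cancel)
  then have "convergent (\<lambda>n. \<Sum>k<n. approx (Suc k) t x - approx k t x)"
    by (simp add: summable_iff_convergent)
  then have "convergent (\<lambda>n. (approx n t x - approx 0 t x) + approx 0 t x)"
    unfolding sum_lessThan_telescope[of "\<lambda>k. approx k t x"]
    by (intro convergent_add convergent_const)
  then show ?thesis by simp
qed

text \<open>The bound \<open>M\<close> is the same for all levels, so a point of the domain of the
  square within \<open>e / (4 * M)\<close> of \<open>x\<close> costs less than \<open>e / 4\<close>
  at either level and leaves \<open>e / 2\<close> for the convergent sequence.\<close>

lemma approx_convergent:
  assumes "x \<in> S"
  shows "convergent (\<lambda>k. approx k t x)"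
proof -
  have "Cauchy (\<lambda>k. approx k t x)"
  proof (rule CauchyI)
    fix e :: real assume e: "e > 0"
    obtain Y Z Z' where YZ: "\<And>n. (Y n, Z n) \<in> G" "\<And>n. (Z n, Z' n) \<in> G" "Y \<longlonglongrightarrow> x"
      using D2_dense[OF assms] by metis
    have "e / (4 * M) > 0" using e M_ge by simp
    then obtain n where n: "norm (Y n - x) < e / (4 * M)"
      using LIMSEQ_D[OF YZ(3)] by blast
    define y where "y = Y n"
    have yS: "y \<in> S" using YZ G_in_S y_def by blast
    have Mn: "M * norm (x - y) < e / 4"
      using n M_ge by (simp add: y_def norm_minus_commute field_simps)
    have "Cauchy (\<lambda>k. approx k t y)"
      unfolding y_def using approx_convergent_D2[OF YZ(1,2)] convergent_Cauchy by blast
    then obtain N where N: "\<And>j k. j \<ge> N \<Longrightarrow> k \<ge> N \<Longrightarrow> norm (approx j t y - approx k t y) < e / 2"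
      using e CauchyD[of _ "e / 2"] by (metis half_gt_zero)
    have "norm (approx j t x - approx k t x) < e" if "j \<ge> N" "k \<ge> N" for j k
    proof -
      have "approx j t x - approx k t x = approx j t (x - y) + (approx j t y - approx k t y) - approx k t (x - y)"
        using assms yS by (simp add: approx_diff)
      also have "norm \<dots> \<le> norm (approx j t (x - y)) + norm (approx j t y - approx k t y) + norm (approx k t (x - y))"
        by (meson norm_triangle_ineq norm_triangle_ineq4 order.trans add_mono order_refl)
      also have "\<dots> < M * norm (x - y) + e / 2 + M * norm (x - y)"
        using assms yS by (intro add_le_less_mono add_less_le_mono approx_bound N that) (auto intro: S_diff approx_bound)
      also have "\<dots> \<le> e" using Mn by simp
      finally show ?thesis .
    qed
    then show "\<exists>N. \<forall>m\<ge>N. \<forall>n\<ge>N. norm (approx m t x - approx n t x) < e" by blast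
  qed
  then show ?thesis by (rule Cauchy_convergent)
qed

definition semi :: "real \<Rightarrow> 'e \<Rightarrow> 'e" where "semi t x = lim (\<lambda>k. approx k t x)"

lemma semi_lim: "x \<in> S \<Longrightarrow> (\<lambda>k. approx k t x) \<longlonglongrightarrow> semi t x"
  unfolding semi_def using approx_convergent convergent_LIMSEQ_iff by blast

lemma semi_diff: "x \<in> S \<Longrightarrow> y \<in> S \<Longrightarrow> semi t (x - y) = semi t x - semi t y"
proof (rule LIMSEQ_unique[OF semi_lim])
  assume "x \<in> S" "y \<in> S"
  then show "(\<lambda>k. approx k t (x - y)) \<longlonglongrightarrow> semi t x - semi t y"
    using tendsto_diff[OF semi_lim semi_lim] by (simp add: approx_diff)
qed (rule S_diff)

lemma semi_bound: "x \<in> S \<Longrightarrow> norm (semi t x) \<le> M * norm x"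
  by (rule LIMSEQ_le_const2[OF tendsto_norm[OF semi_lim]]) (auto intro: approx_bound)

lemma semi_nonpos: "t \<le> 0 \<Longrightarrow> semi t x = x"
proof -
  assume "t \<le> 0"
  then have "steps k t = 0" for k by (rule steps_nonpos)
  then show "semi t x = x" by (simp add: semi_def approx_def)
qed

text \<open>The semigroup maps the domain to itself and commutes with the operator, because the
  Euler iterates do so and the graph is closed.\<close>

lemma semi_G: "(x, y) \<in> G \<Longrightarrow> (semi t x, semi t y) \<in> G"
proof (rule closed_sequentially[OF closed_G])
  assume G: "(x, y) \<in> G"
  show "\<And>k. (approx k t x, approx k t y) \<in> G" unfolding approx_def by (rule Jn_of_G[OF _ G]) simp
  show "(\<lambda>k. (approx k t x, approx k t y)) \<longlonglongrightarrow> (semi t x, semi t y)"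
    using G G_in_S by (intro tendsto_Pair semi_lim) auto
qed

text \<open>Limit of the discrete Taylor formulas over the steps between the times \<open>s\<close>
  and \<open>t\<close>. One factor \<open>M\<close> comes from these formulas, the other from the
  powers of \<open>J\<close> leading up to time \<open>s\<close>.\<close>

lemma semi_step:
  assumes G: "(x, y) \<in> G" and st: "0 \<le> s" "s \<le> t"
  shows "norm (semi t x - semi s x) \<le> (t - s) * (M * M * norm y)"
    and "(y, z) \<in> G \<Longrightarrow> norm (semi t x - semi s x - (t - s) *\<^sub>R semi s y) \<le> (t - s)\<^sup>2 * (M * M * norm z)"
proof -
  have S: "x \<in> S" "y \<in> S" using G G_in_S by auto
  define m where "m k = steps k t - steps k s" for k
  define h :: "nat \<Rightarrow> real" where "h k = 1 / 2 ^ k" for k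
  have h: "h k > 0" for k by (simp add: h_def)
  have mh: "(\<lambda>k. real (m k) * h k) \<longlonglongrightarrow> t - s"
  proof -
    have "(\<lambda>k. real (steps k t) / 2 ^ k - real (steps k s) / 2 ^ k) \<longlonglongrightarrow> t - s"
      using st by (intro tendsto_diff steps_tendsto) auto
    then show ?thesis using steps_mono[OF st(2)] by (simp add: m_def h_def of_nat_diff diff_divide_distrib)
  qed
  have ap: "approx k t x = (J (h k) ^^ steps k s) ((J (h k) ^^ m k) x)" for k
  proof -
    have "steps k t = steps k s + m k" using steps_mono[OF st(2), of k] by (simp add: m_def)
    then show ?thesis by (simp add: approx_def h_def funpow_add)
  qed
  have J1: "approx k t x - approx k s x = (J (h k) ^^ steps k s) ((J (h k) ^^ m k) x - x)" for k
    unfolding ap using h S by (simp add: Jn_diff Jn_S approx_def flip: h_def)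
  have b1: "norm (approx k t x - approx k s x) \<le> (real (m k) * h k) * (M * M * norm y)" for k
  proof -
    have "norm (approx k t x - approx k s x) \<le> M * norm ((J (h k) ^^ m k) x - x)"
      unfolding J1 using h S by (intro Jn_bound S_diff Jn_S)
    also have "\<dots> \<le> M * (real (m k) * h k * (M * norm y))"
      using Jn_taylor(1)[OF h G] M_ge by (intro mult_left_mono) auto
    finally show ?thesis by (simp add: mult_ac)
  qed
  show "norm (semi t x - semi s x) \<le> (t - s) * (M * M * norm y)"
  proof (rule LIMSEQ_le)
    show "(\<lambda>k. norm (approx k t x - approx k s x)) \<longlonglongrightarrow> norm (semi t x - semi s x)"
      by (intro tendsto_intros semi_lim S)
    show "(\<lambda>k. (real (m k) * h k) * (M * M * norm y)) \<longlonglongrightarrow> (t - s) * (M * M * norm y)"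
      by (intro tendsto_intros mh)
  qed (use b1 in blast)
  show "norm (semi t x - semi s x - (t - s) *\<^sub>R semi s y) \<le> (t - s)\<^sup>2 * (M * M * norm z)" if yz: "(y, z) \<in> G"
  proof -
    have b2: "norm (approx k t x - approx k s x - (real (m k) * h k) *\<^sub>R approx k s y)
        \<le> (real (m k) * h k)\<^sup>2 * (M * M * norm z)" for k
    proof -
      have "approx k t x - approx k s x - (real (m k) * h k) *\<^sub>R approx k s y
          = (J (h k) ^^ steps k s) ((J (h k) ^^ m k) x - x - (real (m k) * h k) *\<^sub>R y)"
        unfolding J1 using h S by (simp add: Jn_diff Jn_S Jn_scale S_diff S_scale approx_def flip: h_def)
      also have "norm \<dots> \<le> M * norm ((J (h k) ^^ m k) x - x - (real (m k) * h k) *\<^sub>R y)"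
        using h S by (intro Jn_bound S_diff Jn_S S_scale)
      also have "\<dots> \<le> M * ((real (m k) * h k)\<^sup>2 * (M * norm z))"
        using Jn_taylor(2)[OF h G yz] M_ge by (intro mult_left_mono) auto
      finally show ?thesis by (simp add: mult_ac)
    qed
    show ?thesis
    proof (rule LIMSEQ_le)
      show "(\<lambda>k. norm (approx k t x - approx k s x - (real (m k) * h k) *\<^sub>R approx k s y))
          \<longlonglongrightarrow> norm (semi t x - semi s x - (t - s) *\<^sub>R semi s y)"
        by (intro tendsto_intros semi_lim S mh)
      show "(\<lambda>k. (real (m k) * h k)\<^sup>2 * (M * M * norm z)) \<longlonglongrightarrow> (t - s)\<^sup>2 * (M * M * norm z)"
        by (intro tendsto_intros mh)
    qed (use b2 in blast)
  qed
qed

lemma semi_max: "semi t x = semi (max t 0) x"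
  using semi_nonpos[of t x] semi_nonpos[of 0 x] by (simp add: max_def)

lemma continuous_semi_G:
  assumes "(x, y) \<in> G"
  shows "continuous_on UNIV (\<lambda>t. semi t x)"
proof -
  define L where "L = M * M * norm y"
  have L: "L \<ge> 0" using M_ge by (simp add: L_def)
  have *: "norm (semi t x - semi s x) \<le> L * \<bar>t - s\<bar>" if "s \<le> t" for s t
  proof -
    have "norm (semi t x - semi s x) \<le> (max t 0 - max s 0) * L"
      unfolding L_def by (subst (1 2) semi_max, rule semi_step(1)[OF assms]) (use that in auto)
    also have "\<dots> \<le> \<bar>t - s\<bar> * L" using L that by (intro mult_right_mono) auto
    finally show ?thesis by (simp add: mult_ac)
  qed
  have "norm (semi t x - semi s x) \<le> L * \<bar>t - s\<bar>" for s t
    using *[of s t] *[of t s] by (cases "s \<le> t") (auto simp: norm_minus_commute abs_minus_commute)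
  then have "L-lipschitz_on UNIV (\<lambda>t. semi t x)"
    using L by (auto simp: lipschitz_on_def dist_norm)
  then show ?thesis by (rule lipschitz_on_continuous_on)
qed

text \<open>Orbits starting in the domain are Lipschitz, and by the bound \<open>M\<close> any orbit
  is a limit of such orbits uniformly in time.\<close>

lemma continuous_semi_point:
  assumes "x \<in> S"
  shows "continuous_on UNIV (\<lambda>t. semi t x)"
proof -
  obtain Y Z Z' where YZ: "\<And>n. (Y n, Z n) \<in> G" "\<And>n. (Z n, Z' n) \<in> G" "Y \<longlonglongrightarrow> x"
    using D2_dense[OF assms] by metis
  have YS: "Y n \<in> S" for n using YZ G_in_S by blast
  show ?thesis
  proof (rule uniform_limit_theorem)
    show "\<forall>\<^sub>F n in sequentially. continuous_on UNIV (\<lambda>t. semi t (Y n))"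
      using continuous_semi_G[OF YZ(1)] by simp
    show "uniform_limit UNIV (\<lambda>n t. semi t (Y n)) (\<lambda>t. semi t x) sequentially"
    proof (rule uniform_limitI)
      fix e :: real assume "e > 0"
      have "(\<lambda>n. M * norm (Y n - x)) \<longlonglongrightarrow> 0"
        using YZ(3) by (intro tendsto_mult_right_zero tendsto_norm_zero) (simp add: LIM_zero)
      then have "\<forall>\<^sub>F n in sequentially. M * norm (Y n - x) < e"
        using \<open>e > 0\<close> by (rule order_tendstoD)
      then show "\<forall>\<^sub>F n in sequentially. \<forall>t\<in>UNIV. dist (semi t (Y n)) (semi t x) < e"
      proof eventually_elim
        case (elim n)
        then show ?case
          using semi_bound[OF S_diff[OF YS assms]] semi_diff[OF YS assms]
          by (metis dist_norm order.strict_trans1)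
      qed
    qed
  qed simp
qed

text \<open>Joint continuity in time and state, on a general parameter space so that it applies to
  kernels on a square. The state increment is absorbed by the uniform bound, and what is left is the
  orbit of a fixed point.\<close>

lemma continuous_semi:
  fixes \<alpha> :: "'b::metric_space \<Rightarrow> real"
  assumes \<alpha>: "continuous_on A \<alpha>" and \<gamma>: "continuous_on A \<gamma>" "\<And>p. p \<in> A \<Longrightarrow> \<gamma> p \<in> S"
  shows "continuous_on A (\<lambda>p. semi (\<alpha> p) (\<gamma> p))"
  unfolding continuous_on_def
proof
  fix p assume p: "p \<in> A"
  have "((\<lambda>q. semi (\<alpha> q) (\<gamma> q - \<gamma> p)) \<longlongrightarrow> 0) (at p within A)"
  proof (rule Lim_null_comparison)
    show "\<forall>\<^sub>F q in at p within A. norm (semi (\<alpha> q) (\<gamma> q - \<gamma> p)) \<le> M * norm (\<gamma> q - \<gamma> p)"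
      using \<gamma> p by (auto simp: eventually_at_filter intro!: always_eventually semi_bound S_diff)
    show "((\<lambda>q. M * norm (\<gamma> q - \<gamma> p)) \<longlongrightarrow> 0) (at p within A)"
      using \<gamma>(1) p by (intro tendsto_mult_right_zero tendsto_norm_zero) (simp add: LIM_zero continuous_on_def)
  qed
  moreover have "((\<lambda>q. semi (\<alpha> q) (\<gamma> p)) \<longlongrightarrow> semi (\<alpha> p) (\<gamma> p)) (at p within A)"
    using continuous_on_compose2[OF continuous_semi_point[OF \<gamma>(2)[OF p]] \<alpha>] p
    by (simp add: continuous_on_def)
  ultimately have "((\<lambda>q. semi (\<alpha> q) (\<gamma> q - \<gamma> p) + semi (\<alpha> q) (\<gamma> p)) \<longlongrightarrow> 0 + semi (\<alpha> p) (\<gamma> p)) (at p within A)"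
    by (rule tendsto_add)
  moreover have "\<forall>\<^sub>F q in at p within A. semi (\<alpha> q) (\<gamma> q - \<gamma> p) + semi (\<alpha> q) (\<gamma> p) = semi (\<alpha> q) (\<gamma> q)"
    using \<gamma> p by (auto simp: eventually_at_filter semi_diff intro!: always_eventually)
  ultimately show "((\<lambda>q. semi (\<alpha> q) (\<gamma> q)) \<longlongrightarrow> semi (\<alpha> p) (\<gamma> p)) (at p within A)"
    by (simp add: filterlim_cong)
qed

text \<open>For smooth data \<open>semi r y\<close> is the derivative of \<open>semi r x\<close>, so
  it integrates to the increment of the orbit; the curve of the pairs lies in the closed subspace
  \<open>G\<close>, and so does its integral.\<close>

lemma integral_semi_D2:
  assumes "(x, y) \<in> G" "(y, z) \<in> G" "0 \<le> t"
  shows "(integral {0..t} (\<lambda>r. semi r x), semi t x - x) \<in> G"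
proof -
  have S: "x \<in> S" "y \<in> S" using assms G_in_S by auto
  define C where "C = M * M * norm z"
  have C: "C \<ge> 0" using M_ge by (simp add: C_def)
  have "((\<lambda>r. semi r x) has_vector_derivative semi r y) (at r within {0..t})" if r: "r \<in> {0..t}" for r
  proof (rule has_vector_derivative_quadratic_bound[where C = "2 * C"])
    fix u assume u: "u \<in> {0..t}"
    show "norm (semi u x - semi r x - (u - r) *\<^sub>R semi r y) \<le> 2 * C * (u - r)\<^sup>2"
    proof (cases "r \<le> u")
      case True
      then have "norm (semi u x - semi r x - (u - r) *\<^sub>R semi r y) \<le> (u - r)\<^sup>2 * C"
        unfolding C_def using r by (intro semi_step(2)[OF assms(1) _ _ assms(2)]) auto
      also have "\<dots> \<le> 2 * C * (u - r)\<^sup>2" using C by simp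
      finally show ?thesis .
    next
      case False
      \<comment> \<open>The Taylor estimate only runs forward in time. For \<open>u < r\<close> it
        is used with base point \<open>u\<close>, and replacing \<open>semi u y\<close> by
        \<open>semi r y\<close> costs a second term of the same order, hence the factor 2.\<close>
      have "semi u x - semi r x - (u - r) *\<^sub>R semi r y
          = (r - u) *\<^sub>R (semi r y - semi u y) - (semi r x - semi u x - (r - u) *\<^sub>R semi u y)"
        by (simp add: algebra_simps)
      also have "norm \<dots> \<le> norm ((r - u) *\<^sub>R (semi r y - semi u y)) + norm (semi r x - semi u x - (r - u) *\<^sub>R semi u y)"
        by (rule norm_triangle_ineq4)
      also have "\<dots> \<le> (r - u) * ((r - u) * C) + (r - u)\<^sup>2 * C"
      proof (rule add_mono)
        show "norm ((r - u) *\<^sub>R (semi r y - semi u y)) \<le> (r - u) * ((r - u) * C)"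
          using semi_step(1)[OF assms(2), of u r] False u unfolding C_def
          by (simp add: mult_left_mono)
        show "norm (semi r x - semi u x - (r - u) *\<^sub>R semi u y) \<le> (r - u)\<^sup>2 * C"
          unfolding C_def using False u by (intro semi_step(2)[OF assms(1) _ _ assms(2)]) auto
      qed
      also have "\<dots> = 2 * C * (u - r)\<^sup>2" by (simp add: power2_eq_square algebra_simps)
      finally show ?thesis .
    qed
  qed
  then have "((\<lambda>r. semi r y) has_integral semi t x - semi 0 x) {0..t}"
    using assms(3) by (intro fundamental_theorem_of_calculus) auto
  then have i: "integral {0..t} (\<lambda>r. semi r y) = semi t x - x"
    by (simp add: integral_unique semi_nonpos)
  have cont: "continuous_on {0..t} (\<lambda>r. semi r x)" "continuous_on {0..t} (\<lambda>r. semi r y)"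
    using continuous_semi_point S continuous_on_subset by blast+
  have "integral {0..t} (\<lambda>r. (semi r x, semi r y)) \<in> G"
    by (rule integral_in_closed_subspace[OF closed_G subspace_G])
       (use cont in \<open>auto intro!: continuous_on_Pair semi_G assms\<close>)
  then show ?thesis by (simp add: integral_Pair[OF cont] i)
qed

text \<open>Both components depend continuously on \<open>x\<close>, so the smooth case, density and
  the closed graph suffice.\<close>

lemma integral_semi:
  assumes x: "x \<in> S" and t: "0 \<le> t"
  shows "(integral {0..t} (\<lambda>r. semi r x), semi t x - x) \<in> G"
proof -
  obtain Y Z Z' where YZ: "\<And>n. (Y n, Z n) \<in> G" "\<And>n. (Z n, Z' n) \<in> G" "Y \<longlonglongrightarrow> x"
    using D2_dense[OF x] by metis
  have YS: "Y n \<in> S" for n using YZ G_in_S by blast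
  have bnd0: "(\<lambda>n. M * norm (Y n - x)) \<longlonglongrightarrow> 0"
    using YZ(3) by (intro tendsto_mult_right_zero tendsto_norm_zero) (simp add: LIM_zero)
  have b: "norm (semi r (Y n) - semi r x) \<le> M * norm (Y n - x)" for r n
    using semi_bound[OF S_diff[OF YS x]] semi_diff[OF YS x] by metis
  have l: "(\<lambda>n. semi r (Y n)) \<longlonglongrightarrow> semi r x" for r
    by (rule LIM_zero_cancel, rule Lim_null_comparison[OF _ bnd0]) (use b in simp)
  have int: "(\<lambda>r. semi r y) integrable_on {0..t}" if "y \<in> S" for y
    using continuous_semi_point[OF that] continuous_on_subset by (blast intro: integrable_continuous_real)
  have "(\<lambda>n. integral {0..t} (\<lambda>r. semi r (Y n))) \<longlonglongrightarrow> integral {0..t} (\<lambda>r. semi r x)"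
  proof (rule LIM_zero_cancel, rule Lim_null_comparison)
    show "\<forall>\<^sub>F n in sequentially. norm (integral {0..t} (\<lambda>r. semi r (Y n)) - integral {0..t} (\<lambda>r. semi r x))
        \<le> (M * norm (Y n - x)) * (t - 0)"
    proof (intro always_eventually allI)
      fix n
      have "integral {0..t} (\<lambda>r. semi r (Y n)) - integral {0..t} (\<lambda>r. semi r x)
          = integral {0..t} (\<lambda>r. semi r (Y n) - semi r x)"
        using int YS x by (simp add: Henstock_Kurzweil_Integration.integral_diff)
      also have "norm \<dots> \<le> (M * norm (Y n - x)) * (t - 0)"
      proof (rule integral_bound[OF t])
        show "continuous_on {0..t} (\<lambda>r. semi r (Y n) - semi r x)"
          using continuous_semi_point YS x continuous_on_subset by (blast intro: continuous_on_diff)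
      qed (rule b)
      finally show "norm (integral {0..t} (\<lambda>r. semi r (Y n)) - integral {0..t} (\<lambda>r. semi r x))
        \<le> (M * norm (Y n - x)) * (t - 0)" .
    qed
    show "(\<lambda>n. (M * norm (Y n - x)) * (t - 0)) \<longlonglongrightarrow> 0"
      using bnd0 by (rule tendsto_mult_left_zero)
  qed
  then have "(\<lambda>n. (integral {0..t} (\<lambda>r. semi r (Y n)), semi t (Y n) - Y n)) \<longlonglongrightarrow>
      (integral {0..t} (\<lambda>r. semi r x), semi t x - x)"
    by (intro tendsto_Pair tendsto_diff l YZ)
  then show ?thesis
    by (rule closed_sequentially[OF closed_G, rotated]) (rule integral_semi_D2[OF YZ(1,2) t])
qed

subsection \<open>The inhomogeneous Cauchy problem\<close>

text \<open>For \<open>\<tau> \<le> r\<close> the semigroup is the identity, so the integrand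
  vanishes there, and with the correction \<open>(t - r) *\<^sub>R x\<close> the integral is that of
  the orbit over \<open>{0..t - r}\<close>. The range of integration no longer depends on
  \<open>r\<close>, as the exchange of integrals below requires.\<close>

lemma integral_semi_shifted:
  assumes x: "x \<in> S" and r: "0 \<le> r" "r \<le> t"
  shows "(integral {0..t} (\<lambda>\<tau>. semi (\<tau> - r) x - x) + (t - r) *\<^sub>R x, semi (t - r) x - x) \<in> G"
proof -
  have int: "(\<lambda>\<tau>. semi \<tau> x) integrable_on {a..b}" for a b
    using continuous_semi_point[OF x] continuous_on_subset by (blast intro: integrable_continuous_real)
  have int': "(\<lambda>\<tau>. semi (\<tau> - r) x) integrable_on {0..t}"
    using x by (intro integrable_continuous_real continuous_semi continuous_intros) auto
  have "integral {0..t} (\<lambda>\<tau>. semi (\<tau> - r) x) = integral {-r..t - r} (\<lambda>\<tau>. semi \<tau> x)"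
    using integral_shift_cbox[of "- r" "- r" "t - r" "\<lambda>\<tau>. semi \<tau> x"] by simp
  also have "\<dots> = integral {-r..0} (\<lambda>\<tau>. semi \<tau> x) + integral {0..t - r} (\<lambda>\<tau>. semi \<tau> x)"
    using r by (intro Henstock_Kurzweil_Integration.integral_combine[symmetric] int) auto
  also have "integral {-r..0} (\<lambda>\<tau>. semi \<tau> x) = integral {-r..0} (\<lambda>\<tau>. x)"
    by (intro integral_cong) (simp add: semi_nonpos)
  finally have "integral {0..t} (\<lambda>\<tau>. semi (\<tau> - r) x - x) + (t - r) *\<^sub>R x
      = integral {0..t - r} (\<lambda>\<tau>. semi \<tau> x)"
    using Henstock_Kurzweil_Integration.integral_diff[OF int' integrable_const_ivl[of x 0 t]] r
    by (simp add: algebra_simps)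
  then show ?thesis using integral_semi[OF x, of "t - r"] r by simp
qed

lemma at_within_half_line:
  fixes t T :: real
  assumes "t < T"
  shows "at t within {0..} = at t within {0..T}"
  by (rule at_within_nhd[where S = "{..<T}"]) (use assms in auto)

lemma inhomogeneous_exists:
  assumes x0: "(x0, a0) \<in> G" and FS: "\<And>t. t \<ge> 0 \<Longrightarrow> F t \<in> S" "\<And>t. t \<ge> 0 \<Longrightarrow> g t \<in> S"
    and g: "continuous_on {0..} g"
    and F: "\<And>t. t \<ge> 0 \<Longrightarrow> (F has_vector_derivative g t) (at t within {0..})"
  obtains U w where "U 0 = x0" "continuous_on {0..} w"
    "\<And>t. t \<ge> 0 \<Longrightarrow> (U has_vector_derivative w t) (at t within {0..})"
    "\<And>t. t \<ge> 0 \<Longrightarrow> (U t, w t - F t) \<in> G"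
proof -
  \<comment> \<open>Subtracting \<open>g r\<close> makes the kernel vanish for
    \<open>r \<ge> \<tau>\<close>, so it is continuous on the square and the double integral over
    the triangle becomes one over the square.\<close>
  define k where "k \<tau> r = semi (\<tau> - r) (g r) - g r" for \<tau> r
  define z where "z \<tau> = integral {0..\<tau>} (k \<tau>)" for \<tau>
  \<comment> \<open>The increment of \<open>F\<close> is the integral of \<open>g\<close> and makes
    up for the subtraction in \<open>k\<close>; thus \<open>w\<close> is the orbit of
    \<open>a0 + F 0\<close> plus the convolution of the semigroup with \<open>g\<close>.\<close>
  define w where "w \<tau> = semi \<tau> (a0 + F 0) + (F \<tau> - F 0) + z \<tau>" for \<tau>
  define U where "U t = x0 + integral {0..t} w" for t
  have aS: "a0 + F 0 \<in> S" using x0 G_in_S FS S_add by simp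
  have F': "(F has_vector_derivative g r) (at r within {0..t})" if "r \<in> {0..t}" for r t
    using F[of r] that by (auto intro: has_vector_derivative_within_subset)
  have F_cont: "continuous_on {0..t} F" for t
    using F' has_vector_derivative_continuous continuous_on_eq_continuous_within by blast
  have g_cont: "continuous_on {0..t} g" for t
    using g by (rule continuous_on_subset) auto
  have k_cont: "continuous_on ({0..t} \<times> {0..t}) (\<lambda>(\<tau>, r). k \<tau> r)" for t
  proof -
    have "continuous_on ({0..t} \<times> {0..t}) (\<lambda>p. g (snd p))"
      by (rule continuous_on_compose2[OF g_cont[of t]]) (auto intro: continuous_intros)
    then show ?thesis
      unfolding k_def case_prod_beta using FS
      by (intro continuous_on_diff continuous_semi) (auto intro: continuous_intros)
  qed
  have k_cont1: "continuous_on {0..t} (k \<tau>)" for \<tau> t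
    unfolding k_def using FS g_cont by (intro continuous_on_diff continuous_semi continuous_intros) auto
  have z_eq: "z \<tau> = integral {0..t} (k \<tau>)" if "\<tau> \<in> {0..t}" for \<tau> t
  proof -
    have "integral {\<tau>..t} (k \<tau>) = integral {\<tau>..t} (\<lambda>r. 0)"
      by (intro integral_cong) (simp add: k_def semi_nonpos)
    then show ?thesis
      using Henstock_Kurzweil_Integration.integral_combine[of 0 \<tau> t "k \<tau>"] that
        integrable_continuous_real[OF k_cont1]
      by (simp add: z_def)
  qed
  have z_cont: "continuous_on {0..t} z" for t
  proof -
    have "continuous_on {0..t} (\<lambda>\<tau>. integral (cbox 0 t) (k \<tau>))"
      using k_cont by (intro integral_continuous_on_param) simp
    then show ?thesis
      by (rule continuous_on_eq) (simp add: z_eq[symmetric])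
  qed
  have semi_cont: "continuous_on {0..t} (\<lambda>r. semi r (a0 + F 0))" for t
    using continuous_semi_point[OF aS] continuous_on_subset by blast
  have w_cont: "continuous_on {0..t} w" for t
    unfolding w_def by (intro continuous_intros semi_cont F_cont z_cont)
  have w_cont': "continuous_on {0..} w"
    unfolding continuous_on_eq_continuous_within
  proof
    fix t :: real assume "t \<in> {0..}"
    then show "continuous (at t within {0..}) w"
      using w_cont[of "t + 1"] at_within_half_line[of t "t + 1"]
      by (simp add: continuous_on_eq_continuous_within)
  qed
  have "(U has_vector_derivative w t) (at t within {0..})" if "t \<ge> 0" for t
  proof -
    have "((\<lambda>u. integral {0..u} w) has_vector_derivative w t) (at t within {0..t + 1})"
      using that by (intro integral_has_vector_derivative w_cont) auto
    then have "((\<lambda>u. x0 + integral {0..u} w) has_vector_derivative 0 + w t) (at t within {0..t + 1})"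
      by (intro has_vector_derivative_add has_vector_derivative_const)
    then show ?thesis using at_within_half_line[of t "t + 1"] by (simp add: U_def[abs_def])
  qed
  moreover have "(U t, w t - F t) \<in> G" if t: "t \<ge> 0" for t
  proof -
    define q where "q r = integral {0..t} (\<lambda>\<tau>. k \<tau> r)" for r
    have q_cont: "continuous_on {0..t} q"
    proof -
      have "continuous_on ({0..t} \<times> {0..t}) (\<lambda>p. (\<lambda>(\<tau>, r). k \<tau> r) (snd p, fst p))"
        by (rule continuous_on_compose2[OF k_cont[of t]]) (auto intro!: continuous_intros)
      then have "continuous_on {0..t} (\<lambda>r. integral (cbox 0 t) (\<lambda>\<tau>. k \<tau> r))"
        by (intro integral_continuous_on_param) (simp add: case_prod_beta')
      then show ?thesis by (simp add: q_def)
    qed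
    \<comment> \<open>Exchange of integrals: for fixed \<open>r\<close> the inner integral over
      \<open>\<tau>\<close> is the first component of a pair in the graph.\<close>
    have "integral {0..t} z = integral {0..t} (\<lambda>\<tau>. integral {0..t} (k \<tau>))"
      by (intro integral_cong z_eq)
    also have "\<dots> = integral {0..t} q"
      using integral_swap_continuous[of 0 0 t t k] k_cont[of t] by (simp add: q_def[abs_def] cbox_Pair_eq)
    finally have int_z: "integral {0..t} z = integral {0..t} q" .
    have gt_cont: "continuous_on {0..t} (\<lambda>r. (t - r) *\<^sub>R g r)"
      by (intro continuous_intros g_cont)
    have Fd_cont: "continuous_on {0..t} (\<lambda>r. F r - F 0)"
      by (intro continuous_intros F_cont)
    \<comment> \<open>Integration by parts with the primitive
      \<open>(t - r) *\<^sub>R (F r - F 0)\<close>, which vanishes at both ends. This is how the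
      correction terms of the shifted integrals become the integral of
      \<open>F r - F 0\<close>.\<close>
    have "((\<lambda>r. (t - r) *\<^sub>R g r - (F r - F 0)) has_integral
        (t - t) *\<^sub>R (F t - F 0) - (t - 0) *\<^sub>R (F 0 - F 0)) {0..t}"
    proof (rule fundamental_theorem_of_calculus[OF t])
      fix r assume r: "r \<in> {0..t}"
      have "((\<lambda>r. (t - r) *\<^sub>R (F r - F 0)) has_vector_derivative (t - r) *\<^sub>R (g r - 0) + (0 - 1) *\<^sub>R (F r - F 0)) (at r within {0..t})"
        by (intro has_vector_derivative_scaleR has_vector_derivative_diff has_vector_derivative_const F' r)
           (auto intro!: derivative_eq_intros)
      then show "((\<lambda>r. (t - r) *\<^sub>R (F r - F 0)) has_vector_derivative (t - r) *\<^sub>R g r - (F r - F 0)) (at r within {0..t})"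
        by (simp add: algebra_simps)
    qed
    then have "integral {0..t} (\<lambda>r. (t - r) *\<^sub>R g r - (F r - F 0)) = 0" by (simp add: integral_unique)
    then have int_F: "integral {0..t} (\<lambda>r. F r - F 0) = integral {0..t} (\<lambda>r. (t - r) *\<^sub>R g r)"
      using gt_cont Fd_cont
      by (simp add: Henstock_Kurzweil_Integration.integral_diff integrable_continuous_real)
    have "integral {0..t} (\<lambda>r. (q r + (t - r) *\<^sub>R g r, k t r)) \<in> G"
    proof (rule integral_in_closed_subspace[OF closed_G subspace_G])
      show "continuous_on {0..t} (\<lambda>r. (q r + (t - r) *\<^sub>R g r, k t r))"
        by (intro continuous_intros q_cont gt_cont g_cont k_cont1)
      show "(q r + (t - r) *\<^sub>R g r, k t r) \<in> G" if "r \<in> {0..t}" for r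
        using integral_semi_shifted[of "g r" r t] that FS by (simp add: q_def k_def)
    qed
    moreover have "integral {0..t} (\<lambda>r. (q r + (t - r) *\<^sub>R g r, k t r))
        = (integral {0..t} q + integral {0..t} (\<lambda>r. (t - r) *\<^sub>R g r), z t)"
      using q_cont gt_cont k_cont1
      by (simp add: integral_Pair continuous_on_add Henstock_Kurzweil_Integration.integral_add
          integrable_continuous_real z_def)
    ultimately have 1: "(integral {0..t} z + integral {0..t} (\<lambda>r. F r - F 0), z t) \<in> G"
      by (simp add: int_z int_F)
    have "integral {0..t} w = integral {0..t} (\<lambda>r. semi r (a0 + F 0)) + integral {0..t} (\<lambda>r. F r - F 0) + integral {0..t} z"
      unfolding w_def using semi_cont Fd_cont z_cont
      by (simp add: Henstock_Kurzweil_Integration.integral_add integrable_continuous_real integrable_add)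
    \<comment> \<open>Three elements of the graph are added: the initial pair, the integrated orbit
      of \<open>a0 + F 0\<close>, and the pair from the convolution. In the second components
      \<open>a0\<close> cancels and \<open>- F 0\<close> joins \<open>z t\<close> to give
      \<open>w t - F t\<close>.\<close>
    then show ?thesis
      using G_add[OF x0 G_add[OF integral_semi[OF aS t] 1]] by (simp add: U_def w_def algebra_simps)
  qed
  ultimately show ?thesis
    using that[of U w] w_cont' by (simp add: U_def)
qed

lemma homogeneous_unique:
  assumes W: "\<And>t. t \<ge> 0 \<Longrightarrow> (W has_vector_derivative W' t) (at t within {0..})"
    and G: "\<And>t. t \<ge> 0 \<Longrightarrow> (W t, W' t) \<in> G" and W0: "W 0 = 0" and t: "t \<ge> 0"
  shows "W t = 0"
proof -
  have "((\<lambda>r. ip (W r) (W' r) + ip (W' r) (W r)) has_integral ip (W t) (W t) - ip (W 0) (W 0)) {0..t}"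
  proof (rule fundamental_theorem_of_calculus[OF t])
    fix r assume r: "r \<in> {0..t}"
    then have "(W has_vector_derivative W' r) (at r within {0..t})"
      using W[of r] by (auto intro: has_vector_derivative_within_subset)
    then show "((\<lambda>r. ip (W r) (W r)) has_vector_derivative ip (W r) (W' r) + ip (W' r) (W r)) (at r within {0..t})"
      by (intro ip.has_vector_derivative)
  qed
  then have "ip (W t) (W t) - ip (W 0) (W 0) \<le> 0"
  proof (rule has_integral_le[OF _ has_integral_0])
    fix r assume "r \<in> {0..t}"
    then have g: "(W r, W' r) \<in> G" using G by simp
    then show "ip (W r) (W' r) + ip (W' r) (W r) \<le> 0"
      using dissip[OF g] ip_sym[OF G_in_S[OF g]] by simp
  qed
  then show ?thesis
    using G[OF t] G_in_S ip_self_zero[of "W t"] by (auto simp: W0 ip.zero_left)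
qed

end

section \<open>Second-order evolution equations given by three forms\<close>

lemma bounded_bilinear_add:
  assumes "bounded_bilinear f" "bounded_bilinear g"
  shows "bounded_bilinear (\<lambda>x y. f x y + g x y)"
proof -
  interpret f: bounded_bilinear f by fact
  interpret g: bounded_bilinear g by fact
  obtain K L where K: "\<And>x y. norm (f x y) \<le> norm x * norm y * K"
    and L: "\<And>x y. norm (g x y) \<le> norm x * norm y * L"
    using f.bounded g.bounded by blast
  show ?thesis
  proof
    show "\<exists>K. \<forall>x y. norm (f x y + g x y) \<le> norm x * norm y * K"
    proof (intro exI allI)
      fix x y
      show "norm (f x y + g x y) \<le> norm x * norm y * (K + L)"
        using norm_triangle_le[OF add_mono[OF K[of x y] L[of x y]]] by (simp add: distrib_left)
    qed
  qed (simp_all add: f.add_left f.add_right g.add_left g.add_right f.scaleR_left f.scaleR_right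
        g.scaleR_left g.scaleR_right scaleR_add_right)
qed

lemma bounded_bilinear_sum:
  assumes "\<And>i. i \<in> I \<Longrightarrow> bounded_bilinear (f i)"
  shows "bounded_bilinear (\<lambda>x y. \<Sum>i\<in>I. f i x y)"
  using assms
proof (induction I rule: infinite_finite_induct)
  case (insert i I)
  then show ?case by (auto intro!: bounded_bilinear_add)
qed (unfold_locales, auto intro!: exI[of _ 0])+

lemma bounded_bilinear_scale:
  fixes f :: "'a::real_normed_vector \<Rightarrow> 'b::real_normed_vector \<Rightarrow> 'c::real_normed_vector"
  assumes "bounded_bilinear f"
  shows "bounded_bilinear (\<lambda>x y. k *\<^sub>R f x y)"
proof -
  interpret f: bounded_bilinear f by fact
  have "bounded_bilinear (\<lambda>x y. f (k *\<^sub>R x) y)"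
    using bounded_bilinear.comp[OF assms bounded_linear_scaleR_right bounded_linear_ident] by simp
  then show ?thesis by (simp add: f.scaleR_left)
qed

text \<open>The relation \<open>G\<close> below encodes \<open>m(y'',\<phi>) + b(y',\<phi>) + a(y,\<phi>) = 0\<close> as a first order system. Elements of \<open>V\<close> are pairs of a function and its gradient, so that \<open>fst\<close> is the
  embedding of \<open>V\<close> into \<open>H\<close>.\<close>

locale second_order =
  fixes V :: "('h::{real_inner,banach} \<times> 'g::{real_inner,banach}) set" and H :: "'h set"
    and a b :: "'h \<times> 'g \<Rightarrow> 'h \<times> 'g \<Rightarrow> real" and m :: "'h \<Rightarrow> 'h \<Rightarrow> real" and c :: real
  assumes closed_V: "closed V" and subspace_V: "subspace V"
    and closed_H: "closed H" and subspace_H: "subspace H"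
    and V_H: "\<And>p. p \<in> V \<Longrightarrow> fst p \<in> H"
    and V_graph: "\<And>g. (0, g) \<in> V \<Longrightarrow> g = 0"
    and V_dense: "\<And>r. r \<in> H \<Longrightarrow> (\<And>\<phi>. \<phi> \<in> V \<Longrightarrow> m r (fst \<phi>) = 0) \<Longrightarrow> r = 0"
    and bil_a: "bounded_bilinear a" and bil_b: "bounded_bilinear b" and bil_m: "bounded_bilinear m"
    and a_sym: "\<And>p q. p \<in> V \<Longrightarrow> q \<in> V \<Longrightarrow> a p q = a q p"
    and m_sym: "\<And>p q. p \<in> H \<Longrightarrow> q \<in> H \<Longrightarrow> m p q = m q p"
    and c_pos: "c > 0"
    and a_coercive: "\<And>p. p \<in> V \<Longrightarrow> c * (norm p)\<^sup>2 \<le> a p p"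
    and m_coercive: "\<And>z. z \<in> H \<Longrightarrow> c * (norm z)\<^sup>2 \<le> m z z"
    and b_nonneg: "\<And>p. p \<in> V \<Longrightarrow> 0 \<le> b p p"
begin

interpretation a: bounded_bilinear a by (rule bil_a)
interpretation b: bounded_bilinear b by (rule bil_b)
interpretation m: bounded_bilinear m by (rule bil_m)

definition S :: "(('h \<times> 'g) \<times> 'h) set" where "S = V \<times> H"

definition ip :: "('h \<times> 'g) \<times> 'h \<Rightarrow> ('h \<times> 'g) \<times> 'h \<Rightarrow> real" where
  "ip X Y = a (fst X) (fst Y) + m (snd X) (snd Y)"

text \<open>With \<open>X = (p, z)\<close> and \<open>Y = (q, r)\<close>, the derivative of
  \<open>p\<close> is \<open>q\<close> and that of \<open>z\<close> is \<open>r\<close>. The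
  velocity occurs twice, as the element \<open>z\<close> of \<open>H\<close> and as \<open>q\<close>
  with its gradient; \<open>z = fst q\<close> therefore also says that velocities of the domain lie
  in the smaller space.\<close>

definition G :: "((('h \<times> 'g) \<times> 'h) \<times> (('h \<times> 'g) \<times> 'h)) set" where
  "G = {(X, Y). fst X \<in> V \<and> fst Y \<in> V \<and> snd Y \<in> H \<and> snd X = fst (fst Y) \<and>
     (\<forall>\<phi>\<in>V. m (snd Y) (fst \<phi>) + a (fst X) \<phi> + b (fst Y) \<phi> = 0)}"

lemma GI: "p \<in> V \<Longrightarrow> q \<in> V \<Longrightarrow> r \<in> H \<Longrightarrow> (\<And>\<phi>. \<phi> \<in> V \<Longrightarrow> m r (fst \<phi>) + a p \<phi> + b q \<phi> = 0)
    \<Longrightarrow> ((p, fst q), (q, r)) \<in> G"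
  by (simp add: G_def)

lemma bilinear_ip: "bounded_bilinear ip"
proof -
  have "bounded_bilinear (\<lambda>X Y. a (fst X) (fst Y))" "bounded_bilinear (\<lambda>X Y. m (snd X) (snd Y))"
    using bounded_bilinear.comp[OF bil_a bounded_linear_fst bounded_linear_fst]
      bounded_bilinear.comp[OF bil_m bounded_linear_snd bounded_linear_snd] by simp_all
  then show ?thesis
    unfolding ip_def[abs_def] by (rule bounded_bilinear_add)
qed

text \<open>Eliminating the position by \<open>p + h *\<^sub>R q\<close> and the acceleration by
  \<open>(fst q - r) /\<^sub>R h\<close> leaves a single elliptic equation for the velocity
  \<open>q\<close>. Its form \<open>B\<close> is coercive through the summand with
  \<open>h\<^sup>2\<close> and solved by Lax-Milgram.\<close>

lemma range_G:
  assumes h: "h > 0" and x: "x \<in> S"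
  shows "\<exists>y z. (y, z) \<in> G \<and> y - h *\<^sub>R z = x"
proof -
  obtain p r where pr: "x = (p, r)" "p \<in> V" "r \<in> H" using x by (auto simp: S_def)
  define B where "B q \<phi> = m (fst q) (fst \<phi>) + (h\<^sup>2 *\<^sub>R a q \<phi> + h *\<^sub>R b q \<phi>)" for q \<phi>
  have m1: "bounded_bilinear (\<lambda>q \<phi>. m (fst q) (fst \<phi>))"
    using bounded_bilinear.comp[OF bil_m bounded_linear_fst bounded_linear_fst] by simp
  have bB: "bounded_bilinear B"
    unfolding B_def[abs_def] by (intro bounded_bilinear_add m1 bounded_bilinear_scale bil_a bil_b)
  have l: "bounded_linear (\<lambda>\<phi>. m r (fst \<phi>) - h * a p \<phi>)"
    by (intro bounded_linear_sub bounded_linear_const_mult a.bounded_linear_right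
        bounded_linear_compose[OF m.bounded_linear_right bounded_linear_fst])
  have coer: "(h\<^sup>2 * c) * (norm q)\<^sup>2 \<le> B q q" if q: "q \<in> V" for q
  proof -
    have "h\<^sup>2 * (c * (norm q)\<^sup>2) \<le> h\<^sup>2 * a q q" using a_coercive[OF q] by (intro mult_left_mono) auto
    moreover have "0 \<le> h * b q q" using b_nonneg[OF q] h by simp
    moreover have "0 \<le> m (fst q) (fst q)"
      using m_coercive[OF V_H[OF q]] c_pos by (smt (verit) mult_nonneg_nonneg zero_le_power2)
    ultimately show ?thesis by (simp add: B_def)
  qed
  obtain q where q: "q \<in> V" "\<And>\<phi>. \<phi> \<in> V \<Longrightarrow> B q \<phi> = m r (fst \<phi>) - h * a p \<phi>"
    using lax_milgram[OF closed_V subspace_V bB l _ coer] h c_pos by auto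
  define s where "s = (fst q - r) /\<^sub>R h"
  have "((p + h *\<^sub>R q, fst q), (q, s)) \<in> G"
  proof (rule GI)
    show "p + h *\<^sub>R q \<in> V" using pr q subspace_V by (simp add: subspace_add subspace_scale)
    show "s \<in> H" using pr q V_H subspace_H by (simp add: s_def subspace_diff subspace_scale)
    fix \<phi> assume "\<phi> \<in> V"
    then have "m (fst q) (fst \<phi>) - m r (fst \<phi>) + h * a p \<phi> + h\<^sup>2 * a q \<phi> + h * b q \<phi> = 0"
      using q(2)[of \<phi>] by (simp add: B_def)
    then have "(m (fst q) (fst \<phi>) - m r (fst \<phi>)) / h + a p \<phi> + h * a q \<phi> + b q \<phi> = 0"
      using h by (simp add: field_simps power2_eq_square)
    then show "m s (fst \<phi>) + a (p + h *\<^sub>R q) \<phi> + b q \<phi> = 0"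
      by (simp add: s_def m.scaleR_left m.diff_left a.add_left a.scaleR_left divide_inverse mult_ac)
  qed fact
  moreover have "(p + h *\<^sub>R q, fst q) - h *\<^sub>R (q, s) = x"
    using h by (simp add: s_def pr)
  ultimately show ?thesis by blast
qed

sublocale m_dissipative S ip G c
proof (rule m_dissipative.intro)
  show "closed S" "subspace S"
    unfolding S_def using closed_V closed_H subspace_V subspace_H
    by (auto intro: closed_Times subspace_Times)
  show "bounded_bilinear ip" by (rule bilinear_ip)
  show "ip x y = ip y x" if "x \<in> S" "y \<in> S" for x y
    using that a_sym m_sym by (auto simp: S_def ip_def)
  show "c > 0" by (rule c_pos)
  show "c * (norm x)\<^sup>2 \<le> ip x x" if "x \<in> S" for x
    using that a_coercive[of "fst x"] m_coercive[of "snd x"]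
    by (auto simp: S_def ip_def norm_Pair distrib_left)
  show "subspace G"
  proof (rule subspaceI)
    show "0 \<in> G"
      using subspace_0[OF subspace_V] subspace_0[OF subspace_H]
      by (simp add: G_def case_prod_beta m.zero_left a.zero_left b.zero_left)
    show "X + Y \<in> G" if XY: "X \<in> G" "Y \<in> G" for X Y
    proof -
      have "m (snd (snd (X + Y))) (fst \<phi>) + a (fst (fst (X + Y))) \<phi> + b (fst (snd (X + Y))) \<phi> = 0"
        if "\<phi> \<in> V" for \<phi>
      proof -
        have "m (snd (snd X)) (fst \<phi>) + a (fst (fst X)) \<phi> + b (fst (snd X)) \<phi> = 0"
          "m (snd (snd Y)) (fst \<phi>) + a (fst (fst Y)) \<phi> + b (fst (snd Y)) \<phi> = 0"
          using XY that by (auto simp: G_def)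
        then show ?thesis by (simp add: m.add_left a.add_left b.add_left)
      qed
      then show ?thesis
        using XY subspace_V subspace_H unfolding G_def case_prod_beta mem_Collect_eq
        by (simp add: subspace_add)
    qed
    show "k *\<^sub>R X \<in> G" if X: "X \<in> G" for X k
    proof -
      have "m (snd (snd (k *\<^sub>R X))) (fst \<phi>) + a (fst (fst (k *\<^sub>R X))) \<phi> + b (fst (snd (k *\<^sub>R X))) \<phi> = 0"
        if "\<phi> \<in> V" for \<phi>
      proof -
        have "k * (m (snd (snd X)) (fst \<phi>) + a (fst (fst X)) \<phi> + b (fst (snd X)) \<phi>) = 0"
          using X that by (auto simp: G_def)
        then show ?thesis by (simp add: m.scaleR_left a.scaleR_left b.scaleR_left distrib_left)
      qed
      then show ?thesis
        using X subspace_V subspace_H unfolding G_def case_prod_beta mem_Collect_eq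
        by (simp add: subspace_scale)
    qed
  qed
  show "G \<subseteq> S \<times> S" using V_H by (auto simp: G_def S_def)
  show "ip x y \<le> 0" if "(x, y) \<in> G" for x y
  proof -
    have 1: "fst x \<in> V" "fst y \<in> V" "snd y \<in> H" "snd x = fst (fst y)"
      "m (snd y) (fst (fst y)) + a (fst x) (fst y) + b (fst y) (fst y) = 0"
      using that by (auto simp: G_def)
    \<comment> \<open>The weak equation tested with the velocity itself: its inertial and elastic
      terms add up to the energy product, so exactly the damping is left.\<close>
    then have "ip x y = - b (fst y) (fst y)"
      using m_sym[OF V_H[OF 1(2)] 1(3)] by (simp add: ip_def)
    then show ?thesis using b_nonneg[OF 1(2)] by simp
  qed
  show "\<exists>y z. (y, z) \<in> G \<and> y - h *\<^sub>R z = x" if "h > 0" "x \<in> S" for h x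
    using range_G that by blast
  show "y = 0" if "(0, y) \<in> G" for y
  proof -
    have "fst y \<in> V" "fst (fst y) = 0" using that by (auto simp: G_def)
    then have 1: "fst y = 0" using V_graph[of "snd (fst y)"] by (metis prod.collapse zero_prod_def)
    then have "snd y = 0"
      using that by (intro V_dense) (auto simp: G_def a.zero_left b.zero_left)
    then show ?thesis using 1 by (metis prod.collapse zero_prod_def)
  qed
qed

end

section \<open>The space of square-integrable classes\<close>

lemma sq_int_rep: "sq_int (rep_l2 f)"
  using Quotient3_rep_reflp[OF Quotient3_l2, of f] by (simp add: l2_rel_def)

lemma abs_rep_l2 [simp]: "abs_l2 (rep_l2 f) = f"
  by (rule Quotient3_abs_rep[OF Quotient3_l2])

lemma abs_l2_eqI: "l2_rel f g \<Longrightarrow> abs_l2 f = abs_l2 g"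
  by (rule Quotient3_rel_abs[OF Quotient3_l2])

lemma rep_abs_l2: "sq_int f \<Longrightarrow> AE x in lebesgue. rep_l2 (abs_l2 f) x = f x"
  using rep_abs_rsp_left[OF Quotient3_l2, of f f] by (simp add: l2_rel_def)

lemma rep_measurable [measurable]: "rep_l2 f \<in> borel_measurable lebesgue"
  using sq_int_rep[of f] by (simp add: sq_int_def)

lemma rep_zero: "AE x in lebesgue. rep_l2 0 x = 0"
  unfolding zero_l2_def by (rule rep_abs_l2[OF sq_int_zero])

lemma rep_add: "AE x in lebesgue. rep_l2 (f + g) x = rep_l2 f x + rep_l2 g x"
proof -
  have "f + g = abs_l2 (\<lambda>x. rep_l2 f x + rep_l2 g x)"
    using plus_l2.abs_eq[of "rep_l2 f" "rep_l2 g"] sq_int_rep by (simp add: l2_rel_def)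
  then show ?thesis using rep_abs_l2[OF sq_int_add[OF sq_int_rep sq_int_rep]] by simp
qed

lemma rep_scale: "AE x in lebesgue. rep_l2 (r *\<^sub>R f) x = r * rep_l2 f x"
proof -
  have "r *\<^sub>R f = abs_l2 (\<lambda>x. r * rep_l2 f x)"
    using scaleR_l2.abs_eq[of "rep_l2 f" r] sq_int_rep by (simp add: l2_rel_def)
  then show ?thesis using rep_abs_l2[OF sq_int_scale[OF sq_int_rep]] by simp
qed

lemma inner_l2_rep: "inner f g = (LINT x|lebesgue. rep_l2 f x * rep_l2 g x)"
  using inner_l2.abs_eq[of "rep_l2 f" "rep_l2 g"] sq_int_rep by (simp add: l2_rel_def)

lemma norm_abs_l2: "sq_int f \<Longrightarrow> (norm (abs_l2 f))\<^sup>2 = (LINT x|lebesgue. (f x)\<^sup>2)"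
  unfolding power2_norm_eq_inner
  using inner_l2.abs_eq[of f f] by (simp add: l2_rel_def power2_eq_square)

lemma norm_l2_diff:
  "(norm (f - g))\<^sup>2 = (LINT x|lebesgue. (rep_l2 f x - rep_l2 g x)\<^sup>2)"
proof -
  have "AE x in lebesgue. rep_l2 (f - g) x = rep_l2 f x - rep_l2 g x"
    using rep_add[of f "(-1) *\<^sub>R g"] rep_scale[of "-1" g] by eventually_elim simp
  then show ?thesis
    unfolding power2_norm_eq_inner inner_l2_rep
    by (intro integral_cong_AE) (auto simp: power2_eq_square)
qed

lemma sq_int_diff: "sq_int f \<Longrightarrow> sq_int g \<Longrightarrow> sq_int (\<lambda>x. f x - g x)"
  using sq_int_add[of f "\<lambda>x. (-1) * g x"] sq_int_scale[of g "-1"] by simp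

lemma sq_int_iff_nn_integral:
  "sq_int f \<longleftrightarrow> f \<in> borel_measurable lebesgue \<and> (\<integral>\<^sup>+x. ennreal ((f x)\<^sup>2) \<partial>lebesgue) < \<infinity>"
  unfolding sq_int_def by (auto simp: integrable_iff_bounded)

text \<open>Lebesgue measure is sigma-finite, hence carries a strictly positive integrable function;
  take its square root. It serves as a weight that turns convergence in L2 into convergence in L1 on
  the whole space.\<close>

lemma ex_positive_square_integrable:
  obtains h :: "real^3 \<Rightarrow> real" where "sq_int h" "\<And>x. h x > 0"
proof -
  obtain k :: "real^3 \<Rightarrow> ennreal" where k: "k \<in> borel_measurable lborel" "integral\<^sup>N lborel k \<noteq> \<infinity>"
      "\<And>x. 0 < k x \<and> k x < \<infinity>"
    using sigma_finite_measure.Ex_finite_integrable_function[OF sigma_finite_lborel] by auto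
  define h where "h x = sqrt (enn2real (k x))" for x
  have sq: "ennreal ((h x)\<^sup>2) = k x" for x using k(3)[of x] by (simp add: h_def)
  have km: "k \<in> borel_measurable lebesgue"
    using k(1) by (simp add: measurable_completion)
  have "h \<in> borel_measurable lebesgue" unfolding h_def using km by measurable
  moreover have "(\<integral>\<^sup>+x. k x \<partial>lebesgue) < \<infinity>"
    using k by (simp add: nn_integral_completion top.not_eq_extremum)
  ultimately have "sq_int h" by (simp add: sq_int_iff_nn_integral sq)
  moreover have "h x > 0" for x using k(3)[of x] by (simp add: h_def enn2real_positive_iff)
  ultimately show ?thesis using that by blast
qed

text \<open>Riesz-Fischer. After multiplication with the positive weight \<open>h\<close> the
  representatives are Cauchy in L1 by the Cauchy-Schwarz inequality, so a subsequence is Cauchy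
  almost everywhere; dividing by \<open>h\<close> gives the pointwise limit \<open>l\<close>, and
  Fatou's lemma turns it into a limit in norm.\<close>

lemma l2_Cauchy_convergent:
  fixes X :: "nat \<Rightarrow> l2"
  assumes X: "Cauchy X"
  shows "convergent X"
proof -
  obtain h :: "real^3 \<Rightarrow> real" where h: "sq_int h" "\<And>x. h x > 0"
    using ex_positive_square_integrable by blast
  have hm [measurable]: "h \<in> borel_measurable lebesgue" using h by (simp add: sq_int_def)
  define f where "f n = rep_l2 (X n)" for n
  have f: "sq_int (f n)" for n by (simp add: f_def sq_int_rep)
  have fm [measurable]: "f n \<in> borel_measurable lebesgue" for n by (simp add: f_def)
  have fdiff: "sq_int (\<lambda>x. f i x - f j x)" for i j using f by (intro sq_int_diff)
  define w where "w n x = f n x * h x" for n x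
  have w_int: "integrable lebesgue (w n)" for n
    unfolding w_def by (rule integrable_sq_prod[OF f h(1)])
  have w_diff: "(LINT x|lebesgue. norm (w i x - w j x)) \<le> norm (X i - X j) * norm (abs_l2 h)" for i j
  proof -
    define a where "a x = \<bar>f i x - f j x\<bar>" for x
    have "a \<in> borel_measurable lebesgue" unfolding a_def by measurable
    then have a: "sq_int a" using fdiff[of i j] by (simp add: a_def sq_int_def)
    have "(LINT x|lebesgue. norm (w i x - w j x)) = (LINT x|lebesgue. a x * h x)"
      using h(2) by (intro Bochner_Integration.integral_cong)
        (auto simp: w_def a_def abs_mult abs_of_pos simp flip: left_diff_distrib)
    also have "\<dots> = inner (abs_l2 a) (abs_l2 h)"
      using inner_l2.abs_eq[of a h] a h by (simp add: l2_rel_def)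
    also have "\<dots> \<le> norm (abs_l2 a) * norm (abs_l2 h)" by (rule norm_cauchy_schwarz)
    also have "(norm (abs_l2 a))\<^sup>2 = (norm (X i - X j))\<^sup>2"
      unfolding norm_abs_l2[OF a] norm_l2_diff by (simp add: a_def f_def)
    then have "norm (abs_l2 a) = norm (X i - X j)" by (simp add: power2_eq_iff_nonneg)
    finally show ?thesis by simp
  qed
  have "\<exists>N. \<forall>i\<ge>N. \<forall>j\<ge>N. (LINT x|lebesgue. norm (w i x - w j x)) < e" if e: "e > 0" for e
  proof -
    define k where "k = norm (abs_l2 h) + 1"
    have k: "k > 0" by (simp add: k_def add_nonneg_pos)
    obtain N where N: "\<And>i j. i \<ge> N \<Longrightarrow> j \<ge> N \<Longrightarrow> norm (X i - X j) < e / k"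
      using CauchyD[OF X, of "e / k"] e k by auto
    have "(LINT x|lebesgue. norm (w i x - w j x)) < e" if "i \<ge> N" "j \<ge> N" for i j
    proof -
      have "norm (X i - X j) * norm (abs_l2 h) \<le> norm (X i - X j) * k"
        by (intro mult_left_mono) (auto simp: k_def)
      also have "\<dots> < e" using N[OF that] k by (simp add: field_simps)
      finally show ?thesis using w_diff[of i j] by linarith
    qed
    then show ?thesis by blast
  qed
  then obtain r where r: "strict_mono r" "AE x in lebesgue. Cauchy (\<lambda>i. w (r i) x)"
    using cauchy_L1_AE_cauchy_subseq[of lebesgue w] w_int by blast
  define l where "l x = lim (\<lambda>i. f (r i) x)" for x
  have lm [measurable]: "l \<in> borel_measurable lebesgue" unfolding l_def by measurable
  have conv: "AE x in lebesgue. (\<lambda>i. f (r i) x) \<longlonglongrightarrow> l x"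
    using r(2)
  proof eventually_elim
    case (elim x)
    then have "convergent (\<lambda>i. w (r i) x)" by (rule Cauchy_convergent)
    then have "convergent (\<lambda>i. w (r i) x * inverse (h x))"
      by (intro convergent_mult convergent_const)
    then have "convergent (\<lambda>i. f (r i) x)" using h(2)[of x] by (simp add: w_def mult.assoc)
    then show ?case unfolding l_def by (simp add: convergent_LIMSEQ_iff)
  qed
  \<comment> \<open>Used twice: with \<open>e = 1\<close> for the square-integrability of
    \<open>l\<close>, and with \<open>e / 2\<close> for the convergence. It is stated with
    \<open>nn_integral\<close> because the first use precedes integrability.\<close>
  have fatou: "(\<integral>\<^sup>+x. ennreal ((l x - f n x)\<^sup>2) \<partial>lebesgue) \<le> ennreal (e\<^sup>2)"
    if "\<And>i. i \<ge> N \<Longrightarrow> norm (X i - X n) \<le> e" for n N e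
  proof -
    have "(\<integral>\<^sup>+x. ennreal ((l x - f n x)\<^sup>2) \<partial>lebesgue)
        = (\<integral>\<^sup>+x. liminf (\<lambda>i. ennreal ((f (r i) x - f n x)\<^sup>2)) \<partial>lebesgue)"
    proof (rule nn_integral_cong_AE, use conv in eventually_elim)
      case (elim x)
      then have "(\<lambda>i. ennreal ((f (r i) x - f n x)\<^sup>2)) \<longlonglongrightarrow> ennreal ((l x - f n x)\<^sup>2)"
        by (intro tendsto_intros)
      then show ?case by (metis lim_imp_Liminf trivial_limit_sequentially)
    qed
    also have "\<dots> \<le> liminf (\<lambda>i. \<integral>\<^sup>+x. ennreal ((f (r i) x - f n x)\<^sup>2) \<partial>lebesgue)"
      by (rule nn_integral_liminf) measurable
    also have "\<dots> = liminf (\<lambda>i. ennreal ((norm (X (r i) - X n))\<^sup>2))"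
    proof -
      have "(\<integral>\<^sup>+x. ennreal ((f i x - f n x)\<^sup>2) \<partial>lebesgue) = ennreal ((norm (X i - X n))\<^sup>2)" for i
        unfolding norm_l2_diff f_def[symmetric]
        using fdiff[of i n] by (intro nn_integral_eq_integral) (auto simp: sq_int_def)
      then show ?thesis by simp
    qed
    also have "\<dots> \<le> limsup (\<lambda>i. ennreal ((norm (X (r i) - X n))\<^sup>2))"
      by (rule Liminf_le_Limsup) simp
    also have "\<dots> \<le> ennreal (e\<^sup>2)"
    proof (rule Limsup_bounded)
      show "\<forall>\<^sub>F i in sequentially. ennreal ((norm (X (r i) - X n))\<^sup>2) \<le> ennreal (e\<^sup>2)"
        using that seq_suble[OF r(1)]
        by (auto simp: eventually_sequentially intro!: exI[of _ N] ennreal_leI power_mono) (meson order.trans)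
    qed
    finally show ?thesis .
  qed
  have sql: "sq_int l"
  proof -
    obtain N where N: "\<And>i j. i \<ge> N \<Longrightarrow> j \<ge> N \<Longrightarrow> norm (X i - X j) < 1"
      using CauchyD[OF X, of 1] by auto
    have "(\<integral>\<^sup>+x. ennreal ((l x - f N x)\<^sup>2) \<partial>lebesgue) \<le> ennreal (1\<^sup>2)"
      by (rule fatou[of N]) (use N in \<open>auto intro: less_imp_le\<close>)
    also have "\<dots> < \<infinity>" by simp
    finally have "sq_int (\<lambda>x. l x - f N x)" by (simp add: sq_int_iff_nn_integral)
    from sq_int_add[OF this f[of N]] show ?thesis by simp
  qed
  have "X \<longlonglongrightarrow> abs_l2 l"
  proof (rule LIMSEQ_I)
    fix e :: real assume e: "e > 0"
    obtain N where N: "\<And>i j. i \<ge> N \<Longrightarrow> j \<ge> N \<Longrightarrow> norm (X i - X j) < e / 2"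
      using CauchyD[OF X, of "e / 2"] e by auto
    have "norm (X n - abs_l2 l) < e" if n: "n \<ge> N" for n
    proof -
      have "(norm (abs_l2 l - X n))\<^sup>2 = (LINT x|lebesgue. (l x - f n x)\<^sup>2)"
        unfolding norm_l2_diff f_def
        by (rule integral_cong_AE) (use rep_abs_l2[OF sql] sql in \<open>auto simp: sq_int_def\<close>)
      also have "\<dots> = enn2real (\<integral>\<^sup>+x. ennreal ((l x - f n x)\<^sup>2) \<partial>lebesgue)"
        by (intro integral_eq_nn_integral) auto
      also have "\<dots> \<le> enn2real (ennreal ((e / 2)\<^sup>2))"
        by (intro enn2real_mono fatou[of N]) (use N n in \<open>auto intro: less_imp_le\<close>)
      finally have "(norm (abs_l2 l - X n))\<^sup>2 \<le> (e / 2)\<^sup>2" by simp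
      then have "norm (abs_l2 l - X n) \<le> e / 2"
        by (rule power2_le_imp_le) (use e in simp)
      then show ?thesis using e by (simp add: norm_minus_commute)
    qed
    then show "\<exists>N. \<forall>n\<ge>N. norm (X n - abs_l2 l) < e" by blast
  qed
  then show ?thesis by (auto simp: convergent_def)
qed

instance l2 :: banach
  by standard (rule l2_Cauchy_convergent)

section \<open>Multiplication by bounded coefficients\<close>

text \<open>Both conditions look at the values inside the domain only, as coefficients are arbitrary
  functions outside its closure.\<close>

definition bcoef :: "(real^3) set \<Rightarrow> (real^3 \<Rightarrow> real) \<Rightarrow> bool" where
  "bcoef \<Omega> c \<longleftrightarrow> (\<lambda>x. indicat_real \<Omega> x * c x) \<in> borel_measurable lebesgue \<and> (\<exists>K. \<forall>x\<in>\<Omega>. \<bar>c x\<bar> \<le> K)"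

text \<open>The restriction of \<open>r\<close> to the domain represents the class \<open>f\<close>.
  This is the bridge between classes, in which the abstract theory lives, and pointwise expressions,
  in which coefficients and integrands are given.\<close>

definition reps :: "(real^3) set \<Rightarrow> (real^3 \<Rightarrow> real) \<Rightarrow> l2 \<Rightarrow> bool" where
  "reps \<Omega> r f \<longleftrightarrow> (\<lambda>x. indicat_real \<Omega> x * r x) \<in> borel_measurable lebesgue \<and>
     (AE x in lebesgue. indicat_real \<Omega> x * r x = rep_l2 f x)"

text \<open>The restriction built into \<open>l2_on\<close> makes this a bounded operator on the
  entire type, as the bilinearity of the forms requires.\<close>

definition mul :: "(real^3) set \<Rightarrow> (real^3 \<Rightarrow> real) \<Rightarrow> l2 \<Rightarrow> l2" where
  "mul \<Omega> c f = l2_on \<Omega> (\<lambda>x. c x * rep_l2 f x)"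

lemma reps_meas: "reps \<Omega> r f \<Longrightarrow> (\<lambda>x. indicat_real \<Omega> x * r x) \<in> borel_measurable lebesgue"
  unfolding reps_def by (rule conjunct1)

lemma reps_AE: "reps \<Omega> r f \<Longrightarrow> AE x in lebesgue. indicat_real \<Omega> x * r x = rep_l2 f x"
  unfolding reps_def by (rule conjunct2)

lemma repsI: "(\<lambda>x. indicat_real \<Omega> x * r x) \<in> borel_measurable lebesgue \<Longrightarrow>
    (AE x in lebesgue. indicat_real \<Omega> x * r x = rep_l2 f x) \<Longrightarrow> reps \<Omega> r f"
  unfolding reps_def by (rule conjI)

lemma sq_int_meas: "sq_int f \<Longrightarrow> f \<in> borel_measurable lebesgue"
  unfolding sq_int_def by (rule conjunct1)

lemma sq_int_integrable: "sq_int f \<Longrightarrow> integrable lebesgue (\<lambda>x. (f x)\<^sup>2)"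
  unfolding sq_int_def by (rule conjunct2)

lemma sq_intI: "f \<in> borel_measurable lebesgue \<Longrightarrow> integrable lebesgue (\<lambda>x. (f x)\<^sup>2) \<Longrightarrow> sq_int f"
  unfolding sq_int_def by (rule conjI)

lemma bcoef_meas: "bcoef \<Omega> c \<Longrightarrow> (\<lambda>x. indicat_real \<Omega> x * c x) \<in> borel_measurable lebesgue"
  unfolding bcoef_def by (rule conjunct1)

lemma reps_l2_on:
  assumes "sq_int (\<lambda>x. indicat_real \<Omega> x * r x)"
  shows "reps \<Omega> r (l2_on \<Omega> r)"
  by (rule repsI[OF sq_int_meas[OF assms]])
     (use rep_abs_l2[OF assms] in \<open>auto simp: l2_on_def elim: eventually_mono\<close>)

lemma reps_sq_int: "reps \<Omega> r f \<Longrightarrow> sq_int (\<lambda>x. indicat_real \<Omega> x * r x)"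
proof -
  assume r: "reps \<Omega> r f"
  have "integrable lebesgue (\<lambda>x. (indicat_real \<Omega> x * r x)\<^sup>2)"
  proof (rule integrable_cong_AE_imp[OF sq_int_integrable[OF sq_int_rep[of f]]])
    show "(\<lambda>x. (indicat_real \<Omega> x * r x)\<^sup>2) \<in> borel_measurable lebesgue"
      by (intro borel_measurable_power reps_meas[OF r])
    show "AE x in lebesgue. (rep_l2 f x)\<^sup>2 = (indicat_real \<Omega> x * r x)\<^sup>2"
      using reps_AE[OF r] by eventually_elim simp
  qed
  then show ?thesis using reps_meas[OF r] by (rule sq_intI[rotated])
qed

lemma reps_unique: "reps \<Omega> r f \<Longrightarrow> reps \<Omega> r g \<Longrightarrow> f = g"
proof -
  assume r: "reps \<Omega> r f" "reps \<Omega> r g"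
  then have "AE x in lebesgue. rep_l2 f x = rep_l2 g x"
    unfolding reps_def by (auto elim: eventually_elim2)
  then have "abs_l2 (rep_l2 f) = abs_l2 (rep_l2 g)"
    by (intro abs_l2_eqI) (simp add: l2_rel_def sq_int_rep)
  then show ?thesis by simp
qed

lemma reps_l2_on_eq: "reps \<Omega> r f \<Longrightarrow> l2_on \<Omega> r = f"
  using reps_unique reps_l2_on reps_sq_int by blast

lemma reps_cong: "reps \<Omega> r f \<Longrightarrow> (\<And>x. x \<in> \<Omega> \<Longrightarrow> r x = s x) \<Longrightarrow> reps \<Omega> s f"
proof -
  assume r: "reps \<Omega> r f" and "\<And>x. x \<in> \<Omega> \<Longrightarrow> r x = s x"
  then have "(\<lambda>x. indicat_real \<Omega> x * r x) = (\<lambda>x. indicat_real \<Omega> x * s x)" by (auto simp: indicator_def)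
  then show "reps \<Omega> s f" using r unfolding reps_def by metis
qed

locale region =
  fixes \<Omega> :: "(real^3) set"
  assumes open_region: "open \<Omega>" and bounded_region: "bounded \<Omega>"
begin

lemma sets_region [measurable]: "\<Omega> \<in> sets lebesgue"
  using open_region by (simp add: borel_open)

lemma indicator_measurable [measurable]: "(\<lambda>x. indicat_real \<Omega> x) \<in> borel_measurable lebesgue"
  by (intro borel_measurable_indicator sets_region)

lemma reps_L2: "reps \<Omega> r f \<Longrightarrow> f \<in> L2 \<Omega>"
  unfolding reps_def L2_def by (auto elim: eventually_mono)

lemma reps_rep: "f \<in> L2 \<Omega> \<Longrightarrow> reps \<Omega> (rep_l2 f) f"
  unfolding reps_def L2_def by (auto elim: eventually_mono simp: indicator_def)

lemma reps_zero: "reps \<Omega> (\<lambda>x. 0) 0"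
  unfolding reps_def using rep_zero by (auto elim: eventually_mono)

lemma reps_add: "reps \<Omega> r f \<Longrightarrow> reps \<Omega> s g \<Longrightarrow> reps \<Omega> (\<lambda>x. r x + s x) (f + g)"
proof -
  assume r: "reps \<Omega> r f" and s: "reps \<Omega> s g"
  show ?thesis
  proof (rule repsI)
    show "AE x in lebesgue. indicat_real \<Omega> x * (r x + s x) = rep_l2 (f + g) x"
      using reps_AE[OF r] reps_AE[OF s] rep_add[of f g] by eventually_elim (simp add: distrib_left)
    show "(\<lambda>x. indicat_real \<Omega> x * (r x + s x)) \<in> borel_measurable lebesgue"
      unfolding distrib_left by (intro borel_measurable_add reps_meas[OF r] reps_meas[OF s])
  qed
qed

lemma reps_scale: "reps \<Omega> r f \<Longrightarrow> reps \<Omega> (\<lambda>x. k * r x) (k *\<^sub>R f)"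
proof -
  assume r: "reps \<Omega> r f"
  show ?thesis
  proof (rule repsI)
    show "AE x in lebesgue. indicat_real \<Omega> x * (k * r x) = rep_l2 (k *\<^sub>R f) x"
      using reps_AE[OF r] rep_scale[of k f] by eventually_elim (simp add: mult.left_commute)
    show "(\<lambda>x. indicat_real \<Omega> x * (k * r x)) \<in> borel_measurable lebesgue"
      unfolding mult.left_commute[of _ k] by (intro borel_measurable_times reps_meas[OF r] borel_measurable_const)
  qed
qed

lemma reps_diff: "reps \<Omega> r f \<Longrightarrow> reps \<Omega> s g \<Longrightarrow> reps \<Omega> (\<lambda>x. r x - s x) (f - g)"
  using reps_add[OF _ reps_scale[of s g "-1"], of r f] by simp

lemma reps_minus: "reps \<Omega> r f \<Longrightarrow> reps \<Omega> (\<lambda>x. - r x) (- f)"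
  using reps_scale[of r f "-1"] by simp

lemma reps_sum:
  assumes "\<And>i. i \<in> I \<Longrightarrow> reps \<Omega> (r i) (f i)"
  shows "reps \<Omega> (\<lambda>x. \<Sum>i\<in>I. r i x) (\<Sum>i\<in>I. f i)"
  using assms by (induction I rule: infinite_finite_induct) (auto intro: reps_zero reps_add)

text \<open>\<open>mul\<close> is defined by the chosen representative \<open>rep_l2 f\<close>,
  which may differ from \<open>r\<close> on a null set. Both products are square-integrable by the
  bound on \<open>c\<close>, so they define the same class.\<close>

lemma reps_mul:
  assumes c: "bcoef \<Omega> c" and r: "reps \<Omega> r f"
  shows "reps \<Omega> (\<lambda>x. c x * r x) (mul \<Omega> c f)"
proof -
  obtain K where K: "\<And>x. x \<in> \<Omega> \<Longrightarrow> \<bar>c x\<bar> \<le> K" using c by (auto simp: bcoef_def)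
  have K': "\<bar>indicat_real \<Omega> x * c x\<bar> \<le> \<bar>K\<bar>" for x
    using K[of x] by (auto simp: indicator_def)
  have sq: "sq_int (\<lambda>x. indicat_real \<Omega> x * (c x * s x))" if s: "(\<lambda>x. indicat_real \<Omega> x * s x) \<in> borel_measurable lebesgue"
      "integrable lebesgue (\<lambda>x. (indicat_real \<Omega> x * s x)\<^sup>2)" for s
  proof -
    have e: "indicat_real \<Omega> x * (c x * s x) = (indicat_real \<Omega> x * c x) * (indicat_real \<Omega> x * s x)" for x
      by (auto simp: indicator_def)
    have m: "(\<lambda>x. (indicat_real \<Omega> x * c x) * (indicat_real \<Omega> x * s x)) \<in> borel_measurable lebesgue"
      by (intro borel_measurable_times bcoef_meas[OF c] s)
    have "integrable lebesgue (\<lambda>x. ((indicat_real \<Omega> x * c x) * (indicat_real \<Omega> x * s x))\<^sup>2)"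
    proof (rule Bochner_Integration.integrable_bound)
      show "integrable lebesgue (\<lambda>x. K\<^sup>2 * (indicat_real \<Omega> x * s x)\<^sup>2)" using s by simp
      show "(\<lambda>x. ((indicat_real \<Omega> x * c x) * (indicat_real \<Omega> x * s x))\<^sup>2) \<in> borel_measurable lebesgue"
        by (intro borel_measurable_power m)
      have "((indicat_real \<Omega> x * c x) * (indicat_real \<Omega> x * s x))\<^sup>2 \<le> K\<^sup>2 * (indicat_real \<Omega> x * s x)\<^sup>2" for x
      proof -
        have "(indicat_real \<Omega> x * c x)\<^sup>2 \<le> K\<^sup>2" using power_mono[OF K'[of x], of 2] by simp
        then show ?thesis by (simp add: power_mult_distrib mult_right_mono)
      qed
      then show "AE x in lebesgue. norm (((indicat_real \<Omega> x * c x) * (indicat_real \<Omega> x * s x))\<^sup>2)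
          \<le> norm (K\<^sup>2 * (indicat_real \<Omega> x * s x)\<^sup>2)" by simp
    qed
    then show ?thesis unfolding e by (rule sq_intI[OF m])
  qed
  have 1: "sq_int (\<lambda>x. indicat_real \<Omega> x * (c x * r x))"
    by (intro sq sq_int_meas sq_int_integrable reps_sq_int[OF r])
  have f2: "integrable lebesgue (\<lambda>x. (indicat_real \<Omega> x * rep_l2 f x)\<^sup>2)"
  proof (rule Bochner_Integration.integrable_bound)
    show "integrable lebesgue (\<lambda>x. (rep_l2 f x)\<^sup>2)" using sq_int_rep by (simp add: sq_int_def)
  qed (auto simp: indicator_def)
  have 2: "sq_int (\<lambda>x. indicat_real \<Omega> x * (c x * rep_l2 f x))"
    using f2 by (intro sq) auto
  have "AE x in lebesgue. indicat_real \<Omega> x * r x = indicat_real \<Omega> x * rep_l2 f x"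
    using reps_AE[OF r] by eventually_elim (auto simp: indicator_def)
  then have ae: "AE x in lebesgue. indicat_real \<Omega> x * (c x * r x) = indicat_real \<Omega> x * (c x * rep_l2 f x)"
    by eventually_elim (simp add: mult.left_commute[of _ "c _"])
  then have "l2_on \<Omega> (\<lambda>x. c x * r x) = mul \<Omega> c f"
    unfolding l2_on_def mul_def
    by (intro abs_l2_eqI) (use 1 2 in \<open>simp add: l2_rel_def\<close>)
  then show ?thesis using reps_l2_on[OF 1] by simp
qed

lemma L2_mul: "bcoef \<Omega> c \<Longrightarrow> f \<in> L2 \<Omega> \<Longrightarrow> mul \<Omega> c f \<in> L2 \<Omega>"
  using reps_mul[OF _ reps_rep] reps_L2 by blast

text \<open>Integrability and value are carried together, so that the integral of a long sum follows
  by introduction rules that mirror the shape of the integrand.\<close>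

definition hasI :: "(real^3 \<Rightarrow> real) \<Rightarrow> real \<Rightarrow> bool" where
  "hasI g v \<longleftrightarrow> set_integrable lebesgue \<Omega> g \<and> (LINT x:\<Omega>|lebesgue. g x) = v"

lemma hasI_add: "hasI g v \<Longrightarrow> hasI h w \<Longrightarrow> hasI (\<lambda>x. g x + h x) (v + w)"
  by (simp add: hasI_def set_integral_add)

lemma hasI_zero: "hasI (\<lambda>x. 0) 0"
  by (simp add: hasI_def set_integrable_def set_lebesgue_integral_def)

lemma hasI_sum: "(\<And>i. i \<in> I \<Longrightarrow> hasI (g i) (v i)) \<Longrightarrow> hasI (\<lambda>x. \<Sum>i\<in>I. g i x) (\<Sum>i\<in>I. v i)"
  by (induction I rule: infinite_finite_induct) (auto intro: hasI_zero hasI_add)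

lemma hasI_prod:
  assumes r: "reps \<Omega> r f" and s: "reps \<Omega> s g"
  shows "hasI (\<lambda>x. r x * s x) (inner f g)"
proof -
  have e: "indicat_real \<Omega> x *\<^sub>R (r x * s x) = (indicat_real \<Omega> x * r x) * (indicat_real \<Omega> x * s x)" for x
    by (auto simp: indicator_def)
  have "integrable lebesgue (\<lambda>x. (indicat_real \<Omega> x * r x) * (indicat_real \<Omega> x * s x))"
    using reps_sq_int[OF r] reps_sq_int[OF s] by (rule integrable_sq_prod)
  moreover have "(LINT x|lebesgue. (indicat_real \<Omega> x * r x) * (indicat_real \<Omega> x * s x)) = inner f g"
    unfolding inner_l2_rep
  proof (rule integral_cong_AE)
    show "AE x in lebesgue. indicat_real \<Omega> x * r x * (indicat_real \<Omega> x * s x) = rep_l2 f x * rep_l2 g x"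
      using reps_AE[OF r] reps_AE[OF s] by eventually_elim simp
  qed (intro borel_measurable_times reps_meas[OF r] reps_meas[OF s] rep_measurable)+
  ultimately show ?thesis
    unfolding hasI_def set_integrable_def set_lebesgue_integral_def e by simp
qed

lemma hasI_unique: "hasI g v \<Longrightarrow> (LINT x:\<Omega>|lebesgue. g x) = v"
  by (simp add: hasI_def)

lemma subspace_L2: "subspace (L2 \<Omega>)"
  unfolding subspace_def using reps_L2 reps_add reps_scale reps_zero reps_rep by metis

text \<open>The space is the orthogonal complement of the classes living on the complement of the
  domain. Conversely, \<open>k\<close> below is the part of \<open>f\<close> outside the domain, and
  its product with \<open>f\<close> is its own squared norm.\<close>

lemma closed_L2: "closed (L2 \<Omega>)"
proof -
  have "L2 \<Omega> = (\<Inter>g\<in>L2 (- \<Omega>). {f. inner f g = 0})"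
  proof (intro equalityI subsetI INT_I CollectI)
    fix f g assume fg: "f \<in> L2 \<Omega>" "g \<in> L2 (- \<Omega>)"
    then have "AE x in lebesgue. rep_l2 f x * rep_l2 g x = 0"
      unfolding L2_def by (auto elim: eventually_elim2)
    then show "inner f g = 0" unfolding inner_l2_rep by (rule integral_eq_zero_AE)
  next
    fix f assume f: "f \<in> (\<Inter>g\<in>L2 (- \<Omega>). {f. inner f g = 0})"
    define k where "k x = indicat_real (- \<Omega>) x * rep_l2 f x" for x
    have km: "k \<in> borel_measurable lebesgue" unfolding k_def
      by (intro borel_measurable_times borel_measurable_indicator rep_measurable) (use sets.compl_sets[OF sets_region] in \<open>simp add: Compl_eq_Diff_UNIV\<close>)
    have k: "sq_int k"
    proof (rule sq_intI[OF km], rule Bochner_Integration.integrable_bound)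
      show "integrable lebesgue (\<lambda>x. (rep_l2 f x)\<^sup>2)" using sq_int_rep by (simp add: sq_int_def)
    qed (use km in \<open>auto simp: k_def indicator_def\<close>)
    have kr: "AE x in lebesgue. rep_l2 (abs_l2 k) x = k x" by (rule rep_abs_l2[OF k])
    then have "abs_l2 k \<in> L2 (- \<Omega>)"
      unfolding L2_def by (auto simp: k_def elim: eventually_mono)
    then have "inner f (abs_l2 k) = 0" using f by blast
    also have "inner f (abs_l2 k) = (LINT x|lebesgue. (k x)\<^sup>2)"
      unfolding inner_l2_rep
    proof (rule integral_cong_AE)
      show "AE x in lebesgue. rep_l2 f x * rep_l2 (abs_l2 k) x = (k x)\<^sup>2"
        using kr by eventually_elim (auto simp: k_def indicator_def power2_eq_square)
    qed (use km in auto)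
    finally have "AE x in lebesgue. (k x)\<^sup>2 = 0"
      using k by (subst (asm) integral_nonneg_eq_0_iff_AE) (auto simp: sq_int_def)
    then show "f \<in> L2 \<Omega>"
      unfolding L2_def by (auto simp: k_def indicator_def elim!: eventually_mono split: if_splits)
  qed
  moreover have "closed {f. inner f g = 0}" for g :: l2
    by (intro closed_Collect_eq continuous_intros)
  ultimately show ?thesis by (metis closed_INT)
qed

text \<open>Linearity has to hold for all classes of the type, not only for those in
  \<open>L2 \<Omega>\<close>; hence \<open>r0\<close> works with the restriction of an arbitrary
  representative.\<close>

lemma bounded_linear_mul:
  assumes c: "bcoef \<Omega> c"
  shows "bounded_linear (mul \<Omega> c)"
proof -
  have ind: "bcoef \<Omega> (\<lambda>x. 1)" by (auto simp: bcoef_def)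
  have r0: "reps \<Omega> (rep_l2 f) (l2_on \<Omega> (rep_l2 f))" for f
  proof (rule reps_l2_on)
    show "sq_int (\<lambda>x. indicat_real \<Omega> x * rep_l2 f x)"
    proof (rule sq_intI, simp, rule Bochner_Integration.integrable_bound)
      show "integrable lebesgue (\<lambda>x. (rep_l2 f x)\<^sup>2)" using sq_int_rep by (simp add: sq_int_def)
    qed (auto simp: indicator_def)
  qed
  have r1: "reps \<Omega> (\<lambda>x. c x * rep_l2 f x) (mul \<Omega> c f)" for f
    using reps_mul[OF c r0[of f]] reps_l2_on_eq unfolding mul_def by metis
  obtain K where K: "\<And>x. x \<in> \<Omega> \<Longrightarrow> \<bar>c x\<bar> \<le> K" using c by (auto simp: bcoef_def)
  show ?thesis
  proof (rule bounded_linear_intro[where K = "\<bar>K\<bar>"])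
    fix f g :: l2 and k :: real
    have cong: "reps \<Omega> s h" if "reps \<Omega> r h" "AE x in lebesgue. x \<in> \<Omega> \<longrightarrow> r x = s x"
      "(\<lambda>x. indicat_real \<Omega> x * s x) \<in> borel_measurable lebesgue" for r s h
    proof (rule repsI[OF that(3)])
      show "AE x in lebesgue. indicat_real \<Omega> x * s x = rep_l2 h x"
        using reps_AE[OF that(1)] that(2) by eventually_elim (auto simp: indicator_def)
    qed
    have "reps \<Omega> (\<lambda>x. c x * rep_l2 f x + c x * rep_l2 g x) (mul \<Omega> c (f + g))"
      by (rule cong[OF r1])
         (use rep_add[of f g] reps_meas[OF reps_add[OF r1[of f] r1[of g]]] in \<open>auto elim!: eventually_mono simp: distrib_left\<close>)
    then show "mul \<Omega> c (f + g) = mul \<Omega> c f + mul \<Omega> c g"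
      using reps_add[OF r1 r1] reps_unique by blast
    have "reps \<Omega> (\<lambda>x. k * (c x * rep_l2 f x)) (mul \<Omega> c (k *\<^sub>R f))"
      by (rule cong[OF r1])
         (use rep_scale[of k f] reps_meas[OF reps_scale[OF r1[of f]]] in \<open>auto elim!: eventually_mono\<close>)
    then show "mul \<Omega> c (k *\<^sub>R f) = k *\<^sub>R mul \<Omega> c f"
      using reps_scale[OF r1] reps_unique by blast
    have "(norm (mul \<Omega> c f))\<^sup>2 = (LINT x|lebesgue. (indicat_real \<Omega> x * (c x * rep_l2 f x))\<^sup>2)"
      unfolding mul_def l2_on_def by (intro norm_abs_l2 reps_sq_int[OF r1])
    also have "\<dots> \<le> (LINT x|lebesgue. K\<^sup>2 * (rep_l2 f x)\<^sup>2)"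
    proof (rule integral_mono)
      show "(indicat_real \<Omega> x * (c x * rep_l2 f x))\<^sup>2 \<le> K\<^sup>2 * (rep_l2 f x)\<^sup>2" for x
        using power_mono[OF K[of x], of 2] by (auto simp: indicator_def power_mult_distrib mult_right_mono)
    qed (use reps_sq_int[OF r1[of f]] sq_int_rep[of f] in \<open>auto simp: sq_int_def\<close>)
    also have "\<dots> = K\<^sup>2 * (norm f)\<^sup>2"
      using norm_abs_l2[OF sq_int_rep[of f]] by simp
    finally have "(norm (mul \<Omega> c f))\<^sup>2 \<le> (norm f * \<bar>K\<bar>)\<^sup>2" by (simp add: power_mult_distrib mult.commute)
    then show "norm (mul \<Omega> c f) \<le> norm f * \<bar>K\<bar>" by (rule power2_le_imp_le) simp
  qed
qed

end

section \<open>Test functions\<close>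

lemma pd_eq: "(f has_derivative f') (at x) \<Longrightarrow> pd j f x = f' (axis j 1)"
  unfolding pd_def using frechet_derivative_at by metis

lemma pd_along_line:
  assumes "\<And>x. f differentiable (at x)"
  shows "((\<lambda>t. f (x + t *\<^sub>R axis j 1)) has_real_derivative pd j f (x + t *\<^sub>R axis j 1)) (at t)"
proof -
  define y where "y = x + t *\<^sub>R axis j (1::real)"
  have f: "(f has_derivative frechet_derivative f (at y)) (at y)"
    using assms frechet_derivative_works by blast
  have "((\<lambda>t. x + t *\<^sub>R axis j (1::real)) has_derivative (\<lambda>h. h *\<^sub>R axis j 1)) (at t)"
    by (auto intro!: derivative_eq_intros)
  from has_derivative_compose[OF this, of f "frechet_derivative f (at y)"] f
  have "((\<lambda>t. f (x + t *\<^sub>R axis j 1)) has_derivative (\<lambda>h. frechet_derivative f (at y) (h *\<^sub>R axis j 1))) (at t)"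
    by (simp add: y_def)
  moreover have "frechet_derivative f (at y) (h *\<^sub>R axis j 1) = pd j f y * h" for h
    using has_derivative_linear[OF f] by (simp add: pd_def linear_cmul)
  ultimately show ?thesis by (simp add: has_field_derivative_def y_def)
qed

lemma Ck_Suc_imp: "Ck (Suc k) f \<Longrightarrow> Ck k f"
proof (induction k arbitrary: f)
  case 0
  then show ?case
    by (auto intro!: differentiable_imp_continuous_within continuous_at_imp_continuous_on)
next
  case (Suc k)
  then show ?case by (metis Ck.simps(2))
qed

lemma Ck_le: "Ck k f \<Longrightarrow> m \<le> k \<Longrightarrow> Ck m f"
  by (induction k) (auto simp: le_Suc_eq simp del: Ck.simps dest: Ck_Suc_imp)

lemma Ck_continuous: "Ck k f \<Longrightarrow> continuous_on UNIV f"
  using Ck_le[of k f 0] by simp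

lemma pd_add:
  assumes "f differentiable (at x)" "g differentiable (at x)"
  shows "pd j (\<lambda>x. f x + g x) x = pd j f x + pd j g x"
  by (subst pd_eq[OF has_derivative_add[OF assms[unfolded frechet_derivative_works]]]) (simp add: pd_def)

lemma pd_mult:
  assumes "f differentiable (at x)" "g differentiable (at x)"
  shows "pd j (\<lambda>x. f x * g x) x = f x * pd j g x + pd j f x * g x"
  by (subst pd_eq[OF has_derivative_mult[OF assms[unfolded frechet_derivative_works]]]) (simp add: pd_def)

lemma Ck_add: "Ck k f \<Longrightarrow> Ck k g \<Longrightarrow> Ck k (\<lambda>x. f x + g x)"
proof (induction k arbitrary: f g)
  case 0
  then show ?case by (auto intro: continuous_on_add)
next
  case (Suc k)
  then have "pd j (\<lambda>x. f x + g x) = (\<lambda>x. pd j f x + pd j g x)" for j by (auto simp: pd_add)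
  then show ?case using Suc by auto
qed

lemma Ck_mult: "Ck k f \<Longrightarrow> Ck k g \<Longrightarrow> Ck k (\<lambda>x. f x * g x)"
proof (induction k arbitrary: f g)
  case 0
  then show ?case by (auto intro: continuous_on_mult)
next
  case (Suc k)
  then have e: "pd j (\<lambda>x. f x * g x) = (\<lambda>x. f x * pd j g x + pd j f x * g x)" for j by (auto simp: pd_mult)
  have "Ck k f" "Ck k g" using Suc.prems Ck_Suc_imp by blast+
  then have "Ck k (pd j (\<lambda>x. f x * g x))" for j
    unfolding e using Suc by (intro Ck_add Suc.IH) auto
  then show ?case using Suc.prems by auto
qed

lemma pd_const: "pd j (\<lambda>x. c) = (\<lambda>x. 0)"
proof
  fix x show "pd j (\<lambda>x. c) x = 0"
    using pd_eq[OF has_derivative_const[of c "at x"]] by simp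
qed

lemma Ck_const: "Ck k (\<lambda>x. c)"
  by (induction k arbitrary: c) (auto simp: pd_const)

lemma Ck_prod: "finite I \<Longrightarrow> (\<And>i. i \<in> I \<Longrightarrow> Ck k (f i)) \<Longrightarrow> Ck k (\<lambda>x. \<Prod>i\<in>I. f i x)"
  by (induction I rule: finite_induct) (auto intro: Ck_const Ck_mult)

lemma smooth_pd: "smooth f \<Longrightarrow> smooth (pd j f)"
  unfolding smooth_def by (metis Ck.simps(2))

lemma smooth_differentiable: "smooth f \<Longrightarrow> f differentiable (at x)"
  unfolding smooth_def by (metis Ck.simps(2))

lemma smooth_continuous: "smooth f \<Longrightarrow> continuous_on UNIV f"
  unfolding smooth_def using Ck_continuous by blast

text \<open>Schwarz's theorem. Two applications of the mean value theorem write the second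
  difference of \<open>f\<close> as \<open>h * h\<close> times a mixed derivative at a point near
  \<open>x\<close>. The second difference is symmetric in the two directions, so both mixed
  derivatives agree at nearby points, and by continuity at \<open>x\<close>.\<close>

lemma pd_commute:
  assumes f: "smooth f"
  shows "pd i (pd j f) x = pd j (pd i f) x"
proof -
  have *: "\<exists>y\<in>ball x (3 * h). f (x + h *\<^sub>R axis i 1 + h *\<^sub>R axis j 1) - f (x + h *\<^sub>R axis i 1)
      - f (x + h *\<^sub>R axis j 1) + f x = h * h * pd j (pd i f) y" if h: "h > 0" for h i j
  proof -
    define g where "g s = f (x + h *\<^sub>R axis j 1 + s *\<^sub>R axis i 1) - f (x + s *\<^sub>R axis i 1)" for s
    have "(g has_real_derivative pd i f (x + h *\<^sub>R axis j 1 + s *\<^sub>R axis i 1) - pd i f (x + s *\<^sub>R axis i 1)) (at s)" for s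
      unfolding g_def using smooth_differentiable[OF f] by (intro derivative_intros pd_along_line)
    from MVT2[OF h this] obtain s where s: "0 < s" "s < h"
      "g h - g 0 = h * (pd i f (x + h *\<^sub>R axis j 1 + s *\<^sub>R axis i 1) - pd i f (x + s *\<^sub>R axis i 1))" by auto
    have "((\<lambda>r. pd i f ((x + s *\<^sub>R axis i 1) + r *\<^sub>R axis j 1)) has_real_derivative
        pd j (pd i f) ((x + s *\<^sub>R axis i 1) + r *\<^sub>R axis j 1)) (at r)" for r
      using smooth_differentiable[OF smooth_pd[OF f]] by (intro pd_along_line)
    from MVT2[OF h this] obtain r where r: "0 < r" "r < h"
      "pd i f ((x + s *\<^sub>R axis i 1) + h *\<^sub>R axis j 1) - pd i f (x + s *\<^sub>R axis i 1)
        = h * pd j (pd i f) ((x + s *\<^sub>R axis i 1) + r *\<^sub>R axis j 1)" by auto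
    define y where "y = (x + s *\<^sub>R axis i 1) + r *\<^sub>R axis j 1"
    have "dist x y = norm (y - x)" by (simp add: dist_norm norm_minus_commute)
    also have "y - x = s *\<^sub>R axis i 1 + r *\<^sub>R axis j 1" by (simp add: y_def)
    also have "norm \<dots> \<le> norm (s *\<^sub>R axis i (1::real) :: real^3) + norm (r *\<^sub>R axis j (1::real) :: real^3)"
      by (rule norm_triangle_ineq)
    also have "\<dots> < 3 * h" using s r by simp
    finally have "y \<in> ball x (3 * h)" by simp
    moreover have "f (x + h *\<^sub>R axis i 1 + h *\<^sub>R axis j 1) - f (x + h *\<^sub>R axis i 1)
      - f (x + h *\<^sub>R axis j 1) + f x = g h - g 0"
      by (simp add: g_def add_ac)
    ultimately show ?thesis using s(3) r(3) by (intro bexI[of _ y]) (simp_all add: y_def add_ac)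
  qed
  have cont: "isCont (pd a (pd b f)) x" for a b
    using smooth_continuous[OF smooth_pd[OF smooth_pd[OF f]]] by (simp add: continuous_on_eq_continuous_at)
  show ?thesis
  proof (rule ccontr)
    assume ne: "pd i (pd j f) x \<noteq> pd j (pd i f) x"
    define e where "e = \<bar>pd i (pd j f) x - pd j (pd i f) x\<bar> / 2"
    have e: "e > 0" using ne by (simp add: e_def)
    obtain d1 where d1: "d1 > 0" "\<And>y. dist y x < d1 \<Longrightarrow> dist (pd i (pd j f) y) (pd i (pd j f) x) < e"
      using cont e unfolding continuous_at_eps_delta by blast
    obtain d2 where d2: "d2 > 0" "\<And>y. dist y x < d2 \<Longrightarrow> dist (pd j (pd i f) y) (pd j (pd i f) x) < e"
      using cont e unfolding continuous_at_eps_delta by blast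
    define h where "h = min d1 d2 / 4"
    have h: "h > 0" "3 * h < d1" "3 * h < d2" using d1 d2 by (auto simp: h_def)
    obtain y where y: "y \<in> ball x (3 * h)" "f (x + h *\<^sub>R axis i 1 + h *\<^sub>R axis j 1) - f (x + h *\<^sub>R axis i 1)
      - f (x + h *\<^sub>R axis j 1) + f x = h * h * pd j (pd i f) y" using *[OF h(1)] by blast
    obtain z where z: "z \<in> ball x (3 * h)" "f (x + h *\<^sub>R axis j 1 + h *\<^sub>R axis i 1) - f (x + h *\<^sub>R axis j 1)
      - f (x + h *\<^sub>R axis i 1) + f x = h * h * pd i (pd j f) z" using *[OF h(1)] by blast
    have "h * h * pd j (pd i f) y = h * h * pd i (pd j f) z"
      unfolding y(2)[symmetric] z(2)[symmetric] by (simp add: add_ac)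
    then have yz: "pd j (pd i f) y = pd i (pd j f) z" using h by simp
    have "\<bar>pd j (pd i f) y - pd j (pd i f) x\<bar> < e"
      using d2(2)[of y] y(1) h by (simp add: dist_real_def dist_commute)
    moreover have "\<bar>pd i (pd j f) z - pd i (pd j f) x\<bar> < e"
      using d1(2)[of z] z(1) h by (simp add: dist_real_def dist_commute)
    moreover have "2 * e \<le> \<bar>pd j (pd i f) y - pd j (pd i f) x\<bar> + \<bar>pd i (pd j f) z - pd i (pd j f) x\<bar>"
      unfolding e_def yz
      using abs_triangle_ineq4[of "pd i (pd j f) z - pd j (pd i f) x" "pd i (pd j f) z - pd i (pd j f) x"]
      by simp
    ultimately show False by linarith
  qed
qed

lemma compact_subset_closed:
  fixes S :: "'a::metric_space set"
  shows "compact S \<Longrightarrow> T \<subseteq> S \<Longrightarrow> closed T \<Longrightarrow> compact T"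
  using compact_Int_closed[of S T] by (simp add: inf.absorb2)

lemma test_fun_smooth: "test_fun \<Omega> \<phi> \<Longrightarrow> smooth \<phi>"
  by (simp add: test_fun_def)

lemma test_fun_zero_outside: "test_fun \<Omega> \<phi> \<Longrightarrow> x \<notin> \<Omega> \<Longrightarrow> \<phi> x = 0"
  using closure_subset[of "{x. \<phi> x \<noteq> 0}"] by (auto simp: test_fun_def)

lemma pd_zero_outside_support: "x \<notin> closure {x. f x \<noteq> 0} \<Longrightarrow> pd j f x = 0"
proof -
  assume x: "x \<notin> closure {x. f x \<noteq> 0}"
  have "((\<lambda>x. 0::real) has_derivative (\<lambda>h. 0)) (at x)" by (rule has_derivative_const)
  then have "(f has_derivative (\<lambda>h. 0)) (at x)"
  proof (rule has_derivative_transform_within_open)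
    show "open (- closure {x. f x \<noteq> 0})" by auto
    show "x \<in> - closure {x. f x \<noteq> 0}" using x by simp
    show "0 = f y" if "y \<in> - closure {x. f x \<noteq> 0}" for y
      using that closure_subset[of "{x. f x \<noteq> 0}"] by auto
  qed
  then show ?thesis using pd_eq by metis
qed

lemma test_fun_pd: "test_fun \<Omega> \<phi> \<Longrightarrow> test_fun \<Omega> (pd j \<phi>)"
proof -
  assume t: "test_fun \<Omega> \<phi>"
  have "closure {x. pd j \<phi> x \<noteq> 0} \<subseteq> closure {x. \<phi> x \<noteq> 0}"
  proof (rule closure_minimal[OF subsetI closed_closure])
    fix x assume "x \<in> {x. pd j \<phi> x \<noteq> 0}"
    then show "x \<in> closure {x. \<phi> x \<noteq> 0}" using pd_zero_outside_support[of x \<phi> j] by auto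
  qed
  then show ?thesis
    using t smooth_pd[of \<phi> j] compact_subset_closed[of "closure {x. \<phi> x \<noteq> 0}" "closure {x. pd j \<phi> x \<noteq> 0}"]
    by (auto simp: test_fun_def)
qed

lemma compact_support_ball:
  assumes "compact (closure {x. (f :: real^3 \<Rightarrow> real) x \<noteq> 0})"
  obtains r where "r > 0" "\<And>x. x \<notin> cball 0 r \<Longrightarrow> f x = 0"
proof -
  obtain r where "r > 0" "closure {x. f x \<noteq> 0} \<subseteq> ball 0 r"
    using bounded_subset_ballD[OF compact_imp_bounded[OF assms]] by blast
  then show ?thesis using that[of r] closure_subset[of "{x. f x \<noteq> 0}"] ball_subset_cball by blast
qed

lemma integrable_compact_support:
  fixes f :: "real^3 \<Rightarrow> real"
  assumes "continuous_on UNIV f" "\<And>x. x \<notin> cball 0 r \<Longrightarrow> f x = 0"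
  shows "integrable lebesgue f"
proof -
  have "integrable lborel (\<lambda>x. indicator (cball 0 r) x *\<^sub>R f x)"
    using assms(1) by (intro borel_integrable_compact) (auto intro: continuous_on_subset)
  moreover have "(\<lambda>x. indicator (cball 0 r) x *\<^sub>R f x) = f"
    using assms(2) by (intro ext) (auto simp: indicator_def)
  ultimately show ?thesis
    using borel_measurable_continuous_onI[OF assms(1)] by (simp add: integrable_completion)
qed

lemma integral_translation:
  fixes f :: "real^3 \<Rightarrow> real"
  assumes "continuous_on UNIV f"
  shows "(LINT x|lebesgue. f (x + a)) = (LINT x|lebesgue. f x)"
proof -
  have m: "f \<in> borel_measurable borel" using assms by (rule borel_measurable_continuous_onI)
  have "continuous_on UNIV (\<lambda>x. f (x + a))"
    by (rule continuous_on_compose2[OF assms]) (auto intro: continuous_intros)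
  then have m': "(\<lambda>x. f (x + a)) \<in> borel_measurable borel" by (rule borel_measurable_continuous_onI)
  have "(LINT x|lborel. f x) = (LINT x|distr lborel borel ((+) a). f x)"
    by (simp add: lborel_distr_plus)
  also have "\<dots> = (LINT x|lborel. f (a + x))" using m by (intro integral_distr) auto
  finally show ?thesis using m m' by (simp add: integral_completion add.commute)
qed

text \<open>Difference quotients have integral 0 by translation invariance and converge pointwise to
  the partial derivative; dominated convergence concludes.\<close>

lemma integral_pd_zero:
  fixes f :: "real^3 \<Rightarrow> real"
  assumes f: "\<And>x. f differentiable (at x)" and pd: "continuous_on UNIV (pd j f)"
    and r: "\<And>x::real^3. x \<notin> cball 0 r \<Longrightarrow> f x = 0"
  shows "(LINT x|lebesgue. pd j f x) = 0"
proof -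
  have cf: "continuous_on UNIV f"
    using f by (intro continuous_at_imp_continuous_on ballI differentiable_imp_continuous_within) auto
  define D where "D n x = real (Suc n) * (f (x + (1 / Suc n) *\<^sub>R axis j 1) - f x)" for n x
  have fi: "integrable lebesgue f" using cf r by (rule integrable_compact_support)
  have ci: "continuous_on UNIV (\<lambda>x. f (x + a))" for a
    by (rule continuous_on_compose2[OF cf]) (auto intro: continuous_intros)
  have ti: "integrable lebesgue (\<lambda>x. f (x + a))" for a
  proof (rule integrable_compact_support[OF ci, where r = "r + norm a"])
    fix x :: "real^3" assume "x \<notin> cball 0 (r + norm a)"
    then have "norm x > r + norm a" by simp
    then have "norm (x + a) > r" using norm_triangle_ineq2[of x "- a"] by simp
    then show "f (x + a) = 0" using r by simp
  qed
  have D0: "(LINT x|lebesgue. D n x) = 0" for n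
    unfolding D_def using fi ti integral_translation[OF cf] by simp
  have lim: "(\<lambda>n. D n x) \<longlonglongrightarrow> pd j f x" for x
  proof -
    have "((\<lambda>t. f (x + t *\<^sub>R axis j 1)) has_real_derivative pd j f x) (at 0)"
      using pd_along_line[OF f, of x j 0] by simp
    then have "((\<lambda>h. (f (x + h *\<^sub>R axis j 1) - f x) / h) \<longlongrightarrow> pd j f x) (at 0)"
      by (simp add: DERIV_def)
    moreover have "filterlim (\<lambda>n. 1 / real (Suc n)) (at 0) sequentially"
      unfolding filterlim_at using LIMSEQ_Suc[OF lim_1_over_n] by simp
    ultimately have "(\<lambda>n. (f (x + (1 / Suc n) *\<^sub>R axis j 1) - f x) / (1 / Suc n)) \<longlonglongrightarrow> pd j f x"
      by (rule filterlim_compose)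
    then show ?thesis by (simp add: D_def mult.commute)
  qed
  obtain B where B: "\<And>x. x \<in> cball 0 (r + 2) \<Longrightarrow> \<bar>pd j f x\<bar> \<le> B" "B \<ge> 0"
  proof -
    have "compact (pd j f ` cball 0 (r + 2))"
      using pd by (intro compact_continuous_image) (auto intro: continuous_on_subset)
    then obtain B where "\<And>x. x \<in> cball 0 (r + 2) \<Longrightarrow> \<bar>pd j f x\<bar> \<le> B"
      using compact_imp_bounded[THEN bounded_iff[THEN iffD1]] by (metis imageI real_norm_def)
    then show ?thesis using that[of "max B 0"] by fastforce
  qed
  \<comment> \<open>The shifts have length at most 1: the quotient vanishes outside the ball of
    radius \<open>r + 1\<close>, and inside it the intermediate points stay within radius
    \<open>r + 2\<close>, where \<open>B\<close> bounds the derivative.\<close>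
  have bound: "\<bar>D n x\<bar> \<le> B * indicator (cball 0 (r + 1)) x" for n x
  proof (cases "x \<in> cball 0 (r + 1)")
    case True
    have "\<exists>z. 0 < z \<and> z < 1 / real (Suc n) \<and>
        f (x + (1 / Suc n) *\<^sub>R axis j 1) - f (x + 0 *\<^sub>R axis j 1) = (1 / Suc n - 0) * pd j f (x + z *\<^sub>R axis j 1)"
      by (rule MVT2) (auto intro: pd_along_line f)
    then obtain z where z: "0 < z" "z < 1 / real (Suc n)" "D n x = pd j f (x + z *\<^sub>R axis j 1)"
      by (auto simp: D_def)
    have "norm (z *\<^sub>R axis j (1::real)) \<le> 1"
      using z by (simp add: field_simps) (smt (verit) mult_nonneg_nonneg of_nat_0_le_iff)
    then have "x + z *\<^sub>R axis j 1 \<in> cball 0 (r + 2)"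
      using True norm_triangle_ineq[of x "z *\<^sub>R axis j 1"] by simp
    then show ?thesis using B z True by simp
  next
    case False
    then have n: "norm x > r + 1" by simp
    then have "f x = 0" using r by simp
    moreover have "norm (x + (1 / Suc n) *\<^sub>R axis j 1) > r"
    proof -
      have "norm ((1 / Suc n) *\<^sub>R axis j (1::real) :: real^3) \<le> 1" by simp
      then show ?thesis using n norm_triangle_ineq2[of x "- ((1 / Suc n) *\<^sub>R axis j 1)"]
        unfolding norm_minus_cancel diff_minus_eq_add by linarith
    qed
    then have "f (x + (1 / Suc n) *\<^sub>R axis j 1) = 0" using r by simp
    ultimately show ?thesis using False by (simp add: D_def)
  qed
  have "(\<lambda>n. LINT x|lebesgue. D n x) \<longlonglongrightarrow> (LINT x|lebesgue. pd j f x)"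
  proof (rule integral_dominated_convergence)
    show "pd j f \<in> borel_measurable lebesgue"
      using borel_measurable_continuous_onI[OF pd] by (simp add: measurable_completion)
    show "D n \<in> borel_measurable lebesgue" for n
    proof -
      have "continuous_on UNIV (D n)" unfolding D_def by (intro continuous_intros ci cf)
      from borel_measurable_continuous_onI[OF this] show ?thesis by (simp add: measurable_completion)
    qed
    show "integrable lebesgue (\<lambda>x::real^3. B * indicator (cball 0 (r + 1)) x)"
      by (intro integrable_mult_right integrable_real_indicator) (use emeasure_lborel_cball_finite[of "0::real^3" "r + 1"] in auto)
  qed (use lim bound in auto)
  then show ?thesis using D0 by (simp add: LIMSEQ_const_iff)
qed

section \<open>Bump functions and the fundamental lemma of the calculus of variations\<close>

text \<open>The classical function exp(-1/t), extended by 0, with polynomials in 1/t as factors. The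
  factors close the family under differentiation; with s = 1/t the new factor is s^2 (p - p'), which
  is \<open>dflat p\<close>.\<close>

definition flat :: "real poly \<Rightarrow> real \<Rightarrow> real" where
  "flat p t = (if t > 0 then poly p (1 / t) * exp (- (1 / t)) else 0)"

definition dflat :: "real poly \<Rightarrow> real poly" where "dflat p = [:0, 0, 1:] * (p - pderiv p)"

lemma poly_times_exp_tendsto_0: "((\<lambda>s::real. poly p s * exp (- s)) \<longlongrightarrow> 0) at_top"
proof -
  have "((\<lambda>s. \<Sum>i\<le>degree p. coeff p i * (s ^ i / exp s)) \<longlongrightarrow> (\<Sum>i\<le>degree p. coeff p i * 0)) at_top"
    by (intro tendsto_intros tendsto_power_div_exp_0)
  moreover have "(\<Sum>i\<le>degree p. coeff p i * (s ^ i / exp s)) = poly p s * exp (- s)" for s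
    by (simp add: poly_altdef sum_distrib_right exp_minus divide_inverse mult.assoc)
  ultimately show ?thesis by simp
qed

lemma flat_tendsto_0: "(flat p \<longlongrightarrow> 0) (at 0)"
proof (rule filterlim_split_at)
  have "((\<lambda>t. 0) \<longlongrightarrow> (0::real)) (at_left 0)" by simp
  then show "(flat p \<longlongrightarrow> 0) (at_left 0)"
    by (rule Lim_transform_eventually) (auto simp: flat_def eventually_at_filter)
  have "((\<lambda>t. poly p (inverse t) * exp (- inverse t)) \<longlongrightarrow> 0) (at_right 0)"
    using filterlim_compose[OF poly_times_exp_tendsto_0 filterlim_inverse_at_top_right] by simp
  then show "(flat p \<longlongrightarrow> 0) (at_right 0)"
    by (rule Lim_transform_eventually) (auto simp: flat_def eventually_at_filter inverse_eq_divide)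
qed

lemma flat_derivative: "(flat p has_real_derivative flat (dflat p) t) (at t)"
proof -
  consider "t > 0" | "t < 0" | "t = 0" by linarith
  then show ?thesis
  proof cases
    case 1
    have "((\<lambda>t. poly p (1 / t) * exp (- (1 / t))) has_real_derivative flat (dflat p) t) (at t)"
      using 1 by (auto intro!: derivative_eq_intros DERIV_chain2[OF poly_DERIV]
          simp: flat_def dflat_def field_simps power2_eq_square)
    then show ?thesis
      by (rule has_field_derivative_transform_within_open[where S = "{0<..}"]) (use 1 in \<open>auto simp: flat_def\<close>)
  next
    case 2
    have "((\<lambda>t. 0) has_real_derivative flat (dflat p) t) (at t)" using 2 by (simp add: flat_def)
    then show ?thesis
      by (rule has_field_derivative_transform_within_open[where S = "{..<0}"]) (use 2 in \<open>auto simp: flat_def\<close>)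
  next
    case 3
    \<comment> \<open>Division by \<open>h\<close> is one more factor 1/h, that is, multiplication
      of the polynomial by its variable; so the quotient at 0 is again of the same family and tends
      to 0.\<close>
    have "(\<lambda>h. (flat p (0 + h) - flat p 0) / h) = flat (pCons 0 p)"
      by (auto simp: flat_def)
    then show ?thesis using flat_tendsto_0[of "pCons 0 p"] 3 by (simp add: DERIV_def flat_def[of _ 0])
  qed
qed

text \<open>The factor \<open>c\<close> is there for the induction: differentiation in direction
  \<open>i\<close> multiplies it by \<open>r\<close> and replaces \<open>p\<close> by
  \<open>dflat p\<close>, and in any other direction it becomes 0.\<close>

lemma Ck_flat: "Ck k (\<lambda>x. c * flat p (r * (x $ i) + s))"
proof (induction k arbitrary: c p)
  case 0
  have "isCont (flat p) t" for t using flat_derivative DERIV_isCont by blast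
  then have "continuous_on UNIV (flat p)" by (simp add: continuous_on_eq_continuous_at)
  then have "continuous_on UNIV (\<lambda>x::real^3. flat p (r * (x $ i) + s))"
    by (rule continuous_on_compose2) (auto intro!: continuous_intros)
  then show ?case by (auto intro: continuous_intros)
next
  case (Suc k)
  have d: "((\<lambda>x. c * flat p (r * (x $ i) + s)) has_derivative
      (\<lambda>h. c * (r * (h $ i) * flat (dflat p) (r * (x $ i) + s)))) (at x)" for x :: "real^3"
  proof -
    have 1: "((\<lambda>x::real^3. r * (x $ i) + s) has_derivative (\<lambda>h. r * (h $ i))) (at x)"
      by (auto intro!: derivative_eq_intros bounded_linear_imp_has_derivative bounded_linear_vec_nth)
    have 2: "(flat p has_derivative (*) (flat (dflat p) (r * (x $ i) + s))) (at (r * (x $ i) + s))"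
      using flat_derivative by (simp add: has_field_derivative_def)
    show ?thesis
      using has_derivative_mult_right[OF has_derivative_compose[OF 1 2], of c] by (simp add: mult_ac)
  qed
  have "pd j (\<lambda>x. c * flat p (r * (x $ i) + s)) = (\<lambda>x. (c * r * (if j = i then 1 else 0)) * flat (dflat p) (r * (x $ i) + s))" for j
    by (rule ext, subst pd_eq[OF d]) (auto simp: axis_def)
  moreover have "(\<lambda>x. c * flat p (r * (x $ i) + s)) differentiable (at x)" for x :: "real^3"
    using d differentiable_def by blast
  ultimately show ?case using Suc by simp
qed

text \<open>As \<open>n\<close> grows, \<open>flat 1 (Suc n * t)\<close> tends to 1 for positive
  \<open>t\<close> and stays 0 otherwise. These test functions thus tend to the indicator of the
  open box, staying below it.\<close>

definition box_bump :: "real^3 \<Rightarrow> real^3 \<Rightarrow> nat \<Rightarrow> real^3 \<Rightarrow> real" where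
  "box_bump a b n x = (\<Prod>i\<in>UNIV. flat 1 (Suc n * (x $ i - a $ i)) * flat 1 (Suc n * (b $ i - x $ i)))"

lemma flat_1_range: "0 \<le> flat 1 t" "flat 1 t \<le> 1"
  by (auto simp: flat_def)

lemma box_bump_range: "0 \<le> box_bump a b n x" "box_bump a b n x \<le> 1"
  unfolding box_bump_def using flat_1_range
  by (auto intro!: prod_nonneg prod_le_1 mult_nonneg_nonneg mult_le_one)

lemma box_bump_zero: "x \<notin> box a b \<Longrightarrow> box_bump a b n x = 0"
proof -
  assume "x \<notin> box a b"
  then obtain i where "x $ i \<le> a $ i \<or> b $ i \<le> x $ i" unfolding mem_box_cart by (metis not_le)
  then have "flat 1 (Suc n * (x $ i - a $ i)) * flat 1 (Suc n * (b $ i - x $ i)) = 0"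
    by (auto simp: flat_def zero_less_mult_iff)
  then show ?thesis unfolding box_bump_def by (intro prod_zero) auto
qed

lemma smooth_box_bump: "smooth (box_bump a b n)"
proof -
  have 1: "Ck k (\<lambda>x::real^3. flat 1 (Suc n * (x $ i - a $ i)))" for k i
    using Ck_flat[of k 1 1 "Suc n" i "- (Suc n * a $ i)"] by (simp add: algebra_simps)
  have 2: "Ck k (\<lambda>x::real^3. flat 1 (Suc n * (b $ i - x $ i)))" for k i
    using Ck_flat[of k 1 1 "- Suc n" i "Suc n * b $ i"] by (simp add: algebra_simps)
  show ?thesis
    unfolding smooth_def box_bump_def[abs_def] by (intro allI Ck_prod Ck_mult 1 2) auto
qed

lemma test_fun_box_bump: "cbox a b \<subseteq> \<Omega> \<Longrightarrow> test_fun \<Omega> (box_bump a b n)"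
proof -
  assume ab: "cbox a b \<subseteq> \<Omega>"
  have "closure {x. box_bump a b n x \<noteq> 0} \<subseteq> cbox a b"
  proof (rule closure_minimal[OF _ closed_cbox], rule subsetI)
    fix x assume "x \<in> {x. box_bump a b n x \<noteq> 0}"
    then have "x \<in> box a b" using box_bump_zero[of x a b n] by auto
    then show "x \<in> cbox a b" by (rule subsetD[OF box_subset_cbox])
  qed
  then show ?thesis
    using smooth_box_bump[of a b n] ab compact_subset_closed[OF compact_cbox[of a b], of "closure {x. box_bump a b n x \<noteq> 0}"]
    by (auto simp: test_fun_def)
qed

lemma box_bump_tendsto: "(\<lambda>n. box_bump a b n x) \<longlonglongrightarrow> indicator (box a b) x"
proof (cases "x \<in> box a b")
  case False
  then show ?thesis by (simp add: box_bump_zero)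
next
  case True
  have 1: "(\<lambda>n. flat 1 (Suc n * t)) \<longlonglongrightarrow> 1" if "t > 0" for t :: real
  proof -
    have "(\<lambda>n. exp (- (inverse t * (1 / real (Suc n))))) \<longlonglongrightarrow> exp (- (inverse t * 0))"
      by (intro tendsto_intros LIMSEQ_Suc[OF lim_1_over_n])
    moreover have "exp (- (inverse t * (1 / real (Suc n)))) = flat 1 (Suc n * t)" for n
      using that by (simp add: flat_def zero_less_mult_iff inverse_eq_divide mult.commute)
    ultimately show ?thesis by simp
  qed
  have "(\<lambda>n. box_bump a b n x) \<longlonglongrightarrow> (\<Prod>i\<in>(UNIV::3 set). 1 * 1)"
    unfolding box_bump_def using True by (intro tendsto_intros 1) (auto simp: mem_box_cart)
  then show ?thesis using True by simp
qed

text \<open>After passing to a Borel version \<open>k\<close>, its positive and negative parts are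
  densities of two measures that agree on boxes. Boxes form an intersection-stable generator, so the
  measures coincide and with them, almost everywhere, the densities.\<close>

lemma AE_zero_if_box_integrals_zero:
  fixes h :: "'a::euclidean_space \<Rightarrow> real"
  assumes h: "integrable lebesgue h" and z: "\<And>a b. (LINT x|lebesgue. indicator (box a b) x * h x) = 0"
  shows "AE x in lebesgue. h x = 0"
proof -
  obtain k where k: "k \<in> borel_measurable lborel" "AE x in lborel. h x = k x"
    using completion_ex_borel_measurable_real[OF borel_measurable_integrable[OF h]] by blast
  have hk: "AE x in lebesgue. h x = k x" using k(2) by (rule AE_completion)
  have km: "k \<in> borel_measurable lebesgue" using k(1) by (rule measurable_completion)
  have "integrable lebesgue k" using integrable_cong_AE_imp[OF h km hk] by simp
  then have ki: "integrable lborel k" using k by (simp add: integrable_completion)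
  have eq: "(\<integral>\<^sup>+x. ennreal (k x) * indicator (box a b) x \<partial>lborel)
      = (\<integral>\<^sup>+x. ennreal (- k x) * indicator (box a b) x \<partial>lborel)"
    and fin: "(\<integral>\<^sup>+x. ennreal (k x) * indicator (box a b) x \<partial>lborel) \<noteq> \<infinity>" for a b
  proof -
    define g where "g x = indicator (box a b) x * k x" for x
    have gi: "integrable lborel g" 
      unfolding g_def using integrable_mult_indicator[OF _ ki, of "box a b"] by simp
    have "(LINT x|lborel. g x) = (LINT x|lebesgue. g x)"
      using gi by (simp add: integral_completion borel_measurable_integrable)
    also have "\<dots> = (LINT x|lebesgue. indicator (box a b) x * h x)"
      unfolding g_def using hk km borel_measurable_integrable[OF h]
      by (intro integral_cong_AE borel_measurable_times borel_measurable_indicator) auto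
    also have "\<dots> = 0" by (rule z)
    finally have g0: "(LINT x|lborel. g x) = 0" .
    have f1: "(\<integral>\<^sup>+x. ennreal (g x) \<partial>lborel) < \<infinity>" "(\<integral>\<^sup>+x. ennreal (- g x) \<partial>lborel) < \<infinity>"
      using gi unfolding real_integrable_def by (auto simp: top.not_eq_extremum)
    have "(\<integral>\<^sup>+x. ennreal (g x) \<partial>lborel) = (\<integral>\<^sup>+x. ennreal (- g x) \<partial>lborel)"
      using real_lebesgue_integral_def[OF gi] g0 f1
      by (metis eq_iff_diff_eq_0 ennreal_enn2real infinity_ennreal_def)
    moreover have "ennreal (g x) = ennreal (k x) * indicator (box a b) x"
      "ennreal (- g x) = ennreal (- k x) * indicator (box a b) x" for x
      by (auto simp: g_def indicator_def)
    ultimately show "(\<integral>\<^sup>+x. ennreal (k x) * indicator (box a b) x \<partial>lborel)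
      = (\<integral>\<^sup>+x. ennreal (- k x) * indicator (box a b) x \<partial>lborel)"
      "(\<integral>\<^sup>+x. ennreal (k x) * indicator (box a b) x \<partial>lborel) \<noteq> \<infinity>" using f1 by auto
  qed
  have "density lborel (\<lambda>x. ennreal (k x)) = density lborel (\<lambda>x. ennreal (- k x))"
  proof (rule measure_eqI_generator_eq[where \<Omega> = UNIV and E = "range (\<lambda>(a, b). box a b)"
        and A = "\<lambda>i::nat. box (- (real i *\<^sub>R One)) (real i *\<^sub>R One)"])
    show "Int_stable (range (\<lambda>(a, b). box a b :: 'a set))"
      unfolding Int_stable_def by (auto simp: box_Int_box)
    show "emeasure (density lborel (\<lambda>x. ennreal (k x))) X = emeasure (density lborel (\<lambda>x. ennreal (- k x))) X"
      if "X \<in> range (\<lambda>(a, b). box a b)" for X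
      using that k(1) eq by (auto simp: emeasure_density)
    have "sets borel = sigma_sets UNIV (range (\<lambda>(a, b). box a b :: 'a set))"
      by (subst borel_eq_box) (rule sets_measure_of, simp)
    then show "sets (density lborel (\<lambda>x. ennreal (k x))) = sigma_sets UNIV (range (\<lambda>(a, b). box a b :: 'a set))"
      "sets (density lborel (\<lambda>x. ennreal (- k x))) = sigma_sets UNIV (range (\<lambda>(a, b). box a b :: 'a set))"
      by simp_all
    show "(\<Union>i::nat. box (- (real i *\<^sub>R One)) (real i *\<^sub>R One) :: 'a set) = UNIV" by (rule UN_box_eq_UNIV)
    show "emeasure (density lborel (\<lambda>x. ennreal (k x))) (box (- (real i *\<^sub>R One)) (real i *\<^sub>R One)) \<noteq> \<infinity>" for i
      using k(1) fin by (simp add: emeasure_density)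
  qed auto
  then have "AE x in lborel. ennreal (k x) = ennreal (- k x)"
    using k(1) by (intro sigma_finite_measure.density_unique[OF sigma_finite_lborel]) auto
  then have "AE x in lborel. k x = 0"
  proof eventually_elim
    case (elim x)
    then show ?case by (cases "k x \<ge> 0") (auto simp: ennreal_neg ennreal_eq_0_iff)
  qed
  then have "AE x in lebesgue. k x = 0" by (rule AE_completion)
  then show ?thesis using hk by eventually_elim simp
qed

context region
begin

lemma test_fun_reps:
  assumes t: "test_fun \<Omega> \<phi>"
  shows "reps \<Omega> \<phi> (l2_on \<Omega> \<phi>)"
proof (rule reps_l2_on)
  have e: "(\<lambda>x. indicat_real \<Omega> x * \<phi> x) = \<phi>"
    using test_fun_zero_outside[OF t] by (intro ext) (auto simp: indicator_def)
  obtain r where r: "\<And>x. x \<notin> cball 0 r \<Longrightarrow> \<phi> x = 0"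
    using t compact_support_ball unfolding test_fun_def by metis
  have c: "continuous_on UNIV \<phi>" using t test_fun_smooth smooth_continuous by blast
  have "integrable lebesgue (\<lambda>x. (\<phi> x)\<^sup>2)"
    using c r by (intro integrable_compact_support[of _ r] continuous_intros) auto
  moreover have "\<phi> \<in> borel_measurable lebesgue"
    using borel_measurable_continuous_onI[OF c] by (simp add: measurable_completion)
  ultimately show "sq_int (\<lambda>x. indicat_real \<Omega> x * \<phi> x)" unfolding e by (rule sq_intI[rotated])
qed

text \<open>Bump functions give vanishing integrals over all boxes with closure in the domain, hence
  \<open>g\<close> vanishes almost everywhere on each of them; countably many of these boxes cover
  the domain.\<close>

lemma fundamental_lemma:
  assumes g: "g \<in> L2 \<Omega>" and z: "\<And>\<phi>. test_fun \<Omega> \<phi> \<Longrightarrow> inner g (l2_on \<Omega> \<phi>) = 0"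
  shows "g = 0"
proof -
  define G where "G = rep_l2 g"
  have G [measurable]: "G \<in> borel_measurable lebesgue" by (simp add: G_def)
  have Gsq: "sq_int G" by (simp add: G_def sq_int_rep)
  have box_sq: "sq_int (\<lambda>x. indicat_real (box a b) x)" for a b
  proof -
    have "integrable lebesgue (indicat_real (box a b))"
      by (intro integrable_real_indicator) (auto simp: emeasure_lborel_box_eq)
    moreover have "(\<lambda>x. (indicat_real (box a b) x)\<^sup>2) = indicat_real (box a b)"
      by (auto simp: indicator_def)
    ultimately show ?thesis by (simp add: sq_int_def borel_measurable_integrable)
  qed
  have Gbox: "integrable lebesgue (\<lambda>x. indicat_real (box a b) x * G x)" for a b
    by (rule integrable_sq_prod[OF box_sq Gsq])
  have zero: "(LINT x|lebesgue. indicat_real (box a b) x * G x) = 0" if ab: "cbox a b \<subseteq> \<Omega>" for a b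
  proof -
    have "(\<lambda>n. LINT x|lebesgue. G x * box_bump a b n x) \<longlonglongrightarrow> (LINT x|lebesgue. indicat_real (box a b) x * G x)"
    proof (rule integral_dominated_convergence)
      show "integrable lebesgue (\<lambda>x. norm (indicat_real (box a b) x * G x))"
        using Gbox by (rule integrable_norm)
      show "(\<lambda>x. G x * box_bump a b n x) \<in> borel_measurable lebesgue" for n
        using borel_measurable_continuous_onI[OF smooth_continuous[OF smooth_box_bump]]
        by (intro borel_measurable_times G) (simp add: measurable_completion)
      show "AE x in lebesgue. (\<lambda>n. G x * box_bump a b n x) \<longlonglongrightarrow> indicat_real (box a b) x * G x"
        by (intro AE_I2) (subst mult.commute, intro tendsto_intros box_bump_tendsto)
      show "AE x in lebesgue. norm (G x * box_bump a b n x) \<le> norm (indicat_real (box a b) x * G x)" for n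
        using box_bump_range box_bump_zero
        by (intro AE_I2) (auto simp: indicator_def abs_mult mult_left_le)
    qed (use borel_measurable_integrable[OF Gbox] in auto)
    moreover have "(LINT x|lebesgue. G x * box_bump a b n x) = 0" for n
    proof -
      have t: "test_fun \<Omega> (box_bump a b n)" using ab by (rule test_fun_box_bump)
      have "(LINT x:\<Omega>|lebesgue. G x * box_bump a b n x) = inner g (l2_on \<Omega> (box_bump a b n))"
        unfolding G_def by (intro hasI_unique hasI_prod reps_rep g test_fun_reps t)
      also have "(LINT x:\<Omega>|lebesgue. G x * box_bump a b n x) = (LINT x|lebesgue. G x * box_bump a b n x)"
        unfolding set_lebesgue_integral_def using test_fun_zero_outside[OF t]
        by (intro Bochner_Integration.integral_cong) (auto simp: indicator_def)
      finally show ?thesis using z[OF t] by simp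
    qed
    ultimately show ?thesis by (simp add: LIMSEQ_const_iff)
  qed
  \<comment> \<open>Cut off to one box, \<open>G\<close> has vanishing integrals over arbitrary
    boxes, since the intersection of two boxes is a box whose closure is still inside the
    domain.\<close>
  have AE0: "AE x in lebesgue. indicat_real (box c d) x * G x = 0" if cd: "cbox c d \<subseteq> \<Omega>" for c d
  proof (rule AE_zero_if_box_integrals_zero[OF Gbox])
    fix a b :: "real^3"
    obtain a' b' where ab': "box a b \<inter> box c d = box a' b'" "cbox a' b' \<subseteq> cbox c d"
    proof
      show "box a b \<inter> box c d = box (\<chi> i. max (a $ i) (c $ i)) (\<chi> i. min (b $ i) (d $ i))"
        by (auto simp: mem_box_cart)
      show "cbox (\<chi> i. max (a $ i) (c $ i)) (\<chi> i. min (b $ i) (d $ i)) \<subseteq> cbox c d"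
        by (auto simp: mem_box_cart)
    qed
    have "indicator (box a b) x * (indicat_real (box c d) x * G x) = indicat_real (box a' b') x * G x" for x
      unfolding ab'(1)[symmetric] by (auto simp: indicator_def)
    then have "(\<lambda>x. indicator (box a b) x * (indicat_real (box c d) x * G x)) = (\<lambda>x. indicat_real (box a' b') x * G x)"
      by (rule ext)
    moreover have "(LINT x|lebesgue. indicat_real (box a' b') x * G x) = 0"
      using ab'(2) cd by (intro zero) blast
    ultimately show "(LINT x|lebesgue. indicator (box a b) x * (indicat_real (box c d) x * G x)) = 0"
      by (simp only:)
  qed
  define \<F> where "\<F> = {box a b |a b. cbox a b \<subseteq> \<Omega>}"
  have cover: "\<Omega> \<subseteq> \<Union>\<F>"
  proof
    fix x assume "x \<in> \<Omega>"
    then obtain e where e: "e > 0" "cball x e \<subseteq> \<Omega>" using open_region open_contains_cball by blast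
    obtain a b where ab: "x \<in> box a b" "box a b \<subseteq> ball x e" using rational_boxes[OF e(1)] by blast
    have "cbox a b = closure (box a b)" using ab by (subst closure_box) auto
    also have "\<dots> \<subseteq> cball x e" using ab by (intro closure_minimal) auto
    finally have "box a b \<in> \<F>" using e unfolding \<F>_def by blast
    then show "x \<in> \<Union>\<F>" using ab by blast
  qed
  \<comment> \<open>Each box has its own exceptional null set, so a countable subcover is needed to
    unite them.\<close>
  obtain \<F>' where F': "\<F>' \<subseteq> \<F>" "countable \<F>'" "\<Union>\<F>' = \<Union>\<F>"
    using Lindelof[of \<F>] by (auto simp: \<F>_def open_box)
  have "AE x in lebesgue. \<forall>X\<in>\<F>'. x \<in> X \<longrightarrow> G x = 0"
  proof (subst AE_ball_countable[OF F'(2)], rule ballI)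
    fix X assume "X \<in> \<F>'"
    then obtain a b where X: "X = box a b" "cbox a b \<subseteq> \<Omega>" using F' by (auto simp: \<F>_def)
    show "AE x in lebesgue. x \<in> X \<longrightarrow> G x = 0"
      using AE0[OF X(2)] by eventually_elim (auto simp: X)
  qed
  then have "AE x in lebesgue. indicat_real \<Omega> x * G x = 0"
    by eventually_elim (use cover F' in \<open>auto simp: indicator_def\<close>)
  then have "AE x in lebesgue. rep_l2 g x = rep_l2 0 x"
    using rep_zero reps_AE[OF reps_rep[OF g]] unfolding G_def by eventually_elim simp
  then have "reps \<Omega> (rep_l2 g) 0"
    using reps_AE[OF reps_rep[OF g]] by (intro repsI[OF reps_meas[OF reps_rep[OF g]]], eventually_elim) simp
  then show ?thesis using reps_unique[OF reps_rep[OF g]] by simp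
qed

end

section \<open>Weak derivatives and the space of functions vanishing on the boundary\<close>

lemma smooth_add: "smooth f \<Longrightarrow> smooth g \<Longrightarrow> smooth (\<lambda>x. f x + g x)"
  by (simp add: smooth_def Ck_add)

lemma smooth_scale: "smooth f \<Longrightarrow> smooth (\<lambda>x. c * f x)"
  unfolding smooth_def using Ck_mult[OF Ck_const] by blast

lemma test_fun_subset_support:
  assumes "test_fun \<Omega> \<phi>" "test_fun \<Omega> \<psi>" "smooth \<eta>" "\<And>x. \<phi> x = 0 \<Longrightarrow> \<psi> x = 0 \<Longrightarrow> \<eta> x = 0"
  shows "test_fun \<Omega> \<eta>"
proof -
  define K where "K = closure {x. \<phi> x \<noteq> 0} \<union> closure {x. \<psi> x \<noteq> 0}"
  have K: "compact K" "K \<subseteq> \<Omega>" using assms(1,2) by (auto simp: K_def test_fun_def intro: compact_Un)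
  have "closure {x. \<eta> x \<noteq> 0} \<subseteq> K"
  proof (rule closure_minimal)
    show "closed K" using K(1) by (rule compact_imp_closed)
    show "{x. \<eta> x \<noteq> 0} \<subseteq> K"
      unfolding K_def using assms(4) closure_subset[of "{x. \<phi> x \<noteq> 0}"] closure_subset[of "{x. \<psi> x \<noteq> 0}"] by auto
  qed
  then show ?thesis
    using K assms(3) compact_subset_closed[of K "closure {x. \<eta> x \<noteq> 0}"] by (auto simp: test_fun_def)
qed

lemma test_fun_zero: "test_fun \<Omega> (\<lambda>x. 0)"
  by (simp add: test_fun_def smooth_def Ck_const)

lemma test_fun_add: "test_fun \<Omega> \<phi> \<Longrightarrow> test_fun \<Omega> \<psi> \<Longrightarrow> test_fun \<Omega> (\<lambda>x. \<phi> x + \<psi> x)"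
  by (rule test_fun_subset_support[of \<Omega> \<phi> \<psi>]) (auto intro: smooth_add test_fun_smooth)

lemma test_fun_scale: "test_fun \<Omega> \<phi> \<Longrightarrow> test_fun \<Omega> (\<lambda>x. c * \<phi> x)"
  by (rule test_fun_subset_support[of \<Omega> \<phi> \<phi>]) (auto intro: smooth_scale test_fun_smooth)

lemma pd_test_add: "test_fun \<Omega> \<phi> \<Longrightarrow> test_fun \<Omega> \<psi> \<Longrightarrow> pd j (\<lambda>x. \<phi> x + \<psi> x) = (\<lambda>x. pd j \<phi> x + pd j \<psi> x)"
  using pd_add smooth_differentiable test_fun_smooth by blast

lemma pd_test_scale: "test_fun \<Omega> \<phi> \<Longrightarrow> pd j (\<lambda>x. c * \<phi> x) = (\<lambda>x. c * pd j \<phi> x)"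
  using pd_mult[of "\<lambda>x. c" _ \<phi>] smooth_differentiable[OF test_fun_smooth] by (auto simp: pd_const)

context region
begin

abbreviation cls :: "(real^3 \<Rightarrow> real) \<Rightarrow> l2" where "cls \<phi> \<equiv> l2_on \<Omega> \<phi>"

lemma cls_L2: "test_fun \<Omega> \<phi> \<Longrightarrow> cls \<phi> \<in> L2 \<Omega>"
  using test_fun_reps reps_L2 by blast

lemma cls_add: "test_fun \<Omega> \<phi> \<Longrightarrow> test_fun \<Omega> \<psi> \<Longrightarrow> cls (\<lambda>x. \<phi> x + \<psi> x) = cls \<phi> + cls \<psi>"
  by (intro reps_l2_on_eq reps_add test_fun_reps)

lemma cls_scale: "test_fun \<Omega> \<phi> \<Longrightarrow> cls (\<lambda>x. c * \<phi> x) = c *\<^sub>R cls \<phi>"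
  by (intro reps_l2_on_eq reps_scale test_fun_reps)

lemma distr_of_inner: "reps \<Omega> r f \<Longrightarrow> test_fun \<Omega> \<phi> \<Longrightarrow> distr_of \<Omega> r \<phi> = inner f (cls \<phi>)"
  unfolding distr_of_def by (intro hasI_unique hasI_prod test_fun_reps)

lemma ddist_inner: "reps \<Omega> r f \<Longrightarrow> test_fun \<Omega> \<phi> \<Longrightarrow> ddist j (distr_of \<Omega> r) \<phi> = - inner f (cls (pd j \<phi>))"
  unfolding ddist_def by (simp add: distr_of_inner test_fun_pd)

lemma has_weak_pd_iff:
  "has_weak_pd \<Omega> j f g \<longleftrightarrow> f \<in> L2 \<Omega> \<and> g \<in> L2 \<Omega> \<and>
    (\<forall>\<phi>. test_fun \<Omega> \<phi> \<longrightarrow> inner g (cls \<phi>) = - inner f (cls (pd j \<phi>)))"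
  unfolding has_weak_pd_def eq_distr_def
  using ddist_inner[OF reps_rep] distr_of_inner[OF reps_rep] by metis

lemma has_weak_pd_unique: "has_weak_pd \<Omega> j f g \<Longrightarrow> has_weak_pd \<Omega> j f h \<Longrightarrow> g = h"
proof -
  assume "has_weak_pd \<Omega> j f g" "has_weak_pd \<Omega> j f h"
  then have "g - h = 0"
    unfolding has_weak_pd_iff using subspace_L2
    by (intro fundamental_lemma) (auto simp: inner_diff_left subspace_diff)
  then show ?thesis by simp
qed

lemma weak_pd_eq: "has_weak_pd \<Omega> j f g \<Longrightarrow> weak_pd \<Omega> j f = g"
  unfolding weak_pd_def using has_weak_pd_unique by blast

lemma W12_weak_pd: "f \<in> W12 \<Omega> \<Longrightarrow> has_weak_pd \<Omega> j f (weak_pd \<Omega> j f)"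
  unfolding W12_def using weak_pd_eq by blast

lemma has_weak_pd_add:
  "has_weak_pd \<Omega> j f g \<Longrightarrow> has_weak_pd \<Omega> j f' g' \<Longrightarrow> has_weak_pd \<Omega> j (f + f') (g + g')"
  using subspace_add[OF subspace_L2] by (simp add: has_weak_pd_iff inner_add_left)

lemma has_weak_pd_scale: "has_weak_pd \<Omega> j f g \<Longrightarrow> has_weak_pd \<Omega> j (c *\<^sub>R f) (c *\<^sub>R g)"
  using subspace_scale[OF subspace_L2] by (simp add: has_weak_pd_iff)

lemma has_weak_pd_diff:
  "has_weak_pd \<Omega> j f g \<Longrightarrow> has_weak_pd \<Omega> j f' g' \<Longrightarrow> has_weak_pd \<Omega> j (f - f') (g - g')"
  using has_weak_pd_add[of j f g "(-1) *\<^sub>R f'" "(-1) *\<^sub>R g'"] has_weak_pd_scale[of j f' g' "-1"] by simp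

lemma has_weak_pd_limit:
  assumes "\<And>n. has_weak_pd \<Omega> j (F n) (G n)" "F \<longlonglongrightarrow> f" "G \<longlonglongrightarrow> g"
  shows "has_weak_pd \<Omega> j f g"
  unfolding has_weak_pd_iff
proof (intro conjI allI impI)
  show "f \<in> L2 \<Omega>" "g \<in> L2 \<Omega>"
    using closed_sequentially[OF closed_L2] assms unfolding has_weak_pd_iff by blast+
  fix \<phi> assume "test_fun \<Omega> \<phi>"
  then have "inner (G n) (cls \<phi>) = - inner (F n) (cls (pd j \<phi>))" for n
    using assms(1) unfolding has_weak_pd_iff by blast
  moreover have "(\<lambda>n. inner (G n) (cls \<phi>)) \<longlonglongrightarrow> inner g (cls \<phi>)"
    "(\<lambda>n. - inner (F n) (cls (pd j \<phi>))) \<longlonglongrightarrow> - inner f (cls (pd j \<phi>))"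
    by (intro tendsto_intros assms)+
  ultimately show "inner g (cls \<phi>) = - inner f (cls (pd j \<phi>))"
    using LIMSEQ_unique by simp
qed

lemma inner_cls:
  assumes \<phi>: "test_fun \<Omega> \<phi>" and \<psi>: "test_fun \<Omega> \<psi>"
  shows "integrable lebesgue (\<lambda>x. \<phi> x * \<psi> x)" "inner (cls \<phi>) (cls \<psi>) = (LINT x|lebesgue. \<phi> x * \<psi> x)"
proof -
  have "hasI (\<lambda>x. \<phi> x * \<psi> x) (inner (cls \<phi>) (cls \<psi>))"
    by (intro hasI_prod test_fun_reps \<phi> \<psi>)
  moreover have "(\<lambda>x. indicat_real \<Omega> x *\<^sub>R (\<phi> x * \<psi> x)) = (\<lambda>x. \<phi> x * \<psi> x)"
    using test_fun_zero_outside[OF \<phi>] by (intro ext) (auto simp: indicator_def)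
  ultimately show "integrable lebesgue (\<lambda>x. \<phi> x * \<psi> x)" "inner (cls \<phi>) (cls \<psi>) = (LINT x|lebesgue. \<phi> x * \<psi> x)"
    unfolding hasI_def set_integrable_def set_lebesgue_integral_def by simp_all
qed

lemma test_parts:
  assumes \<phi>: "test_fun \<Omega> \<phi>" and \<psi>: "test_fun \<Omega> \<psi>"
  shows "inner (cls (pd j \<phi>)) (cls \<psi>) = - inner (cls \<phi>) (cls (pd j \<psi>))"
proof -
  have d: "\<phi> differentiable (at x)" "\<psi> differentiable (at x)" for x
    using \<phi> \<psi> test_fun_smooth smooth_differentiable by blast+
  have e: "pd j (\<lambda>x. \<phi> x * \<psi> x) = (\<lambda>x. \<phi> x * pd j \<psi> x + pd j \<phi> x * \<psi> x)"
    by (intro ext pd_mult d)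
  obtain r where r: "\<And>x. x \<notin> cball 0 r \<Longrightarrow> \<phi> x = 0"
    using \<phi> compact_support_ball unfolding test_fun_def by metis
  have c: "continuous_on UNIV f" if "test_fun \<Omega> f" for f
    using that test_fun_smooth smooth_continuous by blast
  have "(LINT x|lebesgue. pd j (\<lambda>x. \<phi> x * \<psi> x) x) = 0"
  proof (rule integral_pd_zero[where r = r])
    show "(\<lambda>x. \<phi> x * \<psi> x) differentiable (at x)" for x by (intro differentiable_mult d)
    show "continuous_on UNIV (pd j (\<lambda>x. \<phi> x * \<psi> x))"
      unfolding e by (intro continuous_on_add continuous_on_mult c \<phi> \<psi> test_fun_pd)
    show "\<phi> x * \<psi> x = 0" if "x \<notin> cball 0 r" for x using r[OF that] by simp
  qed
  then have "inner (cls \<phi>) (cls (pd j \<psi>)) + inner (cls (pd j \<phi>)) (cls \<psi>) = 0"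
    using inner_cls[OF \<phi> test_fun_pd[OF \<psi>]] inner_cls[OF test_fun_pd[OF \<phi>] \<psi>] by (simp add: e)
  then show ?thesis by simp
qed

lemma has_weak_pd_test: "test_fun \<Omega> \<phi> \<Longrightarrow> has_weak_pd \<Omega> j (cls \<phi>) (cls (pd j \<phi>))"
  by (simp add: has_weak_pd_iff cls_L2 test_fun_pd test_parts)

section \<open>Functions vanishing on the boundary as pairs with their gradients\<close>

definition gr :: "l2 \<Rightarrow> l2^3" where "gr f = (\<chi> j. weak_pd \<Omega> j f)"

text \<open>Classical gradients appear here, so that linearity is inherited from test functions;
  that they are the weak gradients is \<open>test_pair_gr\<close>.\<close>

definition test_pairs :: "(l2 \<times> (l2^3)) set" where
  "test_pairs = {(cls \<phi>, \<chi> j. cls (pd j \<phi>)) |\<phi>. test_fun \<Omega> \<phi>}"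

lemma subspace_test_pairs: "subspace test_pairs"
proof (rule subspaceI)
  have "cls (\<lambda>x. 0) = 0" by (rule reps_l2_on_eq[OF reps_zero])
  then show "0 \<in> test_pairs"
    unfolding test_pairs_def by (auto intro!: exI[of _ "\<lambda>x. 0"] simp: test_fun_zero pd_const zero_prod_def vec_eq_iff)
next
  fix p q assume "p \<in> test_pairs" "q \<in> test_pairs"
  then obtain \<phi> \<psi> where t: "test_fun \<Omega> \<phi>" "test_fun \<Omega> \<psi>"
    and "p = (cls \<phi>, \<chi> j. cls (pd j \<phi>))" "q = (cls \<psi>, \<chi> j. cls (pd j \<psi>))"
    unfolding test_pairs_def by blast
  then have "p + q = (cls (\<lambda>x. \<phi> x + \<psi> x), \<chi> j. cls (pd j (\<lambda>x. \<phi> x + \<psi> x)))"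
    by (simp add: cls_add pd_test_add[OF t] test_fun_pd vec_eq_iff)
  then show "p + q \<in> test_pairs" unfolding test_pairs_def using test_fun_add[OF t] by blast
next
  fix c p assume "p \<in> test_pairs"
  then obtain \<phi> where t: "test_fun \<Omega> \<phi>" and "p = (cls \<phi>, \<chi> j. cls (pd j \<phi>))"
    unfolding test_pairs_def by blast
  then have "c *\<^sub>R p = (cls (\<lambda>x. c * \<phi> x), \<chi> j. cls (pd j (\<lambda>x. c * \<phi> x)))"
    by (simp add: cls_scale pd_test_scale[OF t] test_fun_pd vec_eq_iff)
  then show "c *\<^sub>R p \<in> test_pairs" unfolding test_pairs_def using test_fun_scale[OF t] by blast
qed

lemma test_pair_gr: "test_fun \<Omega> \<phi> \<Longrightarrow> (\<chi> j. cls (pd j \<phi>)) = gr (cls \<phi>)"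
  using weak_pd_eq[OF has_weak_pd_test] by (simp add: gr_def vec_eq_iff)

lemma test_W12: "test_fun \<Omega> \<phi> \<Longrightarrow> cls \<phi> \<in> W12 \<Omega>"
  unfolding W12_def using has_weak_pd_test cls_L2 by blast

lemma gr_diff: "f \<in> W12 \<Omega> \<Longrightarrow> g \<in> W12 \<Omega> \<Longrightarrow> gr (f - g) = gr f - gr g"
  unfolding gr_def vec_eq_iff using weak_pd_eq[OF has_weak_pd_diff[OF W12_weak_pd W12_weak_pd]] by simp

lemma W12_norm_eq: "W12_norm \<Omega> f = norm (f, gr f)"
  by (simp add: W12_norm_def norm_Pair gr_def norm_vec_def L2_set_def sum_nonneg)

text \<open>\<open>W12_norm\<close> is the product norm of a function paired with its gradient, and
  weak derivatives pass to limits in that norm. So the closure consists again of such pairs, and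
  both the vector space structure and the completeness of W_0^{1,2} come from a closure of a
  subspace.\<close>

lemma W012_pairs: "{(f, gr f) |f. f \<in> W012 \<Omega>} = closure test_pairs"
proof (intro equalityI subsetI)
  fix p assume "p \<in> {(f, gr f) |f. f \<in> W012 \<Omega>}"
  then obtain f where p: "p = (f, gr f)" and f: "f \<in> W12 \<Omega>"
    "\<And>e. e > 0 \<Longrightarrow> \<exists>\<phi>. test_fun \<Omega> \<phi> \<and> W12_norm \<Omega> (f - cls \<phi>) < e"
    unfolding W012_def by blast
  have "\<exists>y\<in>test_pairs. dist y p < e" if e: "e > 0" for e
  proof -
    obtain \<phi> where t: "test_fun \<Omega> \<phi>" "W12_norm \<Omega> (f - cls \<phi>) < e" using f(2)[OF e] by blast
    have "W12_norm \<Omega> (f - cls \<phi>) = norm (p - (cls \<phi>, gr (cls \<phi>)))"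
      unfolding W12_norm_eq p using gr_diff[OF f(1) test_W12[OF t(1)]] by simp
    then have "dist (cls \<phi>, gr (cls \<phi>)) p < e" using t(2) by (metis dist_commute dist_norm)
    moreover have "(cls \<phi>, gr (cls \<phi>)) \<in> test_pairs"
      unfolding test_pairs_def using test_pair_gr t(1) by force
    ultimately show ?thesis by blast
  qed
  then show "p \<in> closure test_pairs" by (simp add: closure_approachable)
next
  fix p assume "p \<in> closure test_pairs"
  then obtain X where X: "\<And>n. X n \<in> test_pairs" "X \<longlonglongrightarrow> p" unfolding closure_sequential by blast
  obtain \<Phi> where \<Phi>: "\<And>n. test_fun \<Omega> (\<Phi> n)" "\<And>n. X n = (cls (\<Phi> n), \<chi> j. cls (pd j (\<Phi> n)))"
    using X(1) unfolding test_pairs_def by simp metis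
  have 1: "(\<lambda>n. cls (\<Phi> n)) \<longlonglongrightarrow> fst p" using tendsto_fst[OF X(2)] by (simp add: \<Phi>)
  have 2: "(\<lambda>n. cls (pd j (\<Phi> n))) \<longlonglongrightarrow> snd p $ j" for j
    using tendsto_vec_nth[OF tendsto_snd[OF X(2)], of j] by (simp add: \<Phi>)
  have w: "has_weak_pd \<Omega> j (fst p) (snd p $ j)" for j
    by (rule has_weak_pd_limit[OF has_weak_pd_test[OF \<Phi>(1)] 1 2])
  then have W: "fst p \<in> W12 \<Omega>" unfolding W12_def has_weak_pd_iff by blast
  have g: "gr (fst p) = snd p" using weak_pd_eq[OF w] by (simp add: gr_def vec_eq_iff)
  have "\<exists>\<phi>. test_fun \<Omega> \<phi> \<and> W12_norm \<Omega> (fst p - cls \<phi>) < e" if e: "e > 0" for e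
  proof -
    obtain n where n: "norm (X n - p) < e" using LIMSEQ_D[OF X(2) e] by blast
    have "W12_norm \<Omega> (fst p - cls (\<Phi> n)) = norm (p - X n)"
      unfolding W12_norm_eq \<Phi>(2) test_pair_gr[OF \<Phi>(1)]
      using gr_diff[OF W test_W12[OF \<Phi>(1)]] g by (cases p) simp
    then show ?thesis using n \<Phi>(1) by (metis norm_minus_commute)
  qed
  then have "fst p \<in> W012 \<Omega>" using W by (simp add: W012_def)
  then show "p \<in> {(f, gr f) |f. f \<in> W012 \<Omega>}" using g by (auto intro!: exI[of _ "fst p"] simp: prod_eq_iff)
qed

lemma closed_W012_pairs: "closed {(f, gr f) |f. f \<in> W012 \<Omega>}"
  unfolding W012_pairs by simp

lemma subspace_W012_pairs: "subspace {(f, gr f) |f. f \<in> W012 \<Omega>}"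
  unfolding W012_pairs by (rule subspace_closure[OF subspace_test_pairs])

lemma W012_zero: "0 \<in> W012 \<Omega>" "gr 0 = 0"
  using subspace_0[OF subspace_W012_pairs] by (auto simp: zero_prod_def)

lemma W012_add: "f \<in> W012 \<Omega> \<Longrightarrow> g \<in> W012 \<Omega> \<Longrightarrow> f + g \<in> W012 \<Omega> \<and> gr (f + g) = gr f + gr g"
  using subspace_add[OF subspace_W012_pairs, of "(f, gr f)" "(g, gr g)"] by auto

lemma W012_scale: "f \<in> W012 \<Omega> \<Longrightarrow> c *\<^sub>R f \<in> W012 \<Omega> \<and> gr (c *\<^sub>R f) = c *\<^sub>R gr f"
  using subspace_scale[OF subspace_W012_pairs, of "(f, gr f)" c] by auto

lemma W012_limit:
  assumes "\<And>n. F n \<in> W012 \<Omega>" "F \<longlonglongrightarrow> f" "(\<lambda>n. gr (F n)) \<longlonglongrightarrow> g"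
  shows "f \<in> W012 \<Omega> \<and> gr f = g"
proof -
  have "(f, g) \<in> {(f, gr f) |f. f \<in> W012 \<Omega>}"
    by (rule closed_sequentially[OF closed_W012_pairs _ tendsto_Pair[OF assms(2,3)]]) (use assms(1) in auto)
  then show ?thesis by auto
qed

lemma W012_L2: "f \<in> W012 \<Omega> \<Longrightarrow> f \<in> L2 \<Omega>"
  by (simp add: W012_def W12_def)

lemma weak_pd_L2: "f \<in> W012 \<Omega> \<Longrightarrow> weak_pd \<Omega> j f \<in> L2 \<Omega>"
  using W12_weak_pd[of f j] by (simp add: W012_def has_weak_pd_iff)

lemma test_W012: "test_fun \<Omega> \<phi> \<Longrightarrow> cls \<phi> \<in> W012 \<Omega>"
proof -
  assume t: "test_fun \<Omega> \<phi>"
  then have "(cls \<phi>, gr (cls \<phi>)) \<in> test_pairs"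
    unfolding test_pairs_def using test_pair_gr[OF t] by force
  then have "(cls \<phi>, gr (cls \<phi>)) \<in> {(f, gr f) |f. f \<in> W012 \<Omega>}"
    unfolding W012_pairs using closure_subset by blast
  then show ?thesis by auto
qed

lemma W012_approx:
  assumes "f \<in> W012 \<Omega>"
  obtains \<Phi> where "\<And>n. test_fun \<Omega> (\<Phi> n)" "(\<lambda>n. cls (\<Phi> n)) \<longlonglongrightarrow> f"
    "\<And>j. (\<lambda>n. cls (pd j (\<Phi> n))) \<longlonglongrightarrow> weak_pd \<Omega> j f"
proof -
  have "(f, gr f) \<in> closure test_pairs" using assms by (subst W012_pairs[symmetric]) blast
  then obtain X where X: "\<And>n. X n \<in> test_pairs" "X \<longlonglongrightarrow> (f, gr f)" unfolding closure_sequential by blast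
  obtain \<Phi> where \<Phi>: "\<And>n. test_fun \<Omega> (\<Phi> n)" "\<And>n. X n = (cls (\<Phi> n), \<chi> j. cls (pd j (\<Phi> n)))"
    using X(1) unfolding test_pairs_def by simp metis
  have 1: "(\<lambda>n. cls (\<Phi> n)) \<longlonglongrightarrow> f" using tendsto_fst[OF X(2)] by (simp add: \<Phi>)
  have 2: "(\<lambda>n. cls (pd j (\<Phi> n))) \<longlonglongrightarrow> weak_pd \<Omega> j f" for j
    using tendsto_vec_nth[OF tendsto_snd[OF X(2)], of j] by (simp add: \<Phi> gr_def)
  show ?thesis by (rule that[OF \<Phi>(1) 1 2])
qed

text \<open>Both summands are continuous in the function and its gradient, and test functions are
  dense in that sense. No derivative falls on \<open>F\<close>, which is merely
  square-integrable.\<close>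

lemma weak_form_extend:
  assumes z: "\<And>\<phi>. test_fun \<Omega> \<phi> \<Longrightarrow> inner g (cls \<phi>) + (\<Sum>j\<in>UNIV. inner (F j) (cls (pd j \<phi>))) = 0"
    and w: "w \<in> W012 \<Omega>"
  shows "inner g w + (\<Sum>j\<in>UNIV. inner (F j) (weak_pd \<Omega> j w)) = 0"
proof -
  obtain \<Phi> where \<Phi>: "\<And>n. test_fun \<Omega> (\<Phi> n)" "(\<lambda>n. cls (\<Phi> n)) \<longlonglongrightarrow> w"
    "\<And>j. (\<lambda>n. cls (pd j (\<Phi> n))) \<longlonglongrightarrow> weak_pd \<Omega> j w" using W012_approx[OF w] by blast
  have "(\<lambda>n. inner g (cls (\<Phi> n)) + (\<Sum>j\<in>UNIV. inner (F j) (cls (pd j (\<Phi> n)))))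
      \<longlonglongrightarrow> inner g w + (\<Sum>j\<in>UNIV. inner (F j) (weak_pd \<Omega> j w))"
    by (intro tendsto_intros \<Phi>)
  then show ?thesis using z[OF \<Phi>(1)] by (simp add: LIMSEQ_const_iff)
qed

lemma weak_form_test:
  "test_fun \<Omega> \<phi> \<Longrightarrow> weak_pd \<Omega> j (cls \<phi>) = cls (pd j \<phi>)"
  by (rule weak_pd_eq[OF has_weak_pd_test])

lemma L2_zero_if_orthogonal:
  "g \<in> L2 \<Omega> \<Longrightarrow> (\<And>w. w \<in> W012 \<Omega> \<Longrightarrow> inner g w = 0) \<Longrightarrow> g = 0"
  using fundamental_lemma test_W012 by blast

text \<open>For test functions both derivatives can be moved to the second factor, where they
  commute; the identity survives limits of the gradients. It is what makes Korn's inequality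
  elementary in W_0^{1,2}.\<close>

lemma inner_weak_pd_swap:
  assumes u: "u \<in> W012 \<Omega>" and w: "w \<in> W012 \<Omega>"
  shows "inner (weak_pd \<Omega> i u) (weak_pd \<Omega> j w) = inner (weak_pd \<Omega> j u) (weak_pd \<Omega> i w)"
proof -
  have t: "inner (cls (pd i \<phi>)) (cls (pd j \<psi>)) = inner (cls (pd j \<phi>)) (cls (pd i \<psi>))"
    if "test_fun \<Omega> \<phi>" "test_fun \<Omega> \<psi>" for \<phi> \<psi>
  proof -
    have "pd i (pd j \<psi>) = pd j (pd i \<psi>)" using pd_commute[OF test_fun_smooth[OF that(2)]] by (intro ext)
    then show ?thesis using that by (simp add: test_parts test_fun_pd)
  qed
  obtain \<Phi> where \<Phi>: "\<And>n. test_fun \<Omega> (\<Phi> n)" "\<And>j. (\<lambda>n. cls (pd j (\<Phi> n))) \<longlonglongrightarrow> weak_pd \<Omega> j u"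
    using W012_approx[OF u] by metis
  obtain \<Psi> where \<Psi>: "\<And>n. test_fun \<Omega> (\<Psi> n)" "\<And>j. (\<lambda>n. cls (pd j (\<Psi> n))) \<longlonglongrightarrow> weak_pd \<Omega> j w"
    using W012_approx[OF w] by metis
  have "(\<lambda>n. inner (cls (pd i (\<Phi> n))) (cls (pd j (\<Psi> n)))) \<longlonglongrightarrow> inner (weak_pd \<Omega> i u) (weak_pd \<Omega> j w)"
    "(\<lambda>n. inner (cls (pd j (\<Phi> n))) (cls (pd i (\<Psi> n)))) \<longlonglongrightarrow> inner (weak_pd \<Omega> j u) (weak_pd \<Omega> i w)"
    by (intro tendsto_intros \<Phi> \<Psi>)+
  then show ?thesis using t[OF \<Phi>(1) \<Psi>(1)] LIMSEQ_unique by simp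
qed

section \<open>The inequalities of Poincare and Korn\<close>

lemma bcoef_coordinate: "bcoef \<Omega> (\<lambda>x. x $ i)"
proof -
  obtain K where "\<And>x. x \<in> \<Omega> \<Longrightarrow> norm x \<le> K" using bounded_region by (auto simp: bounded_iff)
  then have "\<And>x. x \<in> \<Omega> \<Longrightarrow> \<bar>x $ i\<bar> \<le> K" by (meson component_le_norm_cart order.trans)
  moreover have "(\<lambda>x::real^3. x $ i) \<in> borel_measurable lebesgue"
    using borel_measurable_continuous_onI[of "\<lambda>x::real^3. x $ i"]
    by (simp add: measurable_completion continuous_on_component)
  ultimately show ?thesis unfolding bcoef_def by (auto intro!: borel_measurable_times)
qed

text \<open>Integrate \<open>\<phi>\<^sup>2 = \<phi>\<^sup>2 \<partial>\<^sub>i x\<^sub>i\<close> (no summation) by parts.\<close>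

lemma poincare: "\<exists>C\<ge>0. \<forall>f\<in>W012 \<Omega>. norm f \<le> C * norm (weak_pd \<Omega> i f)"
proof -
  interpret m: bounded_linear "mul \<Omega> (\<lambda>x. x $ i)" by (rule bounded_linear_mul[OF bcoef_coordinate])
  obtain K where K: "K \<ge> 0" "\<And>f. norm (mul \<Omega> (\<lambda>x. x $ i) f) \<le> norm f * K" using m.nonneg_bounded by blast
  have t: "norm (cls \<phi>) \<le> 2 * K * norm (cls (pd i \<phi>))" if \<phi>: "test_fun \<Omega> \<phi>" for \<phi>
  proof -
    define f where "f x = x $ i * (\<phi> x * \<phi> x)" for x
    have d: "\<phi> differentiable (at x)" for x using \<phi> test_fun_smooth smooth_differentiable by blast
    have c: "continuous_on UNIV \<phi>" "continuous_on UNIV (pd i \<phi>)"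
      using \<phi> test_fun_pd test_fun_smooth smooth_continuous by blast+
    have x1: "((\<lambda>x::real^3. x $ i) has_derivative (\<lambda>h. h $ i)) (at x)" for x
      by (intro bounded_linear_imp_has_derivative bounded_linear_vec_nth)
    then have dx: "(\<lambda>x::real^3. x $ i) differentiable (at x)" for x using differentiable_def by blast
    have pf: "pd i f x = x $ i * (\<phi> x * pd i \<phi> x + pd i \<phi> x * \<phi> x) + \<phi> x * \<phi> x" for x
      unfolding f_def using pd_mult[OF dx differentiable_mult[OF d d], of i x] pd_mult[OF d d, of i x] pd_eq[OF x1, of i x]
      by simp
    obtain r where r: "\<And>x. x \<notin> cball 0 r \<Longrightarrow> \<phi> x = 0"
      using \<phi> compact_support_ball unfolding test_fun_def by metis
    have int0: "(LINT x|lebesgue. pd i f x) = 0"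
    proof (rule integral_pd_zero)
      show "f differentiable (at x)" for x
        unfolding f_def by (intro differentiable_mult dx d)
      show "continuous_on UNIV (pd i f)" unfolding pf[abs_def] by (intro continuous_intros c)
      show "f x = 0" if "x \<notin> cball 0 r" for x using r[OF that] by (simp add: f_def)
    qed
    have "(LINT x:\<Omega>|lebesgue. pd i f x) = 0"
    proof -
      have "(\<lambda>x. indicat_real \<Omega> x *\<^sub>R pd i f x) = pd i f"
        using test_fun_zero_outside[OF \<phi>] by (intro ext) (auto simp: indicator_def pf)
      then show ?thesis using int0 by (simp only: set_lebesgue_integral_def)
    qed
    moreover have "hasI (\<lambda>x. (x $ i * \<phi> x) * (pd i \<phi> x + pd i \<phi> x) + \<phi> x * \<phi> x)
      (inner (mul \<Omega> (\<lambda>x. x $ i) (cls \<phi>)) (cls (pd i \<phi>) + cls (pd i \<phi>)) + inner (cls \<phi>) (cls \<phi>))"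
      by (intro hasI_add hasI_prod reps_add reps_mul bcoef_coordinate test_fun_reps test_fun_pd \<phi>)
    moreover have "(\<lambda>x. (x $ i * \<phi> x) * (pd i \<phi> x + pd i \<phi> x) + \<phi> x * \<phi> x) = pd i f"
      by (auto simp: pf algebra_simps)
    ultimately have "inner (mul \<Omega> (\<lambda>x. x $ i) (cls \<phi>)) (cls (pd i \<phi>) + cls (pd i \<phi>)) + inner (cls \<phi>) (cls \<phi>) = 0"
      using hasI_unique by metis
    then have "(norm (cls \<phi>))\<^sup>2 = - 2 * inner (mul \<Omega> (\<lambda>x. x $ i) (cls \<phi>)) (cls (pd i \<phi>))"
      by (simp add: power2_norm_eq_inner inner_add_right)
    also have "\<dots> \<le> 2 * (norm (mul \<Omega> (\<lambda>x. x $ i) (cls \<phi>)) * norm (cls (pd i \<phi>)))"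
      using Cauchy_Schwarz_ineq2[of "mul \<Omega> (\<lambda>x. x $ i) (cls \<phi>)" "cls (pd i \<phi>)"] by linarith
    also have "\<dots> \<le> 2 * ((norm (cls \<phi>) * K) * norm (cls (pd i \<phi>)))"
      using K(2)[of "cls \<phi>"] by (intro mult_left_mono mult_right_mono) auto
    finally have "norm (cls \<phi>) * norm (cls \<phi>) \<le> norm (cls \<phi>) * (2 * K * norm (cls (pd i \<phi>)))"
      by (simp add: power2_eq_square mult_ac)
    then show ?thesis
      using K(1) by (cases "norm (cls \<phi>) = 0") (auto simp: mult_le_cancel_left)
  qed
  have "norm f \<le> 2 * K * norm (weak_pd \<Omega> i f)" if f: "f \<in> W012 \<Omega>" for f
  proof -
    obtain \<Phi> where \<Phi>: "\<And>n. test_fun \<Omega> (\<Phi> n)" "(\<lambda>n. cls (\<Phi> n)) \<longlonglongrightarrow> f"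
      "\<And>j. (\<lambda>n. cls (pd j (\<Phi> n))) \<longlonglongrightarrow> weak_pd \<Omega> j f" using W012_approx[OF f] by blast
    show ?thesis
    proof (rule LIMSEQ_le)
      show "(\<lambda>n. norm (cls (\<Phi> n))) \<longlonglongrightarrow> norm f" by (intro tendsto_intros \<Phi>)
      show "(\<lambda>n. 2 * K * norm (cls (pd i (\<Phi> n)))) \<longlonglongrightarrow> 2 * K * norm (weak_pd \<Omega> i f)"
        by (intro tendsto_intros \<Phi>)
    qed (use t[OF \<Phi>(1)] in blast)
  qed
  then show ?thesis using K(1) by (intro exI[of _ "2 * K"]) auto
qed

text \<open>The mixed products \<open>u\<^sub>i\<^sub>,\<^sub>j u\<^sub>j\<^sub>,\<^sub>i\<close> add up to the squared divergence, as derivatives can be exchanged.\<close>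

lemma korn:
  assumes u: "\<And>i. (u :: l2^3) $ i \<in> W012 \<Omega>"
  shows "(\<Sum>i\<in>UNIV. \<Sum>j\<in>UNIV. (norm (weak_pd \<Omega> j (u $ i)))\<^sup>2)
    \<le> 2 * (\<Sum>i\<in>UNIV. \<Sum>j\<in>UNIV. (norm ((1/2) *\<^sub>R (weak_pd \<Omega> j (u $ i) + weak_pd \<Omega> i (u $ j))))\<^sup>2)"
proof -
  define D where "D i j = weak_pd \<Omega> j (u $ i)" for i j
  have e: "4 * (norm ((1/2) *\<^sub>R (D i j + D j i)))\<^sup>2
      = (norm (D i j))\<^sup>2 + (norm (D j i))\<^sup>2 + 2 * inner (D i j) (D j i)" for i j
    unfolding power2_norm_eq_inner by (simp add: inner_add inner_commute)
  have "4 * (\<Sum>i\<in>UNIV. \<Sum>j\<in>UNIV. (norm ((1/2) *\<^sub>R (D i j + D j i)))\<^sup>2)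
      = (\<Sum>i\<in>UNIV. \<Sum>j\<in>UNIV. (norm (D i j))\<^sup>2) + (\<Sum>i\<in>UNIV. \<Sum>j\<in>UNIV. (norm (D j i))\<^sup>2)
        + 2 * (\<Sum>i\<in>UNIV. \<Sum>j\<in>UNIV. inner (D i j) (D j i))"
    unfolding sum_distrib_left e sum.distrib ..
  also have "(\<Sum>i\<in>UNIV. \<Sum>j\<in>UNIV. (norm (D j i))\<^sup>2) = (\<Sum>i\<in>UNIV. \<Sum>j\<in>UNIV. (norm (D i j))\<^sup>2)"
    by (rule sum.swap)
  also have "(\<Sum>i\<in>UNIV. \<Sum>j\<in>UNIV. inner (D i j) (D j i)) = (\<Sum>i\<in>UNIV. \<Sum>j\<in>UNIV. inner (D i i) (D j j))"
    unfolding D_def using inner_weak_pd_swap[OF u u] by simp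
  also have "\<dots> = (norm (\<Sum>i\<in>UNIV. D i i))\<^sup>2"
    unfolding power2_norm_eq_inner inner_sum_left inner_sum_right by (rule sum.swap)
  \<comment> \<open>Four times the squared strain is twice the squared gradient plus twice the
    squared divergence; dropping the latter leaves the constant 2.\<close>
  finally show ?thesis unfolding D_def[symmetric]
    using zero_le_power2[of "norm (\<Sum>i\<in>UNIV. D i i)"] by linarith
qed

end

section \<open>Index algebra\<close>

lemma sum_symmetric_part:
  fixes S f :: "'n::finite \<Rightarrow> 'n \<Rightarrow> real"
  assumes "\<And>i j. S i j = S j i"
  shows "(\<Sum>i\<in>UNIV. \<Sum>j\<in>UNIV. S i j * ((f i j + f j i) / 2)) = (\<Sum>i\<in>UNIV. \<Sum>j\<in>UNIV. S i j * f i j)"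
proof -
  have "(\<Sum>i\<in>UNIV. \<Sum>j\<in>UNIV. S i j * f j i) = (\<Sum>i\<in>UNIV. \<Sum>j\<in>UNIV. S i j * f i j)"
    by (subst sum.swap) (simp add: assms)
  moreover have e: "S i j * ((f i j + f j i) / 2) = (1/2) * (S i j * f i j) + (1/2) * (S i j * f j i)" for i j
    by (simp add: field_simps)
  have "(\<Sum>i\<in>UNIV. \<Sum>j\<in>UNIV. S i j * ((f i j + f j i) / 2))
      = (1/2) * (\<Sum>i\<in>UNIV. \<Sum>j\<in>UNIV. S i j * f i j) + (1/2) * (\<Sum>i\<in>UNIV. \<Sum>j\<in>UNIV. S i j * f j i)"
    unfolding e sum.distrib sum_distrib_left ..
  ultimately show ?thesis by simp
qed

lemma sum_swap4:
  fixes f :: "'n::finite \<Rightarrow> 'n \<Rightarrow> 'n \<Rightarrow> 'n \<Rightarrow> real"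
  shows "(\<Sum>i\<in>UNIV. \<Sum>j\<in>UNIV. \<Sum>k\<in>UNIV. \<Sum>l\<in>UNIV. f i j k l)
    = (\<Sum>k\<in>UNIV. \<Sum>l\<in>UNIV. \<Sum>i\<in>UNIV. \<Sum>j\<in>UNIV. f i j k l)"
proof -
  have "(\<Sum>i\<in>UNIV. \<Sum>j\<in>UNIV. \<Sum>k\<in>UNIV. \<Sum>l\<in>UNIV. f i j k l)
    = (\<Sum>i\<in>UNIV. \<Sum>k\<in>UNIV. \<Sum>j\<in>UNIV. \<Sum>l\<in>UNIV. f i j k l)"
    by (intro sum.cong refl sum.swap)
  also have "\<dots> = (\<Sum>k\<in>UNIV. \<Sum>i\<in>UNIV. \<Sum>j\<in>UNIV. \<Sum>l\<in>UNIV. f i j k l)" by (rule sum.swap)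
  also have "\<dots> = (\<Sum>k\<in>UNIV. \<Sum>i\<in>UNIV. \<Sum>l\<in>UNIV. \<Sum>j\<in>UNIV. f i j k l)"
    by (intro sum.cong refl sum.swap)
  also have "\<dots> = (\<Sum>k\<in>UNIV. \<Sum>l\<in>UNIV. \<Sum>i\<in>UNIV. \<Sum>j\<in>UNIV. f i j k l)"
    by (intro sum.cong refl sum.swap)
  finally show ?thesis .
qed

text \<open>The energy is written with strains, while the operator contracts the coefficients with
  full gradients in its own index order. At a point both are the same: the minor symmetries of
  \<open>A\<close> and \<open>B\<close> make the antisymmetric parts of \<open>d\<close> and
  \<open>d'\<close> invisible, and the major symmetries move the contraction to the pair of indices
  that is differentiated.\<close>

lemma energy_density_weak_form:
  fixes A B C :: "'n::finite \<Rightarrow> 'n \<Rightarrow> 'n \<Rightarrow> 'n \<Rightarrow> real" and d d' r r' :: "'n \<Rightarrow> 'n \<Rightarrow> real"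
  assumes A: "\<And>i j k l. A i j k l = A j i k l" "\<And>i j k l. A i j k l = A k l i j"
    and B: "\<And>i j k l. B i j k l = B j i k l" "\<And>i j k l. B i j k l = B k l i j"
    and C: "\<And>i j k l. C i j k l = C j i k l" "\<And>i j k l. C i j k l = C k l i j"
  defines "e \<equiv> \<lambda>i j. (d i j + d j i) / 2" and "e' \<equiv> \<lambda>i j. (d' i j + d' j i) / 2"
  shows "(\<Sum>i\<in>UNIV. \<Sum>j\<in>UNIV. \<Sum>k\<in>UNIV. \<Sum>l\<in>UNIV.
      A i j k l * e k l * e' i j + B i j k l * (e i j * r' k l + e' i j * r k l) + C i j k l * r i j * r' k l)
    = (\<Sum>i\<in>UNIV. \<Sum>j\<in>UNIV. ((\<Sum>k\<in>UNIV. \<Sum>l\<in>UNIV. A j i k l * d k l) + (\<Sum>k\<in>UNIV. \<Sum>l\<in>UNIV. B j i k l * r l k)) * d' i j)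
    + (\<Sum>i\<in>UNIV. \<Sum>j\<in>UNIV. ((\<Sum>k\<in>UNIV. \<Sum>l\<in>UNIV. B k l j i * d k l) + (\<Sum>k\<in>UNIV. \<Sum>l\<in>UNIV. C j i k l * r k l)) * r' i j)"
    (is "?L = ?R")
proof -
  \<comment> \<open>Symmetry in the last pair: exchange the pairs, swap the first two indices,
    exchange back.\<close>
  have A3: "A i j k l = A i j l k" for i j k l using A by metis
  have B3: "B i j k l = B i j l k" for i j k l using B by metis
  have 1: "(\<Sum>i\<in>UNIV. \<Sum>j\<in>UNIV. \<Sum>k\<in>UNIV. \<Sum>l\<in>UNIV. A i j k l * e k l * e' i j)
      = (\<Sum>i\<in>UNIV. \<Sum>j\<in>UNIV. (\<Sum>k\<in>UNIV. \<Sum>l\<in>UNIV. A j i k l * d k l) * d' i j)"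
  proof -
    have "(\<Sum>k\<in>UNIV. \<Sum>l\<in>UNIV. A i j k l * e k l) = (\<Sum>k\<in>UNIV. \<Sum>l\<in>UNIV. A j i k l * d k l)" for i j
      unfolding e_def using sum_symmetric_part[of "A i j" d, OF A3] A(1)[of i j] by simp
    then have "(\<Sum>i\<in>UNIV. \<Sum>j\<in>UNIV. \<Sum>k\<in>UNIV. \<Sum>l\<in>UNIV. A i j k l * e k l * e' i j)
      = (\<Sum>i\<in>UNIV. \<Sum>j\<in>UNIV. (\<Sum>k\<in>UNIV. \<Sum>l\<in>UNIV. A j i k l * d k l) * e' i j)"
      by (simp flip: sum_distrib_right)
    also have "\<dots> = (\<Sum>i\<in>UNIV. \<Sum>j\<in>UNIV. (\<Sum>k\<in>UNIV. \<Sum>l\<in>UNIV. A j i k l * d k l) * d' i j)"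
      unfolding e'_def by (rule sum_symmetric_part) (simp add: A(1))
    finally show ?thesis .
  qed
  have 2: "(\<Sum>i\<in>UNIV. \<Sum>j\<in>UNIV. \<Sum>k\<in>UNIV. \<Sum>l\<in>UNIV. B i j k l * (e i j * r' k l))
      = (\<Sum>i\<in>UNIV. \<Sum>j\<in>UNIV. (\<Sum>k\<in>UNIV. \<Sum>l\<in>UNIV. B k l j i * d k l) * r' i j)"
  proof -
    have "(\<Sum>i\<in>UNIV. \<Sum>j\<in>UNIV. B i j k l * e i j) = (\<Sum>i\<in>UNIV. \<Sum>j\<in>UNIV. B i j l k * d i j)" for k l
      unfolding e_def using sum_symmetric_part[of "\<lambda>i j. B i j k l" d, OF B(1)] B3[of _ _ k l] by simp
    then show ?thesis
      by (subst sum_swap4) (simp flip: sum_distrib_right mult.assoc)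
  qed
  have 3: "(\<Sum>i\<in>UNIV. \<Sum>j\<in>UNIV. \<Sum>k\<in>UNIV. \<Sum>l\<in>UNIV. B i j k l * (e' i j * r k l))
      = (\<Sum>i\<in>UNIV. \<Sum>j\<in>UNIV. (\<Sum>k\<in>UNIV. \<Sum>l\<in>UNIV. B j i k l * r l k) * d' i j)"
  proof -
    have m: "(\<Sum>k\<in>UNIV. \<Sum>l\<in>UNIV. B i j k l * r k l) = (\<Sum>k\<in>UNIV. \<Sum>l\<in>UNIV. B j i k l * r l k)" for i j
      by (subst sum.swap) (simp add: B(1)[of i j] B3[of j i])
    have "B i j k l * (e' i j * r k l) = B i j k l * r k l * e' i j" for i j k l by simp
    then have "(\<Sum>i\<in>UNIV. \<Sum>j\<in>UNIV. \<Sum>k\<in>UNIV. \<Sum>l\<in>UNIV. B i j k l * (e' i j * r k l))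
      = (\<Sum>i\<in>UNIV. \<Sum>j\<in>UNIV. (\<Sum>k\<in>UNIV. \<Sum>l\<in>UNIV. B j i k l * r l k) * e' i j)"
      by (simp only: m flip: sum_distrib_right)
    also have "\<dots> = (\<Sum>i\<in>UNIV. \<Sum>j\<in>UNIV. (\<Sum>k\<in>UNIV. \<Sum>l\<in>UNIV. B j i k l * r l k) * d' i j)"
      unfolding e'_def by (rule sum_symmetric_part) (simp add: B(1))
    finally show ?thesis .
  qed
  have 4: "(\<Sum>i\<in>UNIV. \<Sum>j\<in>UNIV. \<Sum>k\<in>UNIV. \<Sum>l\<in>UNIV. C i j k l * r i j * r' k l)
      = (\<Sum>i\<in>UNIV. \<Sum>j\<in>UNIV. (\<Sum>k\<in>UNIV. \<Sum>l\<in>UNIV. C j i k l * r k l) * r' i j)"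
  proof -
    have C4: "C i j k l = C l k i j" for i j k l using C by metis
    show ?thesis by (subst sum_swap4) (simp add: C4 flip: sum_distrib_right)
  qed
  have "?L = (\<Sum>i\<in>UNIV. \<Sum>j\<in>UNIV. \<Sum>k\<in>UNIV. \<Sum>l\<in>UNIV. A i j k l * e k l * e' i j)
    + ((\<Sum>i\<in>UNIV. \<Sum>j\<in>UNIV. \<Sum>k\<in>UNIV. \<Sum>l\<in>UNIV. B i j k l * (e i j * r' k l))
    + (\<Sum>i\<in>UNIV. \<Sum>j\<in>UNIV. \<Sum>k\<in>UNIV. \<Sum>l\<in>UNIV. B i j k l * (e' i j * r k l)))
    + (\<Sum>i\<in>UNIV. \<Sum>j\<in>UNIV. \<Sum>k\<in>UNIV. \<Sum>l\<in>UNIV. C i j k l * r i j * r' k l)"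
    by (simp only: sum.distrib distrib_left)
  also have "\<dots> = ?R" unfolding 1 2 3 4 by (simp only: sum.distrib distrib_right)
  finally show ?thesis .
qed

lemma norm_vec_sq: "(norm (v :: 'a::real_inner^'n))\<^sup>2 = (\<Sum>i\<in>UNIV. (norm (v $ i))\<^sup>2)"
  by (simp add: norm_vec_def L2_set_def sum_nonneg)

lemma bounded_bilinear_inner_comp:
  "bounded_linear f \<Longrightarrow> bounded_linear g \<Longrightarrow> bounded_bilinear (\<lambda>p q. inner (f p) (g q))"
  using bounded_bilinear.comp[OF bounded_bilinear_inner] .

lemma bounded_linear_nth: "bounded_linear f \<Longrightarrow> bounded_linear (\<lambda>p. f p $ i)"
  using bounded_linear_compose[OF bounded_linear_vec_nth] .

lemma bounded_linear_fst_comp: "bounded_linear f \<Longrightarrow> bounded_linear (\<lambda>p. fst (f p))"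
  using bounded_linear_compose[OF bounded_linear_fst] .

lemma bounded_linear_snd_comp: "bounded_linear f \<Longrightarrow> bounded_linear (\<lambda>p. snd (f p))"
  using bounded_linear_compose[OF bounded_linear_snd] .

lemma bounded_linear_scale_comp: "bounded_linear f \<Longrightarrow> bounded_linear (\<lambda>p. (c::real) *\<^sub>R f p)"
  using bounded_linear_compose[OF bounded_linear_scaleR_right] .

context region
begin

lemma hasI_cong: "hasI g v \<Longrightarrow> (\<And>x. x \<in> \<Omega> \<Longrightarrow> g x = h x) \<Longrightarrow> hasI h v"
proof -
  assume g: "hasI g v" and eq: "\<And>x. x \<in> \<Omega> \<Longrightarrow> g x = h x"
  then have "(\<lambda>x. indicat_real \<Omega> x *\<^sub>R g x) = (\<lambda>x. indicat_real \<Omega> x *\<^sub>R h x)"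
    by (auto simp: indicator_def)
  then show "hasI h v" using g unfolding hasI_def set_integrable_def set_lebesgue_integral_def by simp
qed

lemma hasI_mono: "hasI g v \<Longrightarrow> hasI h w \<Longrightarrow> (\<And>x. x \<in> \<Omega> \<Longrightarrow> g x \<le> h x) \<Longrightarrow> v \<le> w"
  unfolding hasI_def using set_integral_mono[of lebesgue \<Omega> g h] by auto

lemma hasI_eq: "hasI g v \<Longrightarrow> hasI h w \<Longrightarrow> (\<And>x. x \<in> \<Omega> \<Longrightarrow> g x = h x) \<Longrightarrow> v = w"
  using hasI_cong[of g v h] hasI_unique by metis

lemma hasI_scale: "hasI g v \<Longrightarrow> hasI (\<lambda>x. k * g x) (k * v)"
  by (simp add: hasI_def)

lemma hasI_mul3:
  assumes "bcoef \<Omega> c" "reps \<Omega> r f" "reps \<Omega> s g"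
  shows "hasI (\<lambda>x. c x * r x * s x) (inner (mul \<Omega> c f) g)"
  using hasI_prod[OF reps_mul[OF assms(1,2)] assms(3)] .

lemma bounded_linear_mul_comp: "bcoef \<Omega> c \<Longrightarrow> bounded_linear f \<Longrightarrow> bounded_linear (\<lambda>p. mul \<Omega> c (f p))"
  using bounded_linear_compose[OF bounded_linear_mul] .

lemma bcoef_continuous:
  assumes "continuous_on (closure \<Omega>) c"
  shows "bcoef \<Omega> c"
proof -
  have "compact (c ` closure \<Omega>)"
    using assms bounded_region by (intro compact_continuous_image) (auto simp: compact_eq_bounded_closed)
  then obtain K where K: "\<And>x. x \<in> closure \<Omega> \<Longrightarrow> \<bar>c x\<bar> \<le> K"
    using compact_imp_bounded[THEN bounded_iff[THEN iffD1]] by (metis imageI real_norm_def)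
  have "continuous_on \<Omega> c" using assms closure_subset continuous_on_subset by blast
  then have "(\<lambda>x. indicat_real \<Omega> x *\<^sub>R c x) \<in> borel_measurable borel"
    using open_region by (intro borel_measurable_continuous_on_indicator) auto
  then have "(\<lambda>x. indicat_real \<Omega> x * c x) \<in> borel_measurable lebesgue"
    by (simp add: measurable_completion)
  then show ?thesis unfolding bcoef_def using K closure_subset by blast
qed

lemma reps_half_sum:
  "reps \<Omega> r f \<Longrightarrow> reps \<Omega> s g \<Longrightarrow> reps \<Omega> (\<lambda>x. (r x + s x) / 2) ((1/2) *\<^sub>R (f + g))"
  using reps_scale[OF reps_add, of r f s g "1/2"] by simp

end

section \<open>The forms of the thermoelastic problem\<close>

type_synonym triple = "(l2^3) \<times> l2 \<times> (l2^3)"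
type_synonym gradient = "(l2^3^3) \<times> (l2^3) \<times> (l2^3^3)"

text \<open>Triples stand for \<open>(u, \<tau>, R)\<close> as well as for the velocities
  \<open>(v, \<theta>, M)\<close>. The names \<open>theta_of\<close> and \<open>micro_of\<close>
  refer to the second reading, as undifferentiated values enter the damping form through velocities
  and test functions.\<close>

abbreviation theta_of :: "triple \<times> gradient \<Rightarrow> l2" where "theta_of p \<equiv> fst (snd (fst p))"
abbreviation micro_of :: "triple \<times> gradient \<Rightarrow> l2^3" where "micro_of p \<equiv> snd (snd (fst p))"
abbreviation d1 :: "triple \<times> gradient \<Rightarrow> l2^3^3" where "d1 p \<equiv> fst (snd p)"
abbreviation d2 :: "triple \<times> gradient \<Rightarrow> l2^3" where "d2 p \<equiv> fst (snd (snd p))"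
abbreviation d3 :: "triple \<times> gradient \<Rightarrow> l2^3^3" where "d3 p \<equiv> snd (snd (snd p))"

definition sym_d1 :: "triple \<times> gradient \<Rightarrow> 3 \<Rightarrow> 3 \<Rightarrow> l2" where
  "sym_d1 p i j = (1/2) *\<^sub>R (d1 p $ i $ j + d1 p $ j $ i)"

text \<open>On the diagonal the couplings cancel: the \<open>a\<close> and \<open>b\<close> terms
  occur once with either sign, and so do the \<open>d\<close> terms after an exchange of indices.
  Only the quadratic form of \<open>k\<close> and \<open>C\<close> survives.\<close>

lemma dissipation_density_nonneg:
  fixes a b d k :: "'n::finite \<Rightarrow> 'n \<Rightarrow> real" and C :: "'n \<Rightarrow> 'n \<Rightarrow> 'n \<Rightarrow> 'n \<Rightarrow> real"
  assumes sym: "\<And>i j. a i j = a j i" "\<And>i j. d i j = d j i"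
    and pos: "\<And>(\<xi>::real^'n) (m::real^'n^'n). (\<Sum>i\<in>UNIV. \<Sum>j\<in>UNIV. k i j * \<xi> $ i * \<xi> $ j) +
        (\<Sum>i\<in>UNIV. \<Sum>j\<in>UNIV. \<Sum>k\<in>UNIV. \<Sum>l\<in>UNIV. C i j k l * m $ l $ k * m $ i $ j) \<ge> 0"
  shows "0 \<le> (\<Sum>i\<in>UNIV. \<Sum>j\<in>UNIV. ((\<Sum>k\<in>UNIV. \<Sum>l\<in>UNIV. C j i k l * E k l) - b j i * \<theta>) * E i j)
    + (\<Sum>i\<in>UNIV. \<Sum>j\<in>UNIV. (- (a j i * \<theta>)) * D i j)
    + (\<Sum>i\<in>UNIV. \<Sum>j\<in>UNIV. a i j * D i j) * \<theta>
    + (\<Sum>i\<in>UNIV. \<Sum>j\<in>UNIV. b j i * E i j) * \<theta>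
    + (\<Sum>i\<in>UNIV. (\<Sum>j\<in>UNIV. k i j * g j - d i j * M j) * g i)
    + (\<Sum>i\<in>UNIV. (\<Sum>j\<in>UNIV. d i j * g j) * M i)" (is "0 \<le> ?R")
proof -
  have 1: "(\<Sum>i\<in>UNIV. \<Sum>j\<in>UNIV. ((\<Sum>k\<in>UNIV. \<Sum>l\<in>UNIV. C j i k l * E k l) - b j i * \<theta>) * E i j)
    = (\<Sum>i\<in>UNIV. \<Sum>j\<in>UNIV. \<Sum>k\<in>UNIV. \<Sum>l\<in>UNIV. C i j k l * E k l * E j i) - (\<Sum>i\<in>UNIV. \<Sum>j\<in>UNIV. b j i * E i j) * \<theta>"
  proof -
    have "(\<Sum>i\<in>UNIV. \<Sum>j\<in>UNIV. (\<Sum>k\<in>UNIV. \<Sum>l\<in>UNIV. C j i k l * E k l) * E i j)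
        = (\<Sum>i\<in>UNIV. \<Sum>j\<in>UNIV. (\<Sum>k\<in>UNIV. \<Sum>l\<in>UNIV. C i j k l * E k l) * E j i)"
      by (rule sum.swap)
    then show ?thesis
      by (simp add: left_diff_distrib sum_subtractf sum_distrib_right mult.assoc mult.commute[of \<theta>])
  qed
  have 2: "(\<Sum>i\<in>UNIV. \<Sum>j\<in>UNIV. (- (a j i * \<theta>)) * D i j) = - (\<Sum>i\<in>UNIV. \<Sum>j\<in>UNIV. a i j * D i j) * \<theta>"
  proof -
    have e: "(- (a j i * \<theta>)) * D i j = - (a i j * D i j * \<theta>)" for i j by (simp add: sym(1)[of j i])
    show ?thesis unfolding e sum_negf sum_distrib_right[symmetric] by simp
  qed
  have 3: "(\<Sum>i\<in>UNIV. (\<Sum>j\<in>UNIV. k i j * g j - d i j * M j) * g i)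
      = (\<Sum>i\<in>UNIV. \<Sum>j\<in>UNIV. k i j * g i * g j) - (\<Sum>i\<in>UNIV. (\<Sum>j\<in>UNIV. d i j * g j) * M i)"
  proof -
    have "(\<Sum>i\<in>UNIV. \<Sum>j\<in>UNIV. d i j * M j * g i) = (\<Sum>i\<in>UNIV. \<Sum>j\<in>UNIV. d i j * g j * M i)"
      by (subst sum.swap) (simp add: sym(2) mult.commute mult.left_commute)
    moreover have e: "(\<Sum>j\<in>UNIV. k i j * g j - d i j * M j) * g i
        = (\<Sum>j\<in>UNIV. k i j * g i * g j) - (\<Sum>j\<in>UNIV. d i j * M j * g i)" for i
      by (simp add: sum_subtractf right_diff_distrib sum_distrib_left mult_ac)
    ultimately show ?thesis unfolding e by (simp add: sum_subtractf sum_distrib_right)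
  qed
  have "?R = (\<Sum>i\<in>UNIV. \<Sum>j\<in>UNIV. k i j * g i * g j) + (\<Sum>i\<in>UNIV. \<Sum>j\<in>UNIV. \<Sum>k\<in>UNIV. \<Sum>l\<in>UNIV. C i j k l * E k l * E j i)"
    unfolding 1 2 3 by simp
  \<comment> \<open>The transposed matrix is inserted because the hypothesis contracts
    \<open>C i j k l\<close> with \<open>m $ l $ k\<close>, whereas the density contracts it with
    \<open>E k l\<close>.\<close>
  then show ?thesis using pos[of "\<chi> i. g i" "\<chi> i j. E j i"] by simp
qed

locale thermo = region +
  fixes P :: coeffs
  assumes adm: "admissible \<Omega> P"
begin

lemma coef_continuous:
  "continuous_on (closure \<Omega>) (rho P)" "continuous_on (closure \<Omega>) (thc P)"
  "continuous_on (closure \<Omega>) (mc P i j)"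
  using adm by (auto simp: admissible_def coeffs_C1_def C1_closure_def)

lemma bcoefs:
  "bcoef \<Omega> (rho P)" "bcoef \<Omega> (thc P)" "bcoef \<Omega> (mc P i j)" "bcoef \<Omega> (ac P i j)" "bcoef \<Omega> (bc P i j)"
  "bcoef \<Omega> (dc P i j)" "bcoef \<Omega> (kc P i j)" "bcoef \<Omega> (ktc P i j)" "bcoef \<Omega> (At P i j k l)"
  "bcoef \<Omega> (Bt P i j k l)" "bcoef \<Omega> (Ct P i j k l)" "bcoef \<Omega> (Ctt P i j k l)"
  using adm by (auto simp: admissible_def coeffs_C1_def C1_closure_def intro!: bcoef_continuous)

lemma symmetries:
  assumes "x \<in> \<Omega>"
  shows "At P i j k l x = At P j i k l x" "At P i j k l x = At P k l i j x"
    "Bt P i j k l x = Bt P j i k l x" "Bt P i j k l x = Bt P k l i j x"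
    "Ct P i j k l x = Ct P j i k l x" "Ct P i j k l x = Ct P k l i j x"
    "ac P i j x = ac P j i x" "mc P i j x = mc P j i x" "dc P i j x = dc P j i x" "kc P i j x = kc P j i x"
  using adm subsetD[OF closure_subset assms] unfolding admissible_def coeffs_symmetric_def by blast+

lemma mul_cong: "(\<And>x. x \<in> \<Omega> \<Longrightarrow> c x = c' x) \<Longrightarrow> mul \<Omega> c f = mul \<Omega> c' f"
  unfolding mul_def l2_on_def by (rule arg_cong[of _ _ abs_l2]) (auto simp: indicator_def)

text \<open>In the second term with \<open>Bt\<close> the coefficient stands on the right, so that
  every inner product has its left factor from \<open>p\<close> and its right factor from
  \<open>q\<close>; the bilinearity rules rely on this shape.\<close>

definition form_a :: "triple \<times> gradient \<Rightarrow> triple \<times> gradient \<Rightarrow> real" where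
  "form_a p q =
    (\<Sum>i\<in>UNIV. \<Sum>j\<in>UNIV. \<Sum>k\<in>UNIV. \<Sum>l\<in>UNIV.
      inner (mul \<Omega> (At P i j k l) (sym_d1 p k l)) (sym_d1 q i j)
      + (inner (mul \<Omega> (Bt P i j k l) (sym_d1 p i j)) (d3 q $ k $ l)
       + inner (d3 p $ k $ l) (mul \<Omega> (Bt P i j k l) (sym_d1 q i j)))
      + inner (mul \<Omega> (Ct P i j k l) (d3 p $ i $ j)) (d3 q $ k $ l))
    + (\<Sum>i\<in>UNIV. \<Sum>j\<in>UNIV. inner (mul \<Omega> (kc P i j) (d2 p $ i)) (d2 q $ j))"

text \<open>The negative of the part of the brackets that depends on the velocities, tested with
  \<open>q\<close> and with the outer divergences moved onto \<open>q\<close>.\<close>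

definition form_b :: "triple \<times> gradient \<Rightarrow> triple \<times> gradient \<Rightarrow> real" where
  "form_b p q =
    (\<Sum>i\<in>UNIV. \<Sum>j\<in>UNIV. inner ((\<Sum>k\<in>UNIV. \<Sum>l\<in>UNIV. mul \<Omega> (Ctt P j i k l) (d3 p $ k $ l))
        - mul \<Omega> (bc P j i) (theta_of p)) (d3 q $ i $ j))
    + (\<Sum>i\<in>UNIV. \<Sum>j\<in>UNIV. inner (- mul \<Omega> (ac P j i) (theta_of p)) (d1 q $ i $ j))
    + inner (\<Sum>i\<in>UNIV. \<Sum>j\<in>UNIV. mul \<Omega> (ac P i j) (d1 p $ i $ j)) (theta_of q)
    + inner (\<Sum>i\<in>UNIV. \<Sum>j\<in>UNIV. mul \<Omega> (bc P j i) (d3 p $ i $ j)) (theta_of q)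
    + (\<Sum>i\<in>UNIV. inner (\<Sum>j\<in>UNIV. mul \<Omega> (ktc P i j) (d2 p $ j) - mul \<Omega> (dc P i j) (micro_of p $ j)) (d2 q $ i))
    + (\<Sum>i\<in>UNIV. inner (\<Sum>j\<in>UNIV. mul \<Omega> (dc P i j) (d2 p $ j)) (micro_of q $ i))"

definition form_m :: "triple \<Rightarrow> triple \<Rightarrow> real" where
  "form_m z w =
    (\<Sum>i\<in>UNIV. inner (mul \<Omega> (rho P) (fst z $ i)) (fst w $ i))
    + inner (mul \<Omega> (thc P) (fst (snd z))) (fst (snd w))
    + (\<Sum>i\<in>UNIV. \<Sum>j\<in>UNIV. inner (mul \<Omega> (mc P i j) (snd (snd z) $ i)) (snd (snd w) $ j))"

lemmas blin_intros = bounded_bilinear_add bounded_bilinear_sum bounded_bilinear_inner_comp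
  bounded_linear_mul_comp bounded_linear_sum bounded_linear_sub bounded_linear_minus bounded_linear_add
  bounded_linear_nth bounded_linear_fst_comp bounded_linear_snd_comp bounded_linear_scale_comp
  bounded_linear_ident bcoefs

lemma bilinear_form_a: "bounded_bilinear form_a"
  unfolding form_a_def[abs_def] sym_d1_def by (intro blin_intros)

lemma bilinear_form_b: "bounded_bilinear form_b"
  unfolding form_b_def[abs_def] by (intro blin_intros)

lemma bilinear_form_m: "bounded_bilinear form_m"
  unfolding form_m_def[abs_def] by (intro blin_intros)

definition grv :: "l2^3 \<Rightarrow> l2^3^3" where "grv u = (\<chi> i. gr (u $ i))"
definition grad :: "triple \<Rightarrow> gradient" where
  "grad y = (grv (fst y), gr (fst (snd y)), grv (snd (snd y)))"
definition W :: "triple set" where "W = W012vec \<Omega> \<times> W012 \<Omega> \<times> W012vec \<Omega>"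
definition V :: "(triple \<times> gradient) set" where "V = {(y, grad y) |y. y \<in> W}"
definition H :: "triple set" where "H = L2vec \<Omega> \<times> L2 \<Omega> \<times> L2vec \<Omega>"

lemma gr_nth: "gr f $ j = weak_pd \<Omega> j f"
  by (simp add: gr_def)

lemma grv_nth: "grv u $ i = gr (u $ i)"
  by (simp add: grv_def)

lemma L2vec_nth: "u \<in> L2vec \<Omega> \<Longrightarrow> u $ i \<in> L2 \<Omega>"
  by (simp add: L2vec_def)

lemma W_D: "y \<in> W \<Longrightarrow> fst y $ i \<in> W012 \<Omega>" "y \<in> W \<Longrightarrow> fst (snd y) \<in> W012 \<Omega>"
  "y \<in> W \<Longrightarrow> snd (snd y) $ i \<in> W012 \<Omega>"
  by (auto simp: W_def W012vec_def)

lemma W_I: "(\<And>i. fst y $ i \<in> W012 \<Omega>) \<Longrightarrow> fst (snd y) \<in> W012 \<Omega> \<Longrightarrow> (\<And>i. snd (snd y) $ i \<in> W012 \<Omega>) \<Longrightarrow> y \<in> W"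
  by (cases y) (auto simp: W_def W012vec_def)

lemma H_D: "z \<in> H \<Longrightarrow> fst z $ i \<in> L2 \<Omega>" "z \<in> H \<Longrightarrow> fst (snd z) \<in> L2 \<Omega>"
  "z \<in> H \<Longrightarrow> snd (snd z) $ i \<in> L2 \<Omega>"
  by (auto simp: H_def L2vec_def)

lemma W_H: "y \<in> W \<Longrightarrow> y \<in> H"
  by (auto simp: W_def H_def W012vec_def L2vec_def W012_L2)

lemma V_iff: "p \<in> V \<longleftrightarrow> fst p \<in> W \<and> snd p = grad (fst p)"
  by (cases p) (auto simp: V_def)

lemma grad_eq_iff: "grad y = g \<longleftrightarrow> (\<forall>i. gr (fst y $ i) = fst g $ i) \<and> gr (fst (snd y)) = fst (snd g)
    \<and> (\<forall>i. gr (snd (snd y) $ i) = snd (snd g) $ i)"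
  by (cases g) (auto simp: grad_def vec_eq_iff[where 'a = "l2^3"] grv_nth)

lemma subspace_V: "subspace V"
proof (rule subspaceI)
  show "0 \<in> V" by (auto simp: V_iff intro!: W_I) (simp_all add: W012_zero grad_eq_iff[THEN iffD2])
next
  fix p q assume "p \<in> V" "q \<in> V"
  then have pq: "fst p \<in> W" "fst q \<in> W" "snd p = grad (fst p)" "snd q = grad (fst q)" by (auto simp: V_iff)
  have "fst (p + q) \<in> W" using W012_add W_D[OF pq(1)] W_D[OF pq(2)] by (intro W_I) auto
  moreover have "grad (fst (p + q)) = snd (p + q)"
    unfolding grad_eq_iff using W012_add W_D[OF pq(1)] W_D[OF pq(2)] pq(3,4) by (simp add: grad_def grv_nth)
  ultimately show "p + q \<in> V" by (simp add: V_iff)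
next
  fix c p assume "p \<in> V"
  then have p: "fst p \<in> W" "snd p = grad (fst p)" by (auto simp: V_iff)
  have "fst (c *\<^sub>R p) \<in> W" using W012_scale W_D[OF p(1)] by (intro W_I) auto
  moreover have "grad (fst (c *\<^sub>R p)) = snd (c *\<^sub>R p)"
    unfolding grad_eq_iff using W012_scale W_D[OF p(1)] p(2) by (simp add: grad_def grv_nth)
  ultimately show "c *\<^sub>R p \<in> V" by (simp add: V_iff)
qed

lemma closed_V: "closed V"
  unfolding closed_sequential_limits
proof (intro allI impI, elim conjE)
  fix X p assume X: "\<forall>n. X n \<in> V" and lim: "X \<longlonglongrightarrow> p"
  have XW: "fst (X n) \<in> W" and Xg: "snd (X n) = grad (fst (X n))" for n using X by (auto simp: V_iff)
  have gl: "(\<lambda>n. grad (fst (X n))) \<longlonglongrightarrow> snd p" using tendsto_snd[OF lim] by (simp add: Xg)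
  have 1: "fst (fst p) $ i \<in> W012 \<Omega> \<and> gr (fst (fst p) $ i) = fst (snd p) $ i" for i
  proof (rule W012_limit[of "\<lambda>n. fst (fst (X n)) $ i"])
    show "fst (fst (X n)) $ i \<in> W012 \<Omega>" for n by (rule W_D[OF XW])
    show "(\<lambda>n. fst (fst (X n)) $ i) \<longlonglongrightarrow> fst (fst p) $ i" by (intro tendsto_intros lim)
    show "(\<lambda>n. gr (fst (fst (X n)) $ i)) \<longlonglongrightarrow> fst (snd p) $ i"
      using tendsto_vec_nth[OF tendsto_fst[OF gl], of i] by (simp add: grad_def grv_nth)
  qed
  have 2: "fst (snd (fst p)) \<in> W012 \<Omega> \<and> gr (fst (snd (fst p))) = fst (snd (snd p))"
  proof (rule W012_limit[of "\<lambda>n. fst (snd (fst (X n)))"])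
    show "fst (snd (fst (X n))) \<in> W012 \<Omega>" for n by (rule W_D[OF XW])
    show "(\<lambda>n. fst (snd (fst (X n)))) \<longlonglongrightarrow> fst (snd (fst p))" by (intro tendsto_intros lim)
    show "(\<lambda>n. gr (fst (snd (fst (X n))))) \<longlonglongrightarrow> fst (snd (snd p))"
      using tendsto_fst[OF tendsto_snd[OF gl]] by (simp add: grad_def)
  qed
  have 3: "snd (snd (fst p)) $ i \<in> W012 \<Omega> \<and> gr (snd (snd (fst p)) $ i) = snd (snd (snd p)) $ i" for i
  proof (rule W012_limit[of "\<lambda>n. snd (snd (fst (X n))) $ i"])
    show "snd (snd (fst (X n))) $ i \<in> W012 \<Omega>" for n by (rule W_D[OF XW])
    show "(\<lambda>n. snd (snd (fst (X n))) $ i) \<longlonglongrightarrow> snd (snd (fst p)) $ i" by (intro tendsto_intros lim)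
    show "(\<lambda>n. gr (snd (snd (fst (X n))) $ i)) \<longlonglongrightarrow> snd (snd (snd p)) $ i"
      using tendsto_vec_nth[OF tendsto_snd[OF tendsto_snd[OF gl]], of i] by (simp add: grad_def grv_nth)
  qed
  have "fst p \<in> W" using 1 2 3 by (intro W_I) auto
  moreover have "grad (fst p) = snd p" using 1 2 3 by (simp add: grad_eq_iff)
  ultimately show "p \<in> V" by (simp add: V_iff)
qed

lemma subspace_L2vec: "subspace (L2vec \<Omega>)"
  using subspace_L2 by (auto simp: subspace_def L2vec_def)

lemma closed_L2vec: "closed (L2vec \<Omega>)"
  unfolding closed_sequential_limits L2vec_def mem_Collect_eq
  using closed_sequentially[OF closed_L2 _ tendsto_vec_nth] by blast

lemma subspace_H: "subspace H"
  unfolding H_def by (intro subspace_Times subspace_L2 subspace_L2vec)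

lemma closed_H: "closed H"
  unfolding H_def by (intro closed_Times closed_L2 closed_L2vec)

lemma reps_wd: "f \<in> W012 \<Omega> \<Longrightarrow> reps \<Omega> (wd \<Omega> f j) (weak_pd \<Omega> j f)"
  unfolding wd_def by (intro reps_rep weak_pd_L2)

lemma reps_strain: "y \<in> W \<Longrightarrow> reps \<Omega> (strain \<Omega> (fst y) i j) (sym_d1 (y, grad y) i j)"
  using reps_half_sum[OF reps_wd[OF W_D(1), of y i j] reps_wd[OF W_D(1), of y j i]]
  by (simp add: sym_d1_def grad_def grv_nth gr_nth strain_def[abs_def])

lemma reps_d1: "y \<in> W \<Longrightarrow> reps \<Omega> (wd \<Omega> (fst y $ i) j) (d1 (y, grad y) $ i $ j)"
  using reps_wd[OF W_D(1), of y i j] by (simp add: grad_def grv_nth gr_nth)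

lemma reps_d2: "y \<in> W \<Longrightarrow> reps \<Omega> (wd \<Omega> (fst (snd y)) j) (d2 (y, grad y) $ j)"
  using reps_wd[OF W_D(2), of y j] by (simp add: grad_def gr_nth)

lemma reps_d3: "y \<in> W \<Longrightarrow> reps \<Omega> (wd \<Omega> (snd (snd y) $ i) j) (d3 (y, grad y) $ i $ j)"
  using reps_wd[OF W_D(3), of y i j] by (simp add: grad_def grv_nth gr_nth)

lemma hasI_mul3': "bcoef \<Omega> c \<Longrightarrow> reps \<Omega> r f \<Longrightarrow> reps \<Omega> s g \<Longrightarrow> hasI (\<lambda>x. c x * r x * s x) (inner g (mul \<Omega> c f))"
  using hasI_mul3 by (simp add: inner_commute)

definition density_a :: "triple \<Rightarrow> triple \<Rightarrow> real^3 \<Rightarrow> real" where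
  "density_a y w x =
    (\<Sum>i\<in>UNIV. \<Sum>j\<in>UNIV. \<Sum>k\<in>UNIV. \<Sum>l\<in>UNIV.
      At P i j k l x * strain \<Omega> (fst y) k l x * strain \<Omega> (fst w) i j x +
      Bt P i j k l x * (strain \<Omega> (fst y) i j x * wd \<Omega> (snd (snd w) $ k) l x +
                        strain \<Omega> (fst w) i j x * wd \<Omega> (snd (snd y) $ k) l x) +
      Ct P i j k l x * wd \<Omega> (snd (snd y) $ i) j x * wd \<Omega> (snd (snd w) $ k) l x) +
    (\<Sum>i\<in>UNIV. \<Sum>j\<in>UNIV. kc P i j x * wd \<Omega> (fst (snd y)) i x * wd \<Omega> (fst (snd w)) j x)"

text \<open>The product with \<open>Bt\<close> is split first, because its two summands belong to
  two different inner products of \<open>form_a\<close>; the splitting is undone pointwise.\<close>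

lemma hasI_density_a:
  assumes y: "y \<in> W" and w: "w \<in> W"
  shows "hasI (density_a y w) (form_a (y, grad y) (w, grad w))"
proof -
  have "hasI (\<lambda>x. (\<Sum>i\<in>UNIV. \<Sum>j\<in>UNIV. \<Sum>k\<in>UNIV. \<Sum>l\<in>UNIV.
      At P i j k l x * strain \<Omega> (fst y) k l x * strain \<Omega> (fst w) i j x +
      (Bt P i j k l x * strain \<Omega> (fst y) i j x * wd \<Omega> (snd (snd w) $ k) l x +
       Bt P i j k l x * strain \<Omega> (fst w) i j x * wd \<Omega> (snd (snd y) $ k) l x) +
      Ct P i j k l x * wd \<Omega> (snd (snd y) $ i) j x * wd \<Omega> (snd (snd w) $ k) l x) +
    (\<Sum>i\<in>UNIV. \<Sum>j\<in>UNIV. kc P i j x * wd \<Omega> (fst (snd y)) i x * wd \<Omega> (fst (snd w)) j x))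
    (form_a (y, grad y) (w, grad w))"
    unfolding form_a_def
    by (intro hasI_add hasI_sum hasI_mul3 hasI_mul3' bcoefs reps_strain reps_d2 reps_d3 y w)
  then show ?thesis
    by (rule hasI_cong) (simp add: density_a_def distrib_left mult.assoc)
qed

lemma form_a_sym:
  assumes "p \<in> V" "q \<in> V"
  shows "form_a p q = form_a q p"
proof -
  obtain y w where y: "y \<in> W" "p = (y, grad y)" and w: "w \<in> W" "q = (w, grad w)"
    using assms unfolding V_def by blast
  show ?thesis unfolding y w
  proof (rule hasI_eq[OF hasI_density_a hasI_density_a])
    fix x assume x: "x \<in> \<Omega>"
    have 1: "(\<Sum>i\<in>UNIV. \<Sum>j\<in>UNIV. \<Sum>k\<in>UNIV. \<Sum>l\<in>UNIV. At P i j k l x * strain \<Omega> (fst y) k l x * strain \<Omega> (fst w) i j x)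
        = (\<Sum>i\<in>UNIV. \<Sum>j\<in>UNIV. \<Sum>k\<in>UNIV. \<Sum>l\<in>UNIV. At P i j k l x * strain \<Omega> (fst w) k l x * strain \<Omega> (fst y) i j x)"
      by (subst sum_swap4, intro sum.cong refl) (simp add: symmetries(2)[OF x] mult_ac)
    have 2: "(\<Sum>i\<in>UNIV. \<Sum>j\<in>UNIV. \<Sum>k\<in>UNIV. \<Sum>l\<in>UNIV. Ct P i j k l x * wd \<Omega> (snd (snd y) $ i) j x * wd \<Omega> (snd (snd w) $ k) l x)
        = (\<Sum>i\<in>UNIV. \<Sum>j\<in>UNIV. \<Sum>k\<in>UNIV. \<Sum>l\<in>UNIV. Ct P i j k l x * wd \<Omega> (snd (snd w) $ i) j x * wd \<Omega> (snd (snd y) $ k) l x)"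
      by (subst sum_swap4, intro sum.cong refl) (simp add: symmetries(6)[OF x] mult_ac)
    have 3: "(\<Sum>i\<in>UNIV. \<Sum>j\<in>UNIV. kc P i j x * wd \<Omega> (fst (snd y)) i x * wd \<Omega> (fst (snd w)) j x)
        = (\<Sum>i\<in>UNIV. \<Sum>j\<in>UNIV. kc P i j x * wd \<Omega> (fst (snd w)) i x * wd \<Omega> (fst (snd y)) j x)"
      by (subst sum.swap, intro sum.cong refl) (simp add: symmetries(10)[OF x] mult_ac)
    show "density_a y w x = density_a w y x"
      unfolding density_a_def sum.distrib 1 2 3 by (simp add: add.commute)
  qed fact+
qed

text \<open>Korn's inequality concerns the displacement alone; the other gradients are doubled to
  share its constant.\<close>

lemma norm_grad_le:
  assumes y: "y \<in> W"
  shows "(norm (grad y))\<^sup>2 \<le> 2 * ((\<Sum>i\<in>UNIV. \<Sum>j\<in>UNIV. (norm (sym_d1 (y, grad y) i j))\<^sup>2)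
    + (\<Sum>i\<in>UNIV. (norm (d2 (y, grad y) $ i))\<^sup>2) + (\<Sum>i\<in>UNIV. \<Sum>j\<in>UNIV. (norm (d3 (y, grad y) $ i $ j))\<^sup>2))"
proof -
  have "(\<Sum>i\<in>UNIV. \<Sum>j\<in>UNIV. (norm (weak_pd \<Omega> j (fst y $ i)))\<^sup>2)
      \<le> 2 * (\<Sum>i\<in>UNIV. \<Sum>j\<in>UNIV. (norm (sym_d1 (y, grad y) i j))\<^sup>2)"
    using korn[of "fst y"] W_D(1)[OF y] by (simp add: sym_d1_def grad_def grv_nth gr_nth)
  moreover have "(norm (grad y))\<^sup>2 = (\<Sum>i\<in>UNIV. \<Sum>j\<in>UNIV. (norm (weak_pd \<Omega> j (fst y $ i)))\<^sup>2)
      + (\<Sum>i\<in>UNIV. (norm (d2 (y, grad y) $ i))\<^sup>2) + (\<Sum>i\<in>UNIV. \<Sum>j\<in>UNIV. (norm (d3 (y, grad y) $ i $ j))\<^sup>2)"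
    by (simp add: grad_def norm_Pair norm_vec_sq grv_nth gr_nth sum_nonneg)
  moreover have "0 \<le> (\<Sum>i\<in>UNIV. (norm (d2 (y, grad y) $ i))\<^sup>2)" "0 \<le> (\<Sum>i\<in>UNIV. \<Sum>j\<in>UNIV. (norm (d3 (y, grad y) $ i $ j))\<^sup>2)"
    by (simp_all add: sum_nonneg)
  moreover have "n \<le> 2 * (b + c + d)" if "a \<le> 2 * b" "n = a + c + d" "0 \<le> c" "0 \<le> d" for a b c d n :: real
    using that by simp
  ultimately show ?thesis by blast
qed

lemma norm_le_grad: "\<exists>C\<ge>0. \<forall>y\<in>W. (norm y)\<^sup>2 \<le> C * (norm (grad y))\<^sup>2"
proof -
  obtain C where C: "C \<ge> 0" "\<And>f. f \<in> W012 \<Omega> \<Longrightarrow> norm f \<le> C * norm (weak_pd \<Omega> 1 f)"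
    using poincare by blast
  have f: "(norm f)\<^sup>2 \<le> C\<^sup>2 * (norm (gr f))\<^sup>2" if "f \<in> W012 \<Omega>" for f
  proof -
    have "norm f \<le> C * norm (gr f)"
      using C(2)[OF that] C(1) Finite_Cartesian_Product.norm_nth_le[of "gr f" 1] by (simp add: gr_nth) (meson mult_left_mono order.trans)
    then have "(norm f)\<^sup>2 \<le> (C * norm (gr f))\<^sup>2" by (intro power_mono) auto
    then show ?thesis by (simp add: power_mult_distrib)
  qed
  have "(norm y)\<^sup>2 \<le> C\<^sup>2 * (norm (grad y))\<^sup>2" if y: "y \<in> W" for y
  proof -
    have "(norm y)\<^sup>2 = (\<Sum>i\<in>UNIV. (norm (fst y $ i))\<^sup>2) + (norm (fst (snd y)))\<^sup>2 + (\<Sum>i\<in>UNIV. (norm (snd (snd y) $ i))\<^sup>2)"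
      by (cases y) (simp add: norm_Pair norm_vec_sq sum_nonneg)
    also have "\<dots> \<le> (\<Sum>i\<in>UNIV. C\<^sup>2 * (norm (gr (fst y $ i)))\<^sup>2) + C\<^sup>2 * (norm (gr (fst (snd y))))\<^sup>2
        + (\<Sum>i\<in>UNIV. C\<^sup>2 * (norm (gr (snd (snd y) $ i)))\<^sup>2)"
      using W_D[OF y] by (intro add_mono sum_mono f) auto
    also have "\<dots> = C\<^sup>2 * (norm (grad y))\<^sup>2"
      by (simp add: grad_def norm_Pair norm_vec_sq[where 'a = "l2^3"] grv_nth sum_nonneg distrib_left sum_distrib_left)
    finally show ?thesis .
  qed
  then show ?thesis by (intro exI[of _ "C\<^sup>2"]) auto
qed

lemma form_a_coercive: "\<exists>c>0. \<forall>p\<in>V. c * (norm p)\<^sup>2 \<le> form_a p p"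
proof -
  obtain C where C: "C \<ge> 0" "\<And>y. y \<in> W \<Longrightarrow> (norm y)\<^sup>2 \<le> C * (norm (grad y))\<^sup>2" using norm_le_grad by blast
  obtain c0 where c0: "c0 > 0" and co: "\<And>u \<tau> R. u \<in> W012vec \<Omega> \<Longrightarrow> \<tau> \<in> W012 \<Omega> \<Longrightarrow> R \<in> W012vec \<Omega> \<Longrightarrow>
        (LINT x:\<Omega>|lebesgue.
           (\<Sum>i\<in>UNIV. \<Sum>j\<in>UNIV. \<Sum>k\<in>UNIV. \<Sum>l\<in>UNIV.
              At P i j k l x * strain \<Omega> u k l x * strain \<Omega> u i j x +
              2 * Bt P i j k l x * strain \<Omega> u i j x * wd \<Omega> (R $ k) l x +
              Ct P i j k l x * wd \<Omega> (R $ i) j x * wd \<Omega> (R $ k) l x) +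
           (\<Sum>i\<in>UNIV. \<Sum>j\<in>UNIV. kc P i j x * wd \<Omega> \<tau> i x * wd \<Omega> \<tau> j x))
        \<ge> c0 *
        (LINT x:\<Omega>|lebesgue.
           (\<Sum>i\<in>UNIV. \<Sum>j\<in>UNIV. strain \<Omega> u i j x * strain \<Omega> u i j x) +
           (\<Sum>i\<in>UNIV. wd \<Omega> \<tau> i x * wd \<Omega> \<tau> i x) +
           (\<Sum>i\<in>UNIV. \<Sum>j\<in>UNIV. wd \<Omega> (R $ i) j x * wd \<Omega> (R $ i) j x))"
    using adm unfolding admissible_def coeffs_coercive_def by blast
  \<comment> \<open>The factor 2 is the constant of Korn's inequality; \<open>C + 1\<close> comes
    from Poincare's inequality, which bounds the values by the gradients already counted.\<close>
  have "c0 / (2 * (C + 1)) * (norm p)\<^sup>2 \<le> form_a p p" if pV: "p \<in> V" for p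
  proof -
    obtain y where y: "y \<in> W" "p = (y, grad y)" using pV unfolding V_def by blast
    define u \<tau> R where "u = fst y" and "\<tau> = fst (snd y)" and "R = snd (snd y)"
    have m: "u \<in> W012vec \<Omega>" "\<tau> \<in> W012 \<Omega>" "R \<in> W012vec \<Omega>"
      using y(1) by (auto simp: u_def \<tau>_def R_def W_def)
    have "hasI (\<lambda>x. (\<Sum>i\<in>UNIV. \<Sum>j\<in>UNIV. strain \<Omega> u i j x * strain \<Omega> u i j x) +
           (\<Sum>i\<in>UNIV. wd \<Omega> \<tau> i x * wd \<Omega> \<tau> i x) +
           (\<Sum>i\<in>UNIV. \<Sum>j\<in>UNIV. wd \<Omega> (R $ i) j x * wd \<Omega> (R $ i) j x))
        ((\<Sum>i\<in>UNIV. \<Sum>j\<in>UNIV. inner (sym_d1 (y, grad y) i j) (sym_d1 (y, grad y) i j))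
    + (\<Sum>i\<in>UNIV. inner (d2 (y, grad y) $ i) (d2 (y, grad y) $ i)) + (\<Sum>i\<in>UNIV. \<Sum>j\<in>UNIV. inner (d3 (y, grad y) $ i $ j) (d3 (y, grad y) $ i $ j)))"
      unfolding u_def \<tau>_def R_def
      by (intro hasI_add hasI_sum hasI_prod reps_strain reps_d2 reps_d3 y(1))
    moreover have "hasI (\<lambda>x. (\<Sum>i\<in>UNIV. \<Sum>j\<in>UNIV. \<Sum>k\<in>UNIV. \<Sum>l\<in>UNIV.
              At P i j k l x * strain \<Omega> u k l x * strain \<Omega> u i j x +
              2 * Bt P i j k l x * strain \<Omega> u i j x * wd \<Omega> (R $ k) l x +
              Ct P i j k l x * wd \<Omega> (R $ i) j x * wd \<Omega> (R $ k) l x) +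
           (\<Sum>i\<in>UNIV. \<Sum>j\<in>UNIV. kc P i j x * wd \<Omega> \<tau> i x * wd \<Omega> \<tau> j x)) (form_a p p)"
      unfolding y(2) by (rule hasI_cong[OF hasI_density_a[OF y(1) y(1)]])
        (simp add: density_a_def u_def \<tau>_def R_def mult.assoc mult.left_commute[of 2])
    ultimately have "c0 * ((\<Sum>i\<in>UNIV. \<Sum>j\<in>UNIV. (norm (sym_d1 (y, grad y) i j))\<^sup>2)
        + (\<Sum>i\<in>UNIV. (norm (d2 (y, grad y) $ i))\<^sup>2) + (\<Sum>i\<in>UNIV. \<Sum>j\<in>UNIV. (norm (d3 (y, grad y) $ i $ j))\<^sup>2)) \<le> form_a p p"
      using co[OF m] unfolding hasI_def power2_norm_eq_inner by simp
    moreover have "c0 / 2 * (norm (grad y))\<^sup>2 \<le> c0 / 2 * (2 * ((\<Sum>i\<in>UNIV. \<Sum>j\<in>UNIV. (norm (sym_d1 (y, grad y) i j))\<^sup>2)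
        + (\<Sum>i\<in>UNIV. (norm (d2 (y, grad y) $ i))\<^sup>2) + (\<Sum>i\<in>UNIV. \<Sum>j\<in>UNIV. (norm (d3 (y, grad y) $ i $ j))\<^sup>2)))"
      using c0 by (intro mult_left_mono norm_grad_le y) auto
    ultimately have 1: "c0 / 2 * (norm (grad y))\<^sup>2 \<le> form_a p p" by linarith
    have "(norm p)\<^sup>2 = (norm y)\<^sup>2 + (norm (grad y))\<^sup>2" by (simp add: y(2) norm_Pair)
    also have "\<dots> \<le> (C + 1) * (norm (grad y))\<^sup>2" using C(2)[OF y(1)] by (simp add: distrib_right)
    finally have "c0 / (2 * (C + 1)) * (norm p)\<^sup>2 \<le> c0 / (2 * (C + 1)) * ((C + 1) * (norm (grad y))\<^sup>2)"
      using c0 C(1) by (intro mult_left_mono) auto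
    also have "\<dots> = c0 / 2 * (norm (grad y))\<^sup>2" using C(1) by (simp add: field_simps)
    finally show ?thesis using 1 by linarith
  qed
  then show ?thesis using c0 C(1) by (intro exI[of _ "c0 / (2 * (C + 1))"]) auto
qed

lemma form_b_nonneg:
  assumes "p \<in> V"
  shows "0 \<le> form_b p p"
proof -
  obtain y where y: "y \<in> W" "p = (y, grad y)" using assms unfolding V_def by blast
  have t: "reps \<Omega> (rep_l2 (fst (snd y))) (theta_of (y, grad y))"
    using reps_rep[OF W012_L2[OF W_D(2)[OF y(1)]]] by simp
  have m: "reps \<Omega> (rep_l2 (snd (snd y) $ i)) (micro_of (y, grad y) $ i)" for i
    using reps_rep[OF W012_L2[OF W_D(3)[OF y(1)]]] by simp
  have "hasI (\<lambda>x. (\<Sum>i\<in>UNIV. \<Sum>j\<in>UNIV. ((\<Sum>k\<in>UNIV. \<Sum>l\<in>UNIV. Ctt P j i k l x * wd \<Omega> (snd (snd y) $ k) l x)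
        - bc P j i x * rep_l2 (fst (snd y)) x) * wd \<Omega> (snd (snd y) $ i) j x)
    + (\<Sum>i\<in>UNIV. \<Sum>j\<in>UNIV. (- (ac P j i x * rep_l2 (fst (snd y)) x)) * wd \<Omega> (fst y $ i) j x)
    + (\<Sum>i\<in>UNIV. \<Sum>j\<in>UNIV. ac P i j x * wd \<Omega> (fst y $ i) j x) * rep_l2 (fst (snd y)) x
    + (\<Sum>i\<in>UNIV. \<Sum>j\<in>UNIV. bc P j i x * wd \<Omega> (snd (snd y) $ i) j x) * rep_l2 (fst (snd y)) x
    + (\<Sum>i\<in>UNIV. (\<Sum>j\<in>UNIV. ktc P i j x * wd \<Omega> (fst (snd y)) j x - dc P i j x * rep_l2 (snd (snd y) $ j) x) * wd \<Omega> (fst (snd y)) i x)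
    + (\<Sum>i\<in>UNIV. (\<Sum>j\<in>UNIV. dc P i j x * wd \<Omega> (fst (snd y)) j x) * rep_l2 (snd (snd y) $ i) x)) (form_b p p)" (is "hasI ?f _")
    unfolding form_b_def y(2)
    by (intro hasI_add hasI_sum hasI_prod reps_diff reps_minus reps_sum reps_mul bcoefs reps_d1 reps_d2 reps_d3 y(1) t m)
  then show ?thesis
  proof (rule hasI_mono[OF hasI_zero])
    fix x assume x: "x \<in> \<Omega>"
    then have "x \<in> closure \<Omega>" using closure_subset by blast
    then have "(\<Sum>i\<in>UNIV. \<Sum>j\<in>UNIV. ktc P i j x * \<xi> $ i * \<xi> $ j) +
        (\<Sum>i\<in>UNIV. \<Sum>j\<in>UNIV. \<Sum>k\<in>UNIV. \<Sum>l\<in>UNIV.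
           Ctt P i j k l x * m $ l $ k * m $ i $ j) \<ge> 0" for \<xi> :: "real^3" and m :: "real^3^3"
      using adm unfolding admissible_def coeffs_positive_def by blast
    then show "0 \<le> ?f x"
      by (intro dissipation_density_nonneg symmetries(7)[OF x] symmetries(9)[OF x])
  qed
qed

definition density_m :: "triple \<Rightarrow> triple \<Rightarrow> real^3 \<Rightarrow> real" where
  "density_m z w x =
    (\<Sum>i\<in>UNIV. rho P x * rep_l2 (fst z $ i) x * rep_l2 (fst w $ i) x)
    + thc P x * rep_l2 (fst (snd z)) x * rep_l2 (fst (snd w)) x
    + (\<Sum>i\<in>UNIV. \<Sum>j\<in>UNIV. mc P i j x * rep_l2 (snd (snd z) $ i) x * rep_l2 (snd (snd w) $ j) x)"

lemma hasI_density_m: "z \<in> H \<Longrightarrow> w \<in> H \<Longrightarrow> hasI (density_m z w) (form_m z w)"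
  unfolding form_m_def density_m_def[abs_def]
  by (intro hasI_add hasI_sum hasI_mul3 bcoefs reps_rep H_D)

lemma form_m_sym:
  assumes "z \<in> H" "w \<in> H"
  shows "form_m z w = form_m w z"
proof (rule hasI_eq[OF hasI_density_m hasI_density_m])
  fix x assume x: "x \<in> \<Omega>"
  have "(\<Sum>i\<in>UNIV. \<Sum>j\<in>UNIV. mc P i j x * rep_l2 (snd (snd z) $ i) x * rep_l2 (snd (snd w) $ j) x)
      = (\<Sum>i\<in>UNIV. \<Sum>j\<in>UNIV. mc P i j x * rep_l2 (snd (snd w) $ i) x * rep_l2 (snd (snd z) $ j) x)"
    by (subst sum.swap, intro sum.cong refl) (simp add: symmetries(8)[OF x] mult_ac)
  then show "density_m z w x = density_m w z x" by (simp add: density_m_def mult_ac)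
qed (use assms in auto)

section \<open>Coercivity of the inertia form\<close>

lemma compact_closure_region: "compact (closure \<Omega>)"
  using bounded_region by simp

lemma positive_lower_bound:
  fixes f :: "'a::metric_space \<Rightarrow> real"
  assumes "compact K" "continuous_on K f" "\<And>x. x \<in> K \<Longrightarrow> f x > 0"
  shows "\<exists>r>0. \<forall>x\<in>K. r \<le> f x"
proof (cases "K = {}")
  case False
  then obtain x where "x \<in> K" "\<And>y. y \<in> K \<Longrightarrow> f x \<le> f y"
    using continuous_attains_inf[OF assms(1) _ assms(2)] by blast
  then show ?thesis using assms(3) by blast
qed (auto intro: exI[of _ 1])

text \<open>Pointwise definiteness is uniform by compactness of the closed domain times the unit
  sphere; the quadratic form is homogeneous of degree two in the vector.\<close>

lemma mc_positive:
  "\<exists>\<mu>>0. \<forall>x\<in>closure \<Omega>. \<forall>\<xi>::real^3. \<mu> * (norm \<xi>)\<^sup>2 \<le> (\<Sum>i\<in>UNIV. \<Sum>j\<in>UNIV. mc P i j x * \<xi> $ i * \<xi> $ j)"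
proof -
  define f where "f p = (\<Sum>i\<in>UNIV. \<Sum>j\<in>UNIV. mc P i j (fst p) * snd p $ i * snd p $ j)" for p :: "(real^3) \<times> (real^3)"
  have c: "continuous_on (closure \<Omega> \<times> sphere 0 1) f"
    unfolding f_def
    by (intro continuous_intros continuous_on_compose2[OF coef_continuous(3) continuous_on_fst[OF continuous_on_id]]) auto
  have "\<exists>r>0. \<forall>p\<in>closure \<Omega> \<times> sphere 0 1. r \<le> f p"
  proof (rule positive_lower_bound[OF _ c])
    show "compact (closure \<Omega> \<times> sphere (0::real^3) 1)"
      by (intro compact_Times compact_closure_region compact_sphere)
    show "f p > 0" if p: "p \<in> closure \<Omega> \<times> sphere 0 1" for p
    proof -
      have "snd p \<noteq> 0" "fst p \<in> closure \<Omega>" using p by auto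
      then show ?thesis using adm unfolding f_def admissible_def coeffs_positive_def by blast
    qed
  qed
  then obtain \<mu> where \<mu>: "\<mu> > 0" "\<And>p. p \<in> closure \<Omega> \<times> sphere 0 1 \<Longrightarrow> \<mu> \<le> f p" by blast
  have "\<mu> * (norm \<xi>)\<^sup>2 \<le> (\<Sum>i\<in>UNIV. \<Sum>j\<in>UNIV. mc P i j x * \<xi> $ i * \<xi> $ j)"
    if x: "x \<in> closure \<Omega>" for x and \<xi> :: "real^3"
  proof (cases "\<xi> = 0")
    case False
    define \<eta> where "\<eta> = \<xi> /\<^sub>R norm \<xi>"
    have "\<mu> \<le> f (x, \<eta>)" using x False by (intro \<mu>) (simp add: \<eta>_def)
    then have "\<mu> * (norm \<xi>)\<^sup>2 \<le> f (x, \<eta>) * (norm \<xi>)\<^sup>2" by (intro mult_right_mono) auto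
    also have "f (x, \<eta>) * (norm \<xi>)\<^sup>2 = f (x, norm \<xi> *\<^sub>R \<eta>)"
      by (simp add: f_def sum_distrib_left sum_distrib_right power2_eq_square mult_ac)
    also have "norm \<xi> *\<^sub>R \<eta> = \<xi>" using False by (simp add: \<eta>_def)
    finally show ?thesis by (simp add: f_def)
  qed simp
  then show ?thesis using \<mu>(1) by blast
qed

lemma form_m_coercive: "\<exists>c>0. \<forall>z\<in>H. c * (norm z)\<^sup>2 \<le> form_m z z"
proof -
  have pos: "rho P x > 0" "thc P x > 0" if "x \<in> closure \<Omega>" for x
    using adm that unfolding admissible_def coeffs_positive_def by blast+
  obtain r where r: "r > 0" "\<And>x. x \<in> closure \<Omega> \<Longrightarrow> r \<le> rho P x"
    using positive_lower_bound[OF compact_closure_region coef_continuous(1)] pos by blast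
  obtain t where t: "t > 0" "\<And>x. x \<in> closure \<Omega> \<Longrightarrow> t \<le> thc P x"
    using positive_lower_bound[OF compact_closure_region coef_continuous(2)] pos by blast
  obtain \<mu> where \<mu>: "\<mu> > 0" "\<And>x \<xi>. x \<in> closure \<Omega> \<Longrightarrow> \<mu> * (norm (\<xi>::real^3))\<^sup>2 \<le> (\<Sum>i\<in>UNIV. \<Sum>j\<in>UNIV. mc P i j x * \<xi> $ i * \<xi> $ j)"
    using mc_positive by blast
  define c where "c = min r (min t \<mu>)"
  have c: "c > 0" "c \<le> r" "c \<le> t" "c \<le> \<mu>" using r t \<mu> by (auto simp: c_def)
  have "c * (norm z)\<^sup>2 \<le> form_m z z" if z: "z \<in> H" for z
  proof -
    have "hasI (\<lambda>x. c * ((\<Sum>i\<in>UNIV. rep_l2 (fst z $ i) x * rep_l2 (fst z $ i) x)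
        + rep_l2 (fst (snd z)) x * rep_l2 (fst (snd z)) x + (\<Sum>i\<in>UNIV. rep_l2 (snd (snd z) $ i) x * rep_l2 (snd (snd z) $ i) x)))
        (c * ((\<Sum>i\<in>UNIV. inner (fst z $ i) (fst z $ i)) + inner (fst (snd z)) (fst (snd z)) + (\<Sum>i\<in>UNIV. inner (snd (snd z) $ i) (snd (snd z) $ i))))"
      by (intro hasI_scale hasI_add hasI_sum hasI_prod reps_rep H_D z)
    moreover have "(\<Sum>i\<in>UNIV. inner (fst z $ i) (fst z $ i)) + inner (fst (snd z)) (fst (snd z)) + (\<Sum>i\<in>UNIV. inner (snd (snd z) $ i) (snd (snd z) $ i)) = (norm z)\<^sup>2"
      by (cases z) (simp add: norm_Pair norm_vec_sq power2_norm_eq_inner[symmetric] sum_nonneg)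
    ultimately have "hasI (\<lambda>x. c * ((\<Sum>i\<in>UNIV. rep_l2 (fst z $ i) x * rep_l2 (fst z $ i) x)
        + rep_l2 (fst (snd z)) x * rep_l2 (fst (snd z)) x + (\<Sum>i\<in>UNIV. rep_l2 (snd (snd z) $ i) x * rep_l2 (snd (snd z) $ i) x)))
        (c * (norm z)\<^sup>2)" by simp
    then show ?thesis
    proof (rule hasI_mono[OF _ hasI_density_m[OF z z]])
      fix x assume "x \<in> \<Omega>"
      then have x: "x \<in> closure \<Omega>" using closure_subset by blast
      have 1: "(\<Sum>i\<in>UNIV. c * (rep_l2 (fst z $ i) x * rep_l2 (fst z $ i) x)) \<le> (\<Sum>i\<in>UNIV. rho P x * rep_l2 (fst z $ i) x * rep_l2 (fst z $ i) x)"
        using r(2)[OF x] c by (intro sum_mono) (simp add: mult.assoc mult_right_mono)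
      have 2: "c * (rep_l2 (fst (snd z)) x * rep_l2 (fst (snd z)) x) \<le> thc P x * rep_l2 (fst (snd z)) x * rep_l2 (fst (snd z)) x"
        using t(2)[OF x] c by (simp add: mult.assoc mult_right_mono)
      define \<xi> :: "real^3" where "\<xi> = (\<chi> i. rep_l2 (snd (snd z) $ i) x)"
      have "c * (norm \<xi>)\<^sup>2 \<le> \<mu> * (norm \<xi>)\<^sup>2" using c by (intro mult_right_mono) auto
      then have "c * (norm \<xi>)\<^sup>2 \<le> (\<Sum>i\<in>UNIV. \<Sum>j\<in>UNIV. mc P i j x * \<xi> $ i * \<xi> $ j)"
        using \<mu>(2)[OF x, of \<xi>] by linarith
      moreover have "(norm \<xi>)\<^sup>2 = (\<Sum>i\<in>UNIV. rep_l2 (snd (snd z) $ i) x * rep_l2 (snd (snd z) $ i) x)"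
        unfolding norm_vec_sq by (simp add: \<xi>_def power2_eq_square)
      ultimately have 3: "c * (\<Sum>i\<in>UNIV. rep_l2 (snd (snd z) $ i) x * rep_l2 (snd (snd z) $ i) x)
          \<le> (\<Sum>i\<in>UNIV. \<Sum>j\<in>UNIV. mc P i j x * rep_l2 (snd (snd z) $ i) x * rep_l2 (snd (snd z) $ j) x)"
        by (simp add: \<xi>_def)
      show "c * ((\<Sum>i\<in>UNIV. rep_l2 (fst z $ i) x * rep_l2 (fst z $ i) x)
        + rep_l2 (fst (snd z)) x * rep_l2 (fst (snd z)) x + (\<Sum>i\<in>UNIV. rep_l2 (snd (snd z) $ i) x * rep_l2 (snd (snd z) $ i) x)) \<le> density_m z z x"
        unfolding density_m_def distrib_left using 1 2 3 by (simp only: sum_distrib_left add_mono)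
    qed
  qed
  then show ?thesis using c(1) by blast
qed

text \<open>The symmetry of \<open>mc\<close> lets the sum over the first factor be completed before
  testing, so that each component of the test function meets a single class.\<close>

lemma form_m_weak:
  "form_m r w = (\<Sum>i\<in>UNIV. inner (mul \<Omega> (rho P) (fst r $ i)) (fst w $ i))
    + inner (mul \<Omega> (thc P) (fst (snd r))) (fst (snd w))
    + (\<Sum>i\<in>UNIV. inner (\<Sum>j\<in>UNIV. mul \<Omega> (mc P i j) (snd (snd r) $ j)) (snd (snd w) $ i))"
proof -
  have "mul \<Omega> (mc P i j) f = mul \<Omega> (mc P j i) f" for i j f
    by (rule mul_cong) (rule symmetries(8))
  then have "(\<Sum>i\<in>UNIV. \<Sum>j\<in>UNIV. inner (mul \<Omega> (mc P i j) (snd (snd r) $ i)) (snd (snd w) $ j))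
    = (\<Sum>i\<in>UNIV. inner (\<Sum>j\<in>UNIV. mul \<Omega> (mc P i j) (snd (snd r) $ j)) (snd (snd w) $ i))"
    by (subst sum.swap) (simp add: inner_sum_left)
  then show ?thesis by (simp add: form_m_def)
qed

text \<open>Test triples with one nonzero component; they split the single weak equation into the
  scalar equations of the system.\<close>

definition only1 :: "3 \<Rightarrow> l2 \<Rightarrow> triple" where "only1 i w = ((\<chi> k. if k = i then w else 0), 0, 0)"
definition only2 :: "l2 \<Rightarrow> triple" where "only2 w = (0, w, 0)"
definition only3 :: "3 \<Rightarrow> l2 \<Rightarrow> triple" where "only3 i w = (0, 0, (\<chi> k. if k = i then w else 0))"

lemma only_W: "w \<in> W012 \<Omega> \<Longrightarrow> only1 i w \<in> W" "w \<in> W012 \<Omega> \<Longrightarrow> only2 w \<in> W" "w \<in> W012 \<Omega> \<Longrightarrow> only3 i w \<in> W"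
  by (auto simp: W_def W012vec_def only1_def only2_def only3_def W012_zero)

lemma sum_inner_only:
  "(\<Sum>k\<in>UNIV. inner (f k) (if k = i then w else (0::'a::real_inner))) = inner (f (i::'n::finite)) w"
  by (simp add: if_distrib[of "inner _"] cong: if_cong)

lemma form_m_only:
  "form_m r (only1 i w) = inner (mul \<Omega> (rho P) (fst r $ i)) w"
  "form_m r (only2 w) = inner (mul \<Omega> (thc P) (fst (snd r))) w"
  "form_m r (only3 i w) = inner (\<Sum>j\<in>UNIV. mul \<Omega> (mc P i j) (snd (snd r) $ j)) w"
  by (simp_all add: form_m_weak only1_def only2_def only3_def sum_inner_only)

text \<open>Testing the components separately shows that the three products of \<open>r\<close> with
  \<open>rho\<close>, \<open>thc\<close> and \<open>mc\<close> vanish. Then the inertia form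
  vanishes at \<open>r\<close> itself, and coercivity gives \<open>r = 0\<close> without dividing by
  coefficients.\<close>

lemma V_dense:
  assumes r: "r \<in> H" and z: "\<And>\<phi>. \<phi> \<in> V \<Longrightarrow> form_m r (fst \<phi>) = 0"
  shows "r = 0"
proof -
  have z': "form_m r w = 0" if "w \<in> W" for w using z[of "(w, grad w)"] that by (simp add: V_iff)
  have 1: "mul \<Omega> (rho P) (fst r $ i) = 0" for i
    using z'[OF only_W(1)] by (intro L2_zero_if_orthogonal L2_mul bcoefs H_D r) (simp add: form_m_only)
  have 2: "mul \<Omega> (thc P) (fst (snd r)) = 0"
    using z'[OF only_W(2)] by (intro L2_zero_if_orthogonal L2_mul bcoefs H_D r) (simp add: form_m_only)
  have 3: "(\<Sum>j\<in>UNIV. mul \<Omega> (mc P i j) (snd (snd r) $ j)) = 0" for i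
    using z'[OF only_W(3)] by (intro L2_zero_if_orthogonal subspace_sum subspace_L2 L2_mul bcoefs H_D r) (simp add: form_m_only)
  have "form_m r r = 0" by (simp add: form_m_weak 1 2 3)
  then show ?thesis using form_m_coercive r by (metis mult_le_0_iff norm_eq_zero not_less order_refl power2_less_eq_zero_iff)
qed

text \<open>The locale takes one common constant as a parameter, so a fixed choice is made for both
  forms.\<close>

definition coercivity :: real where
  "coercivity = (SOME c. c > 0 \<and> (\<forall>p\<in>V. c * (norm p)\<^sup>2 \<le> form_a p p) \<and> (\<forall>z\<in>H. c * (norm z)\<^sup>2 \<le> form_m z z))"

lemma coercivity: "coercivity > 0" "p \<in> V \<Longrightarrow> coercivity * (norm p)\<^sup>2 \<le> form_a p p" "z \<in> H \<Longrightarrow> coercivity * (norm z)\<^sup>2 \<le> form_m z z"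
proof -
  obtain a m where a: "a > 0" "\<And>p. p \<in> V \<Longrightarrow> a * (norm p)\<^sup>2 \<le> form_a p p"
    and m: "m > 0" "\<And>z. z \<in> H \<Longrightarrow> m * (norm z)\<^sup>2 \<le> form_m z z"
    using form_a_coercive form_m_coercive by blast
  have "min a m * (norm p)\<^sup>2 \<le> form_a p p" if "p \<in> V" for p
    using a(2)[OF that] mult_right_mono[of "min a m" a "(norm p)\<^sup>2"] by simp
  moreover have "min a m * (norm z)\<^sup>2 \<le> form_m z z" if "z \<in> H" for z
    using m(2)[OF that] mult_right_mono[of "min a m" m "(norm z)\<^sup>2"] by simp
  ultimately have "\<exists>c. c > 0 \<and> (\<forall>p\<in>V. c * (norm p)\<^sup>2 \<le> form_a p p) \<and> (\<forall>z\<in>H. c * (norm z)\<^sup>2 \<le> form_m z z)"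
    using a(1) m(1) by (intro exI[of _ "min a m"]) auto
  from someI_ex[OF this] show "coercivity > 0" "p \<in> V \<Longrightarrow> coercivity * (norm p)\<^sup>2 \<le> form_a p p" "z \<in> H \<Longrightarrow> coercivity * (norm z)\<^sup>2 \<le> form_m z z"
    unfolding coercivity_def[symmetric] by auto
qed

sublocale E: second_order V H form_a form_b form_m coercivity
proof (rule second_order.intro)
  show "fst p \<in> H" if "p \<in> V" for p using that W_H by (simp add: V_iff)
  show "g = 0" if g: "(0, g) \<in> V" for g
  proof -
    have "grad 0 = 0" by (simp add: grad_eq_iff W012_zero)
    then show ?thesis using g by (simp add: V_iff)
  qed
  show "r = 0" if "r \<in> H" "\<And>\<phi>. \<phi> \<in> V \<Longrightarrow> form_m r (fst \<phi>) = 0" for r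
    using that by (rule V_dense)
  show "form_a p q = form_a q p" if "p \<in> V" "q \<in> V" for p q using that by (rule form_a_sym)
  show "form_m p q = form_m q p" if "p \<in> H" "q \<in> H" for p q using that by (rule form_m_sym)
  show "coercivity * (norm p)\<^sup>2 \<le> form_a p p" if "p \<in> V" for p using that by (rule coercivity)
  show "coercivity * (norm z)\<^sup>2 \<le> form_m z z" if "z \<in> H" for z using that by (rule coercivity)
  show "0 \<le> form_b p p" if "p \<in> V" for p using that by (rule form_b_nonneg)
qed (fact closed_V subspace_V closed_H subspace_H bilinear_form_a bilinear_form_b bilinear_form_m coercivity(1))+

end

section \<open>The operator as a dissipative relation\<close>

lemma matrix_inv_mult:
  assumes "invertible A"
  shows "A ** matrix_inv A = mat 1" "matrix_inv A ** A = mat 1"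
  using someI_ex[OF assms[unfolded invertible_def]] unfolding matrix_inv_def by auto

context thermo
begin

text \<open>The classes under the divergence in the brackets, with \<open>p\<close> for the
  positions and \<open>q\<close> for the velocities. The \<open>src\<close> definitions below
  collect the terms outside the divergences, with reversed sign.\<close>

definition flux2 :: "triple \<times> gradient \<Rightarrow> triple \<times> gradient \<Rightarrow> 3 \<Rightarrow> 3 \<Rightarrow> l2" where
  "flux2 p q i j = (\<Sum>k\<in>UNIV. \<Sum>l\<in>UNIV. mul \<Omega> (At P j i k l) (d1 p $ k $ l))
    - mul \<Omega> (ac P j i) (theta_of q) + (\<Sum>k\<in>UNIV. \<Sum>l\<in>UNIV. mul \<Omega> (Bt P j i k l) (d3 p $ l $ k))"

definition flux4 :: "triple \<times> gradient \<Rightarrow> triple \<times> gradient \<Rightarrow> 3 \<Rightarrow> l2" where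
  "flux4 p q i = (\<Sum>j\<in>UNIV. mul \<Omega> (kc P i j) (d2 p $ j) + mul \<Omega> (ktc P i j) (d2 q $ j)
    - mul \<Omega> (dc P i j) (micro_of q $ j))"

definition flux6 :: "triple \<times> gradient \<Rightarrow> triple \<times> gradient \<Rightarrow> 3 \<Rightarrow> 3 \<Rightarrow> l2" where
  "flux6 p q i j = (\<Sum>k\<in>UNIV. \<Sum>l\<in>UNIV. mul \<Omega> (Bt P k l j i) (d1 p $ k $ l))
    - mul \<Omega> (bc P j i) (theta_of q) + (\<Sum>k\<in>UNIV. \<Sum>l\<in>UNIV. mul \<Omega> (Ct P j i k l) (d3 p $ k $ l))
    + (\<Sum>k\<in>UNIV. \<Sum>l\<in>UNIV. mul \<Omega> (Ctt P j i k l) (d3 q $ k $ l))"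

definition src4a :: "triple \<times> gradient \<Rightarrow> l2" where
  "src4a q = (\<Sum>i\<in>UNIV. \<Sum>j\<in>UNIV. mul \<Omega> (ac P i j) (d1 q $ i $ j))"

definition src4b :: "triple \<times> gradient \<Rightarrow> l2" where
  "src4b q = (\<Sum>i\<in>UNIV. \<Sum>j\<in>UNIV. mul \<Omega> (bc P j i) (d3 q $ i $ j))"

definition src6 :: "triple \<times> gradient \<Rightarrow> 3 \<Rightarrow> l2" where
  "src6 q i = (\<Sum>j\<in>UNIV. mul \<Omega> (dc P i j) (d2 q $ j))"

lemma form_a_weak:
  assumes "p \<in> V" "q \<in> V"
  shows "form_a p q =
    (\<Sum>i\<in>UNIV. \<Sum>j\<in>UNIV. inner ((\<Sum>k\<in>UNIV. \<Sum>l\<in>UNIV. mul \<Omega> (At P j i k l) (d1 p $ k $ l))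
        + (\<Sum>k\<in>UNIV. \<Sum>l\<in>UNIV. mul \<Omega> (Bt P j i k l) (d3 p $ l $ k))) (d1 q $ i $ j))
    + (\<Sum>i\<in>UNIV. \<Sum>j\<in>UNIV. inner ((\<Sum>k\<in>UNIV. \<Sum>l\<in>UNIV. mul \<Omega> (Bt P k l j i) (d1 p $ k $ l))
        + (\<Sum>k\<in>UNIV. \<Sum>l\<in>UNIV. mul \<Omega> (Ct P j i k l) (d3 p $ k $ l))) (d3 q $ i $ j))
    + (\<Sum>i\<in>UNIV. inner (\<Sum>j\<in>UNIV. mul \<Omega> (kc P i j) (d2 p $ j)) (d2 q $ i))"
proof -
  obtain y w where y: "y \<in> W" "p = (y, grad y)" and w: "w \<in> W" "q = (w, grad w)"
    using assms unfolding V_def by blast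
  have "hasI (\<lambda>x. (\<Sum>i\<in>UNIV. \<Sum>j\<in>UNIV. ((\<Sum>k\<in>UNIV. \<Sum>l\<in>UNIV. At P j i k l x * wd \<Omega> (fst y $ k) l x)
        + (\<Sum>k\<in>UNIV. \<Sum>l\<in>UNIV. Bt P j i k l x * wd \<Omega> (snd (snd y) $ l) k x)) * wd \<Omega> (fst w $ i) j x)
    + (\<Sum>i\<in>UNIV. \<Sum>j\<in>UNIV. ((\<Sum>k\<in>UNIV. \<Sum>l\<in>UNIV. Bt P k l j i x * wd \<Omega> (fst y $ k) l x)
        + (\<Sum>k\<in>UNIV. \<Sum>l\<in>UNIV. Ct P j i k l x * wd \<Omega> (snd (snd y) $ k) l x)) * wd \<Omega> (snd (snd w) $ i) j x)
    + (\<Sum>i\<in>UNIV. (\<Sum>j\<in>UNIV. kc P i j x * wd \<Omega> (fst (snd y)) j x) * wd \<Omega> (fst (snd w)) i x))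
   ((\<Sum>i\<in>UNIV. \<Sum>j\<in>UNIV. inner ((\<Sum>k\<in>UNIV. \<Sum>l\<in>UNIV. mul \<Omega> (At P j i k l) (d1 (y, grad y) $ k $ l))
        + (\<Sum>k\<in>UNIV. \<Sum>l\<in>UNIV. mul \<Omega> (Bt P j i k l) (d3 (y, grad y) $ l $ k))) (d1 (w, grad w) $ i $ j))
    + (\<Sum>i\<in>UNIV. \<Sum>j\<in>UNIV. inner ((\<Sum>k\<in>UNIV. \<Sum>l\<in>UNIV. mul \<Omega> (Bt P k l j i) (d1 (y, grad y) $ k $ l))
        + (\<Sum>k\<in>UNIV. \<Sum>l\<in>UNIV. mul \<Omega> (Ct P j i k l) (d3 (y, grad y) $ k $ l))) (d3 (w, grad w) $ i $ j))
    + (\<Sum>i\<in>UNIV. inner (\<Sum>j\<in>UNIV. mul \<Omega> (kc P i j) (d2 (y, grad y) $ j)) (d2 (w, grad w) $ i)))" (is "hasI ?f ?v")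
    by (intro hasI_add hasI_sum hasI_prod reps_add reps_sum reps_mul bcoefs reps_d1 reps_d2 reps_d3 y w)
  moreover have "density_a y w x = ?f x" if x: "x \<in> \<Omega>" for x
  proof -
    have k: "(\<Sum>i\<in>UNIV. \<Sum>j\<in>UNIV. kc P i j x * wd \<Omega> (fst (snd y)) i x * wd \<Omega> (fst (snd w)) j x)
      = (\<Sum>i\<in>UNIV. (\<Sum>j\<in>UNIV. kc P i j x * wd \<Omega> (fst (snd y)) j x) * wd \<Omega> (fst (snd w)) i x)"
      by (subst sum.swap) (simp add: sum_distrib_right symmetries(10)[OF x])
    show ?thesis
      unfolding density_a_def strain_def k
      by (subst energy_density_weak_form) (simp_all add: symmetries[OF x])
  qed
  ultimately show ?thesis
    using hasI_eq[OF hasI_density_a[OF y(1) w(1)]] unfolding y w by blast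
qed

lemma forms_weak:
  assumes "p \<in> V" "\<phi> \<in> V"
  shows "form_a p \<phi> + form_b q \<phi> =
      (\<Sum>i\<in>UNIV. \<Sum>j\<in>UNIV. inner (flux2 p q i j) (d1 \<phi> $ i $ j))
      + (inner (src4a q + src4b q) (theta_of \<phi>) + (\<Sum>i\<in>UNIV. inner (flux4 p q i) (d2 \<phi> $ i)))
      + ((\<Sum>i\<in>UNIV. \<Sum>j\<in>UNIV. inner (flux6 p q i j) (d3 \<phi> $ i $ j)) + (\<Sum>i\<in>UNIV. inner (src6 q i) (micro_of \<phi> $ i)))"
  unfolding form_a_weak[OF assms] form_b_def flux2_def flux4_def flux6_def src4a_def[symmetric] src4b_def[symmetric] src6_def[symmetric]
  by (simp add: inner_add_left inner_diff_left sum.distrib sum_subtractf sum_negf)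

text \<open>Decoupling: test triples with one nonzero component give the scalar equations, and these
  add up to the full equation since both sides are linear in the test function.\<close>

lemma G_components:
  assumes p: "p \<in> V" and q: "q \<in> V"
  shows "(\<forall>\<phi>\<in>V. form_m r (fst \<phi>) + form_a p \<phi> + form_b q \<phi> = 0) \<longleftrightarrow>
    (\<forall>i. \<forall>w\<in>W012 \<Omega>. inner (mul \<Omega> (rho P) (fst r $ i)) w + (\<Sum>j\<in>UNIV. inner (flux2 p q i j) (weak_pd \<Omega> j w)) = 0) \<and>
    (\<forall>w\<in>W012 \<Omega>. inner (mul \<Omega> (thc P) (fst (snd r)) + (src4a q + src4b q)) w
        + (\<Sum>i\<in>UNIV. inner (flux4 p q i) (weak_pd \<Omega> i w)) = 0) \<and>
    (\<forall>i. \<forall>w\<in>W012 \<Omega>. inner ((\<Sum>j\<in>UNIV. mul \<Omega> (mc P i j) (snd (snd r) $ j)) + src6 q i) w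
        + (\<Sum>j\<in>UNIV. inner (flux6 p q i j) (weak_pd \<Omega> j w)) = 0)" (is "?L \<longleftrightarrow> ?R")
proof
  assume L: ?L
  have z: "form_m r w + (form_a p (w, grad w) + form_b q (w, grad w)) = 0" if "w \<in> W" for w
    using L[rule_format, of "(w, grad w)"] that by (simp add: V_iff add.assoc)
  have f: "form_a p (w, grad w) + form_b q (w, grad w) =
      (\<Sum>i\<in>UNIV. \<Sum>j\<in>UNIV. inner (flux2 p q i j) (weak_pd \<Omega> j (fst w $ i)))
      + (inner (src4a q + src4b q) (fst (snd w)) + (\<Sum>i\<in>UNIV. inner (flux4 p q i) (weak_pd \<Omega> i (fst (snd w)))))
      + ((\<Sum>i\<in>UNIV. \<Sum>j\<in>UNIV. inner (flux6 p q i j) (weak_pd \<Omega> j (snd (snd w) $ i))) + (\<Sum>i\<in>UNIV. inner (src6 q i) (snd (snd w) $ i)))"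
    if "w \<in> W" for w
    using forms_weak[OF p, of "(w, grad w)" q] that by (simp add: V_iff grad_def grv_nth gr_nth)
  have w0: "weak_pd \<Omega> j 0 = 0" for j using W012_zero(2) gr_nth[of 0 j] by simp
  have s: "(\<Sum>k\<in>UNIV. \<Sum>j\<in>UNIV. inner (F k j) (weak_pd \<Omega> j (if k = i then w else 0)))
      = (\<Sum>j\<in>UNIV. inner (F i j) (weak_pd \<Omega> j w))" for F w and i :: 3
  proof -
    have "(\<Sum>j\<in>UNIV. inner (F k j) (weak_pd \<Omega> j (if k = i then w else 0)))
        = (if k = i then (\<Sum>j\<in>UNIV. inner (F i j) (weak_pd \<Omega> j w)) else 0)" for k
      by (simp add: w0)
    then show ?thesis by simp
  qed
  show ?R
  proof (intro conjI allI ballI)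
    fix i w assume w: "w \<in> W012 \<Omega>"
    show "inner (mul \<Omega> (rho P) (fst r $ i)) w + (\<Sum>j\<in>UNIV. inner (flux2 p q i j) (weak_pd \<Omega> j w)) = 0"
      using z[OF only_W(1)[OF w, of i]] f[OF only_W(1)[OF w, of i]]
      unfolding form_m_only by (simp add: only1_def s w0)
    show "inner ((\<Sum>j\<in>UNIV. mul \<Omega> (mc P i j) (snd (snd r) $ j)) + src6 q i) w
        + (\<Sum>j\<in>UNIV. inner (flux6 p q i j) (weak_pd \<Omega> j w)) = 0"
      using z[OF only_W(3)[OF w, of i]] f[OF only_W(3)[OF w, of i]]
      unfolding form_m_only by (simp add: only3_def s w0 sum_inner_only inner_add_left)
  next
    fix w assume w: "w \<in> W012 \<Omega>"
    show "inner (mul \<Omega> (thc P) (fst (snd r)) + (src4a q + src4b q)) w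
        + (\<Sum>i\<in>UNIV. inner (flux4 p q i) (weak_pd \<Omega> i w)) = 0"
      using z[OF only_W(2)[OF w]] f[OF only_W(2)[OF w]]
      unfolding form_m_only by (simp add: only2_def w0 inner_add_left)
  qed
next
  assume R: ?R
  show ?L
  proof
    fix \<phi> assume \<phi>: "\<phi> \<in> V"
    then have w: "fst \<phi> \<in> W" and g: "snd \<phi> = grad (fst \<phi>)" by (auto simp: V_iff)
    have d: "d1 \<phi> $ i $ j = weak_pd \<Omega> j (fst (fst \<phi>) $ i)" "d2 \<phi> $ j = weak_pd \<Omega> j (theta_of \<phi>)"
      "d3 \<phi> $ i $ j = weak_pd \<Omega> j (micro_of \<phi> $ i)" for i j
      by (simp_all add: g grad_def grv_nth gr_nth)
    have 1: "(\<Sum>i\<in>UNIV. inner (mul \<Omega> (rho P) (fst r $ i)) (fst (fst \<phi>) $ i))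
        + (\<Sum>i\<in>UNIV. \<Sum>j\<in>UNIV. inner (flux2 p q i j) (d1 \<phi> $ i $ j)) = 0"
      unfolding sum.distrib[symmetric] d using R W_D(1)[OF w] by (intro sum.neutral) blast
    have 2: "inner (mul \<Omega> (thc P) (fst (snd r)) + (src4a q + src4b q)) (theta_of \<phi>)
        + (\<Sum>i\<in>UNIV. inner (flux4 p q i) (d2 \<phi> $ i)) = 0"
      unfolding d using R W_D(2)[OF w] by blast
    have 3: "(\<Sum>i\<in>UNIV. inner ((\<Sum>j\<in>UNIV. mul \<Omega> (mc P i j) (snd (snd r) $ j)) + src6 q i) (micro_of \<phi> $ i))
        + (\<Sum>i\<in>UNIV. \<Sum>j\<in>UNIV. inner (flux6 p q i j) (d3 \<phi> $ i $ j)) = 0"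
      unfolding sum.distrib[symmetric] d using R W_D(3)[OF w] by (intro sum.neutral) blast
    have "form_m r (fst \<phi>) + (form_a p \<phi> + form_b q \<phi>) = 0"
      unfolding form_m_weak forms_weak[OF p \<phi>] using 1 2 3
      by (simp add: inner_add_left sum.distrib)
    then show "form_m r (fst \<phi>) + form_a p \<phi> + form_b q \<phi> = 0" by simp
  qed
qed

text \<open>Passage between the variational equation on W_0^{1,2} and the equation in the sense of
  distributions, by density of the test functions.\<close>

lemma weak_form_iff_test:
  "(\<forall>w\<in>W012 \<Omega>. inner g w + (\<Sum>j\<in>UNIV. inner (F j) (weak_pd \<Omega> j w)) = 0) \<longleftrightarrow>
   (\<forall>\<phi>. test_fun \<Omega> \<phi> \<longrightarrow> inner g (cls \<phi>) = - (\<Sum>j\<in>UNIV. inner (F j) (cls (pd j \<phi>))))"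
  (is "?L \<longleftrightarrow> ?R")
proof
  assume L: ?L
  show ?R
  proof (intro allI impI)
    fix \<phi> assume t: "test_fun \<Omega> \<phi>"
    show "inner g (cls \<phi>) = - (\<Sum>j\<in>UNIV. inner (F j) (cls (pd j \<phi>)))"
      using bspec[OF L test_W012[OF t]] by (simp add: weak_form_test[OF t] eq_neg_iff_add_eq_0)
  qed
next
  assume R: ?R
  show ?L
  proof
    fix w assume "w \<in> W012 \<Omega>"
    then show "inner g w + (\<Sum>j\<in>UNIV. inner (F j) (weak_pd \<Omega> j w)) = 0"
      by (rule weak_form_extend[rotated]) (use R in simp)
  qed
qed

context
  fixes u v R M :: "l2^3" and \<tau> \<theta> :: l2
  assumes y: "(u, \<tau>, R) \<in> W" and z: "(v, \<theta>, M) \<in> W"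
begin

private abbreviation (input) "y \<equiv> (u, \<tau>, R)"
private abbreviation (input) "z \<equiv> (v, \<theta>, M)"

lemma brackets:
  assumes t: "test_fun \<Omega> \<phi>"
  shows "bracket2 \<Omega> P (u, v, \<tau>, \<theta>, R, M) i \<phi>
      = - (\<Sum>j\<in>UNIV. inner (flux2 (y, grad y) (z, grad z) i j) (cls (pd j \<phi>)))" (is ?b2)
    and "bracket4 \<Omega> P (u, v, \<tau>, \<theta>, R, M) \<phi>
      = - inner (src4a (z, grad z) + src4b (z, grad z)) (cls \<phi>)
        - (\<Sum>j\<in>UNIV. inner (flux4 (y, grad y) (z, grad z) j) (cls (pd j \<phi>)))" (is ?b4)
    and "bracket6 \<Omega> P (u, v, \<tau>, \<theta>, R, M) i \<phi>
      = - inner (src6 (z, grad z) i) (cls \<phi>)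
        - (\<Sum>j\<in>UNIV. inner (flux6 (y, grad y) (z, grad z) i j) (cls (pd j \<phi>)))" (is ?b6)
proof -
  have rt: "reps \<Omega> (rep_l2 \<theta>) (theta_of (z, grad z))" using reps_rep[OF W012_L2[OF W_D(2)[OF z]]] by simp
  have rm: "reps \<Omega> (rep_l2 (M $ j)) (micro_of (z, grad z) $ j)" for j
    using reps_rep[OF W012_L2[OF W_D(3)[OF z]]] by simp
  note d = reps_d1[OF y, simplified fst_conv snd_conv] reps_d2[OF y, simplified fst_conv snd_conv]
    reps_d3[OF y, simplified fst_conv snd_conv] reps_d1[OF z, simplified fst_conv snd_conv]
    reps_d2[OF z, simplified fst_conv snd_conv] reps_d3[OF z, simplified fst_conv snd_conv]
    rt[simplified fst_conv snd_conv] rm[simplified fst_conv snd_conv]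
  have f2: "reps \<Omega> (\<lambda>x. (\<Sum>k\<in>UNIV. \<Sum>l\<in>UNIV. At P j i k l x * wd \<Omega> (u $ k) l x)
       - ac P j i x * rep_l2 \<theta> x
       + (\<Sum>k\<in>UNIV. \<Sum>l\<in>UNIV. Bt P j i k l x * wd \<Omega> (R $ l) k x)) (flux2 (y, grad y) (z, grad z) i j)" for j
    unfolding flux2_def fst_conv snd_conv by (intro reps_add reps_diff reps_sum reps_mul bcoefs d)
  show ?b2 by (simp add: ddist_inner[OF f2 t] sum_negf)
  have f4: "reps \<Omega> (\<lambda>x. \<Sum>j\<in>UNIV. kc P i j x * wd \<Omega> \<tau> j x + ktc P i j x * wd \<Omega> \<theta> j x
         - dc P i j x * rep_l2 (M $ j) x) (flux4 (y, grad y) (z, grad z) i)" for i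
    unfolding flux4_def fst_conv snd_conv by (intro reps_add reps_diff reps_sum reps_mul bcoefs d)
  have s4a: "reps \<Omega> (\<lambda>x. \<Sum>i\<in>UNIV. \<Sum>j\<in>UNIV. ac P i j x * wd \<Omega> (v $ i) j x) (src4a (z, grad z))"
    unfolding src4a_def fst_conv snd_conv by (intro reps_sum reps_mul bcoefs d)
  have s4b: "reps \<Omega> (\<lambda>x. \<Sum>i\<in>UNIV. \<Sum>j\<in>UNIV. bc P j i x * wd \<Omega> (M $ i) j x) (src4b (z, grad z))"
    unfolding src4b_def fst_conv snd_conv by (intro reps_sum reps_mul bcoefs d)
  show ?b4
    by (simp add: ddist_inner[OF f4 t] distr_of_inner[OF s4a t] distr_of_inner[OF s4b t] sum_negf inner_add_left)
  have f6: "reps \<Omega> (\<lambda>x. (\<Sum>k\<in>UNIV. \<Sum>l\<in>UNIV. Bt P k l j i x * wd \<Omega> (u $ k) l x)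
       - bc P j i x * rep_l2 \<theta> x
       + (\<Sum>k\<in>UNIV. \<Sum>l\<in>UNIV. Ct P j i k l x * wd \<Omega> (R $ k) l x)
       + (\<Sum>k\<in>UNIV. \<Sum>l\<in>UNIV. Ctt P j i k l x * wd \<Omega> (M $ k) l x)) (flux6 (y, grad y) (z, grad z) i j)" for j
    unfolding flux6_def fst_conv snd_conv by (intro reps_add reps_diff reps_sum reps_mul bcoefs d)
  have s6: "reps \<Omega> (\<lambda>x. \<Sum>j\<in>UNIV. dc P i j x * wd \<Omega> \<theta> j x) (src6 (z, grad z) i)"
    unfolding src6_def fst_conv snd_conv by (intro reps_sum reps_mul bcoefs d)
  show ?b6
    by (simp add: ddist_inner[OF f6 t] distr_of_inner[OF s6 t] sum_negf)
qed

text \<open>For velocities in W_0^{1,2} the abstract relation is the distributional system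
  multiplied through by the coefficients of inertia; \<open>rho\<close>, \<open>thc\<close> and
  \<open>mc\<close> stand on the left, and nothing is inverted yet.\<close>

lemma G_iff_brackets:
  "(((y, grad y), z), ((z, grad z), r)) \<in> E.G \<longleftrightarrow> r \<in> H \<and>
    (\<forall>\<phi>. test_fun \<Omega> \<phi> \<longrightarrow>
      (\<forall>i. inner (mul \<Omega> (rho P) (fst r $ i)) (cls \<phi>) = bracket2 \<Omega> P (u, v, \<tau>, \<theta>, R, M) i \<phi>) \<and>
      inner (mul \<Omega> (thc P) (fst (snd r))) (cls \<phi>) = bracket4 \<Omega> P (u, v, \<tau>, \<theta>, R, M) \<phi> \<and>
      (\<forall>i. inner (\<Sum>j\<in>UNIV. mul \<Omega> (mc P i j) (snd (snd r) $ j)) (cls \<phi>) = bracket6 \<Omega> P (u, v, \<tau>, \<theta>, R, M) i \<phi>))"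
proof -
  have p: "(y, grad y) \<in> V" "(z, grad z) \<in> V" using y z by (auto simp: V_iff)
  have "(((y, grad y), z), ((z, grad z), r)) \<in> E.G \<longleftrightarrow> r \<in> H \<and>
      (\<forall>\<phi>\<in>V. form_m r (fst \<phi>) + form_a (y, grad y) \<phi> + form_b (z, grad z) \<phi> = 0)"
    using p by (simp add: E.G_def)
  also have "\<dots> \<longleftrightarrow> r \<in> H \<and>
    (\<forall>i. \<forall>\<phi>. test_fun \<Omega> \<phi> \<longrightarrow> inner (mul \<Omega> (rho P) (fst r $ i)) (cls \<phi>) = bracket2 \<Omega> P (u, v, \<tau>, \<theta>, R, M) i \<phi>) \<and>
    (\<forall>\<phi>. test_fun \<Omega> \<phi> \<longrightarrow> inner (mul \<Omega> (thc P) (fst (snd r))) (cls \<phi>) = bracket4 \<Omega> P (u, v, \<tau>, \<theta>, R, M) \<phi>) \<and>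
    (\<forall>i. \<forall>\<phi>. test_fun \<Omega> \<phi> \<longrightarrow> inner (\<Sum>j\<in>UNIV. mul \<Omega> (mc P i j) (snd (snd r) $ j)) (cls \<phi>) = bracket6 \<Omega> P (u, v, \<tau>, \<theta>, R, M) i \<phi>)"
  proof -
    have 2: "inner g (cls \<phi>) = - (\<Sum>j\<in>UNIV. inner (flux2 (y, grad y) (z, grad z) i j) (cls (pd j \<phi>)))
        \<longleftrightarrow> inner g (cls \<phi>) = bracket2 \<Omega> P (u, v, \<tau>, \<theta>, R, M) i \<phi>" if "test_fun \<Omega> \<phi>" for \<phi> i g
      unfolding brackets(1)[OF that] ..
    have 4: "inner (g + (src4a (z, grad z) + src4b (z, grad z))) (cls \<phi>) = - (\<Sum>j\<in>UNIV. inner (flux4 (y, grad y) (z, grad z) j) (cls (pd j \<phi>)))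
        \<longleftrightarrow> inner g (cls \<phi>) = bracket4 \<Omega> P (u, v, \<tau>, \<theta>, R, M) \<phi>" if "test_fun \<Omega> \<phi>" for \<phi> g
      unfolding brackets(2)[OF that] inner_add_left by linarith
    have 6: "inner (g + src6 (z, grad z) i) (cls \<phi>) = - (\<Sum>j\<in>UNIV. inner (flux6 (y, grad y) (z, grad z) i j) (cls (pd j \<phi>)))
        \<longleftrightarrow> inner g (cls \<phi>) = bracket6 \<Omega> P (u, v, \<tau>, \<theta>, R, M) i \<phi>" if "test_fun \<Omega> \<phi>" for \<phi> i g
      unfolding brackets(3)[OF that] inner_add_left by linarith
    show ?thesis
      unfolding G_components[OF p] weak_form_iff_test using 2 4 6 by (simp cong: imp_cong del: bracket2.simps bracket4.simps bracket6.simps)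
  qed
  finally show ?thesis by blast
qed

end

section \<open>Inverting the multiplications by \<open>rho\<close>, \<open>thc\<close> and the
  matrix \<open>mc\<close>\<close>

lemma mul_inverse:
  assumes "bcoef \<Omega> c" "bcoef \<Omega> d" "f \<in> L2 \<Omega>" "\<And>x. x \<in> \<Omega> \<Longrightarrow> c x * d x = 1"
  shows "mul \<Omega> c (mul \<Omega> d f) = f"
proof (rule reps_unique)
  show "reps \<Omega> (\<lambda>x. c x * (d x * rep_l2 f x)) (mul \<Omega> c (mul \<Omega> d f))"
    by (intro reps_mul reps_rep assms)
  show "reps \<Omega> (\<lambda>x. c x * (d x * rep_l2 f x)) f"
    by (rule reps_cong[OF reps_rep[OF assms(3)]]) (simp add: assms(4) flip: mult.assoc)
qed

lemma mul_inverse_matrix: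
  fixes c d :: "'n::finite \<Rightarrow> 'n \<Rightarrow> real^3 \<Rightarrow> real"
  assumes "\<And>i j. bcoef \<Omega> (c i j)" "\<And>i j. bcoef \<Omega> (d i j)" "\<And>i. f i \<in> L2 \<Omega>"
    and "\<And>x i k. x \<in> \<Omega> \<Longrightarrow> (\<Sum>j\<in>UNIV. c i j x * d j k x) = (if i = k then 1 else 0)"
  shows "(\<Sum>j\<in>UNIV. mul \<Omega> (c i j) (\<Sum>k\<in>UNIV. mul \<Omega> (d j k) (f k))) = f i"
proof (rule reps_unique)
  show "reps \<Omega> (\<lambda>x. \<Sum>j\<in>UNIV. c i j x * (\<Sum>k\<in>UNIV. d j k x * rep_l2 (f k) x))
      (\<Sum>j\<in>UNIV. mul \<Omega> (c i j) (\<Sum>k\<in>UNIV. mul \<Omega> (d j k) (f k)))"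
    by (intro reps_sum reps_mul reps_rep assms)
  show "reps \<Omega> (\<lambda>x. \<Sum>j\<in>UNIV. c i j x * (\<Sum>k\<in>UNIV. d j k x * rep_l2 (f k) x)) (f i)"
  proof (rule reps_cong[OF reps_rep[OF assms(3)]])
    fix x assume x: "x \<in> \<Omega>"
    have "(\<Sum>j\<in>UNIV. c i j x * (\<Sum>k\<in>UNIV. d j k x * rep_l2 (f k) x))
        = (\<Sum>k\<in>UNIV. (\<Sum>j\<in>UNIV. c i j x * d j k x) * rep_l2 (f k) x)"
      unfolding sum_distrib_left sum_distrib_right mult.assoc by (rule sum.swap)
    also have "\<dots> = rep_l2 (f i) x" by (simp add: assms(4)[OF x] if_distrib[of "\<lambda>a. a * _"] cong: if_cong)
    finally show "rep_l2 (f i) x = (\<Sum>j\<in>UNIV. c i j x * (\<Sum>k\<in>UNIV. d j k x * rep_l2 (f k) x))" by simp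
  qed
qed

abbreviation mcm :: "real^3 \<Rightarrow> real^3^3" where "mcm x \<equiv> (\<chi> p q. mc P p q x)"

lemma mc_invertible: "x \<in> closure \<Omega> \<Longrightarrow> invertible (mcm x)"
proof -
  assume x: "x \<in> closure \<Omega>"
  have "\<xi> = 0" if "mcm x *v \<xi> = 0" for \<xi>
  proof (rule ccontr)
    assume "\<xi> \<noteq> 0"
    then have "0 < (\<Sum>i\<in>UNIV. \<Sum>j\<in>UNIV. mc P i j x * \<xi> $ i * \<xi> $ j)"
      using adm x unfolding admissible_def coeffs_positive_def by blast
    also have "\<dots> = (\<Sum>i\<in>UNIV. \<xi> $ i * (mcm x *v \<xi>) $ i)"
      by (simp add: matrix_vector_mult_def sum_distrib_left mult_ac)
    also have "\<dots> = 0" by (simp add: that)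
    finally show False by simp
  qed
  then show ?thesis by (simp add: invertible_left_inverse matrix_left_invertible_ker)
qed

lemma mc_inv_sums:
  assumes "x \<in> closure \<Omega>"
  shows "(\<Sum>j\<in>UNIV. mc P i j x * mc_inv P j k x) = (if i = k then 1 else 0)"
    and "(\<Sum>j\<in>UNIV. mc_inv P i j x * mc P j k x) = (if i = k then 1 else 0)"
proof -
  have "mcm x ** matrix_inv (mcm x) = mat 1" "matrix_inv (mcm x) ** mcm x = mat 1"
    using matrix_inv_mult[OF mc_invertible[OF assms]] by auto
  then have "(mcm x ** matrix_inv (mcm x)) $ i $ k = mat 1 $ i $ k" "(matrix_inv (mcm x) ** mcm x) $ i $ k = mat 1 $ i $ k"
    by simp_all
  then show "(\<Sum>j\<in>UNIV. mc P i j x * mc_inv P j k x) = (if i = k then 1 else 0)"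
    "(\<Sum>j\<in>UNIV. mc_inv P i j x * mc P j k x) = (if i = k then 1 else 0)"
    by (simp_all add: matrix_matrix_mult_def mat_def mc_inv_def)
qed

text \<open>By Cramer's rule, applied to the equation whose solution is a column of the inverse,
  each entry is a quotient of determinants, that is, of polynomials in the continuous entries of
  \<open>mc\<close>.\<close>

lemma mc_inv_continuous: "continuous_on (closure \<Omega>) (mc_inv P s i)"
proof -
  have e: "mc_inv P s i x = det (\<chi> a b. if b = s then axis i 1 $ a else mc P a b x) / det (mcm x)"
    if x: "x \<in> closure \<Omega>" for x
  proof -
    have inv: "invertible (mcm x)" by (rule mc_invertible[OF x])
    then have "mcm x *v (matrix_inv (mcm x) *v axis i 1) = axis i 1"
      using matrix_inv_mult[OF inv] by (simp add: matrix_vector_mul_assoc)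
    then have "matrix_inv (mcm x) *v axis i 1 = (\<chi> k. det (\<chi> a b. if b = k then axis i 1 $ a else mcm x $ a $ b) / det (mcm x))"
      using inv by (subst (asm) cramer) (simp_all add: invertible_det_nz)
    then have "(matrix_inv (mcm x) *v axis i 1) $ s = det (\<chi> a b. if b = s then axis i 1 $ a else mc P a b x) / det (mcm x)"
      by (simp cong: if_cong)
    moreover have "(matrix_inv (mcm x) *v axis i 1) $ s = mc_inv P s i x"
      by (simp add: matrix_vector_mult_basis column_def mc_inv_def)
    ultimately show ?thesis by simp
  qed
  have c: "continuous_on (closure \<Omega>) (\<lambda>x. if b = s then axis i 1 $ a else mc P a b x)" for a b
    using coef_continuous(3) by (cases "b = s") (auto intro: continuous_on_const)
  have "continuous_on (closure \<Omega>) (\<lambda>x. det (\<chi> a b. if b = s then axis i 1 $ a else mc P a b x) / det (mcm x))"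
    using mc_invertible unfolding invertible_det_nz
    by (intro continuous_on_divide) (auto simp: det_def intro!: continuous_intros c coef_continuous)
  then show ?thesis by (rule continuous_on_eq) (simp add: e)
qed

lemma coef_positive: "x \<in> closure \<Omega> \<Longrightarrow> rho P x > 0" "x \<in> closure \<Omega> \<Longrightarrow> thc P x > 0"
  using adm unfolding admissible_def coeffs_positive_def by blast+

lemma bcoefs_inverse:
  "bcoef \<Omega> (\<lambda>x. inverse (rho P x))" "bcoef \<Omega> (\<lambda>x. inverse (thc P x))" "bcoef \<Omega> (mc_inv P i j)"
  "bcoef \<Omega> (\<lambda>x. inverse (thc P x) * rho P x)" "bcoef \<Omega> (\<lambda>x. mc_inv P i j x * rho P x)"
  using coef_positive mc_inv_continuous coef_continuous
  by (intro bcoef_continuous continuous_intros; force)+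

lemma inverse_rho: "f \<in> L2 \<Omega> \<Longrightarrow> mul \<Omega> (rho P) (mul \<Omega> (\<lambda>x. inverse (rho P x)) f) = f"
  "f \<in> L2 \<Omega> \<Longrightarrow> mul \<Omega> (\<lambda>x. inverse (rho P x)) (mul \<Omega> (rho P) f) = f"
  using coef_positive closure_subset by (intro mul_inverse bcoefs bcoefs_inverse; force)+

lemma inverse_thc: "f \<in> L2 \<Omega> \<Longrightarrow> mul \<Omega> (thc P) (mul \<Omega> (\<lambda>x. inverse (thc P x)) f) = f"
  "f \<in> L2 \<Omega> \<Longrightarrow> mul \<Omega> (\<lambda>x. inverse (thc P x)) (mul \<Omega> (thc P) f) = f"
  using coef_positive closure_subset by (intro mul_inverse bcoefs bcoefs_inverse; force)+

lemma inverse_mc: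
  assumes "\<And>i. f i \<in> L2 \<Omega>"
  shows "(\<Sum>j\<in>UNIV. mul \<Omega> (mc P i j) (\<Sum>k\<in>UNIV. mul \<Omega> (mc_inv P j k) (f k))) = f i"
    and "(\<Sum>j\<in>UNIV. mul \<Omega> (mc_inv P i j) (\<Sum>k\<in>UNIV. mul \<Omega> (mc P j k) (f k))) = f i"
  using mc_inv_sums closure_subset by (intro mul_inverse_matrix bcoefs bcoefs_inverse assms; blast)+

lemma l2_on_mc_inv:
  "(\<And>i. g $ i \<in> L2 \<Omega>) \<Longrightarrow> l2_on \<Omega> (\<lambda>x. \<Sum>i\<in>UNIV. mc_inv P s i x * rep_l2 (g $ i) x) = (\<Sum>i\<in>UNIV. mul \<Omega> (mc_inv P s i) (g $ i))"
  by (intro reps_l2_on_eq reps_sum reps_mul bcoefs_inverse reps_rep)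

end

section \<open>Translation of the Cauchy problem\<close>

text \<open>\<open>deriv_in\<close> is stated with difference quotients, the semigroup theory with
  vector derivatives; both mean the same on any set of times.\<close>

lemma has_vector_derivative_iff_quotient:
  "(f has_vector_derivative D) (at t within A) \<longleftrightarrow>
    ((\<lambda>s. (1 / (s - t)) *\<^sub>R (f s - f t)) \<longlongrightarrow> D) (at t within A)"
proof -
  have "(f has_vector_derivative D) (at t within A) \<longleftrightarrow>
      ((\<lambda>s. (f s - f t - (s - t) *\<^sub>R D) /\<^sub>R norm (s - t)) \<longlongrightarrow> 0) (at t within A)"
    unfolding has_vector_derivative_def has_derivative_within
    by (auto intro!: bounded_linear_scaleR_left simp: diff_diff_eq divide_inverse)
  also have "\<dots> \<longleftrightarrow> ((\<lambda>s. norm ((f s - f t - (s - t) *\<^sub>R D) /\<^sub>R norm (s - t))) \<longlongrightarrow> 0) (at t within A)"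
    by (rule tendsto_norm_zero_iff[symmetric])
  also have "\<dots> \<longleftrightarrow> ((\<lambda>s. norm ((1 / (s - t)) *\<^sub>R (f s - f t) - D)) \<longlongrightarrow> 0) (at t within A)"
  proof (rule filterlim_cong[OF refl refl])
    show "\<forall>\<^sub>F s in at t within A. norm ((f s - f t - (s - t) *\<^sub>R D) /\<^sub>R norm (s - t))
        = norm ((1 / (s - t)) *\<^sub>R (f s - f t) - D)"
      unfolding eventually_at_filter
    proof (intro always_eventually allI impI)
      fix s assume st: "s \<noteq> t"
      have "norm ((f s - f t - (s - t) *\<^sub>R D) /\<^sub>R norm (s - t)) = norm ((f s - f t - (s - t) *\<^sub>R D) /\<^sub>R (s - t))"
        by simp
      also have "(f s - f t - (s - t) *\<^sub>R D) /\<^sub>R (s - t) = (1 / (s - t)) *\<^sub>R (f s - f t) - D"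
        using st by (simp add: scaleR_diff_right divide_inverse)
      finally show "norm ((f s - f t - (s - t) *\<^sub>R D) /\<^sub>R norm (s - t)) = norm ((1 / (s - t)) *\<^sub>R (f s - f t) - D)" .
    qed
  qed
  also have "\<dots> \<longleftrightarrow> ((\<lambda>s. (1 / (s - t)) *\<^sub>R (f s - f t)) \<longlongrightarrow> D) (at t within A)"
    by (simp add: tendsto_norm_zero_iff LIM_zero_iff)
  finally show ?thesis .
qed

lemma deriv_in_norm: "deriv_in norm u t D \<longleftrightarrow> (u has_vector_derivative D) (at t within {0..})"
  unfolding deriv_in_def has_vector_derivative_iff_quotient by (simp add: tendsto_norm_zero_iff LIM_zero_iff)

lemma C0_in_norm: "C0_in X norm u \<longleftrightarrow> (\<forall>t\<ge>0. u t \<in> X) \<and> continuous_on {0..} u"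
  unfolding C0_in_def continuous_on_def by (auto simp: tendsto_norm_zero_iff LIM_zero_iff)

lemma has_vector_derivative_vec:
  assumes "\<And>i. ((\<lambda>t. f t $ i) has_vector_derivative D $ i) (at t within A)"
  shows "(f has_vector_derivative D) (at t within A)"
  using assms unfolding has_vector_derivative_iff_quotient by (intro vec_tendstoI) simp

lemma bounded_linear_vec_lambda:
  fixes f :: "'n::finite \<Rightarrow> 'a::real_normed_vector \<Rightarrow> 'b::real_normed_vector"
  assumes "\<And>i. bounded_linear (f i)"
  shows "bounded_linear (\<lambda>x. \<chi> i. f i x)"
proof -
  have "\<exists>K. \<forall>x. norm (f i x) \<le> norm x * K" for i using bounded_linear.bounded[OF assms] .
  then obtain K where K: "\<And>i x. norm (f i x) \<le> norm x * K i" by metis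
  show ?thesis
  proof (rule bounded_linear_intro[where K = "\<Sum>i\<in>UNIV. K i"])
    fix x
    have "norm (\<chi> i. f i x) \<le> (\<Sum>i\<in>UNIV. norm (f i x))"
      unfolding norm_vec_def by (rule order.trans[OF L2_set_le_sum]) auto
    also have "\<dots> \<le> norm x * (\<Sum>i\<in>UNIV. K i)" unfolding sum_distrib_left by (intro sum_mono K)
    finally show "norm (\<chi> i. f i x) \<le> norm x * (\<Sum>i\<in>UNIV. K i)" .
  qed (simp_all add: vec_eq_iff linear_add[OF bounded_linear.linear[OF assms]] linear_scale[OF bounded_linear.linear[OF assms]])
qed

lemma eventually_half_line: "(\<And>s. s \<ge> 0 \<Longrightarrow> Q s) \<Longrightarrow> \<forall>\<^sub>F s in at t within {0::real..}. Q s"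
  unfolding eventually_at_filter by (rule always_eventually) auto

context thermo
begin

text \<open>Reorders a state into position and velocity and attaches the gradient of the position.
  The type norm of a state sees no derivatives, whereas the norm of \<open>Phi U\<close> is
  equivalent to \<open>Hnorm\<close> on the Hilbert space.\<close>

definition Phi :: "state \<Rightarrow> (triple \<times> gradient) \<times> triple" where
  "Phi = (\<lambda>(u, v, \<tau>, \<theta>, R, M). (((u, \<tau>, R), grad (u, \<tau>, R)), (v, \<theta>, M)))"

definition Psi :: "(triple \<times> gradient) \<times> triple \<Rightarrow> state" where
  "Psi X = (fst (fst (fst X)), fst (snd X), fst (snd (fst (fst X))), fst (snd (snd X)),
     snd (snd (fst (fst X))), snd (snd (snd X)))"

lemma Psi_Phi: "Psi (Phi U) = U"
  by (cases U) (simp add: Phi_def Psi_def)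

lemma Phi_Psi: "X \<in> E.S \<Longrightarrow> Phi (Psi X) = X"
  by (simp add: Phi_def Psi_def E.S_def V_iff mem_Times_iff prod_eq_iff)

lemma H_iff: "(v, \<theta>, M) \<in> H \<longleftrightarrow> v \<in> L2vec \<Omega> \<and> \<theta> \<in> L2 \<Omega> \<and> M \<in> L2vec \<Omega>"
  by (simp add: H_def)

lemma Phi_S: "U \<in> Hsp \<Omega> \<longleftrightarrow> Phi U \<in> E.S"
  by (cases U) (auto simp: Phi_def E.S_def V_iff W_def H_iff Hsp_def)

lemma Psi_Hsp: "X \<in> E.S \<Longrightarrow> Psi X \<in> Hsp \<Omega>"
  by (simp add: Phi_S Phi_Psi)

lemma Psi_add: "Psi (X + Y) = Psi X + Psi Y"
  and Psi_diff: "Psi (X - Y) = Psi X - Psi Y"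
  and Psi_scale: "Psi (c *\<^sub>R X) = c *\<^sub>R Psi X"
  by (simp_all add: Psi_def)

text \<open>Outside the Hilbert space \<open>Phi\<close> need not be linear, as weak gradients are
  chosen by \<open>THE\<close>. Its left inverse \<open>Psi\<close> merely forgets gradients and is
  linear everywhere; linearity on the subspace is transported along it.\<close>

lemma Phi_diff: "U \<in> Hsp \<Omega> \<Longrightarrow> U' \<in> Hsp \<Omega> \<Longrightarrow> Phi (U - U') = Phi U - Phi U' \<and> U - U' \<in> Hsp \<Omega>"
  by (metis E.S_diff Phi_Psi Phi_S Psi_Hsp Psi_Phi Psi_diff)

lemma Phi_scale: "U \<in> Hsp \<Omega> \<Longrightarrow> Phi (c *\<^sub>R U) = c *\<^sub>R Phi U \<and> c *\<^sub>R U \<in> Hsp \<Omega>"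
  by (metis E.S_scale Phi_Psi Phi_S Psi_Hsp Psi_Phi Psi_scale)

lemma Phi_add: "U \<in> Hsp \<Omega> \<Longrightarrow> U' \<in> Hsp \<Omega> \<Longrightarrow> Phi (U + U') = Phi U + Phi U' \<and> U + U' \<in> Hsp \<Omega>"
  by (metis E.S_add Phi_Psi Phi_S Psi_Hsp Psi_Phi Psi_add)

text \<open>Multiplying the entries of the image by the coefficients undoes the inverses and
  recovers the classes \<open>G2\<close>, \<open>G4\<close>, \<open>G6\<close> identified with the
  brackets.\<close>

lemma A_graph_imp_G:
  assumes A: "A_graph \<Omega> P U U'"
  shows "(Phi U, Phi U') \<in> E.G"
proof -
  obtain u v \<tau> \<theta> R M where U: "U = (u, v, \<tau>, \<theta>, R, M)" by (cases U)
  obtain G2 G4 G6 where G: "G2 \<in> L2vec \<Omega>" "G4 \<in> L2 \<Omega>" "G6 \<in> L2vec \<Omega>"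
    and e2: "\<And>i. eq_distr \<Omega> (distr_of \<Omega> (rep_l2 (G2 $ i))) (bracket2 \<Omega> P U i)"
    and e4: "eq_distr \<Omega> (distr_of \<Omega> (rep_l2 G4)) (bracket4 \<Omega> P U)"
    and e6: "\<And>i. eq_distr \<Omega> (distr_of \<Omega> (rep_l2 (G6 $ i))) (bracket6 \<Omega> P U i)"
    and U': "U' = (v, (\<chi> i. l2_on \<Omega> (\<lambda>x. inverse (rho P x) * rep_l2 (G2 $ i) x)), \<theta>,
              l2_on \<Omega> (\<lambda>x. inverse (thc P x) * rep_l2 G4 x), M,
              (\<chi> s. l2_on \<Omega> (\<lambda>x. \<Sum>i\<in>UNIV. mc_inv P s i x * rep_l2 (G6 $ i) x)))"
    using A unfolding A_graph_def U by auto
  have m: "U \<in> Hsp \<Omega>" "U' \<in> Hsp \<Omega>" using A by (auto simp: A_graph_def)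
  have y: "(u, \<tau>, R) \<in> W" using m(1) by (auto simp: U Hsp_def W_def)
  have z: "(v, \<theta>, M) \<in> W" using m(2) by (auto simp: U' Hsp_def W_def)
  define r where "r = snd (Phi U')"
  have Phi': "Phi U' = (((v, \<theta>, M), grad (v, \<theta>, M)), r)" by (simp add: r_def U' Phi_def)
  have rH: "r \<in> H" using m(2) unfolding Phi_S Phi' by (simp add: E.S_def)
  have r: "fst r $ i = mul \<Omega> (\<lambda>x. inverse (rho P x)) (G2 $ i)"
    "fst (snd r) = mul \<Omega> (\<lambda>x. inverse (thc P x)) G4"
    "snd (snd r) $ j = (\<Sum>i\<in>UNIV. mul \<Omega> (mc_inv P j i) (G6 $ i))" for i j
    using l2_on_mc_inv[of G6] G by (simp_all add: r_def U' Phi_def mul_def L2vec_def)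
  have "mul \<Omega> (rho P) (fst r $ i) = G2 $ i" "mul \<Omega> (thc P) (fst (snd r)) = G4"
    "(\<Sum>j\<in>UNIV. mul \<Omega> (mc P i j) (snd (snd r) $ j)) = G6 $ i" for i
    unfolding r using G inverse_mc(1)[of "\<lambda>i. G6 $ i" i] by (simp_all add: inverse_rho inverse_thc L2vec_nth)
  moreover have "inner (G2 $ i) (cls \<phi>) = bracket2 \<Omega> P U i \<phi>" "inner G4 (cls \<phi>) = bracket4 \<Omega> P U \<phi>"
    "inner (G6 $ i) (cls \<phi>) = bracket6 \<Omega> P U i \<phi>" if t: "test_fun \<Omega> \<phi>" for \<phi> i
    using e2[of i] e4 e6[of i] t G distr_of_inner[OF reps_rep t] unfolding eq_distr_def L2vec_def by auto
  ultimately have "((((u, \<tau>, R), grad (u, \<tau>, R)), (v, \<theta>, M)), (((v, \<theta>, M), grad (v, \<theta>, M)), r)) \<in> E.G"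
    unfolding G_iff_brackets[OF y z] using rH by (simp add: U del: bracket2.simps bracket4.simps bracket6.simps)
  moreover have "Phi U = (((u, \<tau>, R), grad (u, \<tau>, R)), (v, \<theta>, M))" by (simp add: U Phi_def)
  ultimately show ?thesis by (simp only: Phi')
qed

text \<open>The witnesses for the brackets are the image multiplied by \<open>rho\<close>,
  \<open>thc\<close> and \<open>mc\<close>; the velocities in the image lie in W_0^{1,2} because the
  relation demands it.\<close>

lemma G_imp_A_graph:
  assumes G: "(Phi U, Phi U') \<in> E.G"
  shows "A_graph \<Omega> P U U'"
proof -
  have m: "U \<in> Hsp \<Omega>" "U' \<in> Hsp \<Omega>" using G E.G_in_S by (auto simp: Phi_S)
  obtain u v \<tau> \<theta> R M where U: "U = (u, v, \<tau>, \<theta>, R, M)" by (cases U)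
  obtain v' r1 \<theta>' r2 M' r3 where U'1: "U' = (v', r1, \<theta>', r2, M', r3)" by (cases U')
  have "(v, \<theta>, M) = (v', \<theta>', M')" using G by (simp add: E.G_def U U'1 Phi_def)
  then have U': "U' = (v, r1, \<theta>, r2, M, r3)" by (simp add: U'1)
  have y: "(u, \<tau>, R) \<in> W" using m(1) by (auto simp: U Hsp_def W_def)
  have z: "(v, \<theta>, M) \<in> W" using m(2) by (auto simp: U' Hsp_def W_def)
  have r: "r1 \<in> L2vec \<Omega>" "r2 \<in> L2 \<Omega>" "r3 \<in> L2vec \<Omega>" using m(2) by (auto simp: U' Hsp_def)
  define G2 G4 G6 where "G2 = (\<chi> i. mul \<Omega> (rho P) (r1 $ i))" and "G4 = mul \<Omega> (thc P) r2"
    and "G6 = (\<chi> i. \<Sum>j\<in>UNIV. mul \<Omega> (mc P i j) (r3 $ j))"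
  have GL: "G2 \<in> L2vec \<Omega>" "G4 \<in> L2 \<Omega>" "G6 \<in> L2vec \<Omega>"
    using r by (auto simp: G2_def G4_def G6_def L2vec_def intro!: L2_mul bcoefs subspace_sum[OF subspace_L2])
  have "((((u, \<tau>, R), grad (u, \<tau>, R)), (v, \<theta>, M)), (((v, \<theta>, M), grad (v, \<theta>, M)), (r1, r2, r3))) \<in> E.G"
    using G by (simp add: U U' Phi_def)
  then have br: "inner (G2 $ i) (cls \<phi>) = bracket2 \<Omega> P U i \<phi>" "inner G4 (cls \<phi>) = bracket4 \<Omega> P U \<phi>"
    "inner (G6 $ i) (cls \<phi>) = bracket6 \<Omega> P U i \<phi>" if "test_fun \<Omega> \<phi>" for \<phi> i
    unfolding G_iff_brackets[OF y z] using that
    by (auto simp: U G2_def G4_def G6_def simp del: bracket2.simps bracket4.simps bracket6.simps)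
  have e: "eq_distr \<Omega> (distr_of \<Omega> (rep_l2 (G2 $ i))) (bracket2 \<Omega> P U i)"
    "eq_distr \<Omega> (distr_of \<Omega> (rep_l2 G4)) (bracket4 \<Omega> P U)"
    "eq_distr \<Omega> (distr_of \<Omega> (rep_l2 (G6 $ i))) (bracket6 \<Omega> P U i)" for i
    unfolding eq_distr_def using br GL distr_of_inner[OF reps_rep] by (auto simp: L2vec_nth)
  have "l2_on \<Omega> (\<lambda>x. inverse (rho P x) * rep_l2 (G2 $ i) x) = r1 $ i" for i
    using inverse_rho(2)[OF L2vec_nth[OF r(1)]] by (simp add: G2_def mul_def)
  moreover have "l2_on \<Omega> (\<lambda>x. inverse (thc P x) * rep_l2 G4 x) = r2"
    using inverse_thc(2)[OF r(2)] by (simp add: G4_def mul_def)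
  moreover have "l2_on \<Omega> (\<lambda>x. \<Sum>i\<in>UNIV. mc_inv P s i x * rep_l2 (G6 $ i) x) = r3 $ s" for s
    using l2_on_mc_inv[OF L2vec_nth[OF GL(3)]] inverse_mc(2)[of "\<lambda>i. r3 $ i" s] L2vec_nth[OF r(3)] by (simp add: G6_def)
  ultimately have "U' = (v, (\<chi> i. l2_on \<Omega> (\<lambda>x. inverse (rho P x) * rep_l2 (G2 $ i) x)), \<theta>,
      l2_on \<Omega> (\<lambda>x. inverse (thc P x) * rep_l2 G4 x), M,
      (\<chi> s. l2_on \<Omega> (\<lambda>x. \<Sum>i\<in>UNIV. mc_inv P s i x * rep_l2 (G6 $ i) x)))"
    by (simp add: U' vec_eq_iff)
  then show ?thesis
    unfolding A_graph_def U prod.case using m(1)[unfolded U] m(2) GL e[unfolded U] by blast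
qed

lemma A_graph_iff: "A_graph \<Omega> P U U' \<longleftrightarrow> (Phi U, Phi U') \<in> E.G"
  using A_graph_imp_G G_imp_A_graph by blast

lemma A_graph_unique: "A_graph \<Omega> P U X \<Longrightarrow> A_graph \<Omega> P U Y \<Longrightarrow> X = Y"
  unfolding A_graph_iff using E.G_diff[of "Phi U" "Phi X" "Phi U" "Phi Y"] E.single[of "Phi X - Phi Y"] Psi_Phi
  by (metis diff_self right_minus_eq)

lemma opA_eq: "A_graph \<Omega> P U X \<Longrightarrow> opA \<Omega> P U = X"
  unfolding opA_def using A_graph_unique by blast

lemma domA_graph: "U \<in> domA \<Omega> P \<Longrightarrow> (Phi U, Phi (opA \<Omega> P U)) \<in> E.G"
  by (auto simp: domA_def simp flip: A_graph_iff) (metis opA_eq)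

lemma opA_in_Hsp: "U \<in> domA \<Omega> P \<Longrightarrow> opA \<Omega> P U \<in> Hsp \<Omega>"
  using domA_graph E.G_in_S Phi_S by blast

lemma domA_I: "A_graph \<Omega> P U X \<Longrightarrow> U \<in> domA \<Omega> P"
  by (auto simp: domA_def A_graph_def)

lemma Hinner_eq: "U \<in> Hsp \<Omega> \<Longrightarrow> Hinner \<Omega> P U U = 1 / 2 * E.ip (Phi U) (Phi U)"
proof -
  assume U: "U \<in> Hsp \<Omega>"
  obtain u v \<tau> \<theta> R M where e: "U = (u, v, \<tau>, \<theta>, R, M)" by (cases U)
  have y: "(u, \<tau>, R) \<in> W" and z: "(v, \<theta>, M) \<in> H" using U by (auto simp: e Hsp_def W_def H_def)
  have "hasI (\<lambda>x. density_m (v, \<theta>, M) (v, \<theta>, M) x + density_a (u, \<tau>, R) (u, \<tau>, R) x)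
      (form_m (v, \<theta>, M) (v, \<theta>, M) + form_a ((u, \<tau>, R), grad (u, \<tau>, R)) ((u, \<tau>, R), grad (u, \<tau>, R)))"
    by (intro hasI_add hasI_density_m hasI_density_a y z)
  from hasI_unique[OF this] show ?thesis
    by (simp add: e E.ip_def Phi_def density_m_def density_a_def add.assoc add.commute[of "form_m _ _"])
qed

text \<open>Lower bound by coercivity, upper bound by boundedness of the energy product; the halves
  under the roots stem from the factor 1/2 in \<open>Hinner\<close>.\<close>

lemma Hnorm_equiv: "\<exists>k K. k > 0 \<and> (\<forall>U\<in>Hsp \<Omega>. k * norm (Phi U) \<le> Hnorm \<Omega> P U \<and> Hnorm \<Omega> P U \<le> K * norm (Phi U))"
proof -
  obtain K where K: "K > 0" "\<And>X Y. norm (E.ip X Y) \<le> norm X * norm Y * K"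
    using bounded_bilinear.pos_bounded[OF E.bilinear_ip] by blast
  have "sqrt (coercivity / 2) * norm (Phi U) \<le> Hnorm \<Omega> P U \<and> Hnorm \<Omega> P U \<le> sqrt (K / 2) * norm (Phi U)"
    if U: "U \<in> Hsp \<Omega>" for U
  proof -
    have "coercivity * (norm (Phi U))\<^sup>2 \<le> E.ip (Phi U) (Phi U)" using E.coercive U by (simp add: Phi_S)
    then have "sqrt ((coercivity / 2) * (norm (Phi U))\<^sup>2) \<le> sqrt (1 / 2 * E.ip (Phi U) (Phi U))" by (intro real_sqrt_le_mono) simp
    moreover have "E.ip (Phi U) (Phi U) \<le> K * (norm (Phi U))\<^sup>2"
      using K(2)[of "Phi U" "Phi U"] by (simp add: power2_eq_square mult_ac)
    then have "sqrt (1 / 2 * E.ip (Phi U) (Phi U)) \<le> sqrt ((K / 2) * (norm (Phi U))\<^sup>2)" by (intro real_sqrt_le_mono) simp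
    moreover have e: "sqrt (a * (norm (Phi U))\<^sup>2) = sqrt a * norm (Phi U)" for a by (simp add: real_sqrt_mult)
    ultimately show ?thesis unfolding e Hnorm_def Hinner_eq[OF U] by blast
  qed
  moreover have "sqrt (coercivity / 2) > 0" using coercivity(1) by simp
  ultimately show ?thesis by blast
qed

lemma Hnorm_tendsto_iff:
  assumes "\<forall>\<^sub>F s in F. X s \<in> Hsp \<Omega>"
  shows "((\<lambda>s. Hnorm \<Omega> P (X s)) \<longlongrightarrow> 0) F \<longleftrightarrow> ((\<lambda>s. Phi (X s)) \<longlongrightarrow> 0) F"
proof -
  obtain k K where k: "k > 0" "\<And>U. U \<in> Hsp \<Omega> \<Longrightarrow> k * norm (Phi U) \<le> Hnorm \<Omega> P U"
    "\<And>U. U \<in> Hsp \<Omega> \<Longrightarrow> Hnorm \<Omega> P U \<le> K * norm (Phi U)" using Hnorm_equiv by blast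
  show ?thesis
  proof
    assume l: "((\<lambda>s. Hnorm \<Omega> P (X s)) \<longlongrightarrow> 0) F"
    show "((\<lambda>s. Phi (X s)) \<longlongrightarrow> 0) F"
    proof (rule Lim_null_comparison)
      show "\<forall>\<^sub>F s in F. norm (Phi (X s)) \<le> Hnorm \<Omega> P (X s) / k"
        using assms by eventually_elim (use k in \<open>simp add: field_simps\<close>)
      show "((\<lambda>s. Hnorm \<Omega> P (X s) / k) \<longlongrightarrow> 0) F" using tendsto_divide_zero[OF l] .
    qed
  next
    assume l: "((\<lambda>s. Phi (X s)) \<longlongrightarrow> 0) F"
    show "((\<lambda>s. Hnorm \<Omega> P (X s)) \<longlongrightarrow> 0) F"
    proof (rule Lim_null_comparison)
      show "\<forall>\<^sub>F s in F. norm (Hnorm \<Omega> P (X s)) \<le> K * norm (Phi (X s))"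
        using assms
      proof eventually_elim
        case (elim s)
        have "0 \<le> k * norm (Phi (X s))" using k(1) by simp
        then have "0 \<le> Hnorm \<Omega> P (X s)" using k(2)[OF elim] by linarith
        then show ?case using k(3)[OF elim] by simp
      qed
      show "((\<lambda>s. K * norm (Phi (X s))) \<longlongrightarrow> 0) F" using l by (intro tendsto_mult_right_zero tendsto_norm_zero)
    qed
  qed
qed

lemma Hnorm_increment_iff:
  fixes U :: "real \<Rightarrow> state"
  assumes U: "\<And>s. s \<ge> 0 \<Longrightarrow> U s \<in> Hsp \<Omega>" and t: "t \<ge> 0"
  shows "((\<lambda>s. Hnorm \<Omega> P (U s - U t)) \<longlongrightarrow> 0) (at t within {0..}) \<longleftrightarrow>
    ((\<lambda>s. Phi (U s)) \<longlongrightarrow> Phi (U t)) (at t within {0..})"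
proof -
  have "((\<lambda>s. Hnorm \<Omega> P (U s - U t)) \<longlongrightarrow> 0) (at t within {0..}) \<longleftrightarrow>
      ((\<lambda>s. Phi (U s - U t)) \<longlongrightarrow> 0) (at t within {0..})"
    by (rule Hnorm_tendsto_iff, rule eventually_half_line) (simp add: Phi_diff U t)
  also have "\<dots> \<longleftrightarrow> ((\<lambda>s. Phi (U s) - Phi (U t)) \<longlongrightarrow> 0) (at t within {0..})"
    by (rule filterlim_cong[OF refl refl], rule eventually_half_line) (simp add: Phi_diff U t)
  finally show ?thesis by (simp add: LIM_zero_iff)
qed

lemma C0_in_Hsp_iff:
  "C0_in (Hsp \<Omega>) (Hnorm \<Omega> P) U \<longleftrightarrow> (\<forall>t\<ge>0. U t \<in> Hsp \<Omega>) \<and> continuous_on {0..} (\<lambda>t. Phi (U t))"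
  unfolding C0_in_def continuous_on_def using Hnorm_increment_iff[of U] by auto

lemma deriv_in_Hnorm_iff:
  assumes U: "\<And>s. s \<ge> 0 \<Longrightarrow> U s \<in> Hsp \<Omega>" and D: "D \<in> Hsp \<Omega>" and t: "t \<ge> 0"
  shows "deriv_in (Hnorm \<Omega> P) U t D \<longleftrightarrow> ((\<lambda>s. Phi (U s)) has_vector_derivative Phi D) (at t within {0..})"
proof -
  have q: "Phi ((1 / (s - t)) *\<^sub>R (U s - U t) - D) = (1 / (s - t)) *\<^sub>R (Phi (U s) - Phi (U t)) - Phi D \<and>
      (1 / (s - t)) *\<^sub>R (U s - U t) - D \<in> Hsp \<Omega>" if "s \<ge> 0" for s
    using Phi_diff[OF U[OF that] U[OF t]] Phi_scale[of "U s - U t" "1 / (s - t)"]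
      Phi_diff[of "(1 / (s - t)) *\<^sub>R (U s - U t)" D] D by simp
  have "deriv_in (Hnorm \<Omega> P) U t D \<longleftrightarrow>
      ((\<lambda>s. Phi ((1 / (s - t)) *\<^sub>R (U s - U t) - D)) \<longlongrightarrow> 0) (at t within {0..})"
    unfolding deriv_in_def by (rule Hnorm_tendsto_iff, rule eventually_half_line) (simp add: q)
  also have "\<dots> \<longleftrightarrow> ((\<lambda>s. (1 / (s - t)) *\<^sub>R (Phi (U s) - Phi (U t)) - Phi D) \<longlongrightarrow> 0) (at t within {0..})"
    by (rule filterlim_cong[OF refl refl], rule eventually_half_line) (simp add: q)
  finally show ?thesis by (simp add: has_vector_derivative_iff_quotient LIM_zero_iff)
qed

text \<open>The source is a bounded linear image of the data \<open>(f, s, Q)\<close>, so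
  differentiability and continuity in time carry over from the data.\<close>

definition load :: "triple \<Rightarrow> triple" where
  "load x = (fst x, mul \<Omega> (\<lambda>x. inverse (thc P x) * rho P x) (fst (snd x)),
    (\<chi> i. \<Sum>j\<in>UNIV. mul \<Omega> (\<lambda>x. mc_inv P i j x * rho P x) (snd (snd x) $ j)))"

lemma bounded_linear_load: "bounded_linear (\<lambda>x. (0 :: triple \<times> gradient, load x))"
  unfolding load_def
  by (intro bounded_linear_Pair bounded_linear_zero bounded_linear_vec_lambda bounded_linear_sum
      bounded_linear_mul_comp bcoefs_inverse bounded_linear_nth bounded_linear_fst_comp bounded_linear_snd_comp bounded_linear_ident)

lemma load_S: "x \<in> H \<Longrightarrow> (0, load x) \<in> E.S"
  unfolding E.S_def load_def using subspace_0[OF subspace_V]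
  by (auto simp: H_def L2vec_def intro!: L2_mul bcoefs_inverse subspace_sum[OF subspace_L2])

lemma source_eq:
  assumes "(f t, s t, Q t) \<in> H"
  shows "source \<Omega> P f s Q t = Psi (0, load (f t, s t, Q t))"
proof -
  have "l2_on \<Omega> (\<lambda>x. \<Sum>j\<in>UNIV. mc_inv P i j x * rho P x * rep_l2 (Q t $ j) x)
      = (\<Sum>j\<in>UNIV. mul \<Omega> (\<lambda>x. mc_inv P i j x * rho P x) (Q t $ j))" for i
    using H_D(3)[OF assms] by (intro reps_l2_on_eq reps_sum reps_mul bcoefs_inverse reps_rep) simp
  then show ?thesis by (simp add: source_def Psi_def load_def mul_def)
qed

text \<open>Everything is moved through \<open>Phi\<close> to the abstract problem and back through
  \<open>Psi\<close>. Continuity in the graph norm reduces to that of \<open>Y\<close> and of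
  \<open>w - F\<close>, because \<open>w t - F t\<close> is the image of \<open>Y t\<close>.\<close>

theorem cauchy_problem:
  assumes f: "\<And>i. C1_in (L2 \<Omega>) norm (\<lambda>t. f t $ i)" and s: "C1_in (L2 \<Omega>) norm s"
    and Q: "\<And>i. C1_in (L2 \<Omega>) norm (\<lambda>t. Q t $ i)" and U0: "U0 \<in> domA \<Omega> P"
  shows "\<exists>U. solution \<Omega> P (source \<Omega> P f s Q) U0 U \<and>
           (\<forall>V. solution \<Omega> P (source \<Omega> P f s Q) U0 V \<longrightarrow> (\<forall>t\<ge>0. V t = U t))"
proof -
  have L2s: "\<And>t i. t \<ge> 0 \<Longrightarrow> f t $ i \<in> L2 \<Omega>" "\<And>t. t \<ge> 0 \<Longrightarrow> s t \<in> L2 \<Omega>" "\<And>t i. t \<ge> 0 \<Longrightarrow> Q t $ i \<in> L2 \<Omega>"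
    using f s Q unfolding C1_in_def by blast+
  have "\<forall>i. \<exists>f'. C0_in (L2 \<Omega>) norm f' \<and> (\<forall>t\<ge>0. deriv_in norm (\<lambda>t. f t $ i) t (f' t))"
    using f unfolding C1_in_def by blast
  then obtain f' where f': "\<And>i. C0_in (L2 \<Omega>) norm (f' i)"
    "\<And>i t. t \<ge> 0 \<Longrightarrow> ((\<lambda>t. f t $ i) has_vector_derivative f' i t) (at t within {0..})"
    unfolding deriv_in_norm by metis
  obtain s' where s': "C0_in (L2 \<Omega>) norm s'" "\<And>t. t \<ge> 0 \<Longrightarrow> (s has_vector_derivative s' t) (at t within {0..})"
    using s unfolding C1_in_def deriv_in_norm by blast
  have "\<forall>i. \<exists>Q'. C0_in (L2 \<Omega>) norm Q' \<and> (\<forall>t\<ge>0. deriv_in norm (\<lambda>t. Q t $ i) t (Q' t))"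
    using Q unfolding C1_in_def by blast
  then obtain Q' where Q': "\<And>i. C0_in (L2 \<Omega>) norm (Q' i)"
    "\<And>i t. t \<ge> 0 \<Longrightarrow> ((\<lambda>t. Q t $ i) has_vector_derivative Q' i t) (at t within {0..})"
    unfolding deriv_in_norm by metis
  define x where "x t = (f t, s t, Q t)" for t
  define x' where "x' t = ((\<chi> i. f' i t) :: l2^3, s' t, (\<chi> i. Q' i t) :: l2^3)" for t
  have xH: "x t \<in> H" "x' t \<in> H" if "t \<ge> 0" for t
    using L2s that f'(1) s'(1) Q'(1) by (auto simp: x_def x'_def H_def L2vec_def C0_in_norm)
  have xd: "(x has_vector_derivative x' t) (at t within {0..})" if "t \<ge> 0" for t
    unfolding x_def[abs_def] x'_def using that
    by (intro has_vector_derivative_Pair has_vector_derivative_vec) (simp_all add: f' s' Q')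
  have xc: "continuous_on {0..} x'"
    unfolding x'_def[abs_def] using f'(1) s'(1) Q'(1)
    by (intro continuous_on_Pair continuous_on_vec_lambda) (auto simp: C0_in_norm)
  define F where "F t = (0 :: triple \<times> gradient, load (x t))" for t
  define g where "g t = (0 :: triple \<times> gradient, load (x' t))" for t
  have FS: "F t \<in> E.S" "g t \<in> E.S" if "t \<ge> 0" for t
    unfolding F_def g_def using xH[OF that] load_S by blast+
  have Fd: "(F has_vector_derivative g t) (at t within {0..})" if "t \<ge> 0" for t
    unfolding F_def[abs_def] g_def by (rule bounded_linear.has_vector_derivative[OF bounded_linear_load xd[OF that]])
  have gc: "continuous_on {0..} g"
    unfolding g_def[abs_def] by (rule bounded_linear.continuous_on[OF bounded_linear_load xc])
  have src: "source \<Omega> P f s Q t = Psi (F t)" if "t \<ge> 0" for t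
    using source_eq[of f t s Q] xH(1)[OF that] by (simp add: F_def x_def)
  obtain Y w where Y: "Y 0 = Phi U0" and wc: "continuous_on {0..} w"
    and Yd: "\<And>t. t \<ge> 0 \<Longrightarrow> (Y has_vector_derivative w t) (at t within {0..})"
    and YG: "\<And>t. t \<ge> 0 \<Longrightarrow> (Y t, w t - F t) \<in> E.G"
    using E.inhomogeneous_exists[OF domA_graph[OF U0] FS gc Fd] by blast
  define U where "U t = Psi (Y t)" for t
  have YS: "Y t \<in> E.S" "w t - F t \<in> E.S" if "t \<ge> 0" for t using YG[OF that] E.G_in_S by blast+
  have wS: "w t \<in> E.S" if "t \<ge> 0" for t using E.S_add[OF YS(2)[OF that] FS(1)[OF that]] by simp
  have PU: "Phi (U t) = Y t" "U t \<in> Hsp \<Omega>" if "t \<ge> 0" for t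
    unfolding U_def using YS(1)[OF that] Phi_Psi Psi_Hsp by blast+
  have AU: "A_graph \<Omega> P (U t) (Psi (w t - F t))" if "t \<ge> 0" for t
    unfolding A_graph_iff PU[OF that] using YG[OF that] YS(2)[OF that] by (simp add: Phi_Psi)
  have opU: "opA \<Omega> P (U t) = Psi (w t - F t)" if "t \<ge> 0" for t by (rule opA_eq[OF AU[OF that]])
  have Ud: "deriv_in (Hnorm \<Omega> P) U t (Psi (w t))" if t: "t \<ge> 0" for t
  proof -
    have "((\<lambda>s. Phi (U s)) has_vector_derivative w t) (at t within {0..})"
      by (rule has_vector_derivative_transform[OF _ _ Yd[OF t]]) (use t PU in auto)
    then show ?thesis using deriv_in_Hnorm_iff[of U "Psi (w t)" t] PU(2) Psi_Hsp[OF wS[OF t]] t by (simp add: Phi_Psi wS)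
  qed
  have sol: "solution \<Omega> P (source \<Omega> P f s Q) U0 U"
    unfolding solution_def
  proof (intro conjI allI impI)
    have "C0_in (Hsp \<Omega>) (Hnorm \<Omega> P) (\<lambda>t. Psi (w t))"
      unfolding C0_in_Hsp_iff
    proof (intro conjI allI impI)
      show "Psi (w t) \<in> Hsp \<Omega>" if "t \<ge> 0" for t by (rule Psi_Hsp[OF wS[OF that]])
      show "continuous_on {0..} (\<lambda>t. Phi (Psi (w t)))"
        by (rule continuous_on_eq[OF wc]) (simp add: Phi_Psi wS)
    qed
    then show "C1_in (Hsp \<Omega>) (Hnorm \<Omega> P) U"
      unfolding C1_in_def using PU(2) Ud by blast
    show "C0_in (domA \<Omega> P) (graph_norm \<Omega> P) U"
      unfolding C0_in_def
    proof (intro conjI allI impI)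
      fix t :: real assume t: "t \<ge> 0"
      show "U t \<in> domA \<Omega> P" by (rule domA_I[OF AU[OF t]])
      have Yc: "continuous_on {0..} Y"
        unfolding continuous_on_eq_continuous_within
        by (intro ballI has_vector_derivative_continuous[OF Yd]) simp
      have Fc: "continuous_on {0..} F"
        unfolding continuous_on_eq_continuous_within
        by (intro ballI has_vector_derivative_continuous[OF Fd]) simp
      have wFc: "continuous_on {0..} (\<lambda>t. w t - F t)" by (intro continuous_on_diff wc Fc)
      \<comment> \<open>The graph norm of an increment involves the operator at the difference of
        two states, which \<open>opA\<close> as a description does not split by itself; linearity is
        taken from the relation.\<close>
      have op_diff: "opA \<Omega> P (U r - U t) = Psi (w r - F r) - Psi (w t - F t)" if r: "r \<ge> 0" for r
      proof (rule opA_eq)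
        have "(Y r - Y t, (w r - F r) - (w t - F t)) \<in> E.G" by (rule E.G_diff[OF YG[OF r] YG[OF t]])
        moreover have "Phi (U r - U t) = Y r - Y t" using Phi_diff[OF PU(2)[OF r] PU(2)[OF t]] PU(1) r t by simp
        moreover have "Phi (Psi (w r - F r) - Psi (w t - F t)) = (w r - F r) - (w t - F t)"
          using E.S_diff[OF YS(2)[OF r] YS(2)[OF t]] Phi_Psi[of "(w r - F r) - (w t - F t)"] Psi_diff[of "w r - F r" "w t - F t"] by simp
        ultimately show "A_graph \<Omega> P (U r - U t) (Psi (w r - F r) - Psi (w t - F t))"
          by (simp only: A_graph_iff)
      qed
      have 1: "((\<lambda>r. Hnorm \<Omega> P (U r - U t)) \<longlongrightarrow> 0) (at t within {0..})"
      proof (subst Hnorm_increment_iff[OF PU(2) t])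
        have "(Y \<longlongrightarrow> Y t) (at t within {0..})" using Yc t by (simp add: continuous_on_def)
        then show "((\<lambda>r. Phi (U r)) \<longlongrightarrow> Phi (U t)) (at t within {0..})"
          unfolding PU(1)[OF t] by (rule Lim_transform_eventually) (use PU(1) in \<open>simp add: eventually_half_line\<close>)
      qed
      have 2: "((\<lambda>r. Hnorm \<Omega> P (Psi (w r - F r) - Psi (w t - F t))) \<longlongrightarrow> 0) (at t within {0..})"
      proof (subst Hnorm_increment_iff[OF Psi_Hsp[OF YS(2)] t])
        have "((\<lambda>r. w r - F r) \<longlongrightarrow> w t - F t) (at t within {0..})" using wFc t by (simp add: continuous_on_def)
        then show "((\<lambda>r. Phi (Psi (w r - F r))) \<longlongrightarrow> Phi (Psi (w t - F t))) (at t within {0..})"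
          unfolding Phi_Psi[OF YS(2)[OF t]]
          by (rule Lim_transform_eventually) (use Phi_Psi[OF YS(2)] in \<open>simp add: eventually_half_line\<close>)
      qed
      have "((\<lambda>r. Hnorm \<Omega> P (U r - U t) + Hnorm \<Omega> P (Psi (w r - F r) - Psi (w t - F t))) \<longlongrightarrow> 0) (at t within {0..})"
        using tendsto_add[OF 1 2] by simp
      then show "((\<lambda>r. graph_norm \<Omega> P (U r - U t)) \<longlongrightarrow> 0) (at t within {0..})"
        by (rule Lim_transform_eventually) (rule eventually_half_line, simp add: graph_norm_def op_diff)
    qed
    show "deriv_in (Hnorm \<Omega> P) U t (opA \<Omega> P (U t) + source \<Omega> P f s Q t)" if "t \<ge> 0" for t
      using Ud[OF that] by (simp add: opU[OF that] src[OF that] flip: Psi_add)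
    show "U 0 = U0" by (simp add: U_def Y Psi_Phi)
  qed
  moreover have "Z t = U t" if Z: "solution \<Omega> P (source \<Omega> P f s Q) U0 Z" and t: "t \<ge> 0" for Z t
  proof -
    have ZD: "Z r \<in> domA \<Omega> P" if "r \<ge> 0" for r using Z that unfolding solution_def C0_in_def by blast
    have ZH: "Z r \<in> Hsp \<Omega>" if "r \<ge> 0" for r using ZD[OF that] by (simp add: domA_def)
    have Zd: "((\<lambda>r. Phi (Z r)) has_vector_derivative Phi (opA \<Omega> P (Z r)) + F r) (at r within {0..})" if r: "r \<ge> 0" for r
    proof -
      have FH: "Psi (F r) \<in> Hsp \<Omega>" by (rule Psi_Hsp[OF FS(1)[OF r]])
      have ad: "Phi (opA \<Omega> P (Z r) + Psi (F r)) = Phi (opA \<Omega> P (Z r)) + F r"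
        "opA \<Omega> P (Z r) + Psi (F r) \<in> Hsp \<Omega>"
        using Phi_add[OF opA_in_Hsp[OF ZD[OF r]] FH] Phi_Psi[OF FS(1)[OF r]] by auto
      have "deriv_in (Hnorm \<Omega> P) Z r (opA \<Omega> P (Z r) + Psi (F r))"
        using Z r src[OF r] unfolding solution_def by metis
      then show ?thesis using deriv_in_Hnorm_iff[OF ZH ad(2) r] ad(1) by simp
    qed
    \<comment> \<open>The sources cancel in the difference, which therefore solves the homogeneous
      equation with zero initial value.\<close>
    have "Phi (Z t) - Y t = 0"
    proof (rule E.homogeneous_unique[OF _ _ _ t])
      fix r :: real assume r: "r \<ge> 0"
      show "((\<lambda>r. Phi (Z r) - Y r) has_vector_derivative (Phi (opA \<Omega> P (Z r)) + F r) - w r) (at r within {0..})"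
        by (intro has_vector_derivative_diff Zd Yd r)
      have "(Phi (Z r) - Y r, Phi (opA \<Omega> P (Z r)) - (w r - F r)) \<in> E.G"
        by (rule E.G_diff[OF domA_graph[OF ZD[OF r]] YG[OF r]])
      then show "(Phi (Z r) - Y r, (Phi (opA \<Omega> P (Z r)) + F r) - w r) \<in> E.G" by (simp add: algebra_simps)
    next
      show "Phi (Z 0) - Y 0 = 0" using Z by (simp add: solution_def Y)
    qed
    then show ?thesis unfolding U_def using Psi_Phi[of "Z t"] by simp
  qed
  ultimately show ?thesis by blast
qed

end

theorem theorem2:
  fixes \<Omega> :: "(real^3) set" and P :: coeffs
    and f Q :: "real \<Rightarrow> l2^3" and s :: "real \<Rightarrow> l2" and U0 :: state
  assumes "smooth_bounded_domain \<Omega>"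
    and "admissible \<Omega> P"
    and "\<And>i. C1_in (L2 \<Omega>) norm (\<lambda>t. f t $ i) \<and> C0_in (W012 \<Omega>) (W12_norm \<Omega>) (\<lambda>t. f t $ i)"
    and "C1_in (L2 \<Omega>) norm s \<and> C0_in (W012 \<Omega>) (W12_norm \<Omega>) s"
    and "\<And>i. C1_in (L2 \<Omega>) norm (\<lambda>t. Q t $ i) \<and> C0_in (W012 \<Omega>) (W12_norm \<Omega>) (\<lambda>t. Q t $ i)"
    and "U0 \<in> domA \<Omega> P"
  shows "\<exists>U. solution \<Omega> P (source \<Omega> P f s Q) U0 U \<and>
           (\<forall>V. solution \<Omega> P (source \<Omega> P f s Q) U0 V \<longrightarrow> (\<forall>t\<ge>0. V t = U t))"
proof -
  interpret thermo \<Omega> P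
    by unfold_locales (use assms(1,2) in \<open>auto simp: smooth_bounded_domain_def\<close>)
  show ?thesis
    using assms(3-6) by (intro cauchy_problem) auto
qed

end
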